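(* Let $k$ be an infinite field, let $n \geq 1$, let $S = k[\![x_1, \dots, x_n, z]\!]$, and let $f \in S$ be a non-zero element of order at least $4$. Set $R = S/(f)$. Fix an expression $$f = z^2 h + (x_1 - a_1 z) g_1 + \cdots + (x_n - a_n z) g_n$$ with $h, g_1, \dots, g_n \in k[a_1,\dots,a_n][\![x_1,\dots,x_n,z]\!]$, where each $g_i$ has order at least $3$ and $h$ has order at least $2$ in $x_1,\dots,x_n,z$, and let $(\Phi(A_1,\dots,A_n), \Psi(A_1,\dots,A_n))$ denote the associated inflated matrix factorizations of $f$ (defined in the context). Let $F$ be the functor from finite-length $k[a_1,\dots,a_n]$-modules to maximal Cohen--Macaulay $R$-modules that sends the module given by a linear representation $L(A_1,\dots,A_n)$ to the MCM $R$-module corresponding to the matrix factorization $(\Phi(A_1,\dots,A_n), \Psi(A_1,\dots,A_n))$. Then $F$ is a representation embedding. In particular, if $n \geq 2$, then $R$ has wild Cohen--Macaulay type.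
   Context: **MCM modules, representation embeddings, wildness.** A finitely generated module $M$ over a (commutative Noetherian) local ring $R$ is maximal Cohen--Macaulay (MCM) if $\operatorname{depth} M = \dim R$. A representation embedding is an exact functor that preserves non-isomorphism (non-isomorphic objects go to non-isomorphic objects) and indecomposability. Let $k$ be an infinite field and $R$ a local $k$-algebra. A full subcategory $\mathcal{C}$ of the finitely generated $R$-modules is wild if for every finite-dimensional (not necessarily commutative) $k$-algebra $\Lambda$ there is a representation embedding $\operatorname{mod}\Lambda \to \mathcal{C}$, where $\operatorname{mod}\Lambda$ is the category of finitely generated $\Lambda$-modules. $R$ has wild Cohen--Macaulay type if the full subcategory of MCM $R$-modules is wild. Exactness of a functor into MCM $R$-modules means that short exact sequences are sent to short exact sequences of $R$-modules. **Matrix factorizations.** A matrix factorization of $f \in S$ is a pair $(\phi,\psi)$ of square matrices of the same size over $S$ with $\phi\psi = \psi\phi = f \cdot \mathrm{id}$. A homomorphism $(\phi,\psi) \to (\phi',\psi')$ is a pair of matrices $(P,Q)$ over $S$ with $P\phi = \phi' Q$ and $Q\psi = \psi' P$. The MCM $R$-module corresponding to $(\phi,\psi)$ is $\operatorname{cok}\phi$, and $(P,Q)$ induces the map $\operatorname{cok}\phi \to \operatorname{cok}\phi'$ given by $P$. **Parameters.** The elements $a_1,\dots,a_n$ are indeterminates (parameters). The order of an element of $S$, or the order in $x_1,\dots,x_n,z$ of an element of $k[a_1,\dots,a_n][\![x_1,\dots,x_n,z]\!]$, is the lowest total degree in $x_1,\dots,x_n,z$ of a monomial occurring with non-zero coefficient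 ($\infty$ for the zero element). An expression of $f$ as in the claim always exists. **The matrices.** Given such an expression, define recursively matrices over $k[a_1,\dots,a_n][\![x_1,\dots,x_n,z]\!]$ by $(\phi_0,\psi_0) = ([z^2],[h])$ and, for $1 \leq i \leq n$, $$\phi_i = \begin{bmatrix} \phi_{i-1} & -g_i\,\mathrm{id}_{2^{i-1}} \\ (x_i - a_i z)\,\mathrm{id}_{2^{i-1}} & \psi_{i-1}\end{bmatrix}, \qquad \psi_i = \begin{bmatrix} \psi_{i-1} & g_i\,\mathrm{id}_{2^{i-1}} \\ (-x_i + a_i z)\,\mathrm{id}_{2^{i-1}} & \phi_{i-1}\end{bmatrix}.$$ **Inflation.** Given pairwise commuting $m \times m$ matrices $A_1,\dots,A_n$ over $k$, inflating a power series in $k[a_1,\dots,a_n][\![x_1,\dots,x_n,z]\!]$ means replacing each scalar $\alpha \in k$ by $\alpha\,\mathrm{id}_m$, each $x_i$ by $x_i\,\mathrm{id}_m$, $z$ by $z\,\mathrm{id}_m$, and each $a_i$ by $A_i$; the result is an $m \times m$ matrix over $S$. The pair $(\Phi(A_1,\dots,A_n),\Psi(A_1,\dots,A_n))$ is obtained by inflating every entry of $\phi_n$ and $\psi_n$; it is a matrix factorization of $f$ of size $m2^n$. **Linear representations and the functor on maps.** A $k[a_1,\dots,a_n]$-module of $k$-dimension $m$ with a chosen $k$-basis is identified with the linear representation $L(A_1,\dots,A_n)\colon k[a_1,\dots,a_n] \to \operatorname{Mat}_m(k)$, $a_i \mapsto A_i$, where $A_1,\dots,A_n$ are the pairwise commuting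 matrices giving the actions of $a_1,\dots,a_n$. A homomorphism $L(A_1,\dots,A_n) \to L(A_1',\dots,A_n')$ is a matrix $U$ over $k$ with $UA_i = A_i'U$ for all $i$. The functor $F$ sends $U$ to the map induced by the pair $(\tilde U, \tilde U)$, where $\tilde U$ is the block-diagonal matrix with $2^n$ diagonal blocks equal to $U$. *)

theory Defs
  imports
    "HOL-Library.Poly_Mapping"
    "HOL-Library.Extended_Nat"
    "HOL-Algebra.QuotRing"
    "Jordan_Normal_Form.VS_Connect"
begin

section \<open>Left modules, depth and Krull dimension\<close>

text \<open>
  The locale \<open>module\<close> of HOL-Algebra requires a commutative base ring. Left modules over a
  possibly noncommutative ring use the same record type and the same axioms.
\<close>

locale left_module = R?: ring R + M?: abelian_group M
  for R :: "('a, 'x) ring_scheme" (structure)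
    and M :: "('a, 'b, 'y) module_scheme" (structure) +
  assumes left_smult_closed:
      "\<lbrakk>a \<in> carrier R; x \<in> carrier M\<rbrakk> \<Longrightarrow> a \<odot>\<^bsub>M\<^esub> x \<in> carrier M"
    and left_smult_l_distr:
      "\<lbrakk>a \<in> carrier R; b \<in> carrier R; x \<in> carrier M\<rbrakk> \<Longrightarrow>
        (a \<oplus>\<^bsub>R\<^esub> b) \<odot>\<^bsub>M\<^esub> x = a \<odot>\<^bsub>M\<^esub> x \<oplus>\<^bsub>M\<^esub> b \<odot>\<^bsub>M\<^esub> x"
    and left_smult_r_distr:
      "\<lbrakk>a \<in> carrier R; x \<in> carrier M; y \<in> carrier M\<rbrakk> \<Longrightarrow>
        a \<odot>\<^bsub>M\<^esub> (x \<oplus>\<^bsub>M\<^esub> y) = a \<odot>\<^bsub>M\<^esub> x \<oplus>\<^bsub>M\<^esub> a \<odot>\<^bsub>M\<^esub> y"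
    and left_smult_assoc:
      "\<lbrakk>a \<in> carrier R; b \<in> carrier R; x \<in> carrier M\<rbrakk> \<Longrightarrow>
        (a \<otimes>\<^bsub>R\<^esub> b) \<odot>\<^bsub>M\<^esub> x = a \<odot>\<^bsub>M\<^esub> (b \<odot>\<^bsub>M\<^esub> x)"
    and left_smult_one:
      "x \<in> carrier M \<Longrightarrow> \<one>\<^bsub>R\<^esub> \<odot>\<^bsub>M\<^esub> x = x"

definition fin_gen_module :: "('a, 'x) ring_scheme \<Rightarrow> ('a, 'b, 'y) module_scheme \<Rightarrow> bool" where
  "fin_gen_module R M \<longleftrightarrow>
     (\<exists>B. finite B \<and> B \<subseteq> carrier M \<and>
       (\<forall>v \<in> carrier M. \<exists>c \<in> B \<rightarrow> carrier R.
          v = finsum M (\<lambda>b. c b \<odot>\<^bsub>M\<^esub> b) B))"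

definition indecomposable :: "('a, 'x) ring_scheme \<Rightarrow> ('a, 'b, 'y) module_scheme \<Rightarrow> bool" where
  "indecomposable R M \<longleftrightarrow>
     carrier M \<noteq> {\<zero>\<^bsub>M\<^esub>} \<and>
     (\<forall>N N'. Module.submodule N R M \<and> Module.submodule N' R M \<and> N \<inter> N' = {\<zero>\<^bsub>M\<^esub>} \<and>
        N <+>\<^bsub>M\<^esub> N' = carrier M \<longrightarrow> N = {\<zero>\<^bsub>M\<^esub>} \<or> N' = {\<zero>\<^bsub>M\<^esub>})"

definition short_exact ::
  "('b, 'x) ring_scheme \<Rightarrow> ('c, 'y) ring_scheme \<Rightarrow> ('d, 'z) ring_scheme \<Rightarrow>
   ('b \<Rightarrow> 'c) \<Rightarrow> ('c \<Rightarrow> 'd) \<Rightarrow> bool" where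
  "short_exact L M N u v \<longleftrightarrow>
     inj_on u (carrier L) \<and>
     u ` carrier L = {y \<in> carrier M. v y = \<zero>\<^bsub>N\<^esub>} \<and>
     v ` carrier M = carrier N"

text \<open>\<open>(x\<^sub>0, \<dots>, x\<^sub>r)M\<close> for a list of ring elements.\<close>

definition list_smult :: "'a list \<Rightarrow> ('a, 'b, 'y) module_scheme \<Rightarrow> 'b set" where
  "list_smult xs M =
     {finsum M (\<lambda>j. (xs ! j) \<odot>\<^bsub>M\<^esub> w j) {..<length xs} | w. w \<in> {..<length xs} \<rightarrow> carrier M}"

definition regular_seq :: "('a, 'b, 'y) module_scheme \<Rightarrow> 'a list \<Rightarrow> bool" where
  "regular_seq M xs \<longleftrightarrow>
     (\<forall>i < length xs. \<forall>v \<in> carrier M.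
        (xs ! i) \<odot>\<^bsub>M\<^esub> v \<in> list_smult (take i xs) M \<longrightarrow> v \<in> list_smult (take i xs) M) \<and>
     list_smult xs M \<noteq> carrier M"

definition depth :: "('a, 'x) ring_scheme \<Rightarrow> ('a, 'b, 'y) module_scheme \<Rightarrow> enat" where
  "depth R M =
     Sup {enat (length xs) | xs. set xs \<subseteq> (THE I. maximalideal I R) \<and> regular_seq M xs}"

definition krull_dim :: "('a, 'x) ring_scheme \<Rightarrow> enat" where
  "krull_dim R =
     Sup {enat r | r. \<exists>P. (\<forall>i \<le> r. primeideal (P i) R) \<and> (\<forall>i < r. P i \<subset> P (Suc i))}"

text \<open>
  The zero module counts as maximal Cohen--Macaulay, whatever its depth, so that these modules
  form an additive category. \<open>depth\<close> and \<open>MCM\<close> are meant for local Noetherian \<open>R\<close>.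
\<close>

definition MCM :: "('a, 'x) ring_scheme \<Rightarrow> ('a, 'b, 'y) module_scheme \<Rightarrow> bool" where
  "MCM R M \<longleftrightarrow> module R M \<and> fin_gen_module R M \<and>
     (carrier M = {\<zero>\<^bsub>M\<^esub>} \<or> depth R M = krull_dim R)"


section \<open>Representation embeddings and wildness\<close>

text \<open>
  A category whose objects stand for modules. It carries the predicate of being a short exact
  sequence \<open>0 \<rightarrow> X \<rightarrow> Y \<rightarrow> Z \<rightarrow> 0\<close> and that of being indecomposable; in all instances below these
  are \<open>short_exact\<close> and \<open>indecomposable\<close> of the underlying modules.
  \<open>Cmp C X Y Z v u\<close> is the composite of \<open>u : X \<rightarrow> Y\<close> and \<open>v : Y \<rightarrow> Z\<close>.
\<close>

record ('o, 'h) exact_cat =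
  Obj :: "'o set"
  Arr :: "'o \<Rightarrow> 'o \<Rightarrow> 'h set"
  Cmp :: "'o \<Rightarrow> 'o \<Rightarrow> 'o \<Rightarrow> 'h \<Rightarrow> 'h \<Rightarrow> 'h"
  Idt :: "'o \<Rightarrow> 'h"
  Ses :: "'o \<Rightarrow> 'o \<Rightarrow> 'o \<Rightarrow> 'h \<Rightarrow> 'h \<Rightarrow> bool"
  Indec :: "'o \<Rightarrow> bool"

definition isomorphic :: "('o, 'h) exact_cat \<Rightarrow> 'o \<Rightarrow> 'o \<Rightarrow> bool" where
  "isomorphic C X Y \<longleftrightarrow>
     (\<exists>u \<in> Arr C X Y. \<exists>v \<in> Arr C Y X. Cmp C X Y X v u = Idt C X \<and> Cmp C Y X Y u v = Idt C Y)"

definition is_functor ::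
  "('o, 'h) exact_cat \<Rightarrow> ('p, 'i) exact_cat \<Rightarrow> ('o \<Rightarrow> 'p) \<Rightarrow> ('o \<Rightarrow> 'o \<Rightarrow> 'h \<Rightarrow> 'i) \<Rightarrow> bool" where
  "is_functor C D F G \<longleftrightarrow>
     (\<forall>X \<in> Obj C. F X \<in> Obj D) \<and>
     (\<forall>X \<in> Obj C. \<forall>Y \<in> Obj C. \<forall>u \<in> Arr C X Y. G X Y u \<in> Arr D (F X) (F Y)) \<and>
     (\<forall>X \<in> Obj C. G X X (Idt C X) = Idt D (F X)) \<and>
     (\<forall>X \<in> Obj C. \<forall>Y \<in> Obj C. \<forall>Z \<in> Obj C. \<forall>u \<in> Arr C X Y. \<forall>v \<in> Arr C Y Z.
        G X Z (Cmp C X Y Z v u) = Cmp D (F X) (F Y) (F Z) (G Y Z v) (G X Y u))"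

definition rep_embedding ::
  "('o, 'h) exact_cat \<Rightarrow> ('p, 'i) exact_cat \<Rightarrow> ('o \<Rightarrow> 'p) \<Rightarrow> ('o \<Rightarrow> 'o \<Rightarrow> 'h \<Rightarrow> 'i) \<Rightarrow> bool" where
  "rep_embedding C D F G \<longleftrightarrow>
     is_functor C D F G \<and>
     (\<forall>X \<in> Obj C. \<forall>Y \<in> Obj C. \<forall>Z \<in> Obj C. \<forall>u \<in> Arr C X Y. \<forall>v \<in> Arr C Y Z.
        Ses C X Y Z u v \<longrightarrow> Ses D (F X) (F Y) (F Z) (G X Y u) (G Y Z v)) \<and>
     (\<forall>X \<in> Obj C. \<forall>Y \<in> Obj C. \<not> isomorphic C X Y \<longrightarrow> \<not> isomorphic D (F X) (F Y)) \<and>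
     (\<forall>X \<in> Obj C. Indec C X \<longrightarrow> Indec D (F X))"

text \<open>
  The full subcategory, on a set of objects, of the category of modules over \<open>R\<close>. Morphisms are
  extensional functions, so that equality of morphisms is equality of functions.
\<close>

definition module_cat ::
  "('a, 'x) ring_scheme \<Rightarrow> ('a, 'b) module set \<Rightarrow> (('a, 'b) module, 'b \<Rightarrow> 'b) exact_cat" where
  "module_cat R Ms =
     \<lparr>Obj = Ms,
      Arr = (\<lambda>M N. module_hom R M N \<inter> extensional (carrier M)),
      Cmp = (\<lambda>L M N v u. compose (carrier L) v u),
      Idt = (\<lambda>M. \<lambda>x \<in> carrier M. x),
      Ses = (\<lambda>L M N u v. short_exact L M N u v),
      Indec = (\<lambda>M. indecomposable R M)\<rparr>"

definition fin_gen_cat ::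
  "('a, 'x) ring_scheme \<Rightarrow> (('a, 'b) module, 'b \<Rightarrow> 'b) exact_cat" where
  "fin_gen_cat R = module_cat R {M. left_module R M \<and> fin_gen_module R M}"

definition MCM_cat ::
  "('a, 'x) ring_scheme \<Rightarrow> (('a, 'b) module, 'b \<Rightarrow> 'b) exact_cat" where
  "MCM_cat R = module_cat R {M. MCM R M}"

text \<open>
  The record type of modules also has room for the multiplication of an algebra \<open>\<Lambda>\<close>, as in
  the locale \<open>algebra\<close> of HOL-Algebra, which is limited to commutative \<open>\<Lambda>\<close>.
\<close>

definition fin_dim_algebra :: "('k :: field, 'l) module \<Rightarrow> bool" where
  "fin_dim_algebra \<Lambda> \<longleftrightarrow>
     ring \<Lambda> \<and> vectorspace class_ring \<Lambda> \<and> vectorspace.fin_dim class_ring \<Lambda> \<and>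
     (\<forall>c. \<forall>x \<in> carrier \<Lambda>. \<forall>y \<in> carrier \<Lambda>.
        (c \<odot>\<^bsub>\<Lambda>\<^esub> x) \<otimes>\<^bsub>\<Lambda>\<^esub> y = c \<odot>\<^bsub>\<Lambda>\<^esub> (x \<otimes>\<^bsub>\<Lambda>\<^esub> y) \<and>
        x \<otimes>\<^bsub>\<Lambda>\<^esub> (c \<odot>\<^bsub>\<Lambda>\<^esub> y) = c \<odot>\<^bsub>\<Lambda>\<^esub> (x \<otimes>\<^bsub>\<Lambda>\<^esub> y))"

text \<open>
  The types \<open>'l\<close> and \<open>'m\<close> are the universes from which the underlying sets of \<open>\<Lambda>\<close> and of the
  \<open>\<Lambda>\<close>-modules are drawn; leaving both arbitrary covers all finite-dimensional algebras and all
  finitely generated modules.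
\<close>

definition wild ::
  "'k :: field itself \<Rightarrow> 'l itself \<Rightarrow> 'm itself \<Rightarrow> ('o, 'h) exact_cat \<Rightarrow> bool" where
  "wild _ _ _ C \<longleftrightarrow>
     (\<forall>\<Lambda> :: ('k, 'l) module. fin_dim_algebra \<Lambda> \<longrightarrow>
        (\<exists>F G. rep_embedding (fin_gen_cat \<Lambda> :: (('l, 'm) module, 'm \<Rightarrow> 'm) exact_cat) C F G))"

text \<open>
  The type \<open>'q\<close> is the universe for the underlying sets of the Cohen--Macaulay modules. For the
  ring \<open>R = S/(f)\<close> below it is \<open>'k mps vec set\<close>, which contains all quotients of the free modules
  \<open>S\<^sup>N\<close> and hence every finitely generated \<open>R\<close>-module up to isomorphism.
\<close>

definition wild_CM_type ::
  "'k :: field itself \<Rightarrow> 'l itself \<Rightarrow> 'm itself \<Rightarrow> 'q itself \<Rightarrow> ('a, 'x) ring_scheme \<Rightarrow> bool" where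
  "wild_CM_type _ _ _ _ R \<longleftrightarrow>
     wild TYPE('k) TYPE('l) TYPE('m) (MCM_cat R :: (('a, 'q) module, 'q \<Rightarrow> 'q) exact_cat)"


section \<open>Multivariate power series\<close>

text \<open>
  Power series in countably many variables, given by their coefficients; monomials are exponent
  vectors of finite support. The ring in finitely many variables is the subring \<open>mps_ring\<close> below.
\<close>

typedef 'a mps = "UNIV :: ((nat \<Rightarrow>\<^sub>0 nat) \<Rightarrow> 'a) set"
  morphisms mcoeff Mps ..

setup_lifting type_definition_mps

lemma mps_eqI: "(\<And>\<mu>. mcoeff p \<mu> = mcoeff q \<mu>) \<Longrightarrow> p = q"
  by transfer auto

lemma mcoeff_Mps [simp]: "mcoeff (Mps c) = c"
  by (rule Mps_inverse) simp

abbreviation mon_splits :: "(nat \<Rightarrow>\<^sub>0 nat) \<Rightarrow> ((nat \<Rightarrow>\<^sub>0 nat) \<times> (nat \<Rightarrow>\<^sub>0 nat)) set" where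
  "mon_splits \<mu> \<equiv> {(\<alpha>, \<beta>). \<alpha> + \<beta> = \<mu>}"

lemma finite_mon_splits [simp]: "finite (mon_splits \<mu>)"
proof -
  let ?K = "Poly_Mapping.keys \<mu>" and ?l = "Poly_Mapping.lookup"
  let ?B = "\<Pi>\<^sub>E i \<in> ?K. {..?l \<mu> i}"
  have fin: "finite (?B \<times> ?B)"
    by (intro finite_cartesian_product finite_PiE) auto
  have zero: "?l \<alpha> i = 0 \<and> ?l \<beta> i = 0" if "\<alpha> + \<beta> = \<mu>" "i \<notin> ?K" for \<alpha> \<beta> i
  proof -
    have "?l \<mu> i = 0" using that(2) by (simp add: in_keys_iff)
    thus ?thesis using that(1) by (auto simp: lookup_add)
  qed
  let ?f = "\<lambda>(\<alpha>, \<beta>). (restrict (?l \<alpha>) ?K, restrict (?l \<beta>) ?K)"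
  have "inj_on ?f (mon_splits \<mu>)"
  proof (rule inj_onI)
    fix x y assume "x \<in> mon_splits \<mu>" "y \<in> mon_splits \<mu>" and e: "?f x = ?f y"
    then obtain \<alpha> \<beta> \<alpha>' \<beta>' where xy: "x = (\<alpha>, \<beta>)" "y = (\<alpha>', \<beta>')"
      and s: "\<alpha> + \<beta> = \<mu>" "\<alpha>' + \<beta>' = \<mu>" by auto
    have e: "restrict (?l \<alpha>) ?K = restrict (?l \<alpha>') ?K"
            "restrict (?l \<beta>) ?K = restrict (?l \<beta>') ?K"
      using e by (simp_all add: xy)
    have "?l \<alpha> i = ?l \<alpha>' i \<and> ?l \<beta> i = ?l \<beta>' i" for i
    proof (cases "i \<in> ?K")
      case True
      thus ?thesis using fun_cong[OF e(1), of i] fun_cong[OF e(2), of i] by simp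
    next
      case False
      thus ?thesis using zero s by metis
    qed
    thus "x = y" by (auto simp: xy intro: poly_mapping_eqI)
  qed
  moreover have "?f ` mon_splits \<mu> \<subseteq> ?B \<times> ?B"
    by (auto simp: lookup_add)
  ultimately show ?thesis using fin finite_imageD finite_subset by blast
qed

instantiation mps :: (comm_ring_1) comm_ring_1
begin

lift_definition zero_mps :: "'a mps" is "\<lambda>_. 0" .
lift_definition one_mps :: "'a mps" is "\<lambda>\<mu>. if \<mu> = 0 then 1 else 0" .
lift_definition plus_mps :: "'a mps \<Rightarrow> 'a mps \<Rightarrow> 'a mps" is "\<lambda>p q \<mu>. p \<mu> + q \<mu>" .
lift_definition uminus_mps :: "'a mps \<Rightarrow> 'a mps" is "\<lambda>p \<mu>. - p \<mu>" .
lift_definition minus_mps :: "'a mps \<Rightarrow> 'a mps \<Rightarrow> 'a mps" is "\<lambda>p q \<mu>. p \<mu> - q \<mu>" .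
lift_definition times_mps :: "'a mps \<Rightarrow> 'a mps \<Rightarrow> 'a mps"
  is "\<lambda>p q \<mu>. \<Sum>(\<alpha>, \<beta>) \<in> mon_splits \<mu>. p \<alpha> * q \<beta>" .

instance
proof
  fix p q r :: "'a mps"
  show "p + q + r = p + (q + r)" by transfer (simp add: add.assoc)
  show "p + q = q + p" by transfer (simp add: add.commute)
  show "0 + p = p" by transfer simp
  show "- p + p = 0" by transfer simp
  show "p - q = p + - q" by transfer simp
  show "(0 :: 'a mps) \<noteq> 1" by transfer (auto simp: fun_eq_iff)
  show "p * q = q * p"
  proof (transfer, rule ext)
    fix p q :: "(nat \<Rightarrow>\<^sub>0 nat) \<Rightarrow> 'a" and \<mu>
    show "(\<Sum>(\<alpha>, \<beta>)\<in>mon_splits \<mu>. p \<alpha> * q \<beta>) = (\<Sum>(\<alpha>, \<beta>)\<in>mon_splits \<mu>. q \<alpha> * p \<beta>)"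
      by (rule sum.reindex_bij_witness[of _ prod.swap prod.swap])
        (auto simp: add.commute mult.commute)
  qed
  show "(p + q) * r = p * r + q * r"
    by transfer (simp add: distrib_right sum.distrib case_prod_unfold)
  show "1 * p = p"
  proof (transfer, rule ext)
    fix p :: "(nat \<Rightarrow>\<^sub>0 nat) \<Rightarrow> 'a" and \<mu>
    have "(\<Sum>(\<alpha>, \<beta>)\<in>mon_splits \<mu>. (if \<alpha> = 0 then 1 else 0) * p \<beta>)
        = (\<Sum>(\<alpha>, \<beta>)\<in>{(0 :: nat \<Rightarrow>\<^sub>0 nat, \<mu>)}. (if \<alpha> = 0 then 1 else 0) * p \<beta>)"
      by (rule sum.mono_neutral_right) (auto split: if_splits)
    thus "(\<Sum>(\<alpha>, \<beta>)\<in>mon_splits \<mu>. (if \<alpha> = 0 then 1 else 0) * p \<beta>) = p \<mu>" by simp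
  qed
  show "p * q * r = p * (q * r)"
  proof (transfer, rule ext)
    fix p q r :: "(nat \<Rightarrow>\<^sub>0 nat) \<Rightarrow> 'a" and \<mu>
    have "(\<Sum>(\<alpha>, \<beta>)\<in>mon_splits \<mu>. (\<Sum>(\<gamma>, \<delta>)\<in>mon_splits \<alpha>. p \<gamma> * q \<delta>) * r \<beta>)
        = (\<Sum>x\<in>mon_splits \<mu>. \<Sum>y\<in>mon_splits (fst x). p (fst y) * q (snd y) * r (snd x))"
      by (simp add: case_prod_unfold sum_distrib_right)
    also have "\<dots> = (\<Sum>(x, y)\<in>Sigma (mon_splits \<mu>) (\<lambda>x. mon_splits (fst x)).
                      p (fst y) * q (snd y) * r (snd x))"
      by (rule sum.Sigma) simp_all
    also have "\<dots> = (\<Sum>(x, y)\<in>Sigma (mon_splits \<mu>) (\<lambda>x. mon_splits (snd x)).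
                      p (fst x) * (q (fst y) * r (snd y)))"
      by (rule sum.reindex_bij_witness[of _
            "\<lambda>((a, _), (c, d)). ((a + c, d), (a, c))" "\<lambda>((_, d), (a, c)). ((a, c + d), (c, d))"])
        (auto simp: add.assoc mult.assoc)
    also have "\<dots> = (\<Sum>x\<in>mon_splits \<mu>. \<Sum>y\<in>mon_splits (snd x). p (fst x) * (q (fst y) * r (snd y)))"
      by (rule sum.Sigma[symmetric]) simp_all
    also have "\<dots> = (\<Sum>(\<alpha>, \<beta>)\<in>mon_splits \<mu>. p \<alpha> * (\<Sum>(\<gamma>, \<delta>)\<in>mon_splits \<beta>. q \<gamma> * r \<delta>))"
      by (simp add: case_prod_unfold sum_distrib_left)
    finally show "(\<Sum>(\<alpha>, \<beta>)\<in>mon_splits \<mu>. (\<Sum>(\<gamma>, \<delta>)\<in>mon_splits \<alpha>. p \<gamma> * q \<delta>) * r \<beta>) =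
        (\<Sum>(\<alpha>, \<beta>)\<in>mon_splits \<mu>. p \<alpha> * (\<Sum>(\<gamma>, \<delta>)\<in>mon_splits \<beta>. q \<gamma> * r \<delta>))" .
  qed
qed

end

definition mps_const :: "'a :: zero \<Rightarrow> 'a mps" where
  "mps_const c = Mps (\<lambda>\<mu>. if \<mu> = 0 then c else 0)"

definition mps_var :: "nat \<Rightarrow> 'a :: zero_neq_one mps" where
  "mps_var i = Mps (\<lambda>\<mu>. if \<mu> = Poly_Mapping.single i 1 then 1 else 0)"

definition total_degree :: "(nat \<Rightarrow>\<^sub>0 nat) \<Rightarrow> nat" where
  "total_degree \<mu> = (\<Sum>i\<in>Poly_Mapping.keys \<mu>. Poly_Mapping.lookup \<mu> i)"

definition mps_order :: "'a :: zero mps \<Rightarrow> enat" where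
  "mps_order p = (INF \<mu> \<in> {\<mu>. mcoeff p \<mu> \<noteq> 0}. enat (total_degree \<mu>))"

text \<open>
  The variable with index \<open>0\<close> plays the role of \<open>z\<close>, those with index \<open>1, \<dots>, n\<close> the role of
  \<open>x\<^sub>1, \<dots>, x\<^sub>n\<close>.
\<close>

abbreviation z_var :: "'a :: zero_neq_one mps" where
  "z_var \<equiv> mps_var 0"

abbreviation x_var :: "nat \<Rightarrow> 'a :: zero_neq_one mps" where
  "x_var i \<equiv> mps_var i"

definition mps_ring :: "nat \<Rightarrow> 'a :: comm_ring_1 mps ring" where
  "mps_ring n =
     \<lparr>carrier = {p. \<forall>\<mu>. mcoeff p \<mu> \<noteq> 0 \<longrightarrow> Poly_Mapping.keys \<mu> \<subseteq> {0..n}},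
      mult = (*), one = 1, zero = 0, add = (+)\<rparr>"

definition hypersurface_ring :: "nat \<Rightarrow> 'k :: field mps \<Rightarrow> 'k mps set ring" where
  "hypersurface_ring n f = mps_ring n Quot (PIdl\<^bsub>mps_ring n\<^esub> f)"


section \<open>The parameters and the matrix factorizations\<close>

type_synonym 'k mpoly = "(nat \<Rightarrow>\<^sub>0 nat) \<Rightarrow>\<^sub>0 'k"

definition param_ring :: "nat \<Rightarrow> 'k :: field mpoly ring" where
  "param_ring n =
     \<lparr>carrier = {q. \<forall>\<epsilon> \<in> Poly_Mapping.keys q. Poly_Mapping.keys \<epsilon> \<subseteq> {1..n}},
      mult = (*), one = 1, zero = 0, add = (+)\<rparr>"

definition param_series :: "nat \<Rightarrow> 'k :: field mpoly mps set" where
  "param_series n = {p \<in> carrier (mps_ring n). \<forall>\<mu>. mcoeff p \<mu> \<in> carrier (param_ring n)}"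

definition a_param :: "nat \<Rightarrow> 'k :: field mpoly mps" where
  "a_param i = mps_const (Poly_Mapping.single (Poly_Mapping.single i 1) 1)"

definition extend_scalars :: "'k :: field mps \<Rightarrow> 'k mpoly mps" where
  "extend_scalars p = Mps (\<lambda>\<mu>. Poly_Mapping.single 0 (mcoeff p \<mu>))"

definition is_expression ::
  "nat \<Rightarrow> 'k :: field mps \<Rightarrow> 'k mpoly mps \<Rightarrow> (nat \<Rightarrow> 'k mpoly mps) \<Rightarrow> bool" where
  "is_expression n f h g \<longleftrightarrow>
     h \<in> param_series n \<and> 2 \<le> mps_order h \<and>
     (\<forall>i \<in> {1..n}. g i \<in> param_series n \<and> 3 \<le> mps_order (g i)) \<and>
     extend_scalars f = z_var ^ 2 * h + (\<Sum>i = 1..n. (x_var i - a_param i * z_var) * g i)"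

fun phi_psi ::
  "'k :: field mpoly mps \<Rightarrow> (nat \<Rightarrow> 'k mpoly mps) \<Rightarrow> nat \<Rightarrow> 'k mpoly mps mat \<times> 'k mpoly mps mat"
where
  "phi_psi h g 0 = (mat 1 1 (\<lambda>_. z_var ^ 2), mat 1 1 (\<lambda>_. h))"
| "phi_psi h g (Suc i) =
     (let (\<phi>, \<psi>) = phi_psi h g i;
          l = x_var (Suc i) - a_param (Suc i) * z_var;
          E = 1\<^sub>m (2 ^ i)
      in (four_block_mat \<phi> ((- g (Suc i)) \<cdot>\<^sub>m E) (l \<cdot>\<^sub>m E) \<psi>,
          four_block_mat \<psi> (g (Suc i) \<cdot>\<^sub>m E) ((- l) \<cdot>\<^sub>m E) \<phi>))"

text \<open>
  Evaluation of \<open>q \<in> k[a\<^sub>1, \<dots>, a\<^sub>n]\<close> at the \<open>m \<times> m\<close> matrices \<open>A\<^sub>1, \<dots>, A\<^sub>n\<close>. They commute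
  whenever this is used, so the order of the factors is immaterial.
\<close>

definition monom_mat :: "nat \<Rightarrow> nat \<Rightarrow> (nat \<Rightarrow> 'k :: field mat) \<Rightarrow> (nat \<Rightarrow>\<^sub>0 nat) \<Rightarrow> 'k mat" where
  "monom_mat n m A \<epsilon> =
     foldr (\<lambda>i B. A i ^\<^sub>m Poly_Mapping.lookup \<epsilon> i * B) [1..<Suc n] (1\<^sub>m m)"

definition poly_mat :: "nat \<Rightarrow> nat \<Rightarrow> (nat \<Rightarrow> 'k :: field mat) \<Rightarrow> 'k mpoly \<Rightarrow> 'k mat" where
  "poly_mat n m A q =
     mat m m (\<lambda>(r, s).
       \<Sum>\<epsilon> \<in> Poly_Mapping.keys q. Poly_Mapping.lookup q \<epsilon> * monom_mat n m A \<epsilon> $$ (r, s))"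

definition inflate ::
  "nat \<Rightarrow> nat \<Rightarrow> (nat \<Rightarrow> 'k :: field mat) \<Rightarrow> 'k mpoly mps \<Rightarrow> 'k mps mat" where
  "inflate n m A p = mat m m (\<lambda>(r, s). Mps (\<lambda>\<mu>. poly_mat n m A (mcoeff p \<mu>) $$ (r, s)))"

definition inflate_mat ::
  "nat \<Rightarrow> nat \<Rightarrow> (nat \<Rightarrow> 'k :: field mat) \<Rightarrow> 'k mpoly mps mat \<Rightarrow> 'k mps mat" where
  "inflate_mat n m A B =
     mat (dim_row B * m) (dim_col B * m)
       (\<lambda>(i, j). inflate n m A (B $$ (i div m, j div m)) $$ (i mod m, j mod m))"

definition inflated_mf ::
  "nat \<Rightarrow> 'k :: field mpoly mps \<Rightarrow> (nat \<Rightarrow> 'k mpoly mps) \<Rightarrow> nat \<times> (nat \<Rightarrow> 'k mat) \<Rightarrow>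
   'k mps mat \<times> 'k mps mat" where
  "inflated_mf n h g = (\<lambda>(m, A).
     (inflate_mat n m A (fst (phi_psi h g n)), inflate_mat n m A (snd (phi_psi h g n))))"


section \<open>Linear representations and the functor\<close>

text \<open>
  \<open>(m, A)\<close> stands for \<open>L(A\<^sub>1, \<dots>, A\<^sub>n)\<close> on \<open>k\<^sup>m\<close>; its underlying module over
  \<open>k[a\<^sub>1, \<dots>, a\<^sub>n]\<close> is \<open>rep_module n (m, A)\<close>.
\<close>

definition lin_reps :: "nat \<Rightarrow> (nat \<times> (nat \<Rightarrow> 'k :: field mat)) set" where
  "lin_reps n =
     {(m, A). A \<in> {1..n} \<rightarrow>\<^sub>E carrier_mat m m \<and> (\<forall>i \<in> {1..n}. \<forall>j \<in> {1..n}. A i * A j = A j * A i)}"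

definition rep_module ::
  "nat \<Rightarrow> nat \<times> (nat \<Rightarrow> 'k :: field mat) \<Rightarrow> ('k mpoly, 'k vec) module" where
  "rep_module n = (\<lambda>(m, A).
     \<lparr>carrier = carrier_vec m, mult = undefined, one = undefined, zero = 0\<^sub>v m, add = (+),
      smult = (\<lambda>q v. poly_mat n m A q *\<^sub>v v)\<rparr>)"

definition lin_rep_cat ::
  "nat \<Rightarrow> (nat \<times> (nat \<Rightarrow> 'k :: field mat), 'k mat) exact_cat" where
  "lin_rep_cat n =
     \<lparr>Obj = lin_reps n,
      Arr = (\<lambda>(m, A) (m', A'). {U \<in> carrier_mat m' m. \<forall>i \<in> {1..n}. U * A i = A' i * U}),
      Cmp = (\<lambda>X Y Z V U. V * U),
      Idt = (\<lambda>(m, A). 1\<^sub>m m),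
      Ses = (\<lambda>X Y Z U V. short_exact (rep_module n X) (rep_module n Y) (rep_module n Z)
               ((*\<^sub>v) U) ((*\<^sub>v) V)),
      Indec = (\<lambda>X. indecomposable (param_ring n) (rep_module n X))\<rparr>"

definition free_vecs :: "nat \<Rightarrow> nat \<Rightarrow> 'k :: field mps vec set" where
  "free_vecs n N = {v \<in> carrier_vec N. \<forall>i < N. v $ i \<in> carrier (mps_ring n)}"

definition cok_class :: "nat \<Rightarrow> 'k :: field mps mat \<Rightarrow> 'k mps vec \<Rightarrow> 'k mps vec set" where
  "cok_class n \<Phi> v = {v + \<Phi> *\<^sub>v w | w. w \<in> free_vecs n (dim_col \<Phi>)}"

text \<open>
  The cokernel of \<open>\<Phi>\<close> as a module over \<open>hypersurface_ring n f\<close>. Both scalars and module elements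
  are cosets; as for \<open>rcoset_mult\<close>, operations are performed on all representatives.
  The scalar multiplication is well-defined if \<open>\<Phi>\<close> belongs to a matrix factorization of \<open>f\<close>.
\<close>

definition cok_module :: "nat \<Rightarrow> 'k :: field mps mat \<Rightarrow> ('k mps set, 'k mps vec set) module" where
  "cok_module n \<Phi> =
     \<lparr>carrier = cok_class n \<Phi> ` free_vecs n (dim_row \<Phi>),
      mult = undefined, one = undefined,
      zero = cok_class n \<Phi> (0\<^sub>v (dim_row \<Phi>)),
      add = (\<lambda>V W. \<Union>v\<in>V. \<Union>w\<in>W. cok_class n \<Phi> (v + w)),
      smult = (\<lambda>r V. \<Union>s\<in>r. \<Union>v\<in>V. cok_class n \<Phi> (s \<cdot>\<^sub>v v))\<rparr>"

definition mf_module ::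
  "nat \<Rightarrow> 'k :: field mps mat \<times> 'k mps mat \<Rightarrow> ('k mps set, 'k mps vec set) module" where
  "mf_module n = (\<lambda>(\<Phi>, \<Psi>). cok_module n \<Phi>)"

definition mf_map ::
  "nat \<Rightarrow> 'k :: field mps mat \<times> 'k mps mat \<Rightarrow> 'k mps mat \<times> 'k mps mat \<Rightarrow>
   'k mps mat \<times> 'k mps mat \<Rightarrow> 'k mps vec set \<Rightarrow> 'k mps vec set" where
  "mf_map n = (\<lambda>(\<Phi>, \<Psi>) (\<Phi>', \<Psi>') (P, Q).
     \<lambda>V \<in> carrier (cok_module n \<Phi>). \<Union>v\<in>V. cok_class n \<Phi>' (P *\<^sub>v v))"

definition F_obj ::
  "nat \<Rightarrow> 'k :: field mpoly mps \<Rightarrow> (nat \<Rightarrow> 'k mpoly mps) \<Rightarrow> nat \<times> (nat \<Rightarrow> 'k mat) \<Rightarrow>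
   ('k mps set, 'k mps vec set) module" where
  "F_obj n h g X = mf_module n (inflated_mf n h g X)"

definition F_arr ::
  "nat \<Rightarrow> 'k :: field mpoly mps \<Rightarrow> (nat \<Rightarrow> 'k mpoly mps) \<Rightarrow>
   nat \<times> (nat \<Rightarrow> 'k mat) \<Rightarrow> nat \<times> (nat \<Rightarrow> 'k mat) \<Rightarrow> 'k mat \<Rightarrow> 'k mps vec set \<Rightarrow> 'k mps vec set"
where
  "F_arr n h g X Y U =
     (let U' = map_mat mps_const (diag_block_mat (replicate (2 ^ n) U))
      in mf_map n (inflated_mf n h g X) (inflated_mf n h g Y) (U', U'))"

end

theory Submission
  imports
    Defs
    "Jordan_Normal_Form.Char_Poly"
    "HOL-Algebra.Ring_Divisibility"
begin

text \<open>
  Every entry of \<open>\<phi>\<^sub>n\<close> and \<open>\<psi>\<^sub>n\<close> that joins two adjacent vertices of the \<open>n\<close>-cube is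
  \<open>\<plusminus>(x\<^sub>j - a\<^sub>j z)\<close>, and all other entries have order at least 2. Comparing the coefficients of \<open>x\<^sub>j\<close> and \<open>z\<close>
  in \<open>P \<Phi> = \<Phi>' Q\<close> therefore shows that the constant term of a homomorphism \<open>(P, Q)\<close> of inflated matrix
  factorizations is block triangular with one and the same matrix \<open>U\<close> in all diagonal positions, and that
  \<open>U\<close> intertwines the \<open>A\<^sub>j\<close>. Homomorphisms of cokernels lift to homomorphisms of matrix factorizations, so
  isomorphisms give an invertible \<open>U\<close> and idempotents an idempotent \<open>U\<close>; an idempotent with \<open>U = 0\<close>
  vanishes by Nakayama's lemma.

  Cokernels of matrix factorizations have depth \<open>n\<close>: after a linear change of coordinates, Weierstrass
  division makes \<open>S/(f)\<close> finite over power series in \<open>n\<close> variables; these variables form a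
  regular sequence, while \<open>n\<close> also bounds the lengths of chains of primes.

  For wildness, a module over a finite-dimensional algebra is a tuple of matrices, and tuples of matrices
  are encoded in pairs of commuting matrices.
\<close>

text \<open>Linear coefficients of \<open>P \<Phi> = \<Phi>' Q\<close> relate a constant block of
  \<open>P\<close> to a block of \<open>Q\<close> at vertices with one element removed, and
  \<open>Q \<Psi> = \<Psi>' P\<close> does the reverse. This leaves open whether the first diagonal
  blocks of \<open>P\<close> and \<open>Q\<close> agree. That is a question about quadratic terms:
  the upper left entry of \<phi> is z^2, and the relation is tested on the substitution x_i = A_i z,
  which is consistent because the A_i commute. Order 3 of the g_i makes the rest of the first row of
  \<phi> invisible in degree 2; order 2 of h keeps the diagonal entries out of degree 1.

  Being maximal Cohen--Macaulay means an equality, obtained from n \<le> depth \<le> Krull dimension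
  \<le> n. The middle inequality attaches to a regular sequence a multiplicative monoid that does
  not contain 0, and a chain of primes to that monoid.

  The field has to be infinite at two places: to find coordinates in which a given series contains a
  pure power of one variable, and to have enough distinct scalars \<lambda>_r in the encoding of
  tuples.\<close>

abbreviation keys :: "('a \<Rightarrow>\<^sub>0 'b :: zero) \<Rightarrow> 'a set" where
  "keys \<equiv> Poly_Mapping.keys"

abbreviation lookup :: "('a \<Rightarrow>\<^sub>0 'b :: zero) \<Rightarrow> 'a \<Rightarrow> 'b" where
  "lookup \<equiv> Poly_Mapping.lookup"

abbreviation single :: "'a \<Rightarrow> 'b \<Rightarrow> ('a \<Rightarrow>\<^sub>0 'b :: zero)" where
  "single \<equiv> Poly_Mapping.single"

section \<open>Coefficients of power series\<close>

lemma mcoeff_zero [simp]: "mcoeff 0 \<mu> = 0"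
  and mcoeff_one: "mcoeff 1 \<mu> = (if \<mu> = 0 then 1 else 0)"
  and mcoeff_add [simp]: "mcoeff (p + q) \<mu> = mcoeff p \<mu> + mcoeff q \<mu>"
  and mcoeff_diff [simp]: "mcoeff (p - q) \<mu> = mcoeff p \<mu> - mcoeff q \<mu>"
  and mcoeff_uminus [simp]: "mcoeff (- p) \<mu> = - mcoeff p \<mu>"
  and mcoeff_times: "mcoeff (p * q) \<mu> = (\<Sum>(\<alpha>, \<beta>)\<in>mon_splits \<mu>. mcoeff p \<alpha> * mcoeff q \<beta>)"
  for p q :: "'a :: comm_ring_1 mps"
  by (simp_all only: zero_mps.rep_eq one_mps.rep_eq plus_mps.rep_eq minus_mps.rep_eq uminus_mps.rep_eq times_mps.rep_eq)

lemma mcoeff_sum [simp]: "mcoeff (sum p A) \<mu> = (\<Sum>i\<in>A. mcoeff (p i) \<mu>)"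
  for p :: "_ \<Rightarrow> 'a :: comm_ring_1 mps"
  by (induction A rule: infinite_finite_induct) auto

lemma mcoeff_const: "mcoeff (mps_const c) \<mu> = (if \<mu> = 0 then c else 0)"
  by (simp add: mps_const_def)

lemma mcoeff_var: "mcoeff (mps_var i) \<mu> = (if \<mu> = single i 1 then 1 else 0)"
  by (simp add: mps_var_def)

lemma keys_add_nat: "keys (\<alpha> + \<beta>) = keys \<alpha> \<union> keys \<beta>"
  for \<alpha> \<beta> :: "nat \<Rightarrow>\<^sub>0 nat"
  by (auto simp: in_keys_iff lookup_add)

lemma total_degree_eq:
  "finite V \<Longrightarrow> keys \<mu> \<subseteq> V \<Longrightarrow> total_degree \<mu> = (\<Sum>i\<in>V. lookup \<mu> i)"
  unfolding total_degree_def by (rule sum.mono_neutral_left) (auto simp: in_keys_iff)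

lemma total_degree_add: "total_degree (\<alpha> + \<beta>) = total_degree \<alpha> + total_degree \<beta>"
  by (simp add: total_degree_eq[of "keys \<alpha> \<union> keys \<beta>"]
      keys_add_nat lookup_add sum.distrib)

lemma total_degree_zero [simp]: "total_degree 0 = 0"
  by (simp add: total_degree_def)

lemma total_degree_single [simp]: "total_degree (single i j) = j"
  by (cases "j = 0") (auto simp: total_degree_def)

lemma total_degree_eq_0_iff [simp]: "total_degree \<mu> = 0 \<longleftrightarrow> \<mu> = 0"
  by (auto simp: total_degree_def in_keys_iff intro!: poly_mapping_eqI)

lemma lookup_le_total_degree: "lookup \<mu> i \<le> total_degree \<mu>"
  by (cases "i \<in> keys \<mu>")
    (auto simp: total_degree_def in_keys_iff intro: member_le_sum)

lemma finite_bounded_monomials: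
  assumes "finite V"
  shows "finite {\<mu>. keys \<mu> \<subseteq> V \<and> total_degree \<mu> \<le> d}"
proof (rule finite_imageD[where f = "\<lambda>\<mu>. restrict (lookup \<mu>) V"])
  have "(\<lambda>\<mu>. restrict (lookup \<mu>) V) ` {\<mu>. keys \<mu> \<subseteq> V \<and> total_degree \<mu> \<le> d}
      \<subseteq> (\<Pi>\<^sub>E i\<in>V. {..d})"
    using lookup_le_total_degree le_trans by fastforce
  thus "finite ((\<lambda>\<mu>. restrict (lookup \<mu>) V) `
      {\<mu>. keys \<mu> \<subseteq> V \<and> total_degree \<mu> \<le> d})"
    by (rule finite_subset) (intro finite_PiE assms, simp)
  show "inj_on (\<lambda>\<mu>. restrict (lookup \<mu>) V)
      {\<mu>. keys \<mu> \<subseteq> V \<and> total_degree \<mu> \<le> d}"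
  proof (rule inj_onI, rule poly_mapping_eqI)
    fix \<mu> \<nu> :: "nat \<Rightarrow>\<^sub>0 nat" and i
    assume *: "\<mu> \<in> {\<mu>. keys \<mu> \<subseteq> V \<and> total_degree \<mu> \<le> d}"
      "\<nu> \<in> {\<mu>. keys \<mu> \<subseteq> V \<and> total_degree \<mu> \<le> d}"
      "restrict (lookup \<mu>) V = restrict (lookup \<nu>) V"
    show "lookup \<mu> i = lookup \<nu> i"
    proof (cases "i \<in> V")
      case True thus ?thesis using fun_cong[OF *(3), of i] by simp
    next
      case False
      hence "i \<notin> keys \<mu>" "i \<notin> keys \<nu>" using * by auto
      thus ?thesis by (simp add: in_keys_iff)
    qed
  qed
qed

section \<open>Monomials as power series, and coefficients of simple products\<close>

definition mps_monom :: "(nat \<Rightarrow>\<^sub>0 nat) \<Rightarrow> 'a :: zero_neq_one mps" where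
  "mps_monom \<nu> = Mps (\<lambda>\<mu>. if \<mu> = \<nu> then 1 else 0)"

lemma mcoeff_monom: "mcoeff (mps_monom \<nu>) \<mu> = (if \<mu> = \<nu> then 1 else 0)"
  by (simp add: mps_monom_def)

lemma mcoeff_monom_times [simp]: "mcoeff (mps_monom \<nu> * p) (\<nu> + \<beta>) = mcoeff p \<beta>"
  for p :: "'a :: comm_ring_1 mps"
proof -
  have "mcoeff (mps_monom \<nu> * p) (\<nu> + \<beta>) =
      (\<Sum>(\<alpha>, \<gamma>)\<in>{(\<nu>, \<beta>)}. mcoeff (mps_monom \<nu>) \<alpha> * mcoeff p \<gamma>)"
    unfolding mcoeff_times by (rule sum.mono_neutral_right) (auto simp: mcoeff_monom split: if_splits)
  thus ?thesis by (simp add: mcoeff_monom)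
qed

lemma mcoeff_monom_times_eq_0: "(\<And>\<beta>. \<mu> \<noteq> \<nu> + \<beta>) \<Longrightarrow> mcoeff (mps_monom \<nu> * p) \<mu> = 0"
  for p :: "'a :: comm_ring_1 mps"
  unfolding mcoeff_times by (rule sum.neutral) (auto simp: mcoeff_monom)

lemma mps_var_eq_monom: "mps_var i = mps_monom (single i 1)"
  by (simp add: mps_var_def mps_monom_def)

lemma mps_monom_zero: "mps_monom 0 = (1 :: 'a :: comm_ring_1 mps)"
  by (rule mps_eqI) (simp add: mcoeff_monom mcoeff_one)

lemma mps_monom_add: "mps_monom (\<mu> + \<nu>) = mps_monom \<mu> * (mps_monom \<nu> :: 'a :: comm_ring_1 mps)"
proof (rule mps_eqI)
  fix \<gamma> show "mcoeff (mps_monom (\<mu> + \<nu>)) \<gamma> = mcoeff (mps_monom \<mu> * (mps_monom \<nu> :: 'a mps)) \<gamma>"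
  proof (cases "\<exists>\<beta>. \<gamma> = \<mu> + \<beta>")
    case True
    then obtain \<beta> where "\<gamma> = \<mu> + \<beta>" by blast
    thus ?thesis by (auto simp: mcoeff_monom)
  next
    case False
    thus ?thesis by (subst mcoeff_monom_times_eq_0) (auto simp: mcoeff_monom)
  qed
qed

lemma lookup_ge_1D:
  assumes "lookup \<mu> i \<noteq> (0 :: nat)"
  shows "\<mu> = single i 1 + (\<mu> - single i 1)"
  using assms by (intro poly_mapping_eqI) (auto simp: lookup_add lookup_minus lookup_single when_def)

lemma mcoeff_var_times:
  "mcoeff (mps_var i * p) \<mu> =
    (if lookup \<mu> i = 0 then 0 else mcoeff p (\<mu> - single i 1))"
  for p :: "'a :: comm_ring_1 mps"
proof (cases "lookup \<mu> i = 0")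
  case True
  have "mcoeff (mps_var i * p) \<mu> = 0" unfolding mps_var_eq_monom
  proof (rule mcoeff_monom_times_eq_0)
    fix \<beta> show "\<mu> \<noteq> single i 1 + \<beta>" using True by (auto simp: lookup_add)
  qed
  thus ?thesis using True by simp
next
  case False
  show ?thesis using False unfolding mps_var_eq_monom
    by (subst lookup_ge_1D[OF False]) (simp only: mcoeff_monom_times if_False)
qed

lemma mcoeff_const_times [simp]: "mcoeff (mps_const c * p) \<mu> = c * mcoeff p \<mu>"
  for p :: "'a :: comm_ring_1 mps"
proof -
  have "mcoeff (mps_const c * p) \<mu> =
      (\<Sum>(\<alpha>, \<gamma>)\<in>{(0, \<mu>)}. mcoeff (mps_const c) \<alpha> * mcoeff p \<gamma>)"
    unfolding mcoeff_times by (rule sum.mono_neutral_right) (auto simp: mcoeff_const split: if_splits)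
  thus ?thesis by (simp add: mcoeff_const)
qed

lemma mps_const_0 [simp]: "mps_const 0 = (0 :: 'a :: comm_ring_1 mps)"
  and mps_const_1 [simp]: "mps_const 1 = (1 :: 'a :: comm_ring_1 mps)"
  and mps_const_add: "mps_const (a + b) = mps_const a + (mps_const b :: 'a :: comm_ring_1 mps)"
  and mps_const_mult: "mps_const (a * b) = mps_const a * (mps_const b :: 'a :: comm_ring_1 mps)"
  by (rule mps_eqI; simp add: mcoeff_const mcoeff_one)+

lemma mon_splits_0: "mon_splits 0 = {(0, 0)}"
  by (auto; metis total_degree_add total_degree_eq_0_iff add_is_0)

lemma mcoeff_times_0 [simp]: "mcoeff (p * q) 0 = mcoeff p 0 * mcoeff q 0"
  for p :: "'a :: comm_ring_1 mps"
  by (simp add: mcoeff_times mon_splits_0)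

section \<open>Power series in a set of variables\<close>

definition mps_over :: "nat set \<Rightarrow> 'a :: zero mps set" where
  "mps_over V = {p. \<forall>\<mu>. mcoeff p \<mu> \<noteq> 0 \<longrightarrow> keys \<mu> \<subseteq> V}"

lemma mps_overI: "(\<And>\<mu>. mcoeff p \<mu> \<noteq> 0 \<Longrightarrow> keys \<mu> \<subseteq> V) \<Longrightarrow> p \<in> mps_over V"
  and mps_overD: "p \<in> mps_over V \<Longrightarrow> mcoeff p \<mu> \<noteq> 0 \<Longrightarrow> keys \<mu> \<subseteq> V"
  and mps_over_coeff_0: "p \<in> mps_over V \<Longrightarrow> \<not> keys \<mu> \<subseteq> V \<Longrightarrow> mcoeff p \<mu> = 0"
  unfolding mps_over_def by blast+

lemma mps_over_mono: "V \<subseteq> W \<Longrightarrow> mps_over V \<subseteq> mps_over W"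
  unfolding mps_over_def by blast

lemma carrier_mps_ring [simp]: "carrier (mps_ring n) = mps_over {0..n}"
  and mps_ring_simps [simp]: "(\<otimes>\<^bsub>mps_ring n\<^esub>) = (*)" "\<one>\<^bsub>mps_ring n\<^esub> = 1"
    "\<zero>\<^bsub>mps_ring n\<^esub> = 0" "(\<oplus>\<^bsub>mps_ring n\<^esub>) = (+)"
  by (simp_all add: mps_ring_def mps_over_def)

text \<open>The ring homomorphism that puts every variable outside \<open>V\<close> equal to 0. It
  retracts onto \<open>mps_over V\<close>: closure properties of that subring follow from its being
  the fixed set of a homomorphism, and solutions found in too many variables can be pushed back into
  it.\<close>

definition res_vars :: "nat set \<Rightarrow> 'a :: zero mps \<Rightarrow> 'a mps" where
  "res_vars V p = Mps (\<lambda>\<mu>. if keys \<mu> \<subseteq> V then mcoeff p \<mu> else 0)"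

lemma mcoeff_res_vars: "mcoeff (res_vars V p) \<mu> = (if keys \<mu> \<subseteq> V then mcoeff p \<mu> else 0)"
  by (simp add: res_vars_def)

lemma res_vars_over: "res_vars V p \<in> mps_over V"
  by (auto simp: mps_over_def mcoeff_res_vars)

lemma res_vars_id: "p \<in> mps_over V \<Longrightarrow> res_vars V p = p"
  by (rule mps_eqI) (auto simp: mps_over_def mcoeff_res_vars)

lemma res_vars_add: "res_vars V (p + q) = res_vars V p + res_vars V q"
  and res_vars_diff: "res_vars V (p - q) = res_vars V p - res_vars V q"
  and res_vars_uminus: "res_vars V (- p) = - res_vars V p"
  and res_vars_0 [simp]: "res_vars V (0 :: 'a mps) = 0"
  and res_vars_1 [simp]: "res_vars V (1 :: 'a mps) = 1"
  for p q :: "'a :: comm_ring_1 mps"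
  by (rule mps_eqI; simp add: mcoeff_res_vars mcoeff_one)+

lemma res_vars_mult: "res_vars V (p * q) = res_vars V p * res_vars V q"
  for p q :: "'a :: comm_ring_1 mps"
proof (rule mps_eqI)
  fix \<mu>
  show "mcoeff (res_vars V (p * q)) \<mu> = mcoeff (res_vars V p * res_vars V q) \<mu>"
  proof (cases "keys \<mu> \<subseteq> V")
    case True
    show ?thesis using True unfolding mcoeff_times mcoeff_res_vars
      by (auto intro!: sum.cong simp: keys_add_nat)
  next
    case False
    have "mcoeff (res_vars V p * res_vars V q) \<mu> = 0"
      unfolding mcoeff_times mcoeff_res_vars
      by (rule sum.neutral) (use False in \<open>auto simp: keys_add_nat\<close>)
    thus ?thesis using False by (simp add: mcoeff_res_vars)
  qed
qed

lemma mps_over_iff: "p \<in> mps_over V \<longleftrightarrow> res_vars V p = p"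
  using res_vars_id res_vars_over by metis

lemma mps_over_closed:
  fixes p q :: "'a :: comm_ring_1 mps"
  shows mps_over_0 [simp]: "0 \<in> mps_over V" 
    and mps_over_1 [simp]: "1 \<in> mps_over V"
    and mps_over_add: "p \<in> mps_over V \<Longrightarrow> q \<in> mps_over V \<Longrightarrow> p + q \<in> mps_over V"
    and mps_over_diff: "p \<in> mps_over V \<Longrightarrow> q \<in> mps_over V \<Longrightarrow> p - q \<in> mps_over V"
    and mps_over_uminus: "p \<in> mps_over V \<Longrightarrow> - p \<in> mps_over V"
    and mps_over_mult: "p \<in> mps_over V \<Longrightarrow> q \<in> mps_over V \<Longrightarrow> p * q \<in> mps_over V"
  by (simp_all add: mps_over_iff res_vars_add res_vars_diff res_vars_uminus res_vars_mult)

lemma mps_over_const [simp]: "mps_const c \<in> mps_over V"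
  by (auto simp: mps_over_def mcoeff_const)

lemma mps_over_var: "i \<in> V \<Longrightarrow> mps_var i \<in> mps_over V"
  by (auto simp: mps_over_def mcoeff_var)

lemma mps_over_power: "p \<in> mps_over V \<Longrightarrow> p ^ j \<in> mps_over V"
  for p :: "'a :: comm_ring_1 mps"
  by (induction j) (auto intro: mps_over_closed)

lemma mps_over_sum: "(\<And>i. i \<in> A \<Longrightarrow> p i \<in> mps_over V) \<Longrightarrow> sum p A \<in> mps_over V"
  for p :: "_ \<Rightarrow> 'a :: comm_ring_1 mps"
  by (induction A rule: infinite_finite_induct) (auto intro: mps_over_closed)

lemma mps_over_prod: "(\<And>i. i \<in> A \<Longrightarrow> p i \<in> mps_over V) \<Longrightarrow> prod p A \<in> mps_over V"
  for p :: "_ \<Rightarrow> 'a :: comm_ring_1 mps"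
  by (induction A rule: infinite_finite_induct) (auto intro: mps_over_closed)

section \<open>Leading monomials, and power series as an integral domain\<close>

lemma mps_over_leading:
  fixes p :: "'a :: comm_ring_1 mps"
  assumes "p \<noteq> 0" "p \<in> mps_over V" "finite V"
  obtains \<mu> where "mcoeff p \<mu> \<noteq> 0"
    "\<And>\<nu>. mcoeff p \<nu> \<noteq> 0 \<Longrightarrow> total_degree \<mu> < total_degree \<nu> \<or> total_degree \<mu> = total_degree \<nu> \<and> \<mu> \<le> \<nu>"
proof -
  obtain \<mu>0 where \<mu>0: "mcoeff p \<mu>0 \<noteq> 0" using assms(1) mps_eqI[of p 0] by auto
  define d where "d = (LEAST d. \<exists>\<mu>. mcoeff p \<mu> \<noteq> 0 \<and> total_degree \<mu> = d)"
  have ex: "\<exists>\<mu>. mcoeff p \<mu> \<noteq> 0 \<and> total_degree \<mu> = d"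
    unfolding d_def by (rule LeastI_ex) (use \<mu>0 in blast)
  have le: "d \<le> total_degree \<nu>" if "mcoeff p \<nu> \<noteq> 0" for \<nu>
    unfolding d_def by (rule Least_le) (use that in blast)
  let ?D = "{\<mu>. mcoeff p \<mu> \<noteq> 0 \<and> total_degree \<mu> = d}"
  \<comment> \<open>Only finitely many monomials in the finite set \<open>V\<close> have the lowest
    degree, so the order on exponent vectors has a least one among them.\<close>
  have fin: "finite ?D"
    by (rule finite_subset[OF _ finite_bounded_monomials[OF assms(3), of d]])
      (use assms(2) in \<open>auto simp: mps_over_def\<close>)
  have "Min ?D \<in> ?D" by (rule Min_in) (use ex fin in auto)
  moreover have "total_degree (Min ?D) < total_degree \<nu> \<or>
      total_degree (Min ?D) = total_degree \<nu> \<and> Min ?D \<le> \<nu>" if "mcoeff p \<nu> \<noteq> 0" for \<nu>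
  proof (cases "total_degree \<nu> = d")
    case True
    hence "Min ?D \<le> \<nu>" using that fin by (intro Min_le) auto
    thus ?thesis using True \<open>Min ?D \<in> ?D\<close> by auto
  next
    case False
    thus ?thesis using le[OF that] \<open>Min ?D \<in> ?D\<close> by auto
  qed
  ultimately show ?thesis using that by blast
qed

text \<open>The product of the two leading monomials arises in only one way. A series in infinitely
  many variables may have infinitely many monomials of lowest degree, so both factors are first
  restricted to the variables of one monomial each; this is harmless because restriction is
  multiplicative.\<close>

instance mps :: (idom) idom
proof
  fix p q :: "'a mps"
  assume "p \<noteq> 0" "q \<noteq> 0"
  obtain \<mu> \<nu> where \<mu>: "mcoeff p \<mu> \<noteq> 0" and \<nu>: "mcoeff q \<nu> \<noteq> 0"
    using \<open>p \<noteq> 0\<close> \<open>q \<noteq> 0\<close> mps_eqI[of p 0] mps_eqI[of q 0] by auto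
  define V where "V = keys \<mu> \<union> keys \<nu>"
  have V: "finite V" by (simp add: V_def)
  let ?p = "res_vars V p" and ?q = "res_vars V q"
  have "mcoeff ?p \<mu> \<noteq> 0" "mcoeff ?q \<nu> \<noteq> 0" using \<mu> \<nu> by (auto simp: mcoeff_res_vars V_def)
  hence nz: "?p \<noteq> 0" "?q \<noteq> 0" by auto
  obtain \<alpha> where \<alpha>: "mcoeff ?p \<alpha> \<noteq> 0" "\<And>\<gamma>. mcoeff ?p \<gamma> \<noteq> 0 \<Longrightarrow>
      total_degree \<alpha> < total_degree \<gamma> \<or> total_degree \<alpha> = total_degree \<gamma> \<and> \<alpha> \<le> \<gamma>"
    using mps_over_leading[OF nz(1) res_vars_over V] by blast
  obtain \<beta> where \<beta>: "mcoeff ?q \<beta> \<noteq> 0" "\<And>\<gamma>. mcoeff ?q \<gamma> \<noteq> 0 \<Longrightarrow>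
      total_degree \<beta> < total_degree \<gamma> \<or> total_degree \<beta> = total_degree \<gamma> \<and> \<beta> \<le> \<gamma>"
    using mps_over_leading[OF nz(2) res_vars_over V] by blast
  have eq: "\<gamma> = \<alpha> \<and> \<delta> = \<beta>" if "\<gamma> + \<delta> = \<alpha> + \<beta>" "mcoeff ?p \<gamma> \<noteq> 0" "mcoeff ?q \<delta> \<noteq> 0" for \<gamma> \<delta>
  proof -
    have "total_degree \<gamma> + total_degree \<delta> = total_degree \<alpha> + total_degree \<beta>"
      using that(1) by (metis total_degree_add)
    hence le: "\<alpha> \<le> \<gamma>" "\<beta> \<le> \<delta>" using \<alpha>(2)[OF that(2)] \<beta>(2)[OF that(3)] by auto
    have "\<gamma> = \<alpha>"
    proof (rule ccontr)
      assume "\<gamma> \<noteq> \<alpha>"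
      hence "\<alpha> + \<beta> < \<gamma> + \<delta>" using le by (intro add_less_le_mono) auto
      thus False using that(1) by simp
    qed
    thus ?thesis using that(1) by simp
  qed
  have "mcoeff (?p * ?q) (\<alpha> + \<beta>) = (\<Sum>(\<gamma>, \<delta>)\<in>{(\<alpha>, \<beta>)}. mcoeff ?p \<gamma> * mcoeff ?q \<delta>)"
    unfolding mcoeff_times by (rule sum.mono_neutral_right) (auto dest: eq)
  also have "\<dots> \<noteq> 0" using \<alpha>(1) \<beta>(1) by simp
  finally have "res_vars V (p * q) \<noteq> 0" by (auto simp: res_vars_mult)
  thus "p * q \<noteq> 0" by (metis res_vars_0)
qed

section \<open>Weierstrass division and units\<close>

text \<open>The coefficients of the quotient are determined recursively: at the monomial
  \<open>\<mu> + e\<close>, the product \<open>q * c\<close> involves the coefficient of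
  \<open>q\<close> at \<open>\<mu>\<close>, multiplied by the non-zero scalar
  \<open>mcoeff c e\<close>, and otherwise only coefficients of \<open>q\<close> that come earlier
  in a well-founded order.\<close>

lemma weierstrass_division:
  fixes c p :: "'k :: field mps"
  assumes c: "c \<in> mps_over V" and p: "p \<in> mps_over V"
    and low: "\<And>j. j < d \<Longrightarrow> mcoeff c (single v j) = 0"
    and lead: "mcoeff c (single v d) \<noteq> 0"
  obtains q where "q \<in> mps_over V"
    "\<And>\<mu>. d \<le> lookup \<mu> v \<Longrightarrow> mcoeff (p - q * c) \<mu> = 0"
proof -
  define e where "e = single v d"
  define rest where "rest \<mu> = total_degree \<mu> - lookup \<mu> v" for \<mu>
  have rest_add: "rest (\<alpha> + \<beta>) = rest \<alpha> + rest \<beta>" for \<alpha> \<beta>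
    using lookup_le_total_degree[of \<alpha> v] lookup_le_total_degree[of \<beta> v]
    by (simp add: rest_def total_degree_add lookup_add)
  have rest_0: "\<mu> = single v (lookup \<mu> v)" if "rest \<mu> = 0" for \<mu>
  proof -
    let ?s = "single v (lookup \<mu> v)"
    have s: "\<mu> = ?s + (\<mu> - ?s)"
      by (rule poly_mapping_eqI) (simp add: lookup_add lookup_minus lookup_single when_def)
    have "total_degree (\<mu> - ?s) = 0"
      using that lookup_le_total_degree[of \<mu> v] arg_cong[OF s, of total_degree]
      by (simp add: rest_def total_degree_add)
    thus ?thesis using s by simp
  qed
  \<comment> \<open>The degree in the other variables comes first, then the exponent of
    \<open>v\<close>. If \<open>\<alpha> + \<beta> = \<mu> + e\<close> and \<open>\<alpha>\<close>,
    \<open>\<mu>\<close> agree in the former, then \<open>\<beta>\<close> is a power of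
    \<open>v\<close>; powers below \<open>d\<close> do not occur in \<open>c\<close>, and those
    above \<open>d\<close> force a smaller exponent of \<open>v\<close> in
    \<open>\<alpha>\<close>.\<close>
  define R where "R = measures [rest, \<lambda>\<mu>. lookup \<mu> v]"
  have wf: "wf R" by (simp add: R_def)
  define F where "F q \<mu> = (if keys \<mu> \<subseteq> V then
      (mcoeff p (\<mu> + e) - (\<Sum>(\<alpha>, \<beta>)\<in>{(\<alpha>, \<beta>) \<in> mon_splits (\<mu> + e). (\<alpha>, \<mu>) \<in> R}. q \<alpha> * mcoeff c \<beta>))
        / mcoeff c e else 0)" for q \<mu>
  have adm: "adm_wf R F"
    unfolding adm_wf_def F_def by (auto intro!: sum.cong arg_cong2[of _ _ _ _ "(/)"])
  define q0 where "q0 = wfrec R F"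
  have q0: "q0 = F q0" unfolding q0_def by (rule wfrec_fixpoint[OF wf adm])
  define q where "q = Mps q0"
  have qV: "q \<in> mps_over V"
  proof (rule mps_overI)
    fix \<mu> assume "mcoeff q \<mu> \<noteq> 0"
    hence "F q0 \<mu> \<noteq> 0" using q0 by (simp add: q_def)
    thus "keys \<mu> \<subseteq> V" by (auto simp: F_def split: if_splits)
  qed
  have main: "mcoeff (p - q * c) (\<mu> + e) = 0" for \<mu>
  proof (cases "keys \<mu> \<subseteq> V")
    case False
    have "p - q * c \<in> mps_over V" using p c qV by (intro mps_over_closed)
    thus ?thesis using False by (intro mps_over_coeff_0) (auto simp: keys_add_nat)
  next
    case True
    let ?A = "{(\<alpha>, \<beta>) \<in> mon_splits (\<mu> + e). (\<alpha>, \<mu>) \<in> R}"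
    have fin: "finite ?A" by (rule finite_subset[OF _ finite_mon_splits[of "\<mu> + e"]]) auto
    have nin: "(\<mu>, e) \<notin> ?A" using wf by auto
    have "mcoeff (q * c) (\<mu> + e) = (\<Sum>(\<alpha>, \<beta>)\<in>insert (\<mu>, e) ?A. q0 \<alpha> * mcoeff c \<beta>)"
      unfolding mcoeff_times q_def mcoeff_Mps
    proof (rule sum.mono_neutral_right, goal_cases)
      case 3
      have "mcoeff c \<beta> = 0" if "\<alpha> + \<beta> = \<mu> + e" "(\<alpha>, \<mu>) \<notin> R" "\<beta> \<noteq> e" for \<alpha> \<beta>
      proof (rule ccontr)
        assume nz: "mcoeff c \<beta> \<noteq> 0"
        have r: "rest \<alpha> + rest \<beta> = rest \<mu>"
          using arg_cong[OF that(1), of rest] by (simp add: rest_add) (simp add: rest_def e_def)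
        have l: "lookup \<alpha> v + lookup \<beta> v = lookup \<mu> v + d"
          using arg_cong[OF that(1), of "\<lambda>m. lookup m v"] by (simp add: lookup_add e_def)
        have "rest \<beta> = 0" using that(2) r by (auto simp: R_def)
        hence \<beta>: "\<beta> = single v (lookup \<beta> v)" by (rule rest_0)
        have "\<not> lookup \<beta> v < d" using nz low \<beta> by metis
        moreover have "lookup \<beta> v \<noteq> d" using that(3) \<beta> e_def by metis
        ultimately show False using that(2) r l \<open>rest \<beta> = 0\<close> by (auto simp: R_def)
      qed
      moreover have "\<alpha> = \<mu> \<longleftrightarrow> \<beta> = e" if "\<alpha> + \<beta> = \<mu> + e" for \<alpha> \<beta>
        using that by auto
      ultimately show ?case by (clarsimp simp del: add_left_cancel) blast
    qed auto
    also have "\<dots> = q0 \<mu> * mcoeff c e + (\<Sum>(\<alpha>, \<beta>)\<in>?A. q0 \<alpha> * mcoeff c \<beta>)"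
      using fin nin by (subst sum.insert) auto
    also have "q0 \<mu> * mcoeff c e = mcoeff p (\<mu> + e) - (\<Sum>(\<alpha>, \<beta>)\<in>?A. q0 \<alpha> * mcoeff c \<beta>)"
      by (subst q0) (use True lead in \<open>simp add: F_def e_def\<close>)
    finally show ?thesis by simp
  qed
  have "mcoeff (p - q * c) \<mu> = 0" if "d \<le> lookup \<mu> v" for \<mu>
  proof -
    have "\<mu> = (\<mu> - e) + e" using that
      by (intro poly_mapping_eqI) (auto simp: lookup_add lookup_minus lookup_single when_def e_def)
    thus ?thesis using main[of "\<mu> - e"] by simp
  qed
  thus ?thesis using that qV by blast
qed

text \<open>Weierstrass division of 1 by \<open>c\<close> with \<open>d = 0\<close>: the condition
  on the remainder then covers all monomials, so the remainder is 0.\<close>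

lemma mps_unit:
  fixes c :: "'k :: field mps"
  assumes c: "c \<in> mps_over V" and "mcoeff c 0 \<noteq> 0"
  obtains q where "q \<in> mps_over V" "q * c = 1"
proof -
  obtain q where "q \<in> mps_over V" "\<And>\<mu>. 0 \<le> lookup \<mu> 0 \<Longrightarrow> mcoeff (1 - q * c) \<mu> = 0"
    using weierstrass_division[OF c mps_over_1, of 0 0] assms(2) by auto
  thus ?thesis using that[of q] mps_eqI[of "1 - q * c" 0] by simp
qed

lemma single_one_eq_iff [simp]:
  "single i (Suc 0) = single j (Suc 0) \<longleftrightarrow> i = j"
  by (metis lookup_single_eq lookup_single_not_eq nat.simps(3))

section \<open>Substitution\<close>

definition order_ge :: "nat \<Rightarrow> 'a :: zero mps \<Rightarrow> bool" where
  "order_ge d p \<longleftrightarrow> (\<forall>\<mu>. total_degree \<mu> < d \<longrightarrow> mcoeff p \<mu> = 0)"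

lemma order_geD: "order_ge d p \<Longrightarrow> total_degree \<mu> < d \<Longrightarrow> mcoeff p \<mu> = 0"
  by (simp add: order_ge_def)

lemma order_ge_0 [simp]: "order_ge 0 p"
  by (simp add: order_ge_def)

lemma order_ge_Suc_0: "order_ge (Suc 0) p \<longleftrightarrow> mcoeff p 0 = 0"
  by (auto simp: order_ge_def)

lemma order_ge_iff: "order_ge d p \<longleftrightarrow> enat d \<le> mps_order p"
  unfolding order_ge_def mps_order_def le_INF_iff by (auto simp: not_less[symmetric])

lemma order_ge_mono: "order_ge d p \<Longrightarrow> e \<le> d \<Longrightarrow> order_ge e p"
  by (auto simp: order_ge_def)

lemma order_ge_mult:
  fixes p q :: "'a :: comm_ring_1 mps"
  assumes "order_ge d p" "order_ge e q"
  shows "order_ge (d + e) (p * q)"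
  unfolding order_ge_def
proof (intro allI impI)
  fix \<mu> assume *: "total_degree \<mu> < d + e"
  show "mcoeff (p * q) \<mu> = 0" unfolding mcoeff_times
  proof (rule sum.neutral, clarify)
    fix \<alpha> \<beta> assume "\<mu> = \<alpha> + \<beta>"
    hence "total_degree \<alpha> < d \<or> total_degree \<beta> < e" using * by (auto simp: total_degree_add)
    thus "mcoeff p \<alpha> * mcoeff q \<beta> = 0" using assms by (auto dest: order_geD)
  qed
qed

lemma order_ge_power: "order_ge d p \<Longrightarrow> order_ge (j * d) (p ^ j)"
  for p :: "'a :: comm_ring_1 mps"
  by (induction j) (auto intro: order_ge_mult)

lemma order_ge_prod: "(\<And>i. i \<in> A \<Longrightarrow> order_ge (d i) (p i)) \<Longrightarrow> order_ge (sum d A) (prod p A)"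
  for p :: "_ \<Rightarrow> 'a :: comm_ring_1 mps"
  by (induction A rule: infinite_finite_induct) (auto intro: order_ge_mult)

definition subst_monom :: "nat set \<Rightarrow> (nat \<Rightarrow> 'a :: comm_ring_1 mps) \<Rightarrow> (nat \<Rightarrow>\<^sub>0 nat) \<Rightarrow> 'a mps" where
  "subst_monom V \<sigma> \<nu> = (\<Prod>i\<in>V. \<sigma> i ^ lookup \<nu> i)"

abbreviation bdd_monoms :: "nat set \<Rightarrow> nat \<Rightarrow> (nat \<Rightarrow>\<^sub>0 nat) set" where
  "bdd_monoms V d \<equiv> {\<nu>. keys \<nu> \<subseteq> V \<and> total_degree \<nu> \<le> d}"

text \<open>The truncation at the degree of \<open>\<mu>\<close> makes the sum finite. Nothing is
  lost as long as no \<open>\<sigma> i\<close> has a constant term, because the image of a monomial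
  then has at least the degree of that monomial as its order.\<close>

definition subst_mps :: "nat set \<Rightarrow> (nat \<Rightarrow> 'a :: comm_ring_1 mps) \<Rightarrow> 'a mps \<Rightarrow> 'a mps" where
  "subst_mps V \<sigma> p =
    Mps (\<lambda>\<mu>. \<Sum>\<nu>\<in>bdd_monoms V (total_degree \<mu>). mcoeff p \<nu> * mcoeff (subst_monom V \<sigma> \<nu>) \<mu>)"

lemma subst_monom_add: "subst_monom V \<sigma> (\<mu> + \<nu>) = subst_monom V \<sigma> \<mu> * subst_monom V \<sigma> \<nu>"
  by (simp add: subst_monom_def lookup_add power_add prod.distrib)

locale substitution =
  fixes V :: "nat set" and \<sigma> :: "nat \<Rightarrow> 'a :: comm_ring_1 mps"
  assumes finite_V: "finite V" and const_0: "\<And>i. i \<in> V \<Longrightarrow> mcoeff (\<sigma> i) 0 = 0"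
begin

lemma subst_monom_order:
  assumes "keys \<nu> \<subseteq> V"
  shows "order_ge (total_degree \<nu>) (subst_monom V \<sigma> \<nu>)"
proof -
  have "order_ge (lookup \<nu> i * Suc 0) (\<sigma> i ^ lookup \<nu> i)" if "i \<in> V" for i
    using that const_0 by (intro order_ge_power) (simp add: order_ge_Suc_0)
  thus ?thesis unfolding subst_monom_def total_degree_eq[OF finite_V assms]
    by (intro order_ge_prod) auto
qed

text \<open>Monomials of degree above that of \<open>\<mu>\<close> contribute 0, so the bound may be
  raised. This gives one common bound for all the coefficients that a product convolves.\<close>

lemma mcoeff_subst:
  assumes "total_degree \<mu> \<le> d"
  shows "mcoeff (subst_mps V \<sigma> p) \<mu> =
    (\<Sum>\<nu>\<in>bdd_monoms V d. mcoeff p \<nu> * mcoeff (subst_monom V \<sigma> \<nu>) \<mu>)"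
  unfolding subst_mps_def mcoeff_Mps
  by (rule sum.mono_neutral_left)
    (use assms finite_V in \<open>auto simp: not_le intro: finite_bounded_monomials dest: order_geD[OF subst_monom_order]\<close>)

lemma subst_add: "subst_mps V \<sigma> (p + q) = subst_mps V \<sigma> p + subst_mps V \<sigma> q"
  and subst_const_mult: "subst_mps V \<sigma> (mps_const c * p) = mps_const c * subst_mps V \<sigma> p"
  by (rule mps_eqI, simp add: subst_mps_def sum.distrib distrib_right sum_distrib_left mult.assoc)+

lemma subst_monom_image:
  assumes "keys \<nu> \<subseteq> V"
  shows "subst_mps V \<sigma> (mps_monom \<nu>) = subst_monom V \<sigma> \<nu>"
proof (rule mps_eqI)
  fix \<mu>
  have "mcoeff (subst_mps V \<sigma> (mps_monom \<nu>)) \<mu> =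
      (\<Sum>\<alpha>\<in>{\<nu>}. mcoeff (mps_monom \<nu>) \<alpha> * mcoeff (subst_monom V \<sigma> \<alpha>) \<mu>)"
    unfolding mcoeff_subst[OF max.cobounded1[of "total_degree \<mu>" "total_degree \<nu>"]]
    by (rule sum.mono_neutral_right)
      (use assms in \<open>auto simp: mcoeff_monom intro: finite_bounded_monomials[OF finite_V]\<close>)
  thus "mcoeff (subst_mps V \<sigma> (mps_monom \<nu>)) \<mu> = mcoeff (subst_monom V \<sigma> \<nu>) \<mu>"
    by (simp add: mcoeff_monom)
qed

lemma subst_1: "subst_mps V \<sigma> 1 = 1"
  using subst_monom_image[of 0] by (simp add: mps_monom_zero subst_monom_def)

lemma subst_var:
  assumes "i \<in> V"
  shows "subst_mps V \<sigma> (mps_var i) = \<sigma> i"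
proof -
  have "subst_mps V \<sigma> (mps_var i) = (\<Prod>j\<in>V. \<sigma> j ^ (if i = j then Suc 0 else 0))"
    unfolding mps_var_eq_monom
    by (subst subst_monom_image) (use assms in \<open>simp_all add: subst_monom_def lookup_single when_def\<close>)
  also have "\<dots> = (\<Prod>j\<in>V. if i = j then \<sigma> j else 1)" by (rule prod.cong) auto
  also have "\<dots> = \<sigma> i" using assms finite_V by simp
  finally show ?thesis .
qed

lemma subst_mult: "subst_mps V \<sigma> (p * q) = subst_mps V \<sigma> p * subst_mps V \<sigma> q"
proof (rule mps_eqI)
  fix \<mu>
  define d where "d = total_degree \<mu>"
  let ?B = "bdd_monoms V d" and ?m = "subst_monom V \<sigma>"
  have fin: "finite ?B" by (rule finite_bounded_monomials[OF finite_V])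
  define T where "T = (\<lambda>(\<alpha>, \<beta>). mcoeff p \<alpha> * mcoeff q \<beta> * mcoeff (?m (\<alpha> + \<beta>)) \<mu>)"
  have "mcoeff (subst_mps V \<sigma> (p * q)) \<mu> = (\<Sum>\<nu>\<in>?B. \<Sum>x\<in>mon_splits \<nu>. T x)"
    by (simp add: subst_mps_def mcoeff_times sum_distrib_right d_def T_def case_prod_unfold
        cong: sum.cong) (auto intro!: sum.cong simp: case_prod_unfold)
  also have "\<dots> = (\<Sum>(\<nu>, x)\<in>Sigma ?B mon_splits. T x)"
    by (rule sum.Sigma) (use fin in auto)
  also have "\<dots> = (\<Sum>x\<in>{x \<in> ?B \<times> ?B. total_degree (fst x + snd x) \<le> d}. T x)"
    by (rule sum.reindex_bij_witness[of _ "\<lambda>x. (fst x + snd x, x)" snd])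
      (auto simp: keys_add_nat total_degree_add)
  \<comment> \<open>The pairs added here have total degree above \<open>d\<close>, so the image of
    their product vanishes at \<open>\<mu>\<close>. The sum now runs over a full rectangle and can
    be factored.\<close>
  also have "\<dots> = (\<Sum>x\<in>?B \<times> ?B. T x)"
  proof (rule sum.mono_neutral_left)
    show "\<forall>x\<in>?B \<times> ?B - {x \<in> ?B \<times> ?B. total_degree (fst x + snd x) \<le> d}. T x = 0"
    proof
      fix x assume x: "x \<in> ?B \<times> ?B - {x \<in> ?B \<times> ?B. total_degree (fst x + snd x) \<le> d}"
      hence "mcoeff (?m (fst x + snd x)) \<mu> = 0"
        by (intro order_geD[OF subst_monom_order]) (auto simp: keys_add_nat d_def)
      thus "T x = 0" by (simp add: T_def case_prod_unfold)
    qed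
  qed (use fin in auto)
  also have "\<dots> = (\<Sum>\<alpha>\<in>?B. \<Sum>\<beta>\<in>?B. T (\<alpha>, \<beta>))"
    by (simp add: sum.cartesian_product)
  also have "\<dots> = (\<Sum>\<alpha>\<in>?B. \<Sum>\<beta>\<in>?B. \<Sum>x\<in>mon_splits \<mu>.
      (mcoeff p \<alpha> * mcoeff (?m \<alpha>) (fst x)) * (mcoeff q \<beta> * mcoeff (?m \<beta>) (snd x)))"
    by (simp add: T_def subst_monom_add mcoeff_times sum_distrib_left case_prod_unfold ac_simps)
  also have "\<dots> = (\<Sum>\<alpha>\<in>?B. \<Sum>x\<in>mon_splits \<mu>. \<Sum>\<beta>\<in>?B.
      (mcoeff p \<alpha> * mcoeff (?m \<alpha>) (fst x)) * (mcoeff q \<beta> * mcoeff (?m \<beta>) (snd x)))"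
    by (intro sum.cong refl sum.swap)
  also have "\<dots> = (\<Sum>x\<in>mon_splits \<mu>. \<Sum>\<alpha>\<in>?B. \<Sum>\<beta>\<in>?B.
      (mcoeff p \<alpha> * mcoeff (?m \<alpha>) (fst x)) * (mcoeff q \<beta> * mcoeff (?m \<beta>) (snd x)))"
    by (rule sum.swap)
  also have "\<dots> = (\<Sum>x\<in>mon_splits \<mu>. mcoeff (subst_mps V \<sigma> p) (fst x) * mcoeff (subst_mps V \<sigma> q) (snd x))"
  proof (rule sum.cong[OF refl])
    fix x assume "x \<in> mon_splits \<mu>"
    hence "total_degree (fst x) \<le> d" "total_degree (snd x) \<le> d"
      by (auto simp: d_def total_degree_add)
    thus "(\<Sum>\<alpha>\<in>?B. \<Sum>\<beta>\<in>?B.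
        (mcoeff p \<alpha> * mcoeff (?m \<alpha>) (fst x)) * (mcoeff q \<beta> * mcoeff (?m \<beta>) (snd x))) =
      mcoeff (subst_mps V \<sigma> p) (fst x) * mcoeff (subst_mps V \<sigma> q) (snd x)"
      by (simp add: mcoeff_subst[of _ d] sum_product)
  qed
  also have "\<dots> = mcoeff (subst_mps V \<sigma> p * subst_mps V \<sigma> q) \<mu>"
    by (simp add: mcoeff_times case_prod_unfold)
  finally show "mcoeff (subst_mps V \<sigma> (p * q)) \<mu> = mcoeff (subst_mps V \<sigma> p * subst_mps V \<sigma> q) \<mu>" .
qed

lemma subst_order: "order_ge d p \<Longrightarrow> order_ge d (subst_mps V \<sigma> p)"
  unfolding order_ge_def subst_mps_def by (auto intro!: sum.neutral)

lemma subst_over: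
  assumes "\<And>i. i \<in> V \<Longrightarrow> \<sigma> i \<in> mps_over W"
  shows "subst_mps V \<sigma> p \<in> mps_over W"
proof (rule mps_overI, rule ccontr)
  fix \<mu> assume "mcoeff (subst_mps V \<sigma> p) \<mu> \<noteq> 0" "\<not> keys \<mu> \<subseteq> W"
  moreover have "subst_monom V \<sigma> \<nu> \<in> mps_over W" for \<nu>
    unfolding subst_monom_def by (intro mps_over_prod mps_over_power assms)
  ultimately show False
    unfolding subst_mps_def mcoeff_Mps by (metis (no_types, lifting) mps_over_coeff_0 mult_zero_right sum.neutral)
qed

end

text \<open>Such an \<open>H\<close> is determined modulo every power of the maximal ideal by its values on polynomials.\<close>

lemma hom_eq_id:
  fixes H :: "'a :: comm_ring_1 mps \<Rightarrow> 'a mps"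
  assumes V: "finite V"
    and add: "\<And>p q. H (p + q) = H p + H q" and mult: "\<And>p q. H (p * q) = H p * H q"
    and one: "H 1 = 1" and const: "\<And>c p. H (mps_const c * p) = mps_const c * H p"
    and order: "\<And>d p. order_ge d p \<Longrightarrow> order_ge d (H p)"
    and var: "\<And>i. i \<in> V \<Longrightarrow> H (mps_var i) = mps_var i"
    and p: "p \<in> mps_over V"
  shows "H p = p"
proof (rule mps_eqI)
  fix \<mu>
  have monom: "H (mps_monom \<nu>) = mps_monom \<nu>" if "keys \<nu> \<subseteq> V" for \<nu>
    using that
  proof (induction "total_degree \<nu>" arbitrary: \<nu>)
    case 0 thus ?case by (simp add: mps_monom_zero one)
  next
    case (Suc d)
    then obtain i where i: "lookup \<nu> i \<noteq> 0"
      by (metis lookup_zero nat.simps(3) poly_mapping_eqI total_degree_zero)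
    let ?\<nu> = "\<nu> - single i 1"
    have eq: "\<nu> = single i 1 + ?\<nu>" using lookup_ge_1D[OF i] .
    have k: "keys ?\<nu> \<subseteq> V" "i \<in> V"
      using Suc.prems eq by (metis keys_add_nat le_sup_iff, use i Suc.prems in \<open>auto simp: in_keys_iff\<close>)
    have "total_degree \<nu> = 1 + total_degree ?\<nu>"
      using arg_cong[OF eq, of total_degree] by (simp only: total_degree_add total_degree_single)
    hence "H (mps_monom ?\<nu>) = mps_monom ?\<nu>" using Suc.hyps k by auto
    moreover have "mps_monom \<nu> = mps_var i * (mps_monom ?\<nu> :: 'a mps)"
      by (metis eq mps_monom_add mps_var_eq_monom)
    ultimately show ?case using var[OF k(2)] mult by simp
  qed
  have zero: "H 0 = 0" using const[of 0 0] by simp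
  let ?B = "bdd_monoms V (total_degree \<mu>)"
  define t where "t = (\<Sum>\<nu>\<in>?B. mps_const (mcoeff p \<nu>) * mps_monom \<nu>)"
  have Hsum: "H (sum g A) = (\<Sum>x\<in>A. H (g x))" for g :: "_ \<Rightarrow> 'a mps" and A :: "(nat \<Rightarrow>\<^sub>0 nat) set"
    by (induction A rule: infinite_finite_induct) (auto simp: zero add)
  have Ht: "H t = t" unfolding t_def Hsum by (rule sum.cong) (auto simp: const monom)
  have fin: "finite ?B" by (rule finite_bounded_monomials[OF V])
  have tc: "mcoeff t \<nu> = (if \<nu> \<in> ?B then mcoeff p \<nu> else 0)" for \<nu>
  proof -
    have "mcoeff t \<nu> = (\<Sum>\<alpha>\<in>?B. if \<nu> = \<alpha> then mcoeff p \<alpha> else 0)"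
      unfolding t_def mcoeff_sum mcoeff_const_times mcoeff_monom by (rule sum.cong) auto
    thus ?thesis using fin by simp
  qed
  have r: "order_ge (Suc (total_degree \<mu>)) (p - t)"
    using p by (auto simp: order_ge_def tc mps_over_def)
  have "H p = t + H (p - t)" using add[of t "p - t"] Ht by simp
  moreover have "mcoeff (H (p - t)) \<mu> = 0" "mcoeff (p - t) \<mu> = 0"
    using order_geD[OF order[OF r]] order_geD[OF r] by simp_all
  ultimately show "mcoeff (H p) \<mu> = mcoeff p \<mu>" by simp
qed

section \<open>Linear coordinate changes\<close>

text \<open>In the induction the terms whose exponent at \<open>x\<close> is that of
  \<open>\<nu>0\<close> form the coefficient of one power of \<open>x\<close>. Once this coefficient
  is non-zero at \<open>\<theta>\<close>, some value \<open>t\<close> of \<open>x\<close> avoids the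
  finitely many roots of the resulting polynomial in one variable.\<close>

lemma multivariate_nonvanishing:
  fixes c :: "('b \<Rightarrow> nat) \<Rightarrow> 'k :: field"
  assumes inf: "infinite (UNIV :: 'k set)" and "finite V" "finite N"
    and "\<And>\<mu> \<nu>. \<mu> \<in> N \<Longrightarrow> \<nu> \<in> N \<Longrightarrow> (\<forall>i\<in>V. \<mu> i = \<nu> i) \<Longrightarrow> \<mu> = \<nu>"
    and "\<nu>0 \<in> N" "c \<nu>0 \<noteq> 0"
  shows "\<exists>\<theta>. (\<Sum>\<nu>\<in>N. c \<nu> * (\<Prod>i\<in>V. \<theta> i ^ \<nu> i)) \<noteq> 0"
  using assms(2-)
proof (induction V arbitrary: N \<nu>0 rule: finite_induct)
  case empty
  hence "N = {\<nu>0}" by auto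
  thus ?case using empty by simp
next
  case (insert x V)
  let ?N = "\<lambda>j. {\<nu> \<in> N. \<nu> x = j}"
  have "\<exists>\<theta>. (\<Sum>\<nu>\<in>?N (\<nu>0 x). c \<nu> * (\<Prod>i\<in>V. \<theta> i ^ \<nu> i)) \<noteq> 0"
  proof (rule insert.IH[of _ \<nu>0])
    fix \<mu> \<nu> assume "\<mu> \<in> ?N (\<nu>0 x)" "\<nu> \<in> ?N (\<nu>0 x)" "\<forall>i\<in>V. \<mu> i = \<nu> i"
    thus "\<mu> = \<nu>" by (intro insert.prems(2)) auto
  qed (use insert.prems in auto)
  then obtain \<theta> where \<theta>: "(\<Sum>\<nu>\<in>?N (\<nu>0 x). c \<nu> * (\<Prod>i\<in>V. \<theta> i ^ \<nu> i)) \<noteq> 0" by blast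
  define d where "d = Max ((\<lambda>\<nu>. \<nu> x) ` N)"
  have d: "\<nu> x \<le> d" if "\<nu> \<in> N" for \<nu> unfolding d_def using that insert.prems(1) by simp
  define P where "P = (\<Sum>j\<le>d. Polynomial.monom (\<Sum>\<nu>\<in>?N j. c \<nu> * (\<Prod>i\<in>V. \<theta> i ^ \<nu> i)) j)"
  have "poly.coeff P (\<nu>0 x) \<noteq> 0"
    using \<theta> d[OF insert.prems(3)] by (simp add: P_def coeff_sum)
  hence "P \<noteq> 0" by auto
  hence "finite {t. poly P t = 0}" by (rule poly_roots_finite)
  then obtain t where t: "poly P t \<noteq> 0" using inf by (metis (mono_tags) UNIV_eq_I mem_Collect_eq)
  have "(\<Sum>\<nu>\<in>N. c \<nu> * (\<Prod>i\<in>insert x V. (\<theta>(x := t)) i ^ \<nu> i)) =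
      (\<Sum>\<nu>\<in>N. t ^ \<nu> x * (c \<nu> * (\<Prod>i\<in>V. \<theta> i ^ \<nu> i)))"
  proof (rule sum.cong[OF refl])
    fix \<nu>
    have "(\<Prod>i\<in>V. (\<theta>(x := t)) i ^ \<nu> i) = (\<Prod>i\<in>V. \<theta> i ^ \<nu> i)"
      by (rule prod.cong) (use insert.hyps in auto)
    thus "c \<nu> * (\<Prod>i\<in>insert x V. (\<theta>(x := t)) i ^ \<nu> i) = t ^ \<nu> x * (c \<nu> * (\<Prod>i\<in>V. \<theta> i ^ \<nu> i))"
      using insert.hyps by simp
  qed
  also have "\<dots> = (\<Sum>j\<le>d. \<Sum>\<nu>\<in>?N j. t ^ \<nu> x * (c \<nu> * (\<Prod>i\<in>V. \<theta> i ^ \<nu> i)))"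
    by (rule sum.group[symmetric]) (use insert.prems(1) d in auto)
  also have "\<dots> = poly P t"
    by (auto simp: P_def poly_sum poly_monom sum_distrib_left ac_simps intro!: sum.cong)
  finally show ?case using t by metis
qed

text \<open>Fixing the variable \<open>v\<close> makes the inverse explicit, namely the shear with
  the coefficients \<open>- \<theta>\<close>, and still leaves enough freedom to make a given series
  regular in \<open>v\<close>.\<close>

definition shear :: "nat set \<Rightarrow> nat \<Rightarrow> (nat \<Rightarrow> 'a :: comm_ring_1) \<Rightarrow> nat \<Rightarrow> 'a mps" where
  "shear V v \<theta> i = (if i = v then mps_var i else mps_var i + mps_const (\<theta> i) * mps_var v)"

lemma substitution_shear: "finite V \<Longrightarrow> substitution V (shear V v \<theta>)"
  by unfold_locales (auto simp: shear_def mcoeff_var single_zero poly_mapping_eq_iff fun_eq_iff lookup_single when_def)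

lemma shear_over: "v \<in> V \<Longrightarrow> i \<in> V \<Longrightarrow> shear V v \<theta> i \<in> mps_over V"
  by (auto simp: shear_def intro!: mps_over_closed mps_over_var)

lemma shear_inverse:
  assumes "finite V" "v \<in> V" "p \<in> mps_over V"
  shows "subst_mps V (shear V v (\<lambda>i. - \<theta> i)) (subst_mps V (shear V v \<theta>) p) = p"
proof -
  interpret A: substitution V "shear V v \<theta>" by (rule substitution_shear) fact
  interpret B: substitution V "shear V v (\<lambda>i. - \<theta> i)" by (rule substitution_shear) fact
  have neg: "mps_const (- c) = - (mps_const c :: 'a mps)" for c
    by (rule mps_eqI) (simp add: mcoeff_const)
  show ?thesis
  proof (rule hom_eq_id[OF assms(1), where H = "\<lambda>p. subst_mps V (shear V v (\<lambda>i. - \<theta> i)) (subst_mps V (shear V v \<theta>) p)"])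
    fix i assume "i \<in> V"
    thus "subst_mps V (shear V v (\<lambda>i. - \<theta> i)) (subst_mps V (shear V v \<theta>) (mps_var i)) = mps_var i"
      using assms by (simp add: A.subst_var shear_def B.subst_add B.subst_const_mult B.subst_var neg)
  qed (use assms in \<open>(simp only: A.subst_const_mult B.subst_const_mult; fail | simp add: A.subst_add B.subst_add
      A.subst_mult B.subst_mult A.subst_1 B.subst_1 A.subst_order B.subst_order)+\<close>)
qed

text \<open>The coefficient of the \<open>d\<close>-th power of \<open>v\<close> after the shear is
  the value of the homogeneous part of degree \<open>d\<close> at the point with coordinates
  \<open>\<theta> i\<close> and 1 in place of \<open>v\<close>. Within one degree a monomial is
  determined by its exponents away from \<open>v\<close>, so this specialization at 1 causes no
  cancellation between monomials.\<close>

lemma regular_shear: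
  fixes p :: "'k :: field mps"
  assumes inf: "infinite (UNIV :: 'k set)" and V: "finite V" "v \<in> V"
    and p: "p \<in> mps_over V" "p \<noteq> 0"
  obtains \<theta> d where "mcoeff (subst_mps V (shear V v \<theta>) p) (single v d) \<noteq> 0"
proof -
  let ?l = lookup
  obtain \<nu>0 where \<nu>0: "mcoeff p \<nu>0 \<noteq> 0" using p(2) mps_eqI[of p 0] by auto
  define d where "d = total_degree \<nu>0"
  define N where "N = {\<nu>. keys \<nu> \<subseteq> V \<and> total_degree \<nu> = d}"
  have N: "finite N" by (rule finite_subset[OF _ finite_bounded_monomials[OF V(1), of d]]) (auto simp: N_def)
  have \<nu>0N: "\<nu>0 \<in> N" using p(1) \<nu>0 by (auto simp: N_def d_def mps_over_def)
  let ?V = "V - {v}"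
  have inj: "\<mu> = \<nu>" if "\<mu> \<in> N" "\<nu> \<in> N" "\<forall>i\<in>?V. ?l \<mu> i = ?l \<nu> i" for \<mu> \<nu>
  proof (rule poly_mapping_eqI)
    fix i
    have s: "(\<Sum>i\<in>?V. ?l \<mu> i) = (\<Sum>i\<in>?V. ?l \<nu> i)" using that(3) by (intro sum.cong) auto
    have "(\<Sum>i\<in>V. ?l \<mu> i) = (\<Sum>i\<in>V. ?l \<nu> i)"
      using that(1,2) by (auto simp: N_def total_degree_eq[OF V(1), symmetric])
    hence "?l \<mu> v = ?l \<nu> v" using s V by (simp add: sum.remove[of V v])
    moreover have "?l \<mu> i = ?l \<nu> i" if "i \<notin> V"
    proof -
      have "i \<notin> keys \<mu>" "i \<notin> keys \<nu>"
        using that \<open>\<mu> \<in> N\<close> \<open>\<nu> \<in> N\<close> by (auto simp: N_def)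
      thus ?thesis by (simp add: in_keys_iff)
    qed
    ultimately show "?l \<mu> i = ?l \<nu> i" using that(3) by (cases "i \<in> V"; cases "i = v") auto
  qed
  have "\<exists>\<theta>. (\<Sum>\<nu>\<in>?l ` N. mcoeff p (Poly_Mapping.Abs_poly_mapping \<nu>) * (\<Prod>i\<in>?V. \<theta> i ^ \<nu> i)) \<noteq> 0"
  proof (rule multivariate_nonvanishing[OF inf, of _ _ "?l \<nu>0"])
    fix \<mu> \<nu> assume "\<mu> \<in> ?l ` N" "\<nu> \<in> ?l ` N" "\<forall>i\<in>?V. \<mu> i = \<nu> i"
    thus "\<mu> = \<nu>" using inj by auto
  qed (use N \<nu>0N \<nu>0 V in auto)
  then obtain \<theta> where \<theta>: "(\<Sum>\<nu>\<in>N. mcoeff p \<nu> * (\<Prod>i\<in>?V. \<theta> i ^ ?l \<nu> i)) \<noteq> 0"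
    by (subst (asm) sum.reindex) (auto simp: inj_on_def lookup_inject o_def lookup_inverse)
  interpret substitution V "shear V v \<theta>" by (rule substitution_shear) fact
  let ?e = "single v d"
  \<comment> \<open>Putting all variables except \<open>v\<close> to 0 does not change the
    coefficient at a power of \<open>v\<close>, and it turns every sheared variable into a multiple
    of \<open>v\<close>.\<close>
  have res: "res_vars {v} (shear V v \<theta> i) = mps_const (if i = v then 1 else \<theta> i) * mps_var v" for i
    by (rule mps_eqI) (auto simp: mcoeff_res_vars shear_def mcoeff_var)
  have res_prod: "res_vars {v} (prod g A) = (\<Prod>i\<in>A. res_vars {v} (g i))" for g :: "nat \<Rightarrow> 'k mps" and A
    by (induction A rule: infinite_finite_induct) (auto simp: res_vars_mult)
  have res_pow: "res_vars {v} (g ^ j) = res_vars {v} g ^ j" for g :: "'k mps" and j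
    by (induction j) (auto simp: res_vars_mult)
  have const_pow: "mps_const (a ^ j) = (mps_const a :: 'k mps) ^ j" for a j
    by (induction j) (auto simp: mps_const_mult)
  have const_prod: "mps_const (\<Prod>i\<in>A. g i) = (\<Prod>i\<in>A. mps_const (g i) :: 'k mps)" for g :: "nat \<Rightarrow> 'k" and A
    by (induction A rule: infinite_finite_induct) (auto simp: mps_const_mult)
  have var_pow: "mps_var v ^ j = (mps_monom (single v j) :: 'k mps)" for j
    by (induction j) (auto simp: mps_monom_zero mps_var_eq_monom mps_monom_add[symmetric] single_add[symmetric])
  have m: "mcoeff (subst_monom V (shear V v \<theta>) \<nu>) ?e =
      (if total_degree \<nu> = d then \<Prod>i\<in>?V. \<theta> i ^ ?l \<nu> i else 0)" if "keys \<nu> \<subseteq> V" for \<nu>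
  proof -
    have "mcoeff (subst_monom V (shear V v \<theta>) \<nu>) ?e = mcoeff (res_vars {v} (subst_monom V (shear V v \<theta>) \<nu>)) ?e"
      by (simp add: mcoeff_res_vars)
    also have "res_vars {v} (subst_monom V (shear V v \<theta>) \<nu>) =
        (\<Prod>i\<in>V. (mps_const (if i = v then 1 else \<theta> i) * mps_var v) ^ ?l \<nu> i)"
      unfolding subst_monom_def res_prod res_pow res ..
    also have "\<dots> = mps_const (\<Prod>i\<in>V. (if i = v then 1 else \<theta> i) ^ ?l \<nu> i) * mps_var v ^ total_degree \<nu>"
      by (simp add: power_mult_distrib prod.distrib const_pow const_prod total_degree_eq[OF V(1) that] power_sum)
    also have "(\<Prod>i\<in>V. (if i = v then 1 else \<theta> i) ^ ?l \<nu> i) = (\<Prod>i\<in>?V. \<theta> i ^ ?l \<nu> i)"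
      by (subst prod.remove[OF V]) (auto intro!: prod.cong)
    finally show ?thesis by (auto simp: var_pow mcoeff_monom) (metis total_degree_single)+
  qed
  have "mcoeff (subst_mps V (shear V v \<theta>) p) ?e =
      (\<Sum>\<nu>\<in>bdd_monoms V d. mcoeff p \<nu> * mcoeff (subst_monom V (shear V v \<theta>) \<nu>) ?e)"
    by (rule mcoeff_subst) simp
  also have "\<dots> = (\<Sum>\<nu>\<in>bdd_monoms V d. if total_degree \<nu> = d then mcoeff p \<nu> * (\<Prod>i\<in>?V. \<theta> i ^ ?l \<nu> i) else 0)"
    by (rule sum.cong) (auto simp: m)
  also have "\<dots> = (\<Sum>\<nu>\<in>N. mcoeff p \<nu> * (\<Prod>i\<in>?V. \<theta> i ^ ?l \<nu> i))"
    by (subst sum.inter_filter[symmetric])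
      (auto simp: N_def intro!: sum.cong finite_bounded_monomials V)
  finally show ?thesis using \<theta> that[of \<theta> d] by simp
qed

section \<open>Chains of primes in power series rings\<close>

text \<open>Prime ideals as plain sets of series: contraction to fewer variables is then just an
  intersection.\<close>

definition prime_over :: "nat set \<Rightarrow> 'a :: comm_ring_1 mps set \<Rightarrow> bool" where
  "prime_over V P \<longleftrightarrow> P \<subseteq> mps_over V \<and> 0 \<in> P \<and> 1 \<notin> P \<and>
     (\<forall>a\<in>P. \<forall>b\<in>P. a + b \<in> P) \<and> (\<forall>a\<in>P. \<forall>r\<in>mps_over V. r * a \<in> P) \<and>
     (\<forall>a\<in>mps_over V. \<forall>b\<in>mps_over V. a * b \<in> P \<longrightarrow> a \<in> P \<or> b \<in> P)"

lemma prime_overD: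
  assumes "prime_over V P"
  shows "P \<subseteq> mps_over V" "0 \<in> P" "1 \<notin> P"
    "a \<in> P \<Longrightarrow> b \<in> P \<Longrightarrow> a + b \<in> P" "a \<in> P \<Longrightarrow> r \<in> mps_over V \<Longrightarrow> r * a \<in> P"
    "a \<in> P \<Longrightarrow> - a \<in> P" "a \<in> P \<Longrightarrow> b \<in> P \<Longrightarrow> a - b \<in> P"
    "a \<in> mps_over V \<Longrightarrow> b \<in> mps_over V \<Longrightarrow> a * b \<in> P \<Longrightarrow> a \<in> P \<or> b \<in> P"
proof -
  show m: "a \<in> P \<Longrightarrow> - a \<in> P" for a
    using assms mps_over_uminus[OF mps_over_1, of V] unfolding prime_over_def
    by (metis mult_minus1)
  show "a \<in> P \<Longrightarrow> b \<in> P \<Longrightarrow> a - b \<in> P"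
    using assms m unfolding prime_over_def by (metis diff_conv_add_uminus)
qed (use assms in \<open>auto simp: prime_over_def\<close>)

text \<open>Polynomials with coefficients in \<open>mps_over V\<close> form a subring, and a
  determinant is a signed sum of products of entries. For a characteristic polynomial this keeps the
  coefficients free of the eliminated variable.\<close>

lemma coeffs_over_det:
  fixes B :: "'a :: comm_ring_1 mps poly mat"
  assumes B: "B \<in> carrier_mat d d" and "\<And>i j l. i < d \<Longrightarrow> j < d \<Longrightarrow> poly.coeff (B $$ (i, j)) l \<in> mps_over V"
  shows "poly.coeff (det B) l \<in> mps_over V"
proof -
  define C where "C = {p :: 'a mps poly. \<forall>l. poly.coeff p l \<in> mps_over V}"
  have C_add: "p + q \<in> C" and C_mult: "p * q \<in> C" if "p \<in> C" "q \<in> C" for p q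
    using that by (auto simp: C_def coeff_mult intro!: mps_over_closed mps_over_sum)
  have C_0: "0 \<in> C" and C_1: "1 \<in> C" by (auto simp: C_def coeff_1)
  have C_m: "- p \<in> C" if "p \<in> C" for p using that by (auto simp: C_def intro!: mps_over_closed)
  have C_sum: "sum f A \<in> C" if "\<And>i. i \<in> A \<Longrightarrow> f i \<in> C" for f :: "(nat \<Rightarrow> nat) \<Rightarrow> 'a mps poly" and A
    using that by (induction A rule: infinite_finite_induct) (auto intro: C_0 C_add)
  have C_prod: "prod f A \<in> C" if "\<And>i. i \<in> A \<Longrightarrow> f i \<in> C" for f :: "nat \<Rightarrow> 'a mps poly" and A
    using that by (induction A rule: infinite_finite_induct) (auto intro: C_1 C_mult)
  have sgn: "signof p \<in> C" for p by (cases p rule: sign_cases) (auto intro: C_1 C_m)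
  have "det B \<in> C" unfolding det_def'[OF B]
  proof (intro C_sum C_mult sgn C_prod)
    fix p i assume "p \<in> {p. p permutes {0..<d}}" "i \<in> {0..<d}"
    hence "i < d" "p i < d" using permutes_in_image[of p "{0..<d}" i] by auto
    thus "B $$ (i, p i) \<in> C" using assms(2) by (auto simp: C_def)
  qed
  thus ?thesis by (auto simp: C_def)
qed

lemma lookup_update_keys:
  fixes \<mu> :: "nat \<Rightarrow>\<^sub>0 nat"
  obtains \<beta> where "\<mu> = single v (lookup \<mu> v) + \<beta>" "v \<notin> keys \<beta>"
    "keys \<beta> \<subseteq> keys \<mu>"
proof
  let ?\<beta> = "\<mu> - single v (lookup \<mu> v)"
  show "\<mu> = single v (lookup \<mu> v) + ?\<beta>"
    by (rule poly_mapping_eqI) (auto simp: lookup_add lookup_minus lookup_single when_def)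
  show "v \<notin> keys ?\<beta>" "keys ?\<beta> \<subseteq> keys \<mu>"
    by (auto simp: in_keys_iff lookup_minus lookup_single when_def split: if_splits)
qed

lemma var_power: "mps_var v ^ j = (mps_monom (single v j) :: 'a :: comm_ring_1 mps)"
  by (induction j) (auto simp: mps_monom_zero mps_var_eq_monom mps_monom_add[symmetric] single_add[symmetric])

text \<open>Turns the remainder of a Weierstrass division into a polynomial in \<open>v\<close>
  whose coefficients are free of \<open>v\<close>, the form from which a matrix can be read
  off.\<close>

lemma bounded_degree_expansion:
  fixes r :: "'a :: comm_ring_1 mps"
  assumes r: "r \<in> mps_over V" and deg: "\<And>\<mu>. d \<le> lookup \<mu> v \<Longrightarrow> mcoeff r \<mu> = 0"
  obtains t where "\<And>i. t i \<in> mps_over (V - {v})" "r = (\<Sum>i<d. t i * mps_var v ^ i)"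
proof
  define t where "t i = Mps (\<lambda>\<mu>. if v \<in> keys \<mu> then 0 else mcoeff r (single v i + \<mu>))" for i
  show "t i \<in> mps_over (V - {v})" for i
    using r by (fastforce simp: t_def mps_over_def keys_add_nat split: if_splits)
  show "r = (\<Sum>i<d. t i * mps_var v ^ i)"
  proof (rule mps_eqI)
    fix \<mu> :: "nat \<Rightarrow>\<^sub>0 nat"
    obtain \<beta> where \<mu>: "\<mu> = single v (lookup \<mu> v) + \<beta>" "v \<notin> keys \<beta>"
      by (rule lookup_update_keys[where \<mu> = \<mu> and v = v])
    have *: "mcoeff (t i * mps_var v ^ i) \<mu> = (if i = lookup \<mu> v then mcoeff r \<mu> else 0)" for i
    proof (cases "\<exists>\<gamma>. \<mu> = single v i + \<gamma>")
      case True
      then obtain \<gamma> where \<gamma>: "\<mu> = single v i + \<gamma>" by blast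
      have "v \<in> keys \<gamma> \<longleftrightarrow> i \<noteq> lookup \<mu> v"
        by (auto simp: \<gamma> lookup_add in_keys_iff)
      moreover have "mcoeff (t i * mps_var v ^ i) \<mu> = mcoeff (t i) \<gamma>"
        unfolding mult.commute[of "t i"] var_power by (subst \<gamma>) (rule mcoeff_monom_times)
      moreover have "mcoeff (t i) \<gamma> = (if v \<in> keys \<gamma> then 0 else mcoeff r \<mu>)"
        using \<gamma> by (simp add: t_def)
      ultimately show ?thesis by metis
    next
      case False
      hence "i \<noteq> lookup \<mu> v" using \<mu> by metis
      thus ?thesis unfolding mult.commute[of "t i"] var_power
        by (subst mcoeff_monom_times_eq_0) (use False in auto)
    qed
    show "mcoeff r \<mu> = mcoeff (\<Sum>i<d. t i * mps_var v ^ i) \<mu>"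
      using deg[of \<mu>] by (auto simp: * )
  qed
qed

text \<open>Determinant trick: \<open>1, x\<^sub>v, \<dots>, x\<^sub>v\<^sup>d\<^sup>-\<^sup>1\<close> generate the residue ring over the smaller power series ring.\<close>

lemma integral_mod_regular:
  fixes c y :: "'k :: field mps"
  assumes c: "c \<in> mps_over V" and y: "y \<in> mps_over V" and v: "v \<in> V"
    and "mcoeff c (single v d0) \<noteq> 0" "mcoeff c 0 = 0"
  obtains t s d where "\<And>i. t i \<in> mps_over (V - {v})" "t d = 1" "s \<in> mps_over V"
    "(\<Sum>i\<le>d. t i * y ^ i) = c * s"
proof -
  define d where "d = (LEAST d. mcoeff c (single v d) \<noteq> 0)"
  have lead: "mcoeff c (single v d) \<noteq> 0"
    unfolding d_def by (rule LeastI) fact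
  have low: "mcoeff c (single v j) = 0" if "j < d" for j
    using not_less_Least[OF that[unfolded d_def]] by simp
  have d: "d > 0" using lead assms(5) by (auto intro: gr0I)
  have "\<exists>t q. (\<forall>i. t i \<in> mps_over (V - {v})) \<and> y * mps_var v ^ j = q * c + (\<Sum>i<d. t i * mps_var v ^ i)" for j
  proof -
    have yj: "y * mps_var v ^ j \<in> mps_over V"
      by (intro mps_over_closed y mps_over_power mps_over_var v)
    obtain q where q: "q \<in> mps_over V" "\<And>\<mu>. d \<le> lookup \<mu> v \<Longrightarrow>
        mcoeff (y * mps_var v ^ j - q * c) \<mu> = 0"
      using weierstrass_division[OF c yj low lead] by blast
    obtain t where "\<And>i. t i \<in> mps_over (V - {v})"
      "y * mps_var v ^ j - q * c = (\<Sum>i<d. t i * mps_var v ^ i)"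
      by (rule bounded_degree_expansion[OF mps_over_diff[OF yj mps_over_mult[OF q(1) c]] q(2), where v = v and d = d]) (assumption, rule that)
    thus ?thesis by (intro exI[of _ t] exI[of _ q]) (simp add: algebra_simps)
  qed
  then obtain t q where t: "\<And>j i. t j i \<in> mps_over (V - {v})"
    and eq: "\<And>j. y * mps_var v ^ j = q j * c + (\<Sum>i<d. t j i * mps_var v ^ i)" by metis
  define T where "T = mat d d (\<lambda>(j, i). t j i)"
  \<comment> \<open>\<open>K\<close>, which is \<open>y - T\<close>, sends the vector of powers of
    the variable \<open>v\<close> to a multiple of \<open>c\<close>. Multiplying by the adjugate and
    reading the first component, where the power is 1, shows that \<open>det K\<close> is a multiple
    of \<open>c\<close>.\<close>
  define K where "K = mat d d (\<lambda>(j, i). (if j = i then y else 0) - t j i)"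
  have T: "T \<in> carrier_mat d d" and K: "K \<in> carrier_mat d d" by (simp_all add: T_def K_def)
  define x where "x = vec d (\<lambda>i. mps_var v ^ i :: 'k mps)"
  have Kx: "K *\<^sub>v x = vec d (\<lambda>j. q j * c)"
  proof (rule eq_vecI)
    fix j assume "j < dim_vec (vec d (\<lambda>j. q j * c))"
    hence j: "j < d" by simp
    have "(K *\<^sub>v x) $ j = (\<Sum>i<d. ((if j = i then y else 0) - t j i) * mps_var v ^ i)"
      using j by (simp add: K_def x_def scalar_prod_def atLeast0LessThan)
    also have "\<dots> = (\<Sum>i<d. (if j = i then y * mps_var v ^ i else 0)) - (\<Sum>i<d. t j i * mps_var v ^ i)"
      unfolding sum_subtractf[symmetric] by (rule sum.cong) (auto simp: left_diff_distrib)
    also have "\<dots> = q j * c" using eq[of j] j by simp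
    finally show "(K *\<^sub>v x) $ j = vec d (\<lambda>j. q j * c) $ j" using j by simp
  qed (simp add: K_def)
  have ax: "(adj_mat K * K) *\<^sub>v x = adj_mat K *\<^sub>v (K *\<^sub>v x)"
    by (rule assoc_mult_mat_vec) (use adj_mat(1)[OF K] K in \<open>auto simp: x_def\<close>)
  have "((adj_mat K * K) *\<^sub>v x) $ 0 = det K"
    using d unfolding adj_mat(3)[OF K]
    by (simp add: x_def scalar_prod_def if_distrib sum.delta cong: if_cong) (simp add: sum.remove[of _ 0])
  moreover have "(adj_mat K *\<^sub>v (K *\<^sub>v x)) $ 0 = c * (\<Sum>j<d. adj_mat K $$ (0, j) * q j)"
    using d adj_mat(1)[OF K] unfolding Kx
    by (auto simp: scalar_prod_def sum_distrib_left atLeast0LessThan ac_simps intro!: sum.cong)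
  ultimately obtain s where s: "det K = c * s" using ax by metis
  have "poly (char_poly T) y = det K" unfolding char_poly_def
    by (rule poly_det_cong[OF K]) (auto simp: T_def K_def char_poly_matrix_def)
  moreover have "poly (char_poly T) y = (\<Sum>i\<le>d. poly.coeff (char_poly T) i * y ^ i)"
    using degree_monic_char_poly[OF T] by (simp add: poly_altdef)
  ultimately have p: "(\<Sum>i\<le>d. poly.coeff (char_poly T) i * y ^ i) = c * s" using s by simp
  have co: "poly.coeff (char_poly T) i \<in> mps_over (V - {v})" for i
    unfolding char_poly_def using T
    by (intro coeffs_over_det[of _ d])
      (auto simp: char_poly_matrix_def T_def coeff_pCons t split: nat.split intro!: mps_over_closed)
  have "c * s \<in> mps_over V" unfolding p[symmetric]
    using co mps_over_mono[of "V - {v}" V] y by (intro mps_over_sum mps_over_mult mps_over_power) auto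
  \<comment> \<open>The variables of \<open>s\<close> have not been controlled; as
    \<open>c * s\<close> lies in \<open>mps_over V\<close>, the cofactor may be restricted.\<close>
  hence "c * s = c * res_vars V s"
    using c by (metis res_vars_id res_vars_mult)
  thus ?thesis
    using that[of "poly.coeff (char_poly T)" d "res_vars V s"] co degree_monic_char_poly[OF T] p
    by (simp add: res_vars_over)
qed

text \<open>This is incomparability of primes in an integral extension. Take \<open>y\<close> in
  \<open>Q\<close> but not in \<open>P\<close>, and a polynomial relation for \<open>y\<close>
  modulo \<open>P\<close> of least degree. Its constant term lies in \<open>Q\<close>, because
  \<open>y\<close> does, but not in \<open>P\<close>, because otherwise \<open>y\<close> could be
  cancelled to give a shorter relation.\<close>

lemma prime_contraction_strict:
  fixes c :: "'k :: field mps"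
  assumes P: "prime_over V P" and Q: "prime_over V Q" and PQ: "P \<subset> Q" and v: "v \<in> V"
    and c: "c \<in> P" "mcoeff c (single v d0) \<noteq> 0" "mcoeff c 0 = 0"
  shows "P \<inter> mps_over (V - {v}) \<subset> Q \<inter> mps_over (V - {v})"
proof -
  note PD = prime_overD[OF P] and QD = prime_overD[OF Q]
  obtain y where y: "y \<in> Q" "y \<notin> P" using PQ by blast
  have yV: "y \<in> mps_over V" using y QD(1) by blast
  \<comment> \<open>A leading coefficient outside \<open>P\<close> excludes degree 0, so that a
    factor \<open>y\<close> can be split off.\<close>
  let ?R = "\<lambda>d t. (\<forall>i. t i \<in> mps_over (V - {v})) \<and> t d \<notin> P \<and> (\<Sum>i\<le>d. t i * y ^ i) \<in> P"
  have "\<exists>d t. ?R d t"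
  proof -
    have cV: "c \<in> mps_over V" using PD(1) c(1) by blast
    obtain t s d where "\<And>i. t i \<in> mps_over (V - {v})" "t d = 1" "s \<in> mps_over V"
      "(\<Sum>i\<le>d. t i * y ^ i) = c * s"
      by (rule integral_mod_regular[OF cV yV v c(2,3)]) (rule that)
    hence "?R d t" using PD(3) PD(5)[OF c(1), of s] by (simp add: mult.commute)
    thus ?thesis by blast
  qed
  then obtain d where d: "\<exists>t. ?R d t" and least: "\<And>d'. d' < d \<Longrightarrow> \<not> (\<exists>t. ?R d' t)"
    using exists_least_iff[of "\<lambda>d. \<exists>t. ?R d t"] by blast
  then obtain t where t: "\<And>i. t i \<in> mps_over (V - {v})" "t d \<notin> P" "(\<Sum>i\<le>d. t i * y ^ i) \<in> P" by blast
  obtain e where e: "d = Suc e" using t by (cases d) auto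
  have tV: "t i \<in> mps_over V" for i using t(1) mps_over_mono[of "V - {v}" V] by auto
  let ?w = "\<Sum>i\<le>e. t (Suc i) * y ^ i"
  have w: "?w \<in> mps_over V" by (intro mps_over_sum mps_over_mult mps_over_power tV yV)
  have eq: "(\<Sum>i\<le>d. t i * y ^ i) = t 0 + ?w * y"
    unfolding e sum.atMost_Suc_shift by (simp add: sum_distrib_left sum_distrib_right ac_simps)
  have "t 0 = (\<Sum>i\<le>d. t i * y ^ i) - ?w * y" using eq by simp
  hence "t 0 \<in> Q" using t(3) PQ QD(5)[OF y(1) w] QD(7) by auto
  moreover have "t 0 \<notin> P"
  proof
    assume "t 0 \<in> P"
    hence "?w * y \<in> P" using PD(7)[OF t(3), of "t 0"] eq by simp
    hence "?w \<in> P" using PD(8)[OF w yV] y(2) by blast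
    moreover have "t (Suc e) \<notin> P" using t(2) e by simp
    ultimately have "\<exists>t. ?R e t" using t(1) by (intro exI[of _ "\<lambda>i. t (Suc i)"]) auto
    moreover have "e < d" using e by simp
    ultimately show False using least by blast
  qed
  ultimately show ?thesis using t(1)[of 0] PQ by blast
qed

lemma prime_over_contraction:
  fixes P :: "'a :: comm_ring_1 mps set"
  shows "prime_over V P \<Longrightarrow> W \<subseteq> V \<Longrightarrow> prime_over W (P \<inter> mps_over W)"
proof -
  assume P: "prime_over V P" and "W \<subseteq> V"
  hence W: "mps_over W \<subseteq> (mps_over V :: 'a mps set)" by (intro mps_over_mono)
  have "a \<in> P \<or> b \<in> P" if "a \<in> mps_over W" "b \<in> mps_over W" "a * b \<in> P" for a b
    using prime_overD(8)[OF P, of a b] that W by blast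
  thus ?thesis using P W unfolding prime_over_def by (auto intro: mps_over_closed)
qed

lemma prime_over_const_0:
  fixes c :: "'k :: field mps"
  assumes "prime_over V P" "c \<in> P"
  shows "mcoeff c 0 = 0"
proof (rule ccontr)
  assume "mcoeff c 0 \<noteq> 0"
  moreover have "c \<in> mps_over V" using prime_overD(1)[OF assms(1)] assms(2) by blast
  ultimately obtain q where "q \<in> mps_over V" "q * c = 1" using mps_unit by blast
  thus False using prime_overD(3,5)[OF assms(1)] assms(2) by metis
qed

text \<open>Induction on the number of variables. A non-zero element of the second prime is made
  regular in \<open>v\<close> by a shear. It lies in all later primes, so their contractions to
  \<open>V - {v}\<close> still increase strictly: one prime is lost against one variable.\<close>

theorem prime_chain_length:
  fixes P :: "nat \<Rightarrow> 'k :: field mps set"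
  assumes inf: "infinite (UNIV :: 'k set)" and "finite V"
    and "\<And>i. i \<le> r \<Longrightarrow> prime_over V (P i)" "\<And>i. i < r \<Longrightarrow> P i \<subset> P (Suc i)"
  shows "r \<le> card V"
  using assms(2-)
proof (induction "card V" arbitrary: V P r)
  case 0
  hence V: "V = {}" by simp
  show ?case
  proof (rule ccontr)
    assume "\<not> r \<le> card V"
    hence r: "0 < r" by simp
    obtain c where c: "c \<in> P (Suc 0)" "c \<notin> P 0" using 0(4)[OF r] by auto
    have pr: "prime_over {} (P (Suc 0))" using 0(3)[of "Suc 0"] r V by simp
    have "mcoeff c \<mu> = 0" for \<mu>
      using prime_over_const_0[OF pr c(1)] prime_overD(1)[OF pr] c(1)
      by (cases "\<mu> = 0") (auto simp: mps_over_def subset_iff)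
    hence "c = 0" by (intro mps_eqI) simp
    thus False using c(2) prime_overD(2)[OF 0(3)[of 0]] by simp
  qed
next
  case (Suc m)
  then obtain v where v: "v \<in> V" by fastforce
  show ?case
  proof (cases r)
    case (Suc r')
    obtain c where c: "c \<in> P (Suc 0)" "c \<notin> P 0" using Suc.prems(3)[of 0] Suc by auto
    have cV: "c \<in> mps_over V" "c \<noteq> 0"
      using c prime_overD(1)[OF Suc.prems(2)[of "Suc 0"]] prime_overD(2)[OF Suc.prems(2)[of 0]] Suc by auto
    obtain \<theta> d where reg: "mcoeff (subst_mps V (shear V v \<theta>) c) (single v d) \<noteq> 0"
      by (rule regular_shear[OF inf Suc.prems(1) v cV])
    define G where "G = subst_mps V (shear V v \<theta>)"
    define H where "H = subst_mps V (shear V v (\<lambda>i. - \<theta> i))"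
    interpret G: substitution V "shear V v \<theta>" by (rule substitution_shear) (rule Suc.prems)
    interpret H: substitution V "shear V v (\<lambda>i. - \<theta> i)" by (rule substitution_shear) (rule Suc.prems)
    have GV: "G p \<in> mps_over V" and HV: "H p \<in> mps_over V" for p
      unfolding G_def H_def by (rule G.subst_over H.subst_over; simp add: shear_over v)+
    have HG: "H (G p) = p" if "p \<in> mps_over V" for p
      unfolding G_def H_def by (rule shear_inverse) (use that v Suc.prems in auto)
    have H0: "H 0 = 0" by (simp add: H_def subst_mps_def zero_mps_def mps_eqI)
    \<comment> \<open>The images of the primes under the shear \<open>G\<close>, written as
      preimages under its inverse.\<close>
    define P' where "P' i = {p \<in> mps_over V. H p \<in> P i}" for i
    have pr: "prime_over V (P' i)" if "i \<le> r" for i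
      using prime_overD[OF Suc.prems(2)[OF that]] HV unfolding prime_over_def P'_def
      by (auto simp: H_def H.subst_add H.subst_mult H.subst_1 H0[unfolded H_def] intro: mps_over_closed)
    have strict: "P' i \<subset> P' (Suc i)" if i: "i < r" for i
    proof -
      obtain y where y: "y \<in> P (Suc i)" "y \<notin> P i" using Suc.prems(3)[OF i] by blast
      have "y \<in> mps_over V" using y(1) prime_overD(1)[OF Suc.prems(2)[of "Suc i"]] i by auto
      hence "G y \<in> P' (Suc i) - P' i" using y by (simp add: P'_def GV HG)
      thus ?thesis using Suc.prems(3)[OF i] by (auto simp: P'_def)
    qed
    have c_mem: "G c \<in> P' i" if "1 \<le> i" "i \<le> r" for i
      using that
    proof (induction i rule: dec_induct)
      case base show ?case using c cV by (simp add: P'_def GV HG)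
    next
      case (step i) thus ?case using strict[of i] by auto
    qed
    have "r' \<le> card (V - {v})"
    proof (rule Suc.hyps(1)[of "V - {v}" r' "\<lambda>i. P' (Suc i) \<inter> mps_over (V - {v})"])
      show "m = card (V - {v})" using Suc.hyps(2) v Suc.prems(1) by simp
      show "finite (V - {v})" using Suc.prems by simp
      fix i
      show "i \<le> r' \<Longrightarrow> prime_over (V - {v}) (P' (Suc i) \<inter> mps_over (V - {v}))"
        using pr[of "Suc i"] Suc by (intro prime_over_contraction) auto
      show "i < r' \<Longrightarrow> P' (Suc i) \<inter> mps_over (V - {v}) \<subset> P' (Suc (Suc i)) \<inter> mps_over (V - {v})"
        using pr[of "Suc i"] pr[of "Suc (Suc i)"] strict[of "Suc i"] Suc c_mem[of "Suc i"] reg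
        by (intro prime_contraction_strict[OF _ _ _ v, of _ _ "G c" d]) (auto simp: G_def intro: prime_over_const_0)
    qed
    thus ?thesis using Suc card_Suc_Diff1[OF Suc.prems(1) v] by simp
  qed simp
qed

section \<open>Regular sequences and chains of primes\<close>

text \<open>An ideal that is maximal among those containing \<open>I\<close> and disjoint from
  \<open>W\<close> is prime. If \<open>a\<close> and \<open>b\<close> lie outside it, adjoining
  either one produces an element of \<open>W\<close>; the product of these two elements lies in
  \<open>W\<close>, and it would lie in the ideal if \<open>a \<otimes> b\<close> did.\<close>

lemma (in cring) exists_prime_avoiding:
  assumes I: "ideal I R" and W: "W \<subseteq> carrier R" "\<one> \<in> W" "\<And>a b. a \<in> W \<Longrightarrow> b \<in> W \<Longrightarrow> a \<otimes> b \<in> W"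
    and disj: "I \<inter> W = {}"
  obtains P where "primeideal P R" "I \<subseteq> P" "P \<inter> W = {}"
proof -
  define F where "F = {J. ideal J R \<and> I \<subseteq> J \<and> J \<inter> W = {}}"
  have "\<exists>M\<in>F. \<forall>X\<in>F. M \<subseteq> X \<longrightarrow> X = M"
  proof (rule subset_Zorn_nonempty)
    show "F \<noteq> {}" using I disj by (auto simp: F_def)
    fix C assume C: "C \<noteq> {}" "subset.chain F C"
    have "subset.chain {J. ideal J R} C" using C(2) by (auto simp: F_def subset.chain_def)
    hence "ideal (\<Union>C) R" using chain_Union_is_ideal[of C] C(1) by simp
    thus "\<Union>C \<in> F" using C by (auto simp: F_def subset.chain_def)
  qed
  then obtain M where M: "ideal M R" "I \<subseteq> M" "M \<inter> W = {}"
    and max: "\<And>X. ideal X R \<Longrightarrow> M \<subseteq> X \<Longrightarrow> X \<inter> W = {} \<Longrightarrow> X = M"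
    by (auto simp: F_def)
  interpret M: ideal M R by (rule M)
  have ext: "\<exists>q\<in>M. \<exists>r\<in>carrier R. q \<oplus> r \<otimes> a \<in> W" if a: "a \<in> carrier R" "a \<notin> M" for a
  proof (rule ccontr)
    assume *: "\<not> ?thesis"
    let ?J = "M <+>\<^bsub>R\<^esub> PIdl a"
    have J: "ideal ?J R" by (intro add_ideals M(1) cgenideal_ideal a(1))
    have "M \<subseteq> ?J"
    proof
      fix q assume "q \<in> M"
      moreover have "\<zero> \<in> PIdl a" using a(1) by (auto simp: cgenideal_def intro!: exI[of _ \<zero>])
      moreover have "q = q \<oplus> \<zero>" using \<open>q \<in> M\<close> M.Icarr by simp
      ultimately show "q \<in> ?J" unfolding set_add_def' by blast
    qed
    moreover have "a = \<zero> \<oplus> a" using a(1) by simp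
    hence "a \<in> ?J" unfolding set_add_def' using cgenideal_self[OF a(1)] M.zero_closed by blast
    moreover have "?J \<inter> W = {}" using * by (fastforce simp: set_add_def' cgenideal_def)
    ultimately show False using max[OF J] a(2) by blast
  qed
  have "primeideal M R"
  proof (rule primeidealI[OF M(1) is_cring])
    show "carrier R \<noteq> M" using M(3) W by auto
    fix a b assume ab: "a \<in> carrier R" "b \<in> carrier R" "a \<otimes> b \<in> M"
    show "a \<in> M \<or> b \<in> M"
    proof (rule ccontr)
      assume "\<not> ?thesis"
      then obtain q r q' r' where q: "q \<in> M" "q' \<in> M" "r \<in> carrier R" "r' \<in> carrier R"
        and w: "q \<oplus> r \<otimes> a \<in> W" "q' \<oplus> r' \<otimes> b \<in> W" using ext ab by metis
      note c = q M.Icarr[OF q(1)] M.Icarr[OF q(2)] ab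
      have "(q \<oplus> r \<otimes> a) \<otimes> (q' \<oplus> r' \<otimes> b) = (q' \<oplus> r' \<otimes> b) \<otimes> q \<oplus> ((r \<otimes> a) \<otimes> q' \<oplus> (r \<otimes> r') \<otimes> (a \<otimes> b))"
        using c by algebra
      also have "\<dots> \<in> M" using c by (simp add: M.a_closed M.I_l_closed)
      finally show False using W(3)[OF w] M(3) by blast
    qed
  qed
  thus ?thesis using that M by blast
qed

context module
begin

lemma list_smult_Nil: "list_smult [] M = {\<zero>\<^bsub>M\<^esub>}"
  by (auto simp: list_smult_def)

lemma list_smult_snoc:
  assumes "set xs \<subseteq> carrier R" "x \<in> carrier R"
  shows "list_smult (xs @ [x]) M = {a \<oplus>\<^bsub>M\<^esub> x \<odot>\<^bsub>M\<^esub> w | a w. a \<in> list_smult xs M \<and> w \<in> carrier M}"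
proof -
  let ?n = "length xs"
  have xs: "xs ! j \<in> carrier R" if "j < ?n" for j using that assms(1) by (auto dest: nth_mem)
  have step: "finsum M (\<lambda>j. ((xs @ [x]) ! j) \<odot>\<^bsub>M\<^esub> w j) {..<length (xs @ [x])} =
      finsum M (\<lambda>j. (xs ! j) \<odot>\<^bsub>M\<^esub> w j) {..<?n} \<oplus>\<^bsub>M\<^esub> x \<odot>\<^bsub>M\<^esub> w ?n"
    if "w \<in> {..?n} \<rightarrow> carrier M" for w
  proof -
    have cl: "(\<lambda>j. (xs ! j) \<odot>\<^bsub>M\<^esub> w j) \<in> {..<?n} \<rightarrow> carrier M"
      using that by (auto intro!: smult_closed xs simp: Pi_iff)
    have "finsum M (\<lambda>j. ((xs @ [x]) ! j) \<odot>\<^bsub>M\<^esub> w j) {..<length (xs @ [x])} =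
        finsum M (\<lambda>j. ((xs @ [x]) ! j) \<odot>\<^bsub>M\<^esub> w j) (insert ?n {..<?n})"
      by (simp add: lessThan_Suc)
    also have "\<dots> = x \<odot>\<^bsub>M\<^esub> w ?n \<oplus>\<^bsub>M\<^esub> finsum M (\<lambda>j. ((xs @ [x]) ! j) \<odot>\<^bsub>M\<^esub> w j) {..<?n}"
      using that assms by (subst M.finsum_insert) (auto simp: nth_append Pi_iff intro!: smult_closed xs)
    also have "finsum M (\<lambda>j. ((xs @ [x]) ! j) \<odot>\<^bsub>M\<^esub> w j) {..<?n} = finsum M (\<lambda>j. (xs ! j) \<odot>\<^bsub>M\<^esub> w j) {..<?n}"
      by (rule M.finsum_cong') (use cl in \<open>auto simp: nth_append\<close>)
    also have "x \<odot>\<^bsub>M\<^esub> w ?n \<oplus>\<^bsub>M\<^esub> finsum M (\<lambda>j. (xs ! j) \<odot>\<^bsub>M\<^esub> w j) {..<?n} =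
        finsum M (\<lambda>j. (xs ! j) \<odot>\<^bsub>M\<^esub> w j) {..<?n} \<oplus>\<^bsub>M\<^esub> x \<odot>\<^bsub>M\<^esub> w ?n"
      using that assms(2) by (intro M.a_comm M.finsum_closed cl) auto
    finally show ?thesis .
  qed
  show ?thesis
  proof (intro equalityI subsetI)
    fix v assume "v \<in> list_smult (xs @ [x]) M"
    then obtain w where w: "w \<in> {..<length (xs @ [x])} \<rightarrow> carrier M"
      and v: "v = finsum M (\<lambda>j. ((xs @ [x]) ! j) \<odot>\<^bsub>M\<^esub> w j) {..<length (xs @ [x])}"
      unfolding list_smult_def by blast
    have w': "w \<in> {..?n} \<rightarrow> carrier M" using w by auto
    show "v \<in> {a \<oplus>\<^bsub>M\<^esub> x \<odot>\<^bsub>M\<^esub> w | a w. a \<in> list_smult xs M \<and> w \<in> carrier M}"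
      unfolding v step[OF w']
    proof (intro CollectI exI conjI)
      show "finsum M (\<lambda>j. (xs ! j) \<odot>\<^bsub>M\<^esub> w j) {..<?n} \<in> list_smult xs M"
        unfolding list_smult_def using w' by (intro CollectI exI[of _ w]) auto
    qed (use w' in auto)
  next
    fix v assume "v \<in> {a \<oplus>\<^bsub>M\<^esub> x \<odot>\<^bsub>M\<^esub> w | a w. a \<in> list_smult xs M \<and> w \<in> carrier M}"
    then obtain w u where w: "w \<in> {..<?n} \<rightarrow> carrier M" "u \<in> carrier M"
      and v: "v = finsum M (\<lambda>j. (xs ! j) \<odot>\<^bsub>M\<^esub> w j) {..<?n} \<oplus>\<^bsub>M\<^esub> x \<odot>\<^bsub>M\<^esub> u"
      unfolding list_smult_def by blast
    let ?w = "w(?n := u)"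
    have w': "?w \<in> {..?n} \<rightarrow> carrier M" using w by (auto simp: Pi_iff)
    have "finsum M (\<lambda>j. (xs ! j) \<odot>\<^bsub>M\<^esub> w j) {..<?n} = finsum M (\<lambda>j. (xs ! j) \<odot>\<^bsub>M\<^esub> ?w j) {..<?n}"
      by (rule M.finsum_cong') (use w in \<open>auto intro!: smult_closed xs simp: Pi_iff\<close>)
    hence "v = finsum M (\<lambda>j. ((xs @ [x]) ! j) \<odot>\<^bsub>M\<^esub> ?w j) {..<length (xs @ [x])}"
      unfolding step[OF w'] v by simp
    thus "v \<in> list_smult (xs @ [x]) M" unfolding list_smult_def using w'
      by (intro CollectI exI[of _ ?w] conjI) (simp_all add: lessThan_Suc_atMost)
  qed
qed

text \<open>The iterated boundary monoids of Coquand and Lombardi; a prime chain of length \<open>length xs\<close>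
  exists as soon as \<open>0\<close> is not in \<open>boundary_monoid xs\<close>.\<close>

fun boundary_monoid :: "'a list \<Rightarrow> 'a set" where
  "boundary_monoid [] = {\<one>\<^bsub>R\<^esub>}"
| "boundary_monoid (x # xs) =
    {x [^]\<^bsub>R\<^esub> (e :: nat) \<otimes>\<^bsub>R\<^esub> (v \<oplus>\<^bsub>R\<^esub> a \<otimes>\<^bsub>R\<^esub> x) | e v a. v \<in> boundary_monoid xs \<and> a \<in> carrier R}"

lemma boundary_monoid_carrier: "set xs \<subseteq> carrier R \<Longrightarrow> boundary_monoid xs \<subseteq> carrier R"
  by (induction xs) auto

lemma boundary_monoid_one: "set xs \<subseteq> carrier R \<Longrightarrow> \<one>\<^bsub>R\<^esub> \<in> boundary_monoid xs"
proof (induction xs)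
  case (Cons x xs)
  have "\<one>\<^bsub>R\<^esub> = x [^]\<^bsub>R\<^esub> (0 :: nat) \<otimes>\<^bsub>R\<^esub> (\<one>\<^bsub>R\<^esub> \<oplus>\<^bsub>R\<^esub> \<zero>\<^bsub>R\<^esub> \<otimes>\<^bsub>R\<^esub> x)"
    using Cons.prems by simp
  thus ?case using Cons by (simp only: boundary_monoid.simps mem_Collect_eq) (metis R.zero_closed insert_subset list.simps(15))
qed simp

lemma boundary_monoid_mult:
  "set xs \<subseteq> carrier R \<Longrightarrow> u \<in> boundary_monoid xs \<Longrightarrow> u' \<in> boundary_monoid xs \<Longrightarrow> u \<otimes>\<^bsub>R\<^esub> u' \<in> boundary_monoid xs"
proof (induction xs arbitrary: u u')
  case (Cons x xs)
  have x: "x \<in> carrier R" using Cons.prems by simp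
  obtain e v a e' v' a' where
    u: "u = x [^]\<^bsub>R\<^esub> (e :: nat) \<otimes>\<^bsub>R\<^esub> (v \<oplus>\<^bsub>R\<^esub> a \<otimes>\<^bsub>R\<^esub> x)" "u' = x [^]\<^bsub>R\<^esub> (e' :: nat) \<otimes>\<^bsub>R\<^esub> (v' \<oplus>\<^bsub>R\<^esub> a' \<otimes>\<^bsub>R\<^esub> x)"
    and v: "v \<in> boundary_monoid xs" "v' \<in> boundary_monoid xs" and a: "a \<in> carrier R" "a' \<in> carrier R"
    using Cons.prems by auto
  have vc: "v \<in> carrier R" "v' \<in> carrier R" using v boundary_monoid_carrier[of xs] Cons.prems by auto
  let ?p = "x [^]\<^bsub>R\<^esub> e" and ?p' = "x [^]\<^bsub>R\<^esub> e'"
  have p: "?p \<in> carrier R" "?p' \<in> carrier R" using x by auto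
  have "u \<otimes>\<^bsub>R\<^esub> u' = (?p \<otimes>\<^bsub>R\<^esub> ?p') \<otimes>\<^bsub>R\<^esub> (v \<otimes>\<^bsub>R\<^esub> v' \<oplus>\<^bsub>R\<^esub> (v \<otimes>\<^bsub>R\<^esub> a' \<oplus>\<^bsub>R\<^esub> a \<otimes>\<^bsub>R\<^esub> v' \<oplus>\<^bsub>R\<^esub> a \<otimes>\<^bsub>R\<^esub> a' \<otimes>\<^bsub>R\<^esub> x) \<otimes>\<^bsub>R\<^esub> x)"
    unfolding u using p x vc a by algebra
  hence uu: "u \<otimes>\<^bsub>R\<^esub> u' = x [^]\<^bsub>R\<^esub> (e + e') \<otimes>\<^bsub>R\<^esub> (v \<otimes>\<^bsub>R\<^esub> v' \<oplus>\<^bsub>R\<^esub> (v \<otimes>\<^bsub>R\<^esub> a' \<oplus>\<^bsub>R\<^esub> a \<otimes>\<^bsub>R\<^esub> v' \<oplus>\<^bsub>R\<^esub> a \<otimes>\<^bsub>R\<^esub> a' \<otimes>\<^bsub>R\<^esub> x) \<otimes>\<^bsub>R\<^esub> x)"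
    by (simp only: R.nat_pow_mult[OF x])
  show ?case unfolding boundary_monoid.simps mem_Collect_eq
  proof (intro exI conjI)
    show "u \<otimes>\<^bsub>R\<^esub> u' = x [^]\<^bsub>R\<^esub> (e + e') \<otimes>\<^bsub>R\<^esub> (v \<otimes>\<^bsub>R\<^esub> v' \<oplus>\<^bsub>R\<^esub> (v \<otimes>\<^bsub>R\<^esub> a' \<oplus>\<^bsub>R\<^esub> a \<otimes>\<^bsub>R\<^esub> v' \<oplus>\<^bsub>R\<^esub> a \<otimes>\<^bsub>R\<^esub> a' \<otimes>\<^bsub>R\<^esub> x) \<otimes>\<^bsub>R\<^esub> x)"
      by (rule uu)
    show "v \<otimes>\<^bsub>R\<^esub> v' \<in> boundary_monoid xs" using Cons.IH v Cons.prems by simp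
    show "v \<otimes>\<^bsub>R\<^esub> a' \<oplus>\<^bsub>R\<^esub> a \<otimes>\<^bsub>R\<^esub> v' \<oplus>\<^bsub>R\<^esub> a \<otimes>\<^bsub>R\<^esub> a' \<otimes>\<^bsub>R\<^esub> x \<in> carrier R" using vc a x by simp
  qed
qed simp

text \<open>Take a prime \<open>Q\<close> above \<open>I\<close> that avoids the monoid of
  \<open>x # xs\<close>. It misses \<open>x\<close>, which belongs to this monoid. The sum of
  \<open>Q\<close> and the ideal of \<open>x\<close> avoids the monoid of \<open>xs\<close>: from
  \<open>q + r x = v\<close> one would get \<open>q = v - r x\<close>, again an element of the
  larger monoid. So the chain can be continued strictly above \<open>Q\<close>.\<close>

lemma boundary_monoid_chain:
  assumes "set xs \<subseteq> carrier R" "ideal I R" "I \<inter> boundary_monoid xs = {}"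
  shows "\<exists>P. (\<forall>i \<le> length xs. primeideal (P i) R) \<and> (\<forall>i < length xs. P i \<subset> P (Suc i)) \<and> I \<subseteq> P 0"
  using assms
proof (induction xs arbitrary: I)
  case Nil
  obtain Q where "primeideal Q R" "I \<subseteq> Q"
    using R.exists_prime_avoiding[of I "{\<one>\<^bsub>R\<^esub>}"] Nil by auto
  thus ?case by (intro exI[of _ "\<lambda>_. Q"]) auto
next
  case (Cons x xs)
  have x: "x \<in> carrier R" "set xs \<subseteq> carrier R" using Cons.prems by auto
  obtain Q where Q: "primeideal Q R" "I \<subseteq> Q" "Q \<inter> boundary_monoid (x # xs) = {}"
    using R.exists_prime_avoiding[OF Cons.prems(2) boundary_monoid_carrier boundary_monoid_one
        boundary_monoid_mult Cons.prems(3)] Cons.prems(1) by blast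
  interpret Q: primeideal Q R by (rule Q)
  let ?J = "Q <+>\<^bsub>R\<^esub> PIdl\<^bsub>R\<^esub> x"
  have J1: "ideal ?J R" by (intro R.add_ideals Q.is_ideal R.cgenideal_ideal x)
  have J2: "?J \<inter> boundary_monoid xs = {}"
  proof (rule ccontr)
    assume "?J \<inter> boundary_monoid xs \<noteq> {}"
    then obtain q r where q: "q \<in> Q" "r \<in> carrier R" and v: "q \<oplus>\<^bsub>R\<^esub> r \<otimes>\<^bsub>R\<^esub> x \<in> boundary_monoid xs"
      by (fastforce simp: set_add_def' cgenideal_def)
    have "q = x [^]\<^bsub>R\<^esub> (0 :: nat) \<otimes>\<^bsub>R\<^esub> ((q \<oplus>\<^bsub>R\<^esub> r \<otimes>\<^bsub>R\<^esub> x) \<oplus>\<^bsub>R\<^esub> (\<ominus>\<^bsub>R\<^esub> r) \<otimes>\<^bsub>R\<^esub> x)"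
      using q Q.Icarr[OF q(1)] x by (simp, algebra)
    hence "q \<in> boundary_monoid (x # xs)" using v q(2) unfolding boundary_monoid.simps by blast
    thus False using Q(3) q(1) by blast
  qed
  obtain P where P: "\<forall>i \<le> length xs. primeideal (P i) R" "\<forall>i < length xs. P i \<subset> P (Suc i)" "?J \<subseteq> P 0"
    using Cons.IH[OF x(2) J1 J2] by (elim exE conjE) (rule that)
  have zero: "\<zero>\<^bsub>R\<^esub> \<in> PIdl\<^bsub>R\<^esub> x" using x by (auto simp: cgenideal_def intro!: exI[of _ "\<zero>\<^bsub>R\<^esub>"])
  have "Q \<subseteq> ?J"
  proof
    fix q assume "q \<in> Q"
    moreover have "q = q \<oplus>\<^bsub>R\<^esub> \<zero>\<^bsub>R\<^esub>" using \<open>q \<in> Q\<close> Q.Icarr by simp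
    ultimately show "q \<in> ?J" unfolding set_add_def' using zero by blast
  qed
  moreover have "x = \<zero>\<^bsub>R\<^esub> \<oplus>\<^bsub>R\<^esub> x" using x(1) by simp
  hence "x \<in> ?J" unfolding set_add_def' using R.cgenideal_self[OF x(1)] Q.zero_closed by blast
  moreover have "x \<notin> Q"
  proof -
    have "x = x [^]\<^bsub>R\<^esub> (1 :: nat) \<otimes>\<^bsub>R\<^esub> (\<one>\<^bsub>R\<^esub> \<oplus>\<^bsub>R\<^esub> \<zero>\<^bsub>R\<^esub> \<otimes>\<^bsub>R\<^esub> x)" using x by simp
    hence "x \<in> boundary_monoid (x # xs)"
      using boundary_monoid_one[OF x(2)] unfolding boundary_monoid.simps by blast
    thus ?thesis using Q(3) by blast
  qed
  ultimately have "Q \<subset> P 0" using P(3) by blast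
  thus ?case using P Q(1,2)
    by (intro exI[of _ "case_nat Q P"]) (auto split: nat.split simp: less_Suc_eq_0_disj)
qed

text \<open>If \<open>x^e (v + a x) w\<close> lies in \<open>(ys) M\<close>, regularity cancels
  \<open>x^e\<close>, and then \<open>v w\<close> lies in \<open>(ys, x) M\<close>, against the
  inductive choice of \<open>w\<close>. At the end of the list only 1 is left, and the claim is that
  the whole sequence does not generate \<open>M\<close>.\<close>

lemma regular_boundary_monoid:
  assumes reg: "regular_seq M zs" and "zs = ys @ xs" "set zs \<subseteq> carrier R" "u \<in> boundary_monoid xs"
  shows "\<exists>w\<in>carrier M. u \<odot>\<^bsub>M\<^esub> w \<notin> list_smult ys M"
  using assms(2-)
proof (induction xs arbitrary: ys u)
  case Nil
  have cl: "list_smult zs M \<subseteq> carrier M"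
    using Nil by (fastforce simp: list_smult_def dest: nth_mem intro!: M.finsum_closed)
  then obtain w where "w \<in> carrier M" "w \<notin> list_smult zs M" using reg by (auto simp: regular_seq_def)
  thus ?case using Nil by (intro bexI[of _ w]) auto
next
  case (Cons x xs)
  have x: "x \<in> carrier R" and ys: "set ys \<subseteq> carrier R" and xs: "set xs \<subseteq> carrier R" using Cons.prems by auto
  obtain e v a where u: "u = x [^]\<^bsub>R\<^esub> (e :: nat) \<otimes>\<^bsub>R\<^esub> (v \<oplus>\<^bsub>R\<^esub> a \<otimes>\<^bsub>R\<^esub> x)"
    and v: "v \<in> boundary_monoid xs" and a: "a \<in> carrier R" using Cons.prems(3) by auto
  have vc: "v \<in> carrier R" using v boundary_monoid_carrier[OF xs] by blast
  have regx: "w \<in> list_smult ys M" if "w \<in> carrier M" "x \<odot>\<^bsub>M\<^esub> w \<in> list_smult ys M" for w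
  proof -
    have "length ys < length zs" "zs ! length ys = x" "take (length ys) zs = ys"
      using Cons.prems(1) by simp_all
    thus ?thesis using reg that unfolding regular_seq_def by (metis (no_types))
  qed
  have regxe: "w \<in> list_smult ys M" if "w \<in> carrier M" "x [^]\<^bsub>R\<^esub> (e :: nat) \<odot>\<^bsub>M\<^esub> w \<in> list_smult ys M" for e w
    using that
  proof (induction e arbitrary: w)
    case (Suc e)
    have "x [^]\<^bsub>R\<^esub> Suc e \<odot>\<^bsub>M\<^esub> w = x [^]\<^bsub>R\<^esub> e \<odot>\<^bsub>M\<^esub> (x \<odot>\<^bsub>M\<^esub> w)"
      using Suc.prems x by (simp add: smult_assoc1)
    hence "x \<odot>\<^bsub>M\<^esub> w \<in> list_smult ys M" using Suc x by auto
    thus ?case using regx Suc.prems by blast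
  qed auto
  obtain w where w: "w \<in> carrier M" "v \<odot>\<^bsub>M\<^esub> w \<notin> list_smult (ys @ [x]) M"
    using Cons.IH[of "ys @ [x]" v] Cons.prems v by auto
  have "u \<odot>\<^bsub>M\<^esub> w \<notin> list_smult ys M"
  proof
    assume "u \<odot>\<^bsub>M\<^esub> w \<in> list_smult ys M"
    hence "x [^]\<^bsub>R\<^esub> e \<odot>\<^bsub>M\<^esub> ((v \<oplus>\<^bsub>R\<^esub> a \<otimes>\<^bsub>R\<^esub> x) \<odot>\<^bsub>M\<^esub> w) \<in> list_smult ys M"
      unfolding u using x a vc w(1) by (simp add: smult_assoc1)
    hence m: "(v \<oplus>\<^bsub>R\<^esub> a \<otimes>\<^bsub>R\<^esub> x) \<odot>\<^bsub>M\<^esub> w \<in> list_smult ys M"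
      using regxe[of "(v \<oplus>\<^bsub>R\<^esub> a \<otimes>\<^bsub>R\<^esub> x) \<odot>\<^bsub>M\<^esub> w" e] x a vc w(1) by simp
    have "v \<odot>\<^bsub>M\<^esub> w = (v \<oplus>\<^bsub>R\<^esub> a \<otimes>\<^bsub>R\<^esub> x \<oplus>\<^bsub>R\<^esub> (\<ominus>\<^bsub>R\<^esub> a) \<otimes>\<^bsub>R\<^esub> x) \<odot>\<^bsub>M\<^esub> w"
    proof -
      have "v = v \<oplus>\<^bsub>R\<^esub> a \<otimes>\<^bsub>R\<^esub> x \<oplus>\<^bsub>R\<^esub> (\<ominus>\<^bsub>R\<^esub> a) \<otimes>\<^bsub>R\<^esub> x" using vc a x by algebra
      thus ?thesis by simp
    qed
    also have "\<dots> = (v \<oplus>\<^bsub>R\<^esub> a \<otimes>\<^bsub>R\<^esub> x) \<odot>\<^bsub>M\<^esub> w \<oplus>\<^bsub>M\<^esub> (x \<otimes>\<^bsub>R\<^esub> (\<ominus>\<^bsub>R\<^esub> a)) \<odot>\<^bsub>M\<^esub> w"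
      using x a vc w(1) by (simp only: R.m_comm smult_l_distr R.add.m_closed R.m_closed R.a_inv_closed)
    also have "(x \<otimes>\<^bsub>R\<^esub> (\<ominus>\<^bsub>R\<^esub> a)) \<odot>\<^bsub>M\<^esub> w = x \<odot>\<^bsub>M\<^esub> ((\<ominus>\<^bsub>R\<^esub> a) \<odot>\<^bsub>M\<^esub> w)"
      using x a w(1) by (simp add: smult_assoc1)
    finally have "v \<odot>\<^bsub>M\<^esub> w \<in> list_smult (ys @ [x]) M"
      unfolding list_smult_snoc[OF ys x] using m a w(1) by blast
    thus False using w(2) by blast
  qed
  thus ?case using w(1) by blast
qed

text \<open>The element 0 annihilates \<open>M\<close>, so it is not in the boundary monoid of a
  regular sequence, and a chain of primes as long as the sequence results. No localization or
  associated primes are involved.\<close>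

lemma regular_seq_length_le_krull_dim:
  assumes "regular_seq M xs" "set xs \<subseteq> carrier R"
  shows "enat (length xs) \<le> krull_dim R"
proof -
  have "\<zero>\<^bsub>R\<^esub> \<notin> boundary_monoid xs"
  proof
    assume "\<zero>\<^bsub>R\<^esub> \<in> boundary_monoid xs"
    then obtain w where "w \<in> carrier M" "\<zero>\<^bsub>R\<^esub> \<odot>\<^bsub>M\<^esub> w \<notin> list_smult [] M"
      using regular_boundary_monoid[OF assms(1), of "[]" xs "\<zero>\<^bsub>R\<^esub>"] assms(2) by (auto simp del: smult_l_null)
    thus False by (simp add: list_smult_Nil)
  qed
  then obtain P where "\<forall>i \<le> length xs. primeideal (P i) R" "\<forall>i < length xs. P i \<subset> P (Suc i)"
    using boundary_monoid_chain[OF assms(2) R.zeroideal] by auto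
  thus ?thesis unfolding krull_dim_def by (intro Sup_upper) auto
qed

end

section \<open>The hypersurface ring\<close>

lemma mps_ring_cring: "cring (mps_ring n :: 'a :: comm_ring_1 mps ring)"
proof (rule cringI)
  show "abelian_group (mps_ring n :: 'a mps ring)"
  proof (rule abelian_groupI)
    fix x :: "'a mps" assume "x \<in> carrier (mps_ring n)"
    thus "\<exists>y\<in>carrier (mps_ring n). y \<oplus>\<^bsub>mps_ring n\<^esub> x = \<zero>\<^bsub>mps_ring n\<^esub>"
      by (intro bexI[of _ "- x"]) (auto intro: mps_over_closed)
  qed (auto intro: mps_over_closed simp: add.assoc add.commute)
  show "Group.comm_monoid (mps_ring n :: 'a mps ring)"
    by (rule comm_monoidI) (auto intro: mps_over_closed simp: mult.assoc mult.commute)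
qed (auto simp: distrib_right)

definition hyp_cls :: "nat \<Rightarrow> 'k :: field mps \<Rightarrow> 'k mps \<Rightarrow> 'k mps set" where
  "hyp_cls n f p = PIdl\<^bsub>mps_ring n\<^esub> f +>\<^bsub>mps_ring n\<^esub> p"

locale hypersurface =
  fixes n :: nat and f :: "'k :: field mps"
  assumes f_over: "f \<in> mps_over {0..n}" and f_nz: "f \<noteq> 0" and f_const: "mcoeff f 0 = 0"
begin

abbreviation "S \<equiv> mps_over {0..n} :: 'k mps set"
abbreviation "R \<equiv> hypersurface_ring n f"
abbreviation "cls \<equiv> hyp_cls n f"

lemma ideal_f: "ideal (PIdl\<^bsub>mps_ring n\<^esub> f) (mps_ring n)"
  by (rule cring.cgenideal_ideal[OF mps_ring_cring]) (simp add: f_over)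

lemma mem_cls: "s \<in> cls p \<longleftrightarrow> (\<exists>r\<in>S. s = r * f + p)"
  by (auto simp: hyp_cls_def a_r_coset_def' cgenideal_def)

lemma cring_R: "cring R"
  unfolding hypersurface_ring_def by (rule ideal.quotient_is_cring[OF ideal_f mps_ring_cring])

lemma carrier_R: "carrier R = cls ` S"
  by (auto simp: hypersurface_ring_def FactRing_def A_RCOSETS_def' hyp_cls_def)

lemma cls_hom: "cls \<in> Ring.ring_hom (mps_ring n) R"
  unfolding hypersurface_ring_def hyp_cls_def[abs_def] by (rule ideal.rcos_ring_hom[OF ideal_f])

lemma cls_closed: "p \<in> S \<Longrightarrow> cls p \<in> carrier R"
  and cls_mult: "p \<in> S \<Longrightarrow> q \<in> S \<Longrightarrow> cls (p * q) = cls p \<otimes>\<^bsub>R\<^esub> cls q"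
  and cls_add: "p \<in> S \<Longrightarrow> q \<in> S \<Longrightarrow> cls (p + q) = cls p \<oplus>\<^bsub>R\<^esub> cls q"
  and cls_one: "cls 1 = \<one>\<^bsub>R\<^esub>"
  using ring_hom_closed[OF cls_hom] ring_hom_mult[OF cls_hom] ring_hom_add[OF cls_hom]
    ring_hom_one[OF cls_hom] by simp_all

lemma cls_zero: "cls 0 = \<zero>\<^bsub>R\<^esub>"
proof -
  interpret R: cring R by (rule cring_R)
  have "cls 0 \<oplus>\<^bsub>R\<^esub> cls 0 = cls 0" using cls_add[of 0 0] by simp
  thus ?thesis using cls_closed[of 0] by (metis R.add.l_cancel_one' mps_over_0)
qed

lemma cls_self: "p \<in> cls p"
  unfolding mem_cls by (rule bexI[of _ 0]) auto

lemma cls_eq_iff: "cls p = cls q \<longleftrightarrow> (\<exists>r\<in>S. p = r * f + q)"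
proof
  assume "cls p = cls q" thus "\<exists>r\<in>S. p = r * f + q" using cls_self[of p] by (simp add: mem_cls)
next
  assume "\<exists>r\<in>S. p = r * f + q"
  then obtain r where r: "r \<in> S" "p = r * f + q" by blast
  show "cls p = cls q"
  proof (intro equalityI subsetI)
    fix s assume "s \<in> cls p"
    then obtain r' where "r' \<in> S" "s = r' * f + p" by (auto simp: mem_cls)
    thus "s \<in> cls q" unfolding mem_cls using r
      by (intro bexI[of _ "r' + r"]) (auto simp: algebra_simps intro: mps_over_closed)
  next
    fix s assume "s \<in> cls q"
    then obtain r' where "r' \<in> S" "s = r' * f + q" by (auto simp: mem_cls)
    thus "s \<in> cls p" unfolding mem_cls using r
      by (intro bexI[of _ "r' - r"]) (auto simp: algebra_simps intro: mps_over_closed)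
  qed
qed

lemma cls_cases:
  assumes "r \<in> carrier R"
  obtains p where "p \<in> S" "r = cls p"
  using assms by (auto simp: carrier_R)

definition max_ideal :: "'k mps set set" where
  "max_ideal = cls ` {p \<in> S. mcoeff p 0 = 0}"

lemma cls_max_ideal: "p \<in> S \<Longrightarrow> cls p \<in> max_ideal \<longleftrightarrow> mcoeff p 0 = 0"
  by (auto simp: max_ideal_def cls_eq_iff f_const)

lemma ideal_max_ideal: "ideal max_ideal R"
proof -
  interpret R: cring R by (rule cring_R)
  show ?thesis
  proof (rule idealI[OF R.ring_axioms])
    show "subgroup max_ideal (add_monoid R)"
    proof (rule group.subgroupI[OF R.add.is_group])
      show "max_ideal \<subseteq> carrier (add_monoid R)" by (auto simp: max_ideal_def cls_closed)
      show "max_ideal \<noteq> {}" using cls_max_ideal[of 0] by auto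
      fix a b assume a: "a \<in> max_ideal" and b: "b \<in> max_ideal"
      then obtain p q where p: "p \<in> S" "mcoeff p 0 = 0" "a = cls p" "q \<in> S" "mcoeff q 0 = 0" "b = cls q"
        by (auto simp: max_ideal_def)
      have "cls (p + q) \<in> max_ideal" using p by (subst cls_max_ideal) (auto intro: mps_over_closed)
      thus "a \<otimes>\<^bsub>add_monoid R\<^esub> b \<in> max_ideal" using p by (simp add: cls_add)
      have "cls (- p) \<oplus>\<^bsub>R\<^esub> cls p = \<zero>\<^bsub>R\<^esub>"
        using p by (simp add: cls_add[symmetric] mps_over_uminus cls_zero)
      hence "inv\<^bsub>add_monoid R\<^esub> a = cls (- p)"
        using p R.minus_equality[of "cls (- p)" a] by (simp add: cls_closed mps_over_uminus a_inv_def)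
      thus "inv\<^bsub>add_monoid R\<^esub> a \<in> max_ideal" using p by (simp add: cls_max_ideal mps_over_uminus)
    qed
    fix a x assume "a \<in> max_ideal" "x \<in> carrier R"
    then obtain p q where p: "p \<in> S" "mcoeff p 0 = 0" "a = cls p" "q \<in> S" "x = cls q"
      by (auto simp: max_ideal_def carrier_R)
    have "cls (q * p) \<in> max_ideal" using p by (subst cls_max_ideal) (auto intro: mps_over_closed)
    thus "x \<otimes>\<^bsub>R\<^esub> a \<in> max_ideal" "a \<otimes>\<^bsub>R\<^esub> x \<in> max_ideal"
      using p by (simp_all add: cls_mult[symmetric] mult.commute)
  qed
qed

lemma ideal_le_max_ideal:
  assumes "ideal J R" "J \<noteq> carrier R"
  shows "J \<subseteq> max_ideal"
proof
  interpret J: ideal J R by (rule assms)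
  fix a assume a: "a \<in> J"
  then obtain p where p: "p \<in> S" "a = cls p" using J.Icarr carrier_R by blast
  show "a \<in> max_ideal"
  proof (rule ccontr)
    assume "a \<notin> max_ideal"
    hence "mcoeff p 0 \<noteq> 0" using p cls_max_ideal by auto
    then obtain q where q: "q \<in> S" "q * p = 1" using mps_unit p(1) by blast
    have "cls q \<otimes>\<^bsub>R\<^esub> a \<in> J" using a q by (intro J.I_l_closed cls_closed)
    hence "\<one>\<^bsub>R\<^esub> \<in> J" using p q by (simp add: cls_mult[symmetric] cls_one)
    thus False using J.one_imp_carrier assms(2) by blast
  qed
qed

lemma max_ideal_proper: "max_ideal \<noteq> carrier R"
proof -
  have "cls 1 \<notin> max_ideal" by (subst cls_max_ideal) (auto simp: mcoeff_one)
  thus ?thesis using cls_closed[of 1] by auto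
qed

text \<open>\<open>depth\<close> names the maximal ideal by a definite description, so uniqueness
  has to be established: a class with non-zero constant term is a unit, hence every proper ideal
  lies in \<open>max_ideal\<close>.\<close>

lemma the_maximalideal: "(THE I. maximalideal I R) = max_ideal"
proof (rule the_equality)
  show "maximalideal max_ideal R"
    by (rule maximalidealI[OF ideal_max_ideal]) (use max_ideal_proper ideal_le_max_ideal in auto)
  fix I assume "maximalideal I R"
  thus "I = max_ideal"
    using ideal_le_max_ideal ideal_max_ideal max_ideal_proper
    by (metis maximalideal.I_maximal maximalideal.I_notcarr maximalideal.axioms(1) ideal.Icarr subsetI)
qed

lemma prime_over_pullback:
  assumes "primeideal P R"
  shows "prime_over {0..n} {p \<in> S. cls p \<in> P}" "f \<in> {p \<in> S. cls p \<in> P}"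
proof -
  interpret P: primeideal P R by (rule assms)
  have one: "cls 1 \<notin> P" using P.one_imp_carrier P.I_notcarr by (auto simp: cls_one)
  show "prime_over {0..n} {p \<in> S. cls p \<in> P}"
    unfolding prime_over_def
    using one P.zero_closed
    by (auto simp: cls_zero cls_add cls_mult mps_over_closed cls_closed
        intro: P.a_closed P.I_l_closed dest!: P.I_prime[rotated 2])
  have "cls f = \<zero>\<^bsub>R\<^esub>" unfolding cls_zero[symmetric] cls_eq_iff by (rule bexI[of _ 1]) auto
  thus "f \<in> {p \<in> S. cls p \<in> P}" using f_over P.zero_closed by simp
qed

text \<open>Primes of \<open>R\<close> pull back to primes of \<open>S\<close> that contain
  \<open>f\<close>. As \<open>f\<close> is not 0, the zero ideal can be put below them, so a chain
  of length \<open>r\<close> becomes one of length \<open>r + 1\<close> in \<open>n + 1\<close>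
  variables.\<close>

lemma krull_dim_le:
  assumes inf: "infinite (UNIV :: 'k set)"
  shows "krull_dim R \<le> enat n"
  unfolding krull_dim_def
proof (rule Sup_least, clarify)
  fix r P
  assume prime: "\<forall>i\<le>r. primeideal (P i) R" and strict: "\<forall>i<r. P i \<subset> P (Suc i)"
  define Q where "Q i = (case i of 0 \<Rightarrow> {0} | Suc i \<Rightarrow> {p \<in> S. cls p \<in> P i})" for i
  have "Suc r \<le> card {0..n}"
  proof (rule prime_chain_length[OF inf])
    fix i
    show "i \<le> Suc r \<Longrightarrow> prime_over {0..n} (Q i)"
      using prime_over_pullback(1)[of "P (i - 1)"] prime
      by (cases i) (auto simp: Q_def prime_over_def)
    show "Q i \<subset> Q (Suc i)" if "i < Suc r"
    proof (cases i)
      case 0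
      have "{p \<in> S. cls p \<in> P 0} \<noteq> {0}" using prime_over_pullback(2)[of "P 0"] prime f_nz by auto
      thus ?thesis using 0 prime_overD(2)[OF prime_over_pullback(1)[of "P 0"]] prime by (auto simp: Q_def)
    next
      case (Suc j)
      have j: "j < r" using that Suc by simp
      then obtain a where a: "a \<in> P (Suc j)" "a \<notin> P j" using strict by blast
      have "primeideal (P (Suc j)) R" using prime j by simp
      hence "a \<in> carrier R" using a(1) primeideal.axioms(1) ideal.Icarr by metis
      then obtain p where "p \<in> S" "a = cls p" by (rule cls_cases)
      thus ?thesis using strict that Suc a by (auto simp: Q_def)
    qed
  qed simp
  thus "enat r \<le> enat n" by simp
qed

text \<open>The given sequence shows that \<open>n\<close> is at most the depth, the depth is at
  most the Krull dimension, and the latter is at most \<open>n\<close>.\<close>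

lemma depth_eq_krull_dimI:
  assumes inf: "infinite (UNIV :: 'k set)" and M: "module R M"
    and reg: "regular_seq M xs" "length xs = n" "set xs \<subseteq> max_ideal"
  shows "depth R M = krull_dim R"
proof -
  interpret M: module R M by (rule M)
  have sub: "max_ideal \<subseteq> carrier R" by (auto simp: max_ideal_def cls_closed)
  have "depth R M \<le> krull_dim R" unfolding depth_def the_maximalideal
    by (rule Sup_least) (use M.regular_seq_length_le_krull_dim sub in blast)
  moreover have "enat n \<le> depth R M" unfolding depth_def the_maximalideal
    using reg by (intro Sup_upper) auto
  ultimately show ?thesis using krull_dim_le[OF inf] by auto
qed

end

section \<open>Cokernels of matrices of power series\<close>

definition mat_over :: "nat \<Rightarrow> nat \<Rightarrow> nat \<Rightarrow> 'k :: field mps mat set" where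
  "mat_over n r c = {B \<in> carrier_mat r c. \<forall>i<r. \<forall>j<c. B $$ (i, j) \<in> mps_over {0..n}}"

lemma mat_overI: "B \<in> carrier_mat r c \<Longrightarrow> (\<And>i j. i < r \<Longrightarrow> j < c \<Longrightarrow> B $$ (i, j) \<in> mps_over {0..n}) \<Longrightarrow> B \<in> mat_over n r c"
  by (auto simp: mat_over_def)

lemma mat_over_carrier: "B \<in> mat_over n r c \<Longrightarrow> B \<in> carrier_mat r c"
  and mat_over_entry: "B \<in> mat_over n r c \<Longrightarrow> i < r \<Longrightarrow> j < c \<Longrightarrow> B $$ (i, j) \<in> mps_over {0..n}"
  by (auto simp: mat_over_def)

lemma free_vecs_iff: "v \<in> free_vecs n N \<longleftrightarrow> v \<in> carrier_vec N \<and> (\<forall>i<N. v $ i \<in> mps_over {0..n})"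
  by (auto simp: free_vecs_def)

lemma free_vecs_carrier: "v \<in> free_vecs n N \<Longrightarrow> v \<in> carrier_vec N"
  and free_vecs_entry: "v \<in> free_vecs n N \<Longrightarrow> i < N \<Longrightarrow> v $ i \<in> mps_over {0..n}"
  by (auto simp: free_vecs_iff)

lemma free_vecs_closed:
  shows free_vecs_add: "v \<in> free_vecs n N \<Longrightarrow> w \<in> free_vecs n N \<Longrightarrow> v + w \<in> free_vecs n N"
    and free_vecs_diff: "v \<in> free_vecs n N \<Longrightarrow> w \<in> free_vecs n N \<Longrightarrow> v - w \<in> free_vecs n N"
    and free_vecs_uminus: "v \<in> free_vecs n N \<Longrightarrow> - v \<in> free_vecs n N"
    and free_vecs_smult: "s \<in> mps_over {0..n} \<Longrightarrow> v \<in> free_vecs n N \<Longrightarrow> s \<cdot>\<^sub>v v \<in> free_vecs n N"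
    and free_vecs_zero: "0\<^sub>v N \<in> free_vecs n N"
    and free_vecs_unit: "unit_vec N j \<in> free_vecs n N"
  unfolding free_vecs_iff by (auto intro!: mps_over_closed simp: unit_vec_def)

lemma mat_over_mult_vec:
  assumes "B \<in> mat_over n r c" "v \<in> free_vecs n c"
  shows "B *\<^sub>v v \<in> free_vecs n r"
  using assms by (auto simp: mat_over_def free_vecs_iff scalar_prod_def intro!: mps_over_sum mps_over_mult)

lemma mat_over_mult: "A \<in> mat_over n r c \<Longrightarrow> B \<in> mat_over n c d \<Longrightarrow> A * B \<in> mat_over n r d"
  by (auto simp: mat_over_def scalar_prod_def intro!: mps_over_sum mps_over_mult)

lemma mat_over_one: "1\<^sub>m N \<in> mat_over n N N"
  by (auto simp: mat_over_def)

lemma mat_over_minus: "A \<in> mat_over n r c \<Longrightarrow> B \<in> mat_over n r c \<Longrightarrow> A - B \<in> mat_over n r c"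
  by (auto simp: mat_over_def intro!: mps_over_closed)

lemma mat_unit_vec_col:
  fixes A :: "'a :: comm_ring_1 mat"
  shows "A \<in> carrier_mat r c \<Longrightarrow> j < c \<Longrightarrow> A *\<^sub>v unit_vec c j = col A j"
  by (intro eq_vecI) auto

lemma mat_eq_by_vecs:
  fixes A B :: "'k :: field mps mat"
  assumes "A \<in> carrier_mat r c" "B \<in> carrier_mat r c" "\<And>v. v \<in> free_vecs n c \<Longrightarrow> A *\<^sub>v v = B *\<^sub>v v"
  shows "A = B"
proof (rule eq_matI)
  fix i j assume "i < dim_row B" "j < dim_col B"
  hence ij: "i < r" "j < c" using assms by auto
  have "col A j = col B j"
    using assms(3)[OF free_vecs_unit[of c j]] ij assms(1,2) by (simp add: mat_unit_vec_col)
  thus "A $$ (i, j) = B $$ (i, j)" using ij assms(1,2) by (metis carrier_matD index_col)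
qed (use assms in auto)

lemma mult_mat_smult_vec:
  fixes A :: "'a :: comm_ring_1 mat"
  assumes "A \<in> carrier_mat r c" "v \<in> carrier_vec c"
  shows "A *\<^sub>v (s \<cdot>\<^sub>v v) = s \<cdot>\<^sub>v (A *\<^sub>v v)"
  using assms by (intro eq_vecI) auto

section \<open>Cokernels as abelian groups of cosets\<close>

locale coker =
  fixes n N :: nat and \<Phi> :: "'k :: field mps mat"
  assumes \<Phi>: "\<Phi> \<in> mat_over n N N"
begin

abbreviation "V \<equiv> free_vecs n N :: 'k mps vec set"
abbreviation "cok \<equiv> cok_class n \<Phi>"
abbreviation "M \<equiv> cok_module n \<Phi>"

lemma \<Phi>_carrier: "\<Phi> \<in> carrier_mat N N" and dims [simp]: "dim_row \<Phi> = N" "dim_col \<Phi> = N"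
  using mat_over_carrier[OF \<Phi>] by auto

lemma V_carrier: "v \<in> V \<Longrightarrow> v \<in> carrier_vec N"
  by (rule free_vecs_carrier)

lemma \<Phi>_zero: "\<Phi> *\<^sub>v 0\<^sub>v N = 0\<^sub>v N"
  using \<Phi>_carrier by (intro eq_vecI) auto

lemma \<Phi>_vec: "w \<in> V \<Longrightarrow> \<Phi> *\<^sub>v w \<in> V"
  by (rule mat_over_mult_vec[OF \<Phi>])

lemma \<Phi>_add: "v \<in> V \<Longrightarrow> w \<in> V \<Longrightarrow> \<Phi> *\<^sub>v (v + w) = \<Phi> *\<^sub>v v + \<Phi> *\<^sub>v w"
  and \<Phi>_diff: "v \<in> V \<Longrightarrow> w \<in> V \<Longrightarrow> \<Phi> *\<^sub>v (v - w) = \<Phi> *\<^sub>v v - \<Phi> *\<^sub>v w"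
  and \<Phi>_smult: "v \<in> V \<Longrightarrow> \<Phi> *\<^sub>v (s \<cdot>\<^sub>v v) = s \<cdot>\<^sub>v (\<Phi> *\<^sub>v v)"
  by (simp_all only: mult_add_distrib_mat_vec[OF \<Phi>_carrier V_carrier V_carrier]
      mult_minus_distrib_mat_vec[OF \<Phi>_carrier V_carrier V_carrier] mult_mat_smult_vec[OF \<Phi>_carrier V_carrier])

lemma mem_cok: "s \<in> cok v \<longleftrightarrow> (\<exists>w\<in>V. s = v + \<Phi> *\<^sub>v w)"
  by (auto simp: cok_class_def)

lemma cok_eq_iff:
  assumes v: "v \<in> V" and v': "v' \<in> V"
  shows "cok v = cok v' \<longleftrightarrow> (\<exists>w\<in>V. v = v' + \<Phi> *\<^sub>v w)"
proof
  assume "cok v = cok v'"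
  moreover have "v \<in> cok v"
    unfolding mem_cok by (rule bexI[of _ "0\<^sub>v N"]) (use V_carrier[OF v] in \<open>simp_all add: free_vecs_zero \<Phi>_zero\<close>)
  ultimately show "\<exists>w\<in>V. v = v' + \<Phi> *\<^sub>v w" by (simp add: mem_cok)
next
  assume "\<exists>w\<in>V. v = v' + \<Phi> *\<^sub>v w"
  then obtain w where w: "w \<in> V" "v = v' + \<Phi> *\<^sub>v w" by blast
  have c: "v' \<in> carrier_vec N" "\<Phi> *\<^sub>v w \<in> carrier_vec N"
    using v' \<Phi>_vec[OF w(1)] by (auto dest: V_carrier)
  show "cok v = cok v'"
  proof (intro equalityI subsetI)
    fix s assume "s \<in> cok v"
    then obtain u where u: "u \<in> V" "s = v + \<Phi> *\<^sub>v u" by (auto simp: mem_cok)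
    have "s = v' + \<Phi> *\<^sub>v (w + u)"
      using c \<Phi>_vec[OF u(1)] u w by (simp add: \<Phi>_add V_carrier assoc_add_vec[of _ N])
    thus "s \<in> cok v'" unfolding mem_cok using u w by (blast intro: free_vecs_add)
  next
    fix s assume "s \<in> cok v'"
    then obtain u where u: "u \<in> V" "s = v' + \<Phi> *\<^sub>v u" by (auto simp: mem_cok)
    have "s = v + \<Phi> *\<^sub>v (u - w)"
      using c V_carrier[OF \<Phi>_vec[OF u(1)]] u w by (simp add: \<Phi>_diff) (intro eq_vecI; auto)
    thus "s \<in> cok v" unfolding mem_cok using u w by (blast intro: free_vecs_diff)
  qed
qed

lemma cok_self: "v \<in> V \<Longrightarrow> v \<in> cok v"
  unfolding mem_cok by (rule bexI[of _ "0\<^sub>v N"]) (simp_all add: free_vecs_zero \<Phi>_zero V_carrier)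

lemma cok_subset: "v \<in> V \<Longrightarrow> s \<in> cok v \<Longrightarrow> s \<in> V"
  by (auto simp: mem_cok intro: free_vecs_add \<Phi>_vec)

lemma cok_UNION:
  assumes "v \<in> V" "\<And>s. s \<in> cok v \<Longrightarrow> F s = X"
  shows "(\<Union>s\<in>cok v. F s) = X"
  using cok_self[OF assms(1)] assms(2) by auto

lemma cok_cong: "v \<in> V \<Longrightarrow> w \<in> V \<Longrightarrow> cok (v + \<Phi> *\<^sub>v w) = cok v"
  using cok_eq_iff[of "v + \<Phi> *\<^sub>v w" v] by (auto intro: free_vecs_add \<Phi>_vec)

lemma carrier_M: "carrier M = cok ` V"
  and zero_M: "\<zero>\<^bsub>M\<^esub> = cok (0\<^sub>v N)"
  by (simp_all add: cok_module_def)

lemma cok_closed: "v \<in> V \<Longrightarrow> cok v \<in> carrier M"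
  by (simp add: carrier_M)

lemma cok_cases:
  assumes "x \<in> carrier M"
  obtains v where "v \<in> V" "x = cok v"
  using assms by (auto simp: carrier_M)

lemma cok_add:
  assumes v: "v \<in> V" and w: "w \<in> V"
  shows "cok v \<oplus>\<^bsub>M\<^esub> cok w = cok (v + w)"
proof -
  have *: "cok (s + t) = cok (v + w)" if st: "s \<in> cok v" "t \<in> cok w" for s t
  proof -
    obtain a b where ab: "a \<in> V" "s = v + \<Phi> *\<^sub>v a" "b \<in> V" "t = w + \<Phi> *\<^sub>v b"
      using st by (auto simp: mem_cok)
    have "s + t = (v + w) + \<Phi> *\<^sub>v (a + b)"
      using ab v w V_carrier[OF \<Phi>_vec[OF ab(1)]] V_carrier[OF \<Phi>_vec[OF ab(3)]]
        V_carrier[OF v] V_carrier[OF w]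
      by (simp add: \<Phi>_add) (intro eq_vecI; auto)
    thus ?thesis using cok_cong ab v w by (auto intro: free_vecs_add)
  qed
  have "(\<Union>t\<in>cok w. cok (s + t)) = cok (v + w)" if "s \<in> cok v" for s
    by (rule cok_UNION[OF w *[OF that]])
  hence "(\<Union>s\<in>cok v. \<Union>t\<in>cok w. cok (s + t)) = cok (v + w)" by (rule cok_UNION[OF v])
  thus ?thesis by (simp add: cok_module_def)
qed

lemma cok_zero_iff:
  assumes "v \<in> V"
  shows "cok v = \<zero>\<^bsub>M\<^esub> \<longleftrightarrow> (\<exists>w\<in>V. v = \<Phi> *\<^sub>v w)"
proof -
  have "0\<^sub>v N + \<Phi> *\<^sub>v w = \<Phi> *\<^sub>v w" if "w \<in> V" for w
    using V_carrier[OF \<Phi>_vec[OF that]] by simp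
  thus ?thesis unfolding zero_M cok_eq_iff[OF assms free_vecs_zero] by (intro bex_cong) auto
qed

lemma M_abelian: "abelian_group M"
proof (rule abelian_groupI)
  show "\<zero>\<^bsub>M\<^esub> \<in> carrier M" by (simp add: zero_M cok_closed free_vecs_zero)
  fix x assume "x \<in> carrier M"
  then obtain v where v: "v \<in> V" "x = cok v" by (rule cok_cases)
  show "\<zero>\<^bsub>M\<^esub> \<oplus>\<^bsub>M\<^esub> x = x"
    using v by (simp add: zero_M cok_add free_vecs_zero V_carrier)
  show "\<exists>y\<in>carrier M. y \<oplus>\<^bsub>M\<^esub> x = \<zero>\<^bsub>M\<^esub>"
  proof (rule bexI[of _ "cok (- v)"])
    have "- v + v = 0\<^sub>v N" using V_carrier[OF v(1)] by (intro eq_vecI) auto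
    thus "cok (- v) \<oplus>\<^bsub>M\<^esub> x = \<zero>\<^bsub>M\<^esub>" using v by (simp add: zero_M cok_add free_vecs_uminus)
  qed (use v in \<open>simp add: cok_closed free_vecs_uminus\<close>)
  fix y assume "y \<in> carrier M"
  then obtain w where w: "w \<in> V" "y = cok w" by (rule cok_cases)
  show "x \<oplus>\<^bsub>M\<^esub> y \<in> carrier M" using v w by (simp add: cok_add cok_closed free_vecs_add)
  show "x \<oplus>\<^bsub>M\<^esub> y = y \<oplus>\<^bsub>M\<^esub> x"
    using v w by (simp add: cok_add comm_add_vec[OF V_carrier V_carrier])
  fix z assume "z \<in> carrier M"
  then obtain u where u: "u \<in> V" "z = cok u" by (rule cok_cases)
  show "x \<oplus>\<^bsub>M\<^esub> y \<oplus>\<^bsub>M\<^esub> z = x \<oplus>\<^bsub>M\<^esub> (y \<oplus>\<^bsub>M\<^esub> z)"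
    using v w u by (simp add: cok_add free_vecs_add assoc_add_vec[OF V_carrier V_carrier V_carrier])
qed

end

section \<open>Cokernels of matrix factorizations as modules over the hypersurface ring\<close>

locale matrix_factorization = hypersurface n f + coker n N \<Phi> for n N :: nat and f :: "'k :: field mps" and \<Phi> :: "'k mps mat" +
  fixes \<Psi> :: "'k mps mat"
  assumes \<Psi>: "\<Psi> \<in> mat_over n N N" and \<Phi>\<Psi>: "\<Phi> * \<Psi> = f \<cdot>\<^sub>m 1\<^sub>m N" and \<Psi>\<Phi>: "\<Psi> * \<Phi> = f \<cdot>\<^sub>m 1\<^sub>m N"
begin

lemma \<Psi>_carrier: "\<Psi> \<in> carrier_mat N N"
  by (rule mat_over_carrier[OF \<Psi>])

lemma f_smult: "v \<in> V \<Longrightarrow> (f \<cdot>\<^sub>m 1\<^sub>m N) *\<^sub>v v = f \<cdot>\<^sub>v v"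
  by (intro eq_vecI) (auto simp: free_vecs_iff)

lemma \<Phi>\<Psi>_vec: "v \<in> V \<Longrightarrow> \<Phi> *\<^sub>v (\<Psi> *\<^sub>v v) = f \<cdot>\<^sub>v v"
  and \<Psi>\<Phi>_vec: "v \<in> V \<Longrightarrow> \<Psi> *\<^sub>v (\<Phi> *\<^sub>v v) = f \<cdot>\<^sub>v v"
  using assoc_mult_mat_vec[OF \<Phi>_carrier \<Psi>_carrier, of v] assoc_mult_mat_vec[OF \<Psi>_carrier \<Phi>_carrier, of v]
  by (auto simp: \<Phi>\<Psi> \<Psi>\<Phi> f_smult dest: V_carrier)

lemma f_cancel: "v \<in> carrier_vec N \<Longrightarrow> w \<in> carrier_vec N \<Longrightarrow> f \<cdot>\<^sub>v v = f \<cdot>\<^sub>v w \<Longrightarrow> v = w"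
proof (rule eq_vecI)
  assume "v \<in> carrier_vec N" "w \<in> carrier_vec N" and eq: "f \<cdot>\<^sub>v v = f \<cdot>\<^sub>v w"
  thus "dim_vec v = dim_vec w" by simp
  fix i assume "i < dim_vec w"
  hence "(f \<cdot>\<^sub>v v) $ i = f * v $ i" "(f \<cdot>\<^sub>v w) $ i = f * w $ i"
    using \<open>v \<in> carrier_vec N\<close> \<open>w \<in> carrier_vec N\<close> by auto
  thus "v $ i = w $ i" using eq f_nz by simp
qed

text \<open>Applying \<open>\<Psi>\<close> gives multiplication by the non-zero element
  \<open>f\<close> of a domain.\<close>

lemma \<Phi>_inj:
  assumes "v \<in> V" "w \<in> V" "\<Phi> *\<^sub>v v = \<Phi> *\<^sub>v w"
  shows "v = w"
proof -
  have "f \<cdot>\<^sub>v v = f \<cdot>\<^sub>v w" using \<Psi>\<Phi>_vec[OF assms(1)] \<Psi>\<Phi>_vec[OF assms(2)] assms(3) by metis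
  thus ?thesis by (rule f_cancel[OF V_carrier[OF assms(1)] V_carrier[OF assms(2)]])
qed

text \<open>Replacing the scalar \<open>s\<close> by \<open>s + r f\<close> changes the product by
  \<open>r f u\<close>, which is \<open>\<Phi>\<close> applied to \<open>r \<Psi> u\<close>. Hence
  the union over all representatives in the scalar multiplication is a single coset.\<close>

lemma smult_cok:
  assumes s: "s \<in> S" and v: "v \<in> V"
  shows "cls s \<odot>\<^bsub>M\<^esub> cok v = cok (s \<cdot>\<^sub>v v)"
proof -
  have "cok (t \<cdot>\<^sub>v u) = cok (s \<cdot>\<^sub>v v)" if t: "t \<in> cls s" and u: "u \<in> cok v" for t u
  proof -
    obtain r where r: "r \<in> S" "t = r * f + s" using t by (auto simp: mem_cls)
    obtain w where w: "w \<in> V" "u = v + \<Phi> *\<^sub>v w" using u by (auto simp: mem_cok)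
    have uV: "u \<in> V" using u v cok_subset by blast
    have \<Psi>u: "\<Psi> *\<^sub>v u \<in> V" by (rule mat_over_mult_vec[OF \<Psi> uV])
    let ?x = "r \<cdot>\<^sub>v (\<Psi> *\<^sub>v u) + s \<cdot>\<^sub>v w"
    have x: "?x \<in> V" using r w s \<Psi>u by (intro free_vecs_add free_vecs_smult)
    have "\<Phi> *\<^sub>v ?x = r \<cdot>\<^sub>v (f \<cdot>\<^sub>v u) + s \<cdot>\<^sub>v (\<Phi> *\<^sub>v w)"
      using r s w \<Psi>u uV by (simp add: \<Phi>_add \<Phi>_smult free_vecs_smult \<Phi>\<Psi>_vec)
    hence "t \<cdot>\<^sub>v u = s \<cdot>\<^sub>v v + \<Phi> *\<^sub>v ?x"
      using r w V_carrier[OF \<Phi>_vec[OF w(1)]] V_carrier[OF v] V_carrier[OF uV]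
      by (intro eq_vecI) (auto simp: algebra_simps)
    thus ?thesis using cok_cong[OF free_vecs_smult[OF s v] x] by simp
  qed
  hence "(\<Union>u\<in>cok v. cok (t \<cdot>\<^sub>v u)) = cok (s \<cdot>\<^sub>v v)" if "t \<in> cls s" for t
    using that by (intro cok_UNION v) auto
  thus ?thesis using cls_self[of s] by (auto simp: cok_module_def)
qed

lemma M_module: "module R M"
proof (rule moduleI[OF cring_R M_abelian])
  fix a x assume "a \<in> carrier R" "x \<in> carrier M"
  then obtain p v where p: "p \<in> S" "a = cls p" and v: "v \<in> V" "x = cok v" by (metis cls_cases cok_cases)
  show "a \<odot>\<^bsub>M\<^esub> x \<in> carrier M" using p v by (simp add: smult_cok cok_closed free_vecs_smult)
  fix b assume "b \<in> carrier R"
  then obtain q where q: "q \<in> S" "b = cls q" by (rule cls_cases)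
  show "(a \<oplus>\<^bsub>R\<^esub> b) \<odot>\<^bsub>M\<^esub> x = a \<odot>\<^bsub>M\<^esub> x \<oplus>\<^bsub>M\<^esub> b \<odot>\<^bsub>M\<^esub> x"
    using p q v by (simp add: smult_cok cok_add cls_add[symmetric] mps_over_closed free_vecs_smult add_smult_distrib_vec)
  show "(a \<otimes>\<^bsub>R\<^esub> b) \<odot>\<^bsub>M\<^esub> x = a \<odot>\<^bsub>M\<^esub> (b \<odot>\<^bsub>M\<^esub> x)"
    using p q v by (simp add: smult_cok cls_mult[symmetric] mps_over_closed free_vecs_smult smult_smult_assoc)
next
  fix a x y assume "a \<in> carrier R" "x \<in> carrier M" "y \<in> carrier M"
  then obtain p v w where p: "p \<in> S" "a = cls p" and v: "v \<in> V" "x = cok v" and w: "w \<in> V" "y = cok w"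
    by (metis cls_cases cok_cases)
  show "a \<odot>\<^bsub>M\<^esub> (x \<oplus>\<^bsub>M\<^esub> y) = a \<odot>\<^bsub>M\<^esub> x \<oplus>\<^bsub>M\<^esub> a \<odot>\<^bsub>M\<^esub> y"
    using p v w by (simp add: smult_cok cok_add free_vecs_add free_vecs_smult
        smult_add_distrib_vec[OF V_carrier V_carrier])
next
  fix x assume "x \<in> carrier M"
  then obtain v where v: "v \<in> V" "x = cok v" by (rule cok_cases)
  show "\<one>\<^bsub>R\<^esub> \<odot>\<^bsub>M\<^esub> x = x" using v by (simp add: cls_one[symmetric] smult_cok)
qed

text \<open>Inductions on \<open>k\<close> build a vector up from multiples of unit vectors one at a
  time; this takes the place of finite sums in the cokernel.\<close>

definition partial_vec :: "nat \<Rightarrow> 'k mps vec \<Rightarrow> 'k mps vec" where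
  "partial_vec k v = vec N (\<lambda>i. if i < k then v $ i else 0)"

lemma partial_vec_props:
  assumes v: "v \<in> V"
  shows "partial_vec k v \<in> V" "partial_vec 0 v = 0\<^sub>v N" "partial_vec N v = v"
    and "k < N \<Longrightarrow> partial_vec (Suc k) v = partial_vec k v + (v $ k) \<cdot>\<^sub>v unit_vec N k"
  using v unfolding partial_vec_def free_vecs_iff
  by (auto intro!: eq_vecI simp: less_Suc_eq unit_vec_def)

text \<open>Different unit vectors may have the same class, so coefficients indexed by the set
  \<open>B\<close> cannot be read off from coordinates. Instead the set \<open>Sp\<close> of all
  combinations is shown to be closed under addition and to contain the multiples of the
  generators.\<close>

lemma M_fin_gen: "fin_gen_module R M"
proof -
  interpret M: module R M by (rule M_module)
  define B where "B = (\<lambda>j. cok (unit_vec N j)) ` {..<N}"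
  have B: "finite B" "B \<subseteq> carrier M" by (auto simp: B_def cok_closed free_vecs_unit)
  define Sp where "Sp = {finsum M (\<lambda>b. c b \<odot>\<^bsub>M\<^esub> b) B | c. c \<in> B \<rightarrow> carrier R}"
  have cl: "(\<lambda>b. c b \<odot>\<^bsub>M\<^esub> b) \<in> B \<rightarrow> carrier M" if "c \<in> B \<rightarrow> carrier R" for c
    using that B by auto
  have Sp_add: "x \<oplus>\<^bsub>M\<^esub> y \<in> Sp" if xy: "x \<in> Sp" "y \<in> Sp" for x y
  proof -
    obtain c d where c: "c \<in> B \<rightarrow> carrier R" "x = finsum M (\<lambda>b. c b \<odot>\<^bsub>M\<^esub> b) B"
      and d: "d \<in> B \<rightarrow> carrier R" "y = finsum M (\<lambda>b. d b \<odot>\<^bsub>M\<^esub> b) B" using xy by (auto simp: Sp_def)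
    have "x \<oplus>\<^bsub>M\<^esub> y = finsum M (\<lambda>b. (c b \<odot>\<^bsub>M\<^esub> b) \<oplus>\<^bsub>M\<^esub> (d b \<odot>\<^bsub>M\<^esub> b)) B"
      unfolding c(2) d(2) by (rule M.finsum_addf[symmetric]) (rule cl c d)+
    also have "\<dots> = finsum M (\<lambda>b. (c b \<oplus>\<^bsub>R\<^esub> d b) \<odot>\<^bsub>M\<^esub> b) B"
      by (rule M.finsum_cong') (use c(1) d(1) B in \<open>auto simp: Pi_iff subset_iff M.smult_l_distr\<close>)
    finally show ?thesis using c(1) d(1) unfolding Sp_def
      by (intro CollectI exI[of _ "\<lambda>b. c b \<oplus>\<^bsub>R\<^esub> d b"]) auto
  qed
  have Sp_gen: "a \<odot>\<^bsub>M\<^esub> b \<in> Sp" if "a \<in> carrier R" "b \<in> B" for a b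
  proof -
    have "finsum M (\<lambda>i. (if b = i then a else \<zero>\<^bsub>R\<^esub>) \<odot>\<^bsub>M\<^esub> i) B = finsum M (\<lambda>i. if b = i then a \<odot>\<^bsub>M\<^esub> i else \<zero>\<^bsub>M\<^esub>) B"
      by (rule M.finsum_cong') (use that B in \<open>auto simp: subset_iff\<close>)
    also have "\<dots> = a \<odot>\<^bsub>M\<^esub> b"
      using that B by (intro M.finsum_singleton) auto
    finally show ?thesis unfolding Sp_def using that
      by (intro CollectI exI[of _ "\<lambda>i. if b = i then a else \<zero>\<^bsub>R\<^esub>"]) auto
  qed
  have zero: "\<zero>\<^bsub>M\<^esub> \<in> Sp"
  proof -
    have "finsum M (\<lambda>i. \<zero>\<^bsub>R\<^esub> \<odot>\<^bsub>M\<^esub> i) B = finsum M (\<lambda>i. \<zero>\<^bsub>M\<^esub>) B"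
      by (rule M.finsum_cong') (use B in \<open>auto simp: subset_iff\<close>)
    thus ?thesis unfolding Sp_def by (intro CollectI exI[of _ "\<lambda>i. \<zero>\<^bsub>R\<^esub>"]) auto
  qed
  have "cok (partial_vec k v) \<in> Sp" if v: "v \<in> V" and "k \<le> N" for k v
    using that(2)
  proof (induction k)
    case 0 thus ?case using zero v by (simp add: partial_vec_props zero_M)
  next
    case (Suc k)
    have vk: "v $ k \<in> S" using v Suc.prems by (auto intro: free_vecs_entry)
    have "cls (v $ k) \<odot>\<^bsub>M\<^esub> cok (unit_vec N k) \<in> Sp"
      by (rule Sp_gen) (use vk Suc.prems in \<open>auto simp: B_def cls_closed\<close>)
    thus ?case using Suc Sp_add v vk
      by (simp add: partial_vec_props smult_cok[OF vk free_vecs_unit] cok_add[symmetric] free_vecs_smult free_vecs_unit)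
  qed
  hence "carrier M \<subseteq> Sp"
    using partial_vec_props(3) by (auto simp: carrier_M) (metis order_refl)
  thus ?thesis unfolding fin_gen_module_def Sp_def using B by (intro exI[of _ B]) auto
qed

end

section \<open>Maps between cokernels\<close>

locale matrix_factorization_pair =
  A: matrix_factorization n N f \<Phi> \<Psi> + B: matrix_factorization n N' f \<Phi>' \<Psi>'
  for n N N' :: nat and f :: "'k :: field mps" and \<Phi> \<Psi> \<Phi>' \<Psi>' :: "'k mps mat"
begin

text \<open>The relation \<open>P * \<Phi> = \<Phi>' * Q\<close> says that \<open>P\<close> sends
  the image of \<open>\<Phi>\<close> into that of \<open>\<Phi>'\<close>, so all representatives
  lead to the same coset.\<close>

lemma induced_map:
  assumes P: "P \<in> mat_over n N' N" and Q: "Q \<in> mat_over n N' N" and PQ: "P * \<Phi> = \<Phi>' * Q" and v: "v \<in> A.V"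
  shows "mf_map n (\<Phi>, \<Psi>) (\<Phi>', \<Psi>') (P, Q0) (A.cok v) = B.cok (P *\<^sub>v v)"
proof -
  have "B.cok (P *\<^sub>v s) = B.cok (P *\<^sub>v v)" if "s \<in> A.cok v" for s
  proof -
    obtain w where w: "w \<in> A.V" "s = v + \<Phi> *\<^sub>v w" using \<open>s \<in> A.cok v\<close> by (auto simp: A.mem_cok)
    have "P *\<^sub>v s = P *\<^sub>v v + P *\<^sub>v (\<Phi> *\<^sub>v w)"
      unfolding w(2) using free_vecs_carrier[OF v] free_vecs_carrier[OF A.\<Phi>_vec[OF w(1)]]
      by (rule mult_add_distrib_mat_vec[OF mat_over_carrier[OF P]])
    also have "P *\<^sub>v (\<Phi> *\<^sub>v w) = \<Phi>' *\<^sub>v (Q *\<^sub>v w)"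
      using assoc_mult_mat_vec[OF mat_over_carrier[OF P] A.\<Phi>_carrier free_vecs_carrier[OF w(1)]]
        assoc_mult_mat_vec[OF B.\<Phi>_carrier mat_over_carrier[OF Q] free_vecs_carrier[OF w(1)]] PQ by metis
    finally show ?thesis
      using B.cok_cong[OF mat_over_mult_vec[OF P v] mat_over_mult_vec[OF Q w(1)]] by simp
  qed
  hence "(\<Union>s\<in>A.cok v. B.cok (P *\<^sub>v s)) = B.cok (P *\<^sub>v v)" by (rule A.cok_UNION[OF v])
  thus ?thesis using v by (simp add: mf_map_def A.cok_closed)
qed

lemma induced_map_hom:
  assumes P: "P \<in> mat_over n N' N" and Q: "Q \<in> mat_over n N' N" and PQ: "P * \<Phi> = \<Phi>' * Q"
  shows "mf_map n (\<Phi>, \<Psi>) (\<Phi>', \<Psi>') (P, Q0) \<in> module_hom A.R A.M B.M \<inter> extensional (carrier A.M)"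
proof
  note ind = induced_map[OF P Q PQ]
  show "mf_map n (\<Phi>, \<Psi>) (\<Phi>', \<Psi>') (P, Q0) \<in> extensional (carrier A.M)"
    by (simp add: mf_map_def)
  show "mf_map n (\<Phi>, \<Psi>) (\<Phi>', \<Psi>') (P, Q0) \<in> module_hom A.R A.M B.M"
    unfolding module_hom_def
  proof (intro CollectI conjI allI impI, goal_cases)
    case 1 show ?case
      using P by (auto simp: A.carrier_M ind B.cok_closed mat_over_mult_vec)
  next
    case (2 x y)
    then obtain v w where "v \<in> A.V" "x = A.cok v" "w \<in> A.V" "y = A.cok w" by (auto simp: A.carrier_M)
    thus ?case
      by (simp add: A.cok_add ind free_vecs_add B.cok_add mat_over_mult_vec[OF P]
          mult_add_distrib_mat_vec[OF mat_over_carrier[OF P]] A.V_carrier B.V_carrier)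
  next
    case (3 r x)
    then obtain p v where "p \<in> A.S" "r = A.cls p" "v \<in> A.V" "x = A.cok v"
      by (auto simp: A.carrier_M A.carrier_R)
    thus ?case
      by (simp add: A.smult_cok ind free_vecs_smult B.smult_cok mat_over_mult_vec[OF P]
          mult_mat_smult_vec[OF mat_over_carrier[OF P]] A.V_carrier B.V_carrier)
  qed
qed

text \<open>Free modules are projective: the columns of \<open>P\<close> represent the images of the
  unit vectors. Each column of \<open>\<Phi>\<close> has class 0, so \<open>P\<close> maps it into
  the image of \<open>\<Phi>'\<close>, and preimages form the columns of \<open>Q\<close>.\<close>

lemma hom_lift:
  assumes h: "h \<in> module_hom A.R A.M B.M"
  obtains P Q where "P \<in> mat_over n N' N" "Q \<in> mat_over n N' N" "P * \<Phi> = \<Phi>' * Q"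
    "\<And>v. v \<in> A.V \<Longrightarrow> h (A.cok v) = B.cok (P *\<^sub>v v)"
proof -
  have h_cl: "h x \<in> carrier B.M" if "x \<in> carrier A.M" for x using h that by (auto simp: module_hom_def)
  have h_add: "h (A.cok v \<oplus>\<^bsub>A.M\<^esub> A.cok w) = h (A.cok v) \<oplus>\<^bsub>B.M\<^esub> h (A.cok w)" if "v \<in> A.V" "w \<in> A.V" for v w
    using h that by (auto simp: module_hom_def A.cok_closed)
  have h_smult: "h (A.cls s \<odot>\<^bsub>A.M\<^esub> A.cok v) = A.cls s \<odot>\<^bsub>B.M\<^esub> h (A.cok v)" if "v \<in> A.V" "s \<in> A.S" for v s
    using h that by (auto simp: module_hom_def A.cok_closed A.cls_closed)
  have "\<exists>p. p \<in> B.V \<and> h (A.cok (unit_vec N j)) = B.cok p" for j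
    using h_cl[OF A.cok_closed[OF free_vecs_unit]] by (metis B.cok_cases)
  then obtain p where p: "\<And>j. p j \<in> B.V" "\<And>j. h (A.cok (unit_vec N j)) = B.cok (p j)" by metis
  define P where "P = mat N' N (\<lambda>(i, j). p j $ i)"
  have P: "P \<in> mat_over n N' N"
    using p(1) by (auto simp: P_def mat_over_def free_vecs_iff)
  note Pc = mat_over_carrier[OF P]
  have P_unit: "P *\<^sub>v unit_vec N j = p j" if "j < N" for j
    using that p(1)[of j] by (auto simp: mat_unit_vec_col[OF Pc] P_def free_vecs_iff intro!: eq_vecI)
  have h0: "h (A.cok (0\<^sub>v N)) = B.cok (0\<^sub>v N')"
  proof -
    interpret AM: module A.R A.M by (rule A.M_module)
    interpret BM: module A.R B.M by (rule B.M_module)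
    have "h (A.cls 0 \<odot>\<^bsub>A.M\<^esub> A.cok (0\<^sub>v N)) = A.cls 0 \<odot>\<^bsub>B.M\<^esub> h (A.cok (0\<^sub>v N))"
      by (rule h_smult) (auto simp: free_vecs_zero)
    thus ?thesis
      using h_cl[OF A.cok_closed[OF free_vecs_zero]] A.cok_closed[OF free_vecs_zero]
      by (simp add: A.cls_zero A.zero_M[symmetric] B.zero_M[symmetric])
  qed
  have partial: "h (A.cok (A.partial_vec k v)) = B.cok (P *\<^sub>v A.partial_vec k v)" if v: "v \<in> A.V" and "k \<le> N" for k v
    using that(2)
  proof (induction k)
    case 0 
    have "P *\<^sub>v 0\<^sub>v N = 0\<^sub>v N'" using Pc by auto
    thus ?case using h0 v by (simp add: A.partial_vec_props)
  next
    case (Suc k)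
    have vk: "v $ k \<in> A.S" using v Suc.prems by (auto intro: free_vecs_entry)
    have u: "(v $ k) \<cdot>\<^sub>v unit_vec N k \<in> A.V" by (intro free_vecs_smult vk free_vecs_unit)
    note pv = A.partial_vec_props(1)[OF v, of k]
    have "h (A.cok (A.partial_vec (Suc k) v)) = h (A.cok (A.partial_vec k v) \<oplus>\<^bsub>A.M\<^esub> A.cok ((v $ k) \<cdot>\<^sub>v unit_vec N k))"
      using Suc.prems v u pv by (simp add: A.partial_vec_props A.cok_add)
    also have "\<dots> = B.cok (P *\<^sub>v A.partial_vec k v) \<oplus>\<^bsub>B.M\<^esub> h (A.cok ((v $ k) \<cdot>\<^sub>v unit_vec N k))"
      using Suc u pv by (simp add: h_add)
    also have "h (A.cok ((v $ k) \<cdot>\<^sub>v unit_vec N k)) = B.cok ((v $ k) \<cdot>\<^sub>v p k)"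
      using h_smult[OF free_vecs_unit vk] A.smult_cok[OF vk free_vecs_unit] p vk by (simp add: B.smult_cok)
    also have "(v $ k) \<cdot>\<^sub>v p k = P *\<^sub>v ((v $ k) \<cdot>\<^sub>v unit_vec N k)"
      using Suc.prems by (simp add: mult_mat_smult_vec[OF Pc] P_unit)
    also have "B.cok (P *\<^sub>v A.partial_vec k v) \<oplus>\<^bsub>B.M\<^esub> B.cok (P *\<^sub>v ((v $ k) \<cdot>\<^sub>v unit_vec N k)) =
        B.cok (P *\<^sub>v A.partial_vec k v + P *\<^sub>v ((v $ k) \<cdot>\<^sub>v unit_vec N k))"
      by (intro B.cok_add mat_over_mult_vec[OF P] pv u)
    also have "\<dots> = B.cok (P *\<^sub>v A.partial_vec (Suc k) v)"
      using Suc.prems v mult_add_distrib_mat_vec[OF Pc free_vecs_carrier[OF pv] free_vecs_carrier[OF u]]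
      by (simp add: A.partial_vec_props)
    finally show ?case .
  qed
  have hP: "h (A.cok v) = B.cok (P *\<^sub>v v)" if "v \<in> A.V" for v
    using partial[OF that order_refl] that by (simp add: A.partial_vec_props)
  have "\<exists>q. q \<in> B.V \<and> P *\<^sub>v (\<Phi> *\<^sub>v unit_vec N j) = \<Phi>' *\<^sub>v q" for j
  proof -
    note u = free_vecs_unit[of N j n]
    have "A.cok (\<Phi> *\<^sub>v unit_vec N j) = A.cok (0\<^sub>v N)"
      using A.cok_zero_iff[OF A.\<Phi>_vec[OF u]] u by (auto simp: A.zero_M)
    hence "B.cok (P *\<^sub>v (\<Phi> *\<^sub>v unit_vec N j)) = \<zero>\<^bsub>B.M\<^esub>"
      using hP[OF A.\<Phi>_vec[OF u]] h0 by (simp add: B.zero_M)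
    thus ?thesis using B.cok_zero_iff[OF mat_over_mult_vec[OF P A.\<Phi>_vec[OF u]]] by blast
  qed
  then obtain q where q: "\<And>j. q j \<in> B.V" "\<And>j. P *\<^sub>v (\<Phi> *\<^sub>v unit_vec N j) = \<Phi>' *\<^sub>v q j" by metis
  define Q where "Q = mat N' N (\<lambda>(i, j). q j $ i)"
  have Q: "Q \<in> mat_over n N' N"
    using q(1) by (auto simp: Q_def mat_over_def free_vecs_iff)
  note Qc = mat_over_carrier[OF Q]
  have Q_unit: "Q *\<^sub>v unit_vec N j = q j" if "j < N" for j
    using that q(1)[of j] by (auto simp: mat_unit_vec_col[OF Qc] Q_def free_vecs_iff intro!: eq_vecI)
  have "P * \<Phi> = \<Phi>' * Q"
  proof (rule mat_col_eqI)
    fix j assume "j < dim_col (\<Phi>' * Q)"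
    hence j: "j < N" using Qc by simp
    have "col (P * \<Phi>) j = P *\<^sub>v (\<Phi> *\<^sub>v unit_vec N j)"
      by (subst mat_unit_vec_col[OF A.\<Phi>_carrier j]) (rule col_mult2[OF Pc A.\<Phi>_carrier j])
    also have "\<dots> = \<Phi>' *\<^sub>v (Q *\<^sub>v unit_vec N j)" using q(2) Q_unit[OF j] by simp
    also have "\<dots> = col (\<Phi>' * Q) j"
      by (subst mat_unit_vec_col[OF Qc j]) (rule col_mult2[OF B.\<Phi>_carrier Qc j, symmetric])
    finally show "col (P * \<Phi>) j = col (\<Phi>' * Q) j" .
  qed (use Pc Qc in auto)
  thus ?thesis using that P Q hP by blast
qed

end

section \<open>Cokernels of reduced matrix factorizations are maximal Cohen--Macaulay\<close>

lemma res_vars_mono: "V \<subseteq> W \<Longrightarrow> res_vars V p = res_vars V (res_vars W p)"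
  by (rule mps_eqI) (auto simp: mcoeff_res_vars)

text \<open>\<open>Z i\<close> is the ideal generated by the first \<open>i\<close> elements of the
  sequence \<open>l\<close>. It is realized as the kernel of a homomorphism into a domain: change
  coordinates so that \<open>f\<close> contains a pure power of \<open>z\<close>, then put
  \<open>x_1, ..., x_i\<close> to 0. Elements with non-zero image, such as \<open>l i\<close> and
  \<open>f\<close>, can therefore be cancelled modulo \<open>Z i\<close>. The listed properties are
  what regularity on a cokernel will be deduced from.\<close>

lemma (in hypersurface) linear_system:
  assumes inf: "infinite (UNIV :: 'k set)"
  obtains l :: "nat \<Rightarrow> 'k mps" and Z :: "nat \<Rightarrow> 'k mps set" where
    "\<And>i. i < n \<Longrightarrow> l i \<in> S \<and> mcoeff (l i) 0 = 0"
    "\<And>i. Z i \<subseteq> S" "\<And>i p. p \<in> Z i \<Longrightarrow> mcoeff p 0 = 0"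
    "\<And>i p q. p \<in> Z i \<Longrightarrow> q \<in> Z i \<Longrightarrow> p + q \<in> Z i"
    "\<And>i p q. p \<in> Z i \<Longrightarrow> q \<in> S \<Longrightarrow> q * p \<in> Z i"
    "Z 0 = {0}" "\<And>i. i < n \<Longrightarrow> Z (Suc i) = {a + l i * r | a r. a \<in> Z i \<and> r \<in> S}"
    "\<And>i p. i < n \<Longrightarrow> p \<in> S \<Longrightarrow> l i * p \<in> Z i \<Longrightarrow> p \<in> Z i"
    "\<And>i p. p \<in> S \<Longrightarrow> f * p \<in> Z i \<Longrightarrow> p \<in> Z i"
proof -
  have 0: "0 \<in> {0..n}" by simp
  obtain \<theta> d where reg: "mcoeff (subst_mps {0..n} (shear {0..n} 0 \<theta>) f) (single 0 d) \<noteq> 0"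
    by (rule regular_shear[OF inf finite_atLeastAtMost 0 f_over f_nz])
  define G where "G = subst_mps {0..n} (shear {0..n} 0 \<theta>)"
  define H where "H = subst_mps {0..n} (shear {0..n} 0 (\<lambda>i. - \<theta> i))"
  interpret G: substitution "{0..n}" "shear {0..n} 0 \<theta>" by (rule substitution_shear) simp
  interpret H: substitution "{0..n}" "shear {0..n} 0 (\<lambda>i. - \<theta> i)" by (rule substitution_shear) simp
  have GS: "G p \<in> S" and HS: "H p \<in> S" for p
    unfolding G_def H_def by (rule G.subst_over H.subst_over; simp add: shear_over)+
  have HG: "H (G p) = p" if "p \<in> S" for p
    unfolding G_def H_def by (rule shear_inverse) (use that in auto)
  have GH: "G (H p) = p" if "p \<in> S" for p
    using shear_inverse[of "{0..n}" 0 p "\<lambda>i. - \<theta> i"] that unfolding G_def H_def by simp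
  have Gadd: "G (p + q) = G p + G q" and Gmult: "G (p * q) = G p * G q"
    and Hadd: "H (p + q) = H p + H q" and Hmult: "H (p * q) = H p * H q" for p q
    unfolding G_def H_def by (simp_all add: G.subst_add G.subst_mult H.subst_add H.subst_mult)
  have H0: "H 0 = 0" using Hadd[of 0 0] by (metis add_0 add_cancel_right_left)
  have Gord: "order_ge d (G p)" and Hord: "order_ge d (H p)" if "order_ge d p" for d p
    unfolding G_def H_def using that by (auto intro: G.subst_order H.subst_order)
  \<comment> \<open>The variable 0, which is \<open>z\<close>, is always kept, so the pure power of
    \<open>z\<close> in \<open>G f\<close> survives for every \<open>i\<close>.\<close>
  define W where "W i = {0..n} - {1..i}" for i
  define l where "l i = H (mps_var (Suc i))" for i
  define Z where "Z i = {p \<in> S. res_vars (W i) (G p) = 0}" for i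
  have Gl: "G (l i) = mps_var (Suc i)" if "i < n" for i
    unfolding l_def by (rule GH) (use that in \<open>auto intro: mps_over_var\<close>)
  show ?thesis
  proof (rule that[of l Z])
    fix i assume i: "i < n"
    have "order_ge (Suc 0) (l i)" unfolding l_def by (rule Hord) (simp add: order_ge_Suc_0 mcoeff_var single_zero poly_mapping_eq_iff fun_eq_iff lookup_single when_def)
    thus "l i \<in> S \<and> mcoeff (l i) 0 = 0" using HS by (simp add: l_def order_ge_Suc_0)
    have li: "l i \<in> S" by (simp add: l_def HS)
    show "Z (Suc i) = {a + l i * r | a r. a \<in> Z i \<and> r \<in> S}"
    proof (intro equalityI subsetI)
      fix p assume "p \<in> Z (Suc i)"
      hence p: "p \<in> S" "res_vars (W (Suc i)) (G p) = 0" by (auto simp: Z_def)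
      define q where "q = res_vars (W i) (G p)"
      \<comment> \<open>Every monomial of \<open>q\<close> involves the variable
        \<open>Suc i\<close>, because \<open>G p\<close> vanishes once this variable is put to 0 as
        well; \<open>s\<close> is the quotient.\<close>
      define s where "s = Mps (\<lambda>\<mu>. mcoeff q (single (Suc i) 1 + \<mu>))"
      have Wi: "W i \<subseteq> {0..n}" by (auto simp: W_def)
      have qS: "q \<in> S" unfolding q_def using res_vars_over mps_over_mono[OF Wi] by blast
      have s: "s \<in> S"
      proof (rule mps_overI)
        fix \<mu> assume "mcoeff s \<mu> \<noteq> 0"
        hence "keys (single (Suc i) 1 + \<mu>) \<subseteq> {0..n}"
          by (intro mps_overD[OF qS]) (simp add: s_def)
        thus "keys \<mu> \<subseteq> {0..n}" by (simp add: keys_add_nat)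
      qed
      have q: "q = mps_var (Suc i) * s"
      proof (rule mps_eqI)
        fix \<mu>
        show "mcoeff q \<mu> = mcoeff (mps_var (Suc i) * s) \<mu>"
        proof (cases "lookup \<mu> (Suc i) = 0")
          case True
          have "mcoeff (res_vars (W (Suc i)) (G p)) \<mu> = 0" using p by simp
          moreover have "keys \<mu> \<subseteq> W i \<Longrightarrow> keys \<mu> \<subseteq> W (Suc i)"
            using True by (auto simp: W_def subset_iff in_keys_iff) (metis le_Suc_eq not_gr_zero)
          ultimately show ?thesis using True by (auto simp: q_def mcoeff_res_vars mcoeff_var_times split: if_splits)
        next
          case False
          thus ?thesis using lookup_ge_1D[OF False] by (simp add: mcoeff_var_times s_def)
        qed
      qed
      define a where "a = H (G p - q)"
      have "G p - q \<in> S" by (intro mps_over_diff GS qS)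
      hence "G a = G p - q" unfolding a_def by (rule GH)
      hence "res_vars (W i) (G a) = 0" by (simp add: res_vars_diff q_def res_vars_id res_vars_over)
      moreover have "a \<in> S" by (simp add: a_def HS)
      moreover have "p = a + l i * H s"
        using HG[OF p(1)] Hadd[of "G p - q" q] by (simp add: a_def q Hmult l_def)
      ultimately show "p \<in> {a + l i * r | a r. a \<in> Z i \<and> r \<in> S}" using HS by (auto simp: Z_def)
    next
      fix p assume "p \<in> {a + l i * r | a r. a \<in> Z i \<and> r \<in> S}"
      then obtain a r where ar: "p = a + l i * r" "a \<in> Z i" "r \<in> S" by blast
      have sub: "W (Suc i) \<subseteq> W i" by (auto simp: W_def)
      have "res_vars (W (Suc i)) (G a) = 0"
        using ar(2) res_vars_mono[OF sub, of "G a"] by (simp add: Z_def)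
      moreover have "res_vars (W (Suc i)) (mps_var (Suc i)) = (0 :: 'k mps)"
        by (rule mps_eqI) (auto simp: mcoeff_res_vars mcoeff_var W_def)
      ultimately have "res_vars (W (Suc i)) (G p) = 0"
        by (simp add: ar(1) Gadd Gmult Gl[OF i] res_vars_add res_vars_mult)
      thus "p \<in> Z (Suc i)" using ar li by (auto simp: Z_def intro: mps_over_closed)
    qed
    fix p assume p: "p \<in> S" "l i * p \<in> Z i"
    have "mcoeff (res_vars (W i) (mps_var (Suc i) :: 'k mps)) (single (Suc i) 1) \<noteq> 0"
      using i by (simp add: mcoeff_res_vars mcoeff_var W_def)
    hence "res_vars (W i) (mps_var (Suc i) :: 'k mps) \<noteq> 0" by auto
    thus "p \<in> Z i" using p by (simp add: Z_def Gmult Gl[OF i] res_vars_mult)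
  next
    fix i p assume p: "p \<in> S" "f * p \<in> Z i"
    have "mcoeff (res_vars (W i) (G f)) (single 0 d) \<noteq> 0"
      using reg by (auto simp: mcoeff_res_vars W_def G_def)
    hence "res_vars (W i) (G f) \<noteq> 0" by auto
    thus "p \<in> Z i" using p by (simp add: Z_def Gmult res_vars_mult)
  next
    fix i p assume "p \<in> Z i"
    hence p: "p \<in> S" "mcoeff (res_vars (W i) (G p)) 0 = 0" by (auto simp: Z_def)
    hence "order_ge (Suc 0) (H (G p))" by (intro Hord) (simp add: order_ge_Suc_0 mcoeff_res_vars)
    thus "mcoeff p 0 = 0" using HG[OF p(1)] by (simp add: order_ge_Suc_0)
  next
    have "G 0 = 0" using Gadd[of 0 0] by (metis add_0 add_cancel_right_left)
    thus "Z 0 = {0}" using HG GS H0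
      by (auto simp: Z_def W_def res_vars_id) metis
  qed (auto simp: Z_def Gadd Gmult res_vars_add res_vars_mult intro: mps_over_closed)
qed

text \<open>The elements \<open>l i\<close> form a regular sequence on the cokernel. From
  \<open>l v = u + \<Phi> w\<close> with the entries of \<open>u\<close> in \<open>Z i\<close>,
  applying \<open>\<Psi>\<close> gives \<open>f w = l \<Psi> v - \<Psi> u\<close>. Cancelling
  \<open>f\<close> modulo \<open>Z (Suc i)\<close> yields \<open>w = a + l r\<close>, and then
  \<open>l (v - \<Phi> r) = u + \<Phi> a\<close>, where \<open>l\<close> cancels modulo
  \<open>Z i\<close>. So \<open>v\<close> has the class of a vector with entries in
  \<open>Z i\<close>. As neither \<open>\<Phi>\<close> nor \<open>Z n\<close> has constant terms, a
  unit vector shows that the whole sequence does not generate the module.\<close>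

lemma (in matrix_factorization) M_MCM:
  assumes inf: "infinite (UNIV :: 'k set)"
    and const_0: "\<And>i j. i < N \<Longrightarrow> j < N \<Longrightarrow> mcoeff (\<Phi> $$ (i, j)) 0 = 0"
  shows "MCM R M"
proof (cases "N = 0")
  \<comment> \<open>In size 0 there is no unit vector to work with; the zero module is maximal
    Cohen--Macaulay by definition.\<close>
  case True
  have "v = 0\<^sub>v N" if "v \<in> V" for v using V_carrier[OF that] True by auto
  hence "carrier M = {\<zero>\<^bsub>M\<^esub>}" using free_vecs_zero[of N n] by (auto simp: carrier_M zero_M)
  thus ?thesis using M_module M_fin_gen by (simp add: MCM_def)
next
  case False
  interpret M: module R M by (rule M_module)
  obtain l Z where
    l: "\<And>i. i < n \<Longrightarrow> l i \<in> S \<and> mcoeff (l i) 0 = 0" and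
    ZS: "\<And>i. Z i \<subseteq> S" and Z0: "\<And>i p. p \<in> Z i \<Longrightarrow> mcoeff p 0 = 0" and
    Z_add: "\<And>i p q. p \<in> Z i \<Longrightarrow> q \<in> Z i \<Longrightarrow> p + q \<in> Z i" and
    Z_mult: "\<And>i p q. p \<in> Z i \<Longrightarrow> q \<in> S \<Longrightarrow> q * p \<in> Z i" and
    Zzero: "Z 0 = {0}" and ZSuc: "\<And>i. i < n \<Longrightarrow> Z (Suc i) = {a + l i * r | a r. a \<in> Z i \<and> r \<in> S}" and
    Zl: "\<And>i p. i < n \<Longrightarrow> p \<in> S \<Longrightarrow> l i * p \<in> Z i \<Longrightarrow> p \<in> Z i" and
    Zf: "\<And>i p. p \<in> S \<Longrightarrow> f * p \<in> Z i \<Longrightarrow> p \<in> Z i"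
    by (rule linear_system[OF inf]) blast
  \<comment> \<open>\<open>Z i\<close> times the free module; its image in the cokernel will be the
    submodule generated by the first \<open>i\<close> elements of the sequence.\<close>
  define VZ where "VZ i = {v \<in> V. \<forall>j<N. v $ j \<in> Z i}" for i
  have Z_0: "0 \<in> Z i" if "p \<in> Z i" for i p using Z_mult[OF that, of 0] by simp
  have Z_sum: "sum g A \<in> Z i" if "\<And>j. j \<in> A \<Longrightarrow> g j \<in> Z i" "0 \<in> Z i" for g and A :: "nat set" and i
    using that by (induction A rule: infinite_finite_induct) (auto intro: Z_add)
  have Z0mem: "0 \<in> Z i" if "i \<le> n" for i
    using that
  proof (induction i)
    case (Suc i)
    have "0 = 0 + l i * 0" by simp
    thus ?case using Suc ZSuc[of i] mps_over_0[of "{0..n}"] by (metis (mono_tags, lifting) CollectI Suc_leD Suc_le_lessD)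
  qed (simp add: Zzero)
  have VZ_add: "v + w \<in> VZ i" if "v \<in> VZ i" "w \<in> VZ i" for v w i
    using that V_carrier[of v] V_carrier[of w] by (auto simp: VZ_def free_vecs_add Z_add)
  have VZ_smult: "s \<cdot>\<^sub>v v \<in> VZ i" if "v \<in> VZ i" "s \<in> S" for v s i
    using that V_carrier[of v] by (auto simp: VZ_def free_vecs_smult Z_mult)
  have VZ_mat: "B *\<^sub>v v \<in> VZ i" if "v \<in> VZ i" "B \<in> mat_over n N N" "i \<le> n" for v B i
  proof -
    have "(B *\<^sub>v v) $ j \<in> Z i" if j: "j < N" for j
      using \<open>v \<in> VZ i\<close> V_carrier[of v] mat_over_carrier[OF \<open>B \<in> mat_over n N N\<close>]
        mat_over_entry[OF \<open>B \<in> mat_over n N N\<close> j] j Z0mem[OF \<open>i \<le> n\<close>]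
      by (auto simp: VZ_def scalar_prod_def intro!: Z_sum Z_mult)
    thus ?thesis using that mat_over_mult_vec by (auto simp: VZ_def)
  qed
  have split: "\<exists>a r. a \<in> VZ i \<and> r \<in> V \<and> u = a + l i \<cdot>\<^sub>v r" if u: "u \<in> VZ (Suc i)" and i: "i < n" for u i
  proof -
    have "\<forall>j<N. \<exists>a r. a \<in> Z i \<and> r \<in> S \<and> u $ j = a + l i * r" using u ZSuc[OF i] by (auto simp: VZ_def; blast)
    then obtain a r where ar: "\<And>j. j < N \<Longrightarrow> a j \<in> Z i \<and> r j \<in> S \<and> u $ j = a j + l i * r j" by metis
    have "vec N a \<in> VZ i" using ar ZS by (auto simp: VZ_def free_vecs_iff)
    moreover have "vec N r \<in> V" using ar by (auto simp: free_vecs_iff)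
    moreover have "u = vec N a + l i \<cdot>\<^sub>v vec N r"
      using u ar V_carrier by (intro eq_vecI) (auto simp: VZ_def)
    ultimately show ?thesis by blast
  qed
  have unsplit: "a + l i \<cdot>\<^sub>v r \<in> VZ (Suc i)" if "a \<in> VZ i" "r \<in> V" "i < n" for a r i
    using that V_carrier[of a] V_carrier[of r] l[OF that(3)]
    by (auto simp: VZ_def ZSuc free_vecs_add free_vecs_smult) (metis free_vecs_entry)
  have VZ_l: "x \<in> VZ i" if x: "x \<in> V" "l i \<cdot>\<^sub>v x \<in> VZ i" and i: "i < n" for x i
  proof -
    have "l i * x $ j \<in> Z i" if "j < N" for j
      using x V_carrier[OF x(1)] that by (auto simp: VZ_def)
    thus ?thesis using x(1) Zl[OF i] by (auto simp: VZ_def free_vecs_entry)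
  qed
  define xs where "xs = map (\<lambda>i. cls (l i)) [0..<n]"
  have len: "length xs = n" by (simp add: xs_def)
  have take_xs: "take i xs = map (\<lambda>i. cls (l i)) [0..<i]" if "i \<le> n" for i
    using that by (simp add: xs_def take_map)
  have ls: "list_smult (take i xs) M = cok ` VZ i" if "i \<le> n" for i
    using that
  proof (induction i)
    case 0
    have "VZ 0 = {0\<^sub>v N}" using free_vecs_zero V_carrier by (auto simp: VZ_def Zzero)
    thus ?case by (simp add: M.list_smult_Nil zero_M)
  next
    case (Suc i)
    have i: "i < n" using Suc.prems by simp
    have eq: "take (Suc i) xs = take i xs @ [cls (l i)]" using i by (simp add: take_xs)
    have "set (take i xs) \<subseteq> carrier R" using l i by (auto simp: take_xs cls_closed)
    hence "list_smult (take (Suc i) xs) M =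
        {a \<oplus>\<^bsub>M\<^esub> cls (l i) \<odot>\<^bsub>M\<^esub> w | a w. a \<in> cok ` VZ i \<and> w \<in> carrier M}"
      unfolding eq using l[OF i] Suc by (subst M.list_smult_snoc) (auto simp: cls_closed)
    also have "\<dots> = {cok (a + l i \<cdot>\<^sub>v r) | a r. a \<in> VZ i \<and> r \<in> V}"
    proof -
      have "cok a \<oplus>\<^bsub>M\<^esub> cls (l i) \<odot>\<^bsub>M\<^esub> cok r = cok (a + l i \<cdot>\<^sub>v r)" if "a \<in> VZ i" "r \<in> V" for a r
        using that l[OF i] by (simp add: smult_cok cok_add VZ_def free_vecs_smult)
      thus ?thesis unfolding carrier_M by (auto; metis imageI)
    qed
    also have "\<dots> = cok ` VZ (Suc i)" using split[OF _ i] unsplit[OF _ _ i] by (auto; metis imageI)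
    finally show ?case .
  qed
  have VZV: "VZ i \<subseteq> V" for i by (auto simp: VZ_def)
  have "regular_seq M xs" unfolding regular_seq_def len
  proof (intro conjI allI impI ballI)
    fix i x assume i: "i < n" and x: "x \<in> carrier M" and mem: "xs ! i \<odot>\<^bsub>M\<^esub> x \<in> list_smult (take i xs) M"
    obtain v where v: "v \<in> V" "x = cok v" using x by (rule cok_cases)
    have li: "l i \<in> S" using l[OF i] by simp
    have lv: "l i \<cdot>\<^sub>v v \<in> V" by (intro free_vecs_smult li v)
    have "xs ! i = cls (l i)" using i by (simp add: xs_def)
    hence "cok (l i \<cdot>\<^sub>v v) \<in> cok ` VZ i"
      using mem ls[of i] i v li by (simp only: smult_cok less_imp_le)
    then obtain u where u: "u \<in> VZ i" "cok (l i \<cdot>\<^sub>v v) = cok u" by blast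
    have uV: "u \<in> V" using u VZV by blast
    obtain w where w: "w \<in> V" "l i \<cdot>\<^sub>v v = u + \<Phi> *\<^sub>v w" using u(2) cok_eq_iff[OF lv uV] by blast
    note c = V_carrier[OF v(1)] V_carrier[OF uV] V_carrier[OF w(1)]
    have "\<Psi> *\<^sub>v (l i \<cdot>\<^sub>v v) = \<Psi> *\<^sub>v u + f \<cdot>\<^sub>v w"
      unfolding w(2) using c V_carrier[OF \<Phi>_vec[OF w(1)]]
      by (simp add: mult_add_distrib_mat_vec[OF \<Psi>_carrier] \<Psi>\<Phi>_vec w(1))
    hence "l i \<cdot>\<^sub>v (\<Psi> *\<^sub>v v) = \<Psi> *\<^sub>v u + f \<cdot>\<^sub>v w"
      using mult_mat_smult_vec[OF \<Psi>_carrier c(1)] by simp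
    moreover have "\<Psi> *\<^sub>v u \<in> carrier_vec N" using \<Psi>_carrier c by simp
    ultimately have fw: "f \<cdot>\<^sub>v w = (- 1) \<cdot>\<^sub>v (\<Psi> *\<^sub>v u) + l i \<cdot>\<^sub>v (\<Psi> *\<^sub>v v)"
      using c \<Psi>_carrier by (intro eq_vecI) (auto simp del: index_mult_mat_vec)
    have "(- 1) \<cdot>\<^sub>v (\<Psi> *\<^sub>v u) \<in> VZ i"
      by (intro VZ_smult VZ_mat u \<Psi> mps_over_uminus mps_over_1) (use i in simp)
    hence "f \<cdot>\<^sub>v w \<in> VZ (Suc i)" unfolding fw
      by (intro unsplit mat_over_mult_vec[OF \<Psi> v(1)] i)
    hence "w \<in> VZ (Suc i)" using w(1) c Zf by (auto simp: VZ_def free_vecs_entry)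
    then obtain a r where ar: "a \<in> VZ i" "r \<in> V" "w = a + l i \<cdot>\<^sub>v r" using split[OF _ i] by blast
    have aV: "a \<in> V" using ar VZV by blast
    have v': "v - \<Phi> *\<^sub>v r \<in> V" by (intro free_vecs_diff v \<Phi>_vec ar)
    note c' = V_carrier[OF \<Phi>_vec[OF aV]] V_carrier[OF \<Phi>_vec[OF ar(2)]]
    have "\<Phi> *\<^sub>v w = \<Phi> *\<^sub>v a + l i \<cdot>\<^sub>v (\<Phi> *\<^sub>v r)"
      using ar aV li by (simp add: \<Phi>_add \<Phi>_smult free_vecs_smult)
    hence "l i \<cdot>\<^sub>v (v - \<Phi> *\<^sub>v r) = u + \<Phi> *\<^sub>v a"
      using w(2) c c' by (intro eq_vecI) (auto dest!: arg_cong[of "l i \<cdot>\<^sub>v v"] simp: algebra_simps vec_eq_iff)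
    moreover have "u + \<Phi> *\<^sub>v a \<in> VZ i" by (intro VZ_add VZ_mat u ar \<Phi>) (use i in simp)
    ultimately have "v - \<Phi> *\<^sub>v r \<in> VZ i" using VZ_l[OF v' _ i] by simp
    moreover have "cok v = cok (v - \<Phi> *\<^sub>v r)"
      unfolding cok_eq_iff[OF v(1) v'] using ar c c' by (intro bexI[of _ r] eq_vecI) auto
    ultimately show "x \<in> list_smult (take i xs) M" using i v by (simp add: ls)
  next
    show "list_smult xs M \<noteq> carrier M"
    proof
      assume "list_smult xs M = carrier M"
      hence "cok (unit_vec N 0) \<in> cok ` VZ n"
        using ls[of n] cok_closed[OF free_vecs_unit[of N 0 n]] len by simp
      then obtain u where u: "u \<in> VZ n" "cok (unit_vec N 0) = cok u" by blast
      have uV: "u \<in> V" using u VZV by blast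
      obtain w where w: "w \<in> V" "unit_vec N 0 = u + \<Phi> *\<^sub>v w"
        using u(2) cok_eq_iff[OF free_vecs_unit uV] by blast
      have "(unit_vec N 0 :: 'k mps vec) $ 0 = u $ 0 + (\<Sum>j<N. \<Phi> $$ (0, j) * w $ j)"
        unfolding w(2) using V_carrier[OF uV] V_carrier[OF w(1)] False \<Phi>_carrier
        by (simp add: scalar_prod_def atLeast0LessThan)
      hence "mcoeff (1 :: 'k mps) 0 = mcoeff (u $ 0 + (\<Sum>j<N. \<Phi> $$ (0, j) * w $ j)) 0"
        using False by simp
      also have "\<dots> = 0" using u(1) False const_0 Z0[of "u $ 0" n] by (simp add: VZ_def)
      finally show False by (simp add: mcoeff_one)
    qed
  qed
  moreover have "set xs \<subseteq> max_ideal" using l by (auto simp: xs_def cls_max_ideal)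
  ultimately have "depth R M = krull_dim R" by (intro depth_eq_krull_dimI[OF inf M_module _ len])
  thus ?thesis using M_module M_fin_gen by (simp add: MCM_def)
qed

section \<open>Functoriality and exactness of the cokernel\<close>

lemma (in matrix_factorization) induced_map_one:
  "mf_map n (\<Phi>, \<Psi>) (\<Phi>, \<Psi>) (1\<^sub>m N, Q) = (\<lambda>x\<in>carrier M. x)"
proof -
  interpret P: matrix_factorization_pair n N N f \<Phi> \<Psi> \<Phi> \<Psi> ..
  show ?thesis
  proof (rule ext)
    fix x show "mf_map n (\<Phi>, \<Psi>) (\<Phi>, \<Psi>) (1\<^sub>m N, Q) x = (\<lambda>x\<in>carrier M. x) x"
    proof (cases "x \<in> carrier M")
      case True
      then obtain v where v: "v \<in> V" "x = cok v" by (rule cok_cases)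
      show ?thesis using P.induced_map[OF mat_over_one mat_over_one _ v(1)] v \<Phi>_carrier V_carrier[OF v(1)]
        by (simp add: cok_closed)
    next
      case False thus ?thesis by (simp add: mf_map_def)
    qed
  qed
qed

locale matrix_factorization_triple =
  AB: matrix_factorization_pair n N N' f \<Phi> \<Psi> \<Phi>' \<Psi>' + BC: matrix_factorization_pair n N' N'' f \<Phi>' \<Psi>' \<Phi>'' \<Psi>''
  for n N N' N'' :: nat and f :: "'k :: field mps" and \<Phi> \<Psi> \<Phi>' \<Psi>' \<Phi>'' \<Psi>'' :: "'k mps mat" +
  fixes P P' :: "'k mps mat"
  assumes P: "P \<in> mat_over n N' N" and P\<Phi>: "P * \<Phi> = \<Phi>' * P"
    and P': "P' \<in> mat_over n N'' N'" and P'\<Phi>: "P' * \<Phi>' = \<Phi>'' * P'"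
begin

lemma P\<Phi>_vec: "v \<in> AB.A.V \<Longrightarrow> P *\<^sub>v (\<Phi> *\<^sub>v v) = \<Phi>' *\<^sub>v (P *\<^sub>v v)"
  using assoc_mult_mat_vec[OF mat_over_carrier[OF P] AB.A.\<Phi>_carrier, of v]
    assoc_mult_mat_vec[OF AB.B.\<Phi>_carrier mat_over_carrier[OF P], of v] AB.A.V_carrier[of v] by (simp add: P\<Phi>)

lemma P'\<Phi>_vec: "v \<in> AB.B.V \<Longrightarrow> P' *\<^sub>v (\<Phi>' *\<^sub>v v) = \<Phi>'' *\<^sub>v (P' *\<^sub>v v)"
  using assoc_mult_mat_vec[OF mat_over_carrier[OF P'] AB.B.\<Phi>_carrier, of v]
    assoc_mult_mat_vec[OF BC.B.\<Phi>_carrier mat_over_carrier[OF P'], of v] AB.B.V_carrier[of v] by (simp add: P'\<Phi>)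

lemma induced_map_comp:
  "mf_map n (\<Phi>, \<Psi>) (\<Phi>'', \<Psi>'') (P' * P, P' * P) =
    compose (carrier AB.A.M) (mf_map n (\<Phi>', \<Psi>') (\<Phi>'', \<Psi>'') (P', P')) (mf_map n (\<Phi>, \<Psi>) (\<Phi>', \<Psi>') (P, P))"
proof (rule ext)
  fix x
  interpret AC: matrix_factorization_pair n N N'' f \<Phi> \<Psi> \<Phi>'' \<Psi>'' ..
  note c = mat_over_carrier[OF P] mat_over_carrier[OF P'] AB.A.\<Phi>_carrier AB.B.\<Phi>_carrier BC.B.\<Phi>_carrier
  have eq: "P' * P * \<Phi> = \<Phi>'' * (P' * P)"
  proof -
    have "P' * P * \<Phi> = P' * (P * \<Phi>)" by (rule assoc_mult_mat[OF c(2,1,3)])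
    also have "\<dots> = P' * \<Phi>' * P" unfolding P\<Phi> by (rule assoc_mult_mat[OF c(2,4,1), symmetric])
    also have "\<dots> = \<Phi>'' * (P' * P)" unfolding P'\<Phi> by (rule assoc_mult_mat[OF c(5,2,1)])
    finally show ?thesis .
  qed
  show "mf_map n (\<Phi>, \<Psi>) (\<Phi>'', \<Psi>'') (P' * P, P' * P) x =
    compose (carrier AB.A.M) (mf_map n (\<Phi>', \<Psi>') (\<Phi>'', \<Psi>'') (P', P')) (mf_map n (\<Phi>, \<Psi>) (\<Phi>', \<Psi>') (P, P)) x"
  proof (cases "x \<in> carrier AB.A.M")
    case True
    then obtain v where v: "v \<in> AB.A.V" "x = AB.A.cok v" by (rule AB.A.cok_cases)
    have "mf_map n (\<Phi>, \<Psi>) (\<Phi>'', \<Psi>'') (P' * P, P' * P) x = BC.B.cok (P' * P *\<^sub>v v)"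
      unfolding v(2) by (rule AC.induced_map[OF mat_over_mult[OF P' P] mat_over_mult[OF P' P] eq v(1)])
    also have "P' * P *\<^sub>v v = P' *\<^sub>v (P *\<^sub>v v)"
      by (rule assoc_mult_mat_vec[OF c(2,1) AB.A.V_carrier[OF v(1)]])
    finally show ?thesis
      using True v AB.induced_map[OF P P P\<Phi> v(1)] BC.induced_map[OF P' P' P'\<Phi> mat_over_mult_vec[OF P v(1)]]
      by (simp add: compose_def)
  qed (simp add: mf_map_def compose_def)
qed

text \<open>An instance of the snake lemma. Exactness on the left rests on the injectivity of
  \<open>\<Phi>''\<close>: if \<open>P a = P b + \<Phi>' w\<close>, then
  \<open>\<Phi>'' (P' w) = 0\<close>, so \<open>P' w = 0\<close>, \<open>w\<close> comes from the
  left, and \<open>a\<close> and \<open>b\<close> differ by an element of the image of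
  \<open>\<Phi>\<close>.\<close>

lemma induced_map_exact:
  assumes inj: "\<And>v. v \<in> AB.A.V \<Longrightarrow> P *\<^sub>v v = 0\<^sub>v N' \<Longrightarrow> v = 0\<^sub>v N"
    and zero: "\<And>v. v \<in> AB.A.V \<Longrightarrow> P' *\<^sub>v (P *\<^sub>v v) = 0\<^sub>v N''"
    and exact: "\<And>v. v \<in> AB.B.V \<Longrightarrow> P' *\<^sub>v v = 0\<^sub>v N'' \<Longrightarrow> \<exists>u\<in>AB.A.V. v = P *\<^sub>v u"
    and surj: "\<And>w. w \<in> BC.B.V \<Longrightarrow> \<exists>v\<in>AB.B.V. w = P' *\<^sub>v v"
  shows "short_exact AB.A.M AB.B.M BC.B.M
    (mf_map n (\<Phi>, \<Psi>) (\<Phi>', \<Psi>') (P, P)) (mf_map n (\<Phi>', \<Psi>') (\<Phi>'', \<Psi>'') (P', P'))"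
proof -
  let ?u = "mf_map n (\<Phi>, \<Psi>) (\<Phi>', \<Psi>') (P, P)" and ?v = "mf_map n (\<Phi>', \<Psi>') (\<Phi>'', \<Psi>'') (P', P')"
  note u = AB.induced_map[OF P P P\<Phi>] and v = BC.induced_map[OF P' P' P'\<Phi>]
  note Pc = mat_over_carrier[OF P] and P'c = mat_over_carrier[OF P']
  note PV = mat_over_mult_vec[OF P] and P'V = mat_over_mult_vec[OF P']
  have P_inj: "x = y" if "x \<in> AB.A.V" "y \<in> AB.A.V" "P *\<^sub>v x = P *\<^sub>v y" for x y
  proof -
    have "P *\<^sub>v (x - y) = P *\<^sub>v x - P *\<^sub>v y"
      by (rule mult_minus_distrib_mat_vec[OF Pc]) (use that AB.A.V_carrier in auto)
    also have "\<dots> = 0\<^sub>v N'" using that(3) AB.B.V_carrier[OF PV[OF that(2)]] by simp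
    finally have "x - y = 0\<^sub>v N" using inj free_vecs_diff[OF that(1,2)] by blast
    hence "(x - y) $ i = 0" if "i < N" for i using that by simp
    thus ?thesis using AB.A.V_carrier[OF that(1)] AB.A.V_carrier[OF that(2)] by (intro eq_vecI) auto
  qed
  have A: "inj_on ?u (carrier AB.A.M)"
  proof (rule inj_onI)
    fix x y assume "x \<in> carrier AB.A.M" "y \<in> carrier AB.A.M" and eq: "?u x = ?u y"
    then obtain a b where a: "a \<in> AB.A.V" "x = AB.A.cok a" and b: "b \<in> AB.A.V" "y = AB.A.cok b"
      by (metis AB.A.cok_cases)
    note ac = AB.A.V_carrier[OF a(1)] and bc = AB.A.V_carrier[OF b(1)]
    have "AB.B.cok (P *\<^sub>v a) = AB.B.cok (P *\<^sub>v b)" using eq a b by (simp add: u)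
    then obtain w where w: "w \<in> AB.B.V" "P *\<^sub>v a = P *\<^sub>v b + \<Phi>' *\<^sub>v w"
      using AB.B.cok_eq_iff[OF PV[OF a(1)] PV[OF b(1)]] by blast
    have "P' *\<^sub>v (P *\<^sub>v a) = P' *\<^sub>v (P *\<^sub>v b) + P' *\<^sub>v (\<Phi>' *\<^sub>v w)"
      unfolding w(2) by (rule mult_add_distrib_mat_vec[OF P'c])
        (use AB.B.V_carrier PV[OF b(1)] AB.B.\<Phi>_vec[OF w(1)] in auto)
    hence "\<Phi>'' *\<^sub>v (P' *\<^sub>v w) = \<Phi>'' *\<^sub>v 0\<^sub>v N''"
      unfolding zero[OF a(1)] zero[OF b(1)] P'\<Phi>_vec[OF w(1)] BC.B.\<Phi>_zero
      using BC.B.V_carrier[OF BC.B.\<Phi>_vec[OF P'V[OF w(1)]]] by simp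
    hence "P' *\<^sub>v w = 0\<^sub>v N''" by (rule BC.B.\<Phi>_inj[OF P'V[OF w(1)] free_vecs_zero])
    then obtain w' where w': "w' \<in> AB.A.V" "w = P *\<^sub>v w'" using exact w(1) by blast
    have "P *\<^sub>v a = P *\<^sub>v (b + \<Phi> *\<^sub>v w')"
      unfolding w(2) w'(2) P\<Phi>_vec[OF w'(1), symmetric]
      by (rule mult_add_distrib_mat_vec[OF Pc, symmetric])
        (use bc AB.A.V_carrier[OF AB.A.\<Phi>_vec[OF w'(1)]] in auto)
    hence "a = b + \<Phi> *\<^sub>v w'" using P_inj a b w' free_vecs_add AB.A.\<Phi>_vec by blast
    thus "x = y" using a b w' AB.A.cok_cong by simp
  qed
  have B: "?u ` carrier AB.A.M = {y \<in> carrier AB.B.M. ?v y = \<zero>\<^bsub>BC.B.M\<^esub>}"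
  proof (intro equalityI subsetI)
    fix y assume "y \<in> ?u ` carrier AB.A.M"
    then obtain a where a: "a \<in> AB.A.V" "y = AB.B.cok (P *\<^sub>v a)" by (auto simp: AB.A.carrier_M u)
    thus "y \<in> {y \<in> carrier AB.B.M. ?v y = \<zero>\<^bsub>BC.B.M\<^esub>}"
      using PV[OF a(1)] by (simp add: v AB.B.cok_closed zero BC.B.zero_M)
  next
    fix y assume "y \<in> {y \<in> carrier AB.B.M. ?v y = \<zero>\<^bsub>BC.B.M\<^esub>}"
    then obtain b where b: "b \<in> AB.B.V" "y = AB.B.cok b" "?v (AB.B.cok b) = \<zero>\<^bsub>BC.B.M\<^esub>"
      by (auto simp: AB.B.carrier_M)
    then obtain w where w: "w \<in> BC.B.V" "P' *\<^sub>v b = \<Phi>'' *\<^sub>v w"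
      using BC.B.cok_zero_iff[OF P'V[OF b(1)]] by (auto simp: v)
    then obtain w' where w': "w' \<in> AB.B.V" "w = P' *\<^sub>v w'" using surj by blast
    note c = AB.B.V_carrier[OF b(1)] AB.B.V_carrier[OF AB.B.\<Phi>_vec[OF w'(1)]]
    have d: "b - \<Phi>' *\<^sub>v w' \<in> AB.B.V" by (intro free_vecs_diff b AB.B.\<Phi>_vec w')
    have "P' *\<^sub>v (b - \<Phi>' *\<^sub>v w') = P' *\<^sub>v b - P' *\<^sub>v (\<Phi>' *\<^sub>v w')"
      by (rule mult_minus_distrib_mat_vec[OF P'c c])
    also have "\<dots> = 0\<^sub>v N''"
      using w w' BC.B.V_carrier[OF BC.B.\<Phi>_vec[OF w(1)]] by (simp add: P'\<Phi>_vec)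
    finally obtain a where a: "a \<in> AB.A.V" "b - \<Phi>' *\<^sub>v w' = P *\<^sub>v a" using exact[OF d] by blast
    have "b = P *\<^sub>v a + \<Phi>' *\<^sub>v w'" unfolding a(2)[symmetric] using c by (intro eq_vecI) auto
    hence "AB.B.cok b = AB.B.cok (P *\<^sub>v a)" using AB.B.cok_cong[OF PV[OF a(1)] w'(1)] by simp
    hence "y = ?u (AB.A.cok a)" using b a by (simp add: u)
    thus "y \<in> ?u ` carrier AB.A.M" using a AB.A.cok_closed by blast
  qed
  have C: "?v ` carrier AB.B.M = carrier BC.B.M"
  proof (intro equalityI subsetI)
    fix z assume "z \<in> ?v ` carrier AB.B.M"
    thus "z \<in> carrier BC.B.M" using P'V by (auto simp: AB.B.carrier_M v BC.B.cok_closed)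
  next
    fix z assume "z \<in> carrier BC.B.M"
    then obtain c where c: "c \<in> BC.B.V" "z = BC.B.cok c" by (rule BC.B.cok_cases)
    then obtain b where b: "b \<in> AB.B.V" "c = P' *\<^sub>v b" using surj by blast
    hence "z = ?v (AB.B.cok b)" using c by (simp add: v)
    thus "z \<in> ?v ` carrier AB.B.M" using b AB.B.cok_closed by blast
  qed
  show ?thesis unfolding short_exact_def using A B C by simp
qed

end

section \<open>Evaluation of polynomials at commuting matrices\<close>

text \<open>Besides homomorphisms of representations this covers a matrix that commutes with a
  family, by taking the two families equal.\<close>

lemma foldr_intertwine:
  fixes U :: "'k :: field mat"
  assumes U: "U \<in> carrier_mat m' m"
    and A: "\<And>i. i \<in> set xs \<Longrightarrow> A i \<in> carrier_mat m m" and A': "\<And>i. i \<in> set xs \<Longrightarrow> A' i \<in> carrier_mat m' m'"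
    and UA: "\<And>i. i \<in> set xs \<Longrightarrow> U * A i = A' i * U"
  shows "foldr (\<lambda>i B. A i ^\<^sub>m e i * B) xs (1\<^sub>m m) \<in> carrier_mat m m \<and>
    foldr (\<lambda>i B. A' i ^\<^sub>m e i * B) xs (1\<^sub>m m') \<in> carrier_mat m' m' \<and>
    U * foldr (\<lambda>i B. A i ^\<^sub>m e i * B) xs (1\<^sub>m m) = foldr (\<lambda>i B. A' i ^\<^sub>m e i * B) xs (1\<^sub>m m') * U"
  using A A' UA
proof (induction xs)
  case (Cons i xs)
  let ?F = "foldr (\<lambda>i B. A i ^\<^sub>m e i * B) xs (1\<^sub>m m)" and ?F' = "foldr (\<lambda>i B. A' i ^\<^sub>m e i * B) xs (1\<^sub>m m')"
  have IH: "?F \<in> carrier_mat m m" "?F' \<in> carrier_mat m' m'" "U * ?F = ?F' * U" using Cons by auto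
  have Ai: "A i \<in> carrier_mat m m" "A' i \<in> carrier_mat m' m'" "U * A i = A' i * U" using Cons.prems by auto
  have pow: "U * A i ^\<^sub>m j = A' i ^\<^sub>m j * U" for j
  proof (induction j)
    case (Suc j)
    have "U * (A i ^\<^sub>m j * A i) = (U * A i ^\<^sub>m j) * A i"
      by (rule assoc_mult_mat[symmetric, OF U]) (use Ai in auto)
    also have "\<dots> = A' i ^\<^sub>m j * (U * A i)"
      unfolding Suc by (rule assoc_mult_mat[OF _ U Ai(1)]) (use Ai in auto)
    also have "\<dots> = A' i ^\<^sub>m j * A' i * U"
      unfolding Ai(3) by (rule assoc_mult_mat[symmetric, OF _ Ai(2) U]) (use Ai in auto)
    finally show ?case by simp
  qed (use U Ai in auto)
  let ?p = "A i ^\<^sub>m e i" and ?p' = "A' i ^\<^sub>m e i"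
  have p: "?p \<in> carrier_mat m m" "?p' \<in> carrier_mat m' m'" using Ai by auto
  have "U * (?p * ?F) = (U * ?p) * ?F" by (rule assoc_mult_mat[symmetric, OF U p(1) IH(1)])
  also have "\<dots> = ?p' * (U * ?F)" unfolding pow by (rule assoc_mult_mat[OF p(2) U IH(1)])
  also have "\<dots> = ?p' * ?F' * U" unfolding IH(3) by (rule assoc_mult_mat[symmetric, OF p(2) IH(2) U])
  finally show ?case using p IH by simp
qed (use U in auto)

lemma pow_mat_plus:
  fixes A :: "'a :: semiring_1 mat"
  assumes A: "A \<in> carrier_mat m m"
  shows "A ^\<^sub>m (a + b) = A ^\<^sub>m a * A ^\<^sub>m b"
proof (induction b)
  case 0 show ?case using pow_carrier_mat[OF A] carrier_matD[OF A] by simp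
next
  case (Suc b)
  thus ?case using A by (simp add: assoc_mult_mat[of _ m m _ m _ m])
qed

section \<open>Evaluation at commuting matrices as a ring homomorphism\<close>

locale linear_rep =
  fixes n m :: nat and A :: "nat \<Rightarrow> 'k :: field mat"
  assumes A_carrier: "\<And>i. i \<in> {1..n} \<Longrightarrow> A i \<in> carrier_mat m m"
    and A_comm: "\<And>i j. i \<in> {1..n} \<Longrightarrow> j \<in> {1..n} \<Longrightarrow> A i * A j = A j * A i"
begin

lemma A_dim: "Suc 0 \<le> i \<Longrightarrow> i \<le> n \<Longrightarrow> A i \<in> carrier_mat m m \<and> dim_row (A i) = m \<and> dim_col (A i) = m"
  using A_carrier[of i] by auto

abbreviation "pm \<equiv> poly_mat n m A"
abbreviation "infl \<equiv> inflate n m A"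

lemma foldr_carrier:
  "set xs \<subseteq> {1..n} \<Longrightarrow> foldr (\<lambda>i B. A i ^\<^sub>m e i * B) xs (1\<^sub>m m) \<in> carrier_mat m m"
  by (induction xs) (auto intro!: mult_carrier_mat pow_carrier_mat simp: A_dim)

lemma monom_mat_carrier [simp]: "monom_mat n m A \<epsilon> \<in> carrier_mat m m"
  unfolding monom_mat_def by (rule foldr_carrier) auto

lemma monom_mat_zero: "monom_mat n m A 0 = 1\<^sub>m m"
proof -
  have *: "foldr (\<lambda>i B. A i ^\<^sub>m lookup 0 i * B) xs (1\<^sub>m m) = 1\<^sub>m m" if "set xs \<subseteq> {1..n}" for xs
    using that by (induction xs) (auto simp: A_dim)
  show ?thesis unfolding monom_mat_def by (rule *) auto
qed

lemma monom_mat_single: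
  assumes "i \<in> {1..n}"
  shows "monom_mat n m A (single i 1) = A i"
proof -
  have "foldr (\<lambda>i' B. A i' ^\<^sub>m lookup (single i 1) i' * B) xs (1\<^sub>m m) =
      (if i \<in> set xs then A i else 1\<^sub>m m)" if "set xs \<subseteq> {1..n}" "distinct xs" for xs
    using that by (induction xs) (auto simp: lookup_single A_dim when_def)
  from this[of "[1..<Suc n]"] have "monom_mat n m A (single i 1) = (if i \<in> set [1..<Suc n] then A i else 1\<^sub>m m)"
    unfolding monom_mat_def by fastforce
  thus ?thesis using assms by auto
qed

text \<open>The factors of a monomial stand in the fixed order of the variables. Merging two such
  products moves a power of \<open>A i\<close> past a monomial in the later matrices, which is where
  commutativity enters.\<close>

lemma monom_mat_add: "monom_mat n m A (\<epsilon> + \<delta>) = monom_mat n m A \<epsilon> * monom_mat n m A \<delta>"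
proof -
  let ?F = "\<lambda>e xs. foldr (\<lambda>i B. A i ^\<^sub>m lookup e i * B) xs (1\<^sub>m m)"
  have cl: "?F e xs \<in> carrier_mat m m" if "set xs \<subseteq> {1..n}" for xs e
    by (rule foldr_carrier[OF that])
  have "?F (\<epsilon> + \<delta>) xs = ?F \<epsilon> xs * ?F \<delta> xs" if "set xs \<subseteq> {1..n}" for xs
    using that
  proof (induction xs)
    case (Cons i xs)
    let ?p = "A i ^\<^sub>m lookup \<epsilon> i" and ?q = "A i ^\<^sub>m lookup \<delta> i"
    have i: "i \<in> {1..n}" and xs: "set xs \<subseteq> {1..n}" using Cons.prems by auto
    have Ai: "A i \<in> carrier_mat m m" using A_carrier i by blast
    have c: "?p \<in> carrier_mat m m" "?q \<in> carrier_mat m m" "?F \<epsilon> xs \<in> carrier_mat m m" "?F \<delta> xs \<in> carrier_mat m m"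
      using Ai cl[OF xs] by auto
    have "A i * ?F \<epsilon> xs = ?F \<epsilon> xs * A i"
      using foldr_intertwine[OF Ai, of xs A A] xs i A_carrier A_comm by (auto simp: subset_iff)
    hence qF: "?F \<epsilon> xs * ?q = ?q * ?F \<epsilon> xs"
      using foldr_intertwine[OF c(3), of "[i]" A A "lookup \<delta>"] Ai c by (auto simp: carrier_matD)
    have "A i ^\<^sub>m (lookup \<epsilon> i + lookup \<delta> i) = ?p * ?q"
      by (rule pow_mat_plus[OF Ai])
    hence "?F (\<epsilon> + \<delta>) (i # xs) = (?p * ?q) * (?F \<epsilon> xs * ?F \<delta> xs)"
      using Cons.IH[OF xs] by (simp add: lookup_add)
    also have "\<dots> = ?p * (?q * (?F \<epsilon> xs * ?F \<delta> xs))" using c by (intro assoc_mult_mat) auto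
    also have "?q * (?F \<epsilon> xs * ?F \<delta> xs) = (?q * ?F \<epsilon> xs) * ?F \<delta> xs" using c by (intro assoc_mult_mat[symmetric]) auto
    also have "\<dots> = ?F \<epsilon> xs * (?q * ?F \<delta> xs)" unfolding qF[symmetric] using c by (intro assoc_mult_mat) auto
    also have "?p * (?F \<epsilon> xs * (?q * ?F \<delta> xs)) = (?p * ?F \<epsilon> xs) * (?q * ?F \<delta> xs)"
      using c by (intro assoc_mult_mat[of _ m m _ m _ m, symmetric]) auto
    finally show ?case by simp
  qed auto
  from this[of "[1..<Suc n]"] show ?thesis unfolding monom_mat_def by fastforce
qed

lemma pm_carrier [simp]: "pm q \<in> carrier_mat m m" and pm_dims [simp]: "dim_row (pm q) = m" "dim_col (pm q) = m"
  by (simp_all add: poly_mat_def)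

lemma pm_entry:
  assumes "r < m" "s < m" "finite K" "keys q \<subseteq> K"
  shows "pm q $$ (r, s) = (\<Sum>\<epsilon>\<in>K. lookup q \<epsilon> * monom_mat n m A \<epsilon> $$ (r, s))"
  using assms by (simp add: poly_mat_def) (rule sum.mono_neutral_left, auto simp: in_keys_iff)

lemma pm_add:
  assumes "r < m" "s < m"
  shows "pm (p + q) $$ (r, s) = pm p $$ (r, s) + pm q $$ (r, s)"
proof -
  let ?K = "keys p \<union> keys q"
  have "keys (p + q) \<subseteq> ?K" by (rule Poly_Mapping.keys_add)
  thus ?thesis using assms by (simp add: pm_entry[where K = ?K] lookup_add distrib_right sum.distrib)
qed

lemma pm_single: "r < m \<Longrightarrow> s < m \<Longrightarrow> pm (single \<epsilon> c) $$ (r, s) = c * monom_mat n m A \<epsilon> $$ (r, s)"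
  by (subst pm_entry[where K = "{\<epsilon>}"]) auto

lemma pm_zero: "r < m \<Longrightarrow> s < m \<Longrightarrow> pm 0 $$ (r, s) = 0"
  by (simp add: poly_mat_def)

lemma pm_sum: "r < m \<Longrightarrow> s < m \<Longrightarrow> pm (sum q I) $$ (r, s) = (\<Sum>i\<in>I. pm (q i) $$ (r, s))"
  by (induction I rule: infinite_finite_induct) (auto simp: pm_zero pm_add)

lemma pm_uminus: "r < m \<Longrightarrow> s < m \<Longrightarrow> pm (- q) $$ (r, s) = - pm q $$ (r, s)"
  using pm_add[of r s q "- q"] pm_zero[of r s] by (simp add: eq_neg_iff_add_eq_0 add.commute)

lemma mpoly_expand: "q = (\<Sum>\<epsilon>\<in>keys q. single \<epsilon> (lookup q \<epsilon>))"
  for q :: "'b \<Rightarrow>\<^sub>0 'c :: comm_monoid_add"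
  by (rule poly_mapping_eqI) (auto simp: lookup_sum lookup_single when_def in_keys_iff)

lemma pm_mult:
  assumes rs: "r < m" "s < m"
  shows "pm (p * q) $$ (r, s) = (\<Sum>t<m. pm p $$ (r, t) * pm q $$ (t, s))"
proof -
  let ?l = lookup and ?M = "\<lambda>\<epsilon>. monom_mat n m A \<epsilon>"
  let ?P = "keys p" and ?Q = "keys q"
  have M: "?M (\<epsilon> + \<delta>) $$ (r, s) = (\<Sum>t<m. ?M \<epsilon> $$ (r, t) * ?M \<delta> $$ (t, s))" for \<epsilon> \<delta>
    using rs carrier_matD[OF monom_mat_carrier[of \<epsilon>]] carrier_matD[OF monom_mat_carrier[of \<delta>]]
    by (simp add: monom_mat_add scalar_prod_def atLeast0LessThan)
  have "p * q = (\<Sum>\<epsilon>\<in>?P. \<Sum>\<delta>\<in>?Q. single (\<epsilon> + \<delta>) (?l p \<epsilon> * ?l q \<delta>))"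
    by (subst (1) mpoly_expand[of p], subst (1) mpoly_expand[of q]) (simp add: sum_product mult_single)
  hence "pm (p * q) $$ (r, s) = (\<Sum>\<epsilon>\<in>?P. \<Sum>\<delta>\<in>?Q. ?l p \<epsilon> * ?l q \<delta> * ?M (\<epsilon> + \<delta>) $$ (r, s))"
    using rs by (simp add: pm_sum pm_single)
  also have "\<dots> = (\<Sum>\<epsilon>\<in>?P. \<Sum>\<delta>\<in>?Q. \<Sum>t<m. (?l p \<epsilon> * ?M \<epsilon> $$ (r, t)) * (?l q \<delta> * ?M \<delta> $$ (t, s)))"
    by (simp add: M sum_distrib_left ac_simps)
  also have "\<dots> = (\<Sum>\<epsilon>\<in>?P. \<Sum>t<m. \<Sum>\<delta>\<in>?Q. (?l p \<epsilon> * ?M \<epsilon> $$ (r, t)) * (?l q \<delta> * ?M \<delta> $$ (t, s)))"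
    by (intro sum.cong refl sum.swap)
  also have "\<dots> = (\<Sum>t<m. \<Sum>\<epsilon>\<in>?P. \<Sum>\<delta>\<in>?Q. (?l p \<epsilon> * ?M \<epsilon> $$ (r, t)) * (?l q \<delta> * ?M \<delta> $$ (t, s)))"
    by (rule sum.swap)
  also have "\<dots> = (\<Sum>t<m. pm p $$ (r, t) * pm q $$ (t, s))"
    using rs by (simp add: poly_mat_def sum_product)
  finally show ?thesis .
qed

lemma pm_one: "r < m \<Longrightarrow> s < m \<Longrightarrow> pm 1 $$ (r, s) = (if r = s then 1 else 0)"
  using pm_single[of r s 0 1] by (simp add: monom_mat_zero)

section \<open>Inflation\<close>

lemma infl_dims [simp]: "dim_row (infl p) = m" "dim_col (infl p) = m"
  by (simp_all add: inflate_def)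

lemma mcoeff_infl: "r < m \<Longrightarrow> s < m \<Longrightarrow> mcoeff (infl p $$ (r, s)) \<mu> = pm (mcoeff p \<mu>) $$ (r, s)"
  by (simp add: inflate_def)

lemma infl_over: "p \<in> mps_over V \<Longrightarrow> r < m \<Longrightarrow> s < m \<Longrightarrow> infl p $$ (r, s) \<in> mps_over V"
  by (rule mps_overI) (metis mcoeff_infl mps_over_coeff_0 pm_zero)

lemma infl_order: "order_ge d p \<Longrightarrow> r < m \<Longrightarrow> s < m \<Longrightarrow> order_ge d (infl p $$ (r, s))"
  by (simp add: order_ge_def mcoeff_infl pm_zero)

lemma infl_add: "r < m \<Longrightarrow> s < m \<Longrightarrow> infl (p + q) $$ (r, s) = infl p $$ (r, s) + infl q $$ (r, s)"
  and infl_uminus: "r < m \<Longrightarrow> s < m \<Longrightarrow> infl (- p) $$ (r, s) = - infl p $$ (r, s)"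
  and infl_zero: "r < m \<Longrightarrow> s < m \<Longrightarrow> infl 0 $$ (r, s) = 0"
  by (rule mps_eqI, simp add: mcoeff_infl pm_add pm_uminus pm_zero)+

lemma infl_sum: "r < m \<Longrightarrow> s < m \<Longrightarrow> infl (sum p I) $$ (r, s) = (\<Sum>i\<in>I. infl (p i) $$ (r, s))"
  by (induction I rule: infinite_finite_induct) (auto simp: infl_zero infl_add)

lemma infl_mult:
  assumes rs: "r < m" "s < m"
  shows "infl (p * q) $$ (r, s) = (\<Sum>t<m. infl p $$ (r, t) * infl q $$ (t, s))"
proof (rule mps_eqI)
  fix \<mu>
  have "mcoeff (infl (p * q) $$ (r, s)) \<mu> =
      (\<Sum>x\<in>mon_splits \<mu>. \<Sum>t<m. pm (mcoeff p (fst x)) $$ (r, t) * pm (mcoeff q (snd x)) $$ (t, s))"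
    using rs by (simp add: mcoeff_infl mcoeff_times pm_sum pm_mult case_prod_unfold)
  also have "\<dots> = (\<Sum>t<m. \<Sum>x\<in>mon_splits \<mu>. pm (mcoeff p (fst x)) $$ (r, t) * pm (mcoeff q (snd x)) $$ (t, s))"
    by (rule sum.swap)
  finally show "mcoeff (infl (p * q) $$ (r, s)) \<mu> = mcoeff (\<Sum>t<m. infl p $$ (r, t) * infl q $$ (t, s)) \<mu>"
    using rs by (simp add: mcoeff_times mcoeff_infl case_prod_unfold)
qed

lemma infl_extend: "r < m \<Longrightarrow> s < m \<Longrightarrow> infl (extend_scalars p) $$ (r, s) = (if r = s then p else 0)"
  by (rule mps_eqI) (simp add: mcoeff_infl extend_scalars_def pm_single monom_mat_zero)

lemma infl_linear:
  assumes i: "i \<in> {1..n}" and rs: "r < m" "s < m"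
  shows "infl (x_var i - a_param i * z_var) $$ (r, s) =
    (if r = s then mps_var i else 0) - mps_const (A i $$ (r, s)) * mps_var 0"
proof (rule mps_eqI)
  fix \<mu> :: "nat \<Rightarrow>\<^sub>0 nat"
  have "mcoeff (x_var i - a_param i * z_var :: 'k mpoly mps) \<mu> =
      (if \<mu> = single i 1 then 1 else 0) +
      - (if \<mu> = single 0 1 then single (single i 1) 1 else 0)"
    by (simp add: a_param_def mcoeff_var)
  hence "mcoeff (infl (x_var i - a_param i * z_var) $$ (r, s)) \<mu> =
      pm (if \<mu> = single i 1 then 1 else 0) $$ (r, s) +
      - pm (if \<mu> = single 0 1 then single (single i 1) 1 else 0) $$ (r, s)"
    by (simp only: mcoeff_infl[OF rs] pm_add[OF rs] pm_uminus[OF rs])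
  also have "\<dots> = (if \<mu> = single i 1 then if r = s then 1 else 0 else 0)
      - (if \<mu> = single 0 1 then A i $$ (r, s) else 0)"
    using rs monom_mat_single[OF i] by (simp add: pm_one pm_single pm_zero)
  also have "\<dots> = mcoeff ((if r = s then mps_var i else 0) - mps_const (A i $$ (r, s)) * mps_var 0) \<mu>"
    by (simp add: mcoeff_var)
  finally show "mcoeff (infl (x_var i - a_param i * z_var) $$ (r, s)) \<mu> =
    mcoeff ((if r = s then mps_var i else 0) - mps_const (A i $$ (r, s)) * mps_var 0) \<mu>" .
qed

end

section \<open>Block indices and inflation of matrices\<close>

lemma sum_blocks:
  fixes F :: "nat \<Rightarrow> nat \<Rightarrow> 'a :: comm_monoid_add"
  shows "(\<Sum>k<c * m. F (k div m) (k mod m)) = (\<Sum>a<c. \<Sum>b<m. F a b)"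
proof (cases "m = 0")
  case False
  have "(\<Sum>k<c * m. F (k div m) (k mod m)) = (\<Sum>x\<in>{..<c} \<times> {..<m}. F (fst x) (snd x))"
  proof (rule sum.reindex_bij_witness[of _ "\<lambda>x. fst x * m + snd x" "\<lambda>k. (k div m, k mod m)"])
    fix x assume "x \<in> {..<c} \<times> {..<m}"
    hence x: "fst x < c" "snd x < m" by auto
    hence "Suc (fst x) * m \<le> c * m" by (intro mult_le_mono1) simp
    thus "fst x * m + snd x \<in> {..<c * m}" using x by simp
  qed (use False in \<open>auto simp: less_mult_imp_div_less\<close>)
  thus ?thesis by (simp add: sum.cartesian_product case_prod_unfold)
qed simp

lemma block_index_less: "a < c \<Longrightarrow> b < m \<Longrightarrow> a * m + b < c * (m :: nat)"
  by (metis add.commute add_less_mono1 mult_Suc less_le_trans mult_le_mono1 Suc_leI)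

lemma (in linear_rep) inflate_mat_carrier:
  "B \<in> carrier_mat R C \<Longrightarrow> inflate_mat n m A B \<in> carrier_mat (R * m) (C * m)"
  by (auto simp: inflate_mat_def)

lemma (in linear_rep) inflate_mat_entry:
  assumes "B \<in> carrier_mat R C" "r < R" "s < C" "\<rho> < m" "\<sigma> < m"
  shows "inflate_mat n m A B $$ (r * m + \<rho>, s * m + \<sigma>) = infl (B $$ (r, s)) $$ (\<rho>, \<sigma>)"
  using assms block_index_less[of r R \<rho> m] block_index_less[of s C \<sigma> m] by (auto simp: inflate_mat_def)

lemma (in linear_rep) inflate_mat_entry':
  assumes "B \<in> carrier_mat R C" "i < R * m" "j < C * m"
  shows "inflate_mat n m A B $$ (i, j) = infl (B $$ (i div m, j div m)) $$ (i mod m, j mod m)"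
  using assms by (auto simp: inflate_mat_def)

text \<open>Inflation of single series is multiplicative, and the sum over the \<open>C * m\<close>
  inner indices splits into a sum over blocks and one inside each block.\<close>

lemma (in linear_rep) inflate_mat_mult:
  assumes B: "B \<in> carrier_mat R C" and B': "B' \<in> carrier_mat C D"
  shows "inflate_mat n m A (B * B') = inflate_mat n m A B * inflate_mat n m A B'"
proof (rule eq_matI)
  note c = inflate_mat_carrier[OF B] inflate_mat_carrier[OF B'] 
  have BB: "B * B' \<in> carrier_mat R D" using B B' by simp
  fix i j assume "i < dim_row (inflate_mat n m A B * inflate_mat n m A B')"
    "j < dim_col (inflate_mat n m A B * inflate_mat n m A B')"
  hence ij: "i < R * m" "j < D * m" using c by auto
  hence m: "m > 0" by (cases m) auto
  have d: "i div m < R" "j div m < D" "i mod m < m" "j mod m < m"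
    using ij m by (auto simp: less_mult_imp_div_less)
  have "inflate_mat n m A (B * B') $$ (i, j) =
      infl (\<Sum>a<C. B $$ (i div m, a) * B' $$ (a, j div m)) $$ (i mod m, j mod m)"
    using inflate_mat_entry'[OF BB ij] d B B' by (simp add: scalar_prod_def atLeast0LessThan)
  also have "\<dots> = (\<Sum>a<C. \<Sum>b<m. infl (B $$ (i div m, a)) $$ (i mod m, b) * infl (B' $$ (a, j div m)) $$ (b, j mod m))"
    using d by (simp add: infl_sum infl_mult)
  also have "\<dots> = (\<Sum>k<C * m. infl (B $$ (i div m, k div m)) $$ (i mod m, k mod m) *
      infl (B' $$ (k div m, j div m)) $$ (k mod m, j mod m))"
    by (rule sum_blocks[symmetric])
  also have "\<dots> = (\<Sum>k<C * m. inflate_mat n m A B $$ (i, k) * inflate_mat n m A B' $$ (k, j))"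
    using ij by (intro sum.cong refl) (simp add: inflate_mat_entry'[OF B] inflate_mat_entry'[OF B'])
  also have "\<dots> = (inflate_mat n m A B * inflate_mat n m A B') $$ (i, j)"
    using ij c by (simp add: scalar_prod_def atLeast0LessThan)
  finally show "inflate_mat n m A (B * B') $$ (i, j) = (inflate_mat n m A B * inflate_mat n m A B') $$ (i, j)" .
qed (use B B' in \<open>auto simp: inflate_mat_def\<close>)

lemma mcoeff_var_0: "mcoeff (mps_var i) 0 = (0 :: 'a :: comm_ring_1)"
proof -
  have "lookup (0 :: nat \<Rightarrow>\<^sub>0 nat) i \<noteq> lookup (single i 1) i" by simp
  hence "(0 :: nat \<Rightarrow>\<^sub>0 nat) \<noteq> single i 1" by metis
  thus ?thesis unfolding mcoeff_var by (rule if_not_P)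
qed

section \<open>The matrices \<open>\<phi>\<^sub>i\<close> and \<open>\<psi>\<^sub>i\<close>\<close>

abbreviation lin_form :: "nat \<Rightarrow> 'k :: field mpoly mps" where
  "lin_form i \<equiv> x_var i - a_param i * z_var"

abbreviation phi :: "'k :: field mpoly mps \<Rightarrow> (nat \<Rightarrow> 'k mpoly mps) \<Rightarrow> nat \<Rightarrow> 'k mpoly mps mat" where
  "phi h g i \<equiv> fst (phi_psi h g i)"

abbreviation psi :: "'k :: field mpoly mps \<Rightarrow> (nat \<Rightarrow> 'k mpoly mps) \<Rightarrow> nat \<Rightarrow> 'k mpoly mps mat" where
  "psi h g i \<equiv> snd (phi_psi h g i)"

lemma phi_Suc: "phi h g (Suc i) = four_block_mat (phi h g i) ((- g (Suc i)) \<cdot>\<^sub>m 1\<^sub>m (2 ^ i))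
    (lin_form (Suc i) \<cdot>\<^sub>m 1\<^sub>m (2 ^ i)) (psi h g i)"
  and psi_Suc: "psi h g (Suc i) = four_block_mat (psi h g i) (g (Suc i) \<cdot>\<^sub>m 1\<^sub>m (2 ^ i))
    ((- lin_form (Suc i)) \<cdot>\<^sub>m 1\<^sub>m (2 ^ i)) (phi h g i)"
  by (simp_all add: case_prod_unfold Let_def)

lemma phi_psi_0: "phi h g 0 = mat 1 1 (\<lambda>_. z_var ^ 2)" "psi h g 0 = mat 1 1 (\<lambda>_. h)"
  by simp_all

declare phi_psi.simps [simp del]

lemma phi_psi_carrier: "phi h g i \<in> carrier_mat (2 ^ i) (2 ^ i) \<and> psi h g i \<in> carrier_mat (2 ^ i) (2 ^ i)"
proof (induction i)
  case (Suc i)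
  have e: "(2 :: nat) ^ Suc i = 2 ^ i + 2 ^ i" by simp
  show ?case unfolding phi_Suc psi_Suc e using Suc by (intro conjI four_block_carrier_mat) auto
qed (simp add: phi_psi_0)

lemmas phi_carrier = phi_psi_carrier[THEN conjunct1]
  and psi_carrier = phi_psi_carrier[THEN conjunct2]

text \<open>Up to signs this is a Koszul matrix factorization, the tensor product of
  \<open>(z^2, h)\<close> with the factorizations of size one of \<open>lin_form j * g j\<close>. In
  the block product the scalar blocks commute with everything: the off-diagonal blocks cancel, and
  the diagonal ones add \<open>lin_form * g\<close> to the previous value of
  \<open>F\<close>.\<close>

lemma phi_psi_mult:
  fixes h :: "'k :: field mpoly mps" and g :: "nat \<Rightarrow> 'k mpoly mps"
  defines "F \<equiv> \<lambda>i. z_var ^ 2 * h + (\<Sum>j = 1..i. lin_form j * g j)"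
  shows "phi h g i * psi h g i = F i \<cdot>\<^sub>m 1\<^sub>m (2 ^ i) \<and> psi h g i * phi h g i = F i \<cdot>\<^sub>m 1\<^sub>m (2 ^ i)"
proof (induction i)
  case 0
  show ?case by (intro conjI eq_matI) (auto simp: phi_psi_0 F_def scalar_prod_def mult.commute)
next
  case (Suc i)
  let ?N = "2 ^ i :: nat" and ?p = "phi h g i" and ?q = "psi h g i" and ?l = "lin_form (Suc i) :: 'k mpoly mps"
  let ?g = "g (Suc i)"
  note c = phi_carrier[of h g i] psi_carrier[of h g i]
  have F: "F (Suc i) = F i + ?l * ?g" by (simp add: F_def add.assoc)
  have sm: "(a \<cdot>\<^sub>m 1\<^sub>m ?N) * B = a \<cdot>\<^sub>m B" "B * (a \<cdot>\<^sub>m 1\<^sub>m ?N) = a \<cdot>\<^sub>m B"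
    if "B \<in> carrier_mat ?N ?N" for a and B :: "'k mpoly mps mat"
    using that by (auto simp: mult_smult_assoc_mat[of _ ?N ?N] mult_smult_distrib[of _ ?N ?N])
  have one: "F (Suc i) \<cdot>\<^sub>m 1\<^sub>m (2 ^ Suc i) = four_block_mat (F (Suc i) \<cdot>\<^sub>m 1\<^sub>m ?N) (0\<^sub>m ?N ?N) (0\<^sub>m ?N ?N) (F (Suc i) \<cdot>\<^sub>m 1\<^sub>m ?N)"
    by (rule eq_matI) auto
  have "phi h g (Suc i) * psi h g (Suc i) = F (Suc i) \<cdot>\<^sub>m 1\<^sub>m (2 ^ Suc i)"
    unfolding phi_Suc psi_Suc one
    apply (subst mult_four_block_mat[of _ ?N ?N _ ?N _ ?N _ _ ?N _ ?N])
    using c apply (simp_all add: sm Suc)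
    apply (rule cong_four_block_mat)
    apply (rule eq_matI; auto simp: F ring_distribs ac_simps)+
    done
  moreover have "psi h g (Suc i) * phi h g (Suc i) = F (Suc i) \<cdot>\<^sub>m 1\<^sub>m (2 ^ Suc i)"
    unfolding phi_Suc psi_Suc one
    apply (subst mult_four_block_mat[of _ ?N ?N _ ?N _ ?N _ _ ?N _ ?N])
    using c apply (simp_all add: sm Suc)
    apply (rule cong_four_block_mat)
    apply (rule eq_matI; auto simp: F ring_distribs ac_simps)+
    done
  ultimately show ?case by blast
qed

text \<open>Indices below \<open>2\<^sup>i\<close> are subsets of \<open>{0..<i}\<close>, read as binary digits;
  \<open>cube_edge i j r s\<close> says that \<open>r\<close> arises from \<open>s\<close> by adding the element \<open>j\<close>.\<close>

fun cube_edge :: "nat \<Rightarrow> nat \<Rightarrow> nat \<Rightarrow> nat \<Rightarrow> bool" where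
  "cube_edge 0 j r s \<longleftrightarrow> False"
| "cube_edge (Suc i) j r s \<longleftrightarrow>
    (if r < 2 ^ i then s < 2 ^ i \<and> cube_edge i j r s
     else if s < 2 ^ i then j = i \<and> r = s + 2 ^ i
     else cube_edge i j (r - 2 ^ i) (s - 2 ^ i))"

lemma cube_edgeD: "cube_edge i j r s \<Longrightarrow> r = s + 2 ^ j \<and> j < i"
proof (induction i arbitrary: r s)
  case (Suc i)
  show ?case
  proof (cases "r < 2 ^ i \<or> s < 2 ^ i")
    case True thus ?thesis using Suc by (fastforce split: if_splits)
  next
    case False
    hence "cube_edge i j (r - 2 ^ i) (s - 2 ^ i)" using Suc.prems by simp
    from Suc.IH[OF this] show ?thesis using False by auto
  qed
qed simp

text \<open>A non-empty set has an element to remove. This supplies the predecessor vertex in the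
  induction over the block columns of a homomorphism.\<close>

lemma cube_edge_exists: "0 < r \<Longrightarrow> r < 2 ^ i \<Longrightarrow> \<exists>j s. cube_edge i j r s"
proof (induction i arbitrary: r)
  case (Suc i)
  show ?case
  proof (cases "r < 2 ^ i")
    case True
    then obtain j s where "cube_edge i j r s" using Suc by blast
    thus ?thesis using True cube_edgeD[of i j r s] by (intro exI[of _ j] exI[of _ s]) auto
  next
    case False
    thus ?thesis using Suc.prems by (intro exI[of _ i] exI[of _ "r - 2 ^ i"]) auto
  qed
qed simp

lemma cube_edge_0: "j < i \<Longrightarrow> cube_edge i j (2 ^ j) 0"
proof (induction i)
  case (Suc i)
  show ?case
  proof (cases "j = i")
    case False
    hence "(2 :: nat) ^ j < 2 ^ i" using Suc.prems by (intro power_strict_increasing) auto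
    thus ?thesis using Suc False by simp
  qed auto
qed simp

lemma four_block_entry:
  assumes "A \<in> carrier_mat N N" "B \<in> carrier_mat N N" "C \<in> carrier_mat N N" "D \<in> carrier_mat N N"
    "r < 2 * N" "s < 2 * N"
  shows "four_block_mat A B C D $$ (r, s) = (if r < N then if s < N then A $$ (r, s) else B $$ (r, s - N)
     else if s < N then C $$ (r - N, s) else D $$ (r - N, s - N))"
  using assms by auto

text \<open>Both matrices go through one induction because the lower right block of
  \<open>phi\<close> at stage \<open>i + 1\<close> is \<open>psi\<close> at stage \<open>i\<close>;
  the sign rule off the diagonal transfers the other facts to it. Up to sign, only 0 and the
  \<open>g j\<close> occur above the diagonal, 0 and the linear forms below it, \<open>z^2\<close>
  and \<open>h\<close> on it.\<close>

lemma phi_psi_structure: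
  fixes h :: "'k :: field mpoly mps"
  assumes h: "order_ge 2 h" and g: "\<And>j. j \<in> {1..n} \<Longrightarrow> order_ge 3 (g j)"
    and i: "i \<le> n" and rs: "r < 2 ^ i" "s < 2 ^ i"
  shows "(r \<noteq> s \<longrightarrow> psi h g i $$ (r, s) = - (phi h g i $$ (r, s))) \<and>
    (r < s \<longrightarrow> order_ge 3 (phi h g i $$ (r, s))) \<and>
    (r = s \<longrightarrow> order_ge 2 (phi h g i $$ (r, s)) \<and> order_ge 2 (psi h g i $$ (r, s))) \<and>
    (\<forall>j. cube_edge i j r s \<longrightarrow> phi h g i $$ (r, s) = lin_form (Suc j) \<or> phi h g i $$ (r, s) = - lin_form (Suc j)) \<and>
    (s < r \<longrightarrow> (\<forall>j. \<not> cube_edge i j r s) \<longrightarrow> phi h g i $$ (r, s) = 0)"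
  using i rs
proof (induction i arbitrary: r s)
  case 0
  have "order_ge (2 * Suc 0) (z_var ^ 2 :: 'k mpoly mps)"
    by (rule order_ge_power) (simp add: order_ge_Suc_0 mcoeff_var_0)
  thus ?case using 0 h by (simp add: phi_psi_0 numeral_2_eq_2)
next
  case (Suc i)
  let ?N = "2 ^ i :: nat"
  note c = phi_carrier[of h g i] psi_carrier[of h g i]
  have rs: "r < 2 * ?N" "s < 2 * ?N" using Suc.prems by auto
  have gi: "order_ge 3 (g (Suc i))" using g Suc.prems by auto
  have neg: "order_ge d (- p)" if "order_ge d p" for d and p :: "'k mpoly mps" using that by (auto simp: order_ge_def)
  have p: "phi h g (Suc i) $$ (r, s) = (if r < ?N then if s < ?N then phi h g i $$ (r, s) else if r = s - ?N then - g (Suc i) else 0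
     else if s < ?N then if r - ?N = s then lin_form (Suc i) else 0 else psi h g i $$ (r - ?N, s - ?N))"
    unfolding phi_Suc using rs by (subst four_block_entry[OF c(1) _ _ c(2) rs]) auto
  have q: "psi h g (Suc i) $$ (r, s) = (if r < ?N then if s < ?N then psi h g i $$ (r, s) else if r = s - ?N then g (Suc i) else 0
     else if s < ?N then if r - ?N = s then - lin_form (Suc i) else 0 else phi h g i $$ (r - ?N, s - ?N))"
    unfolding psi_Suc using rs by (subst four_block_entry[OF c(2) _ _ c(1) rs]) auto
  consider "r < ?N" "s < ?N" | "r < ?N" "\<not> s < ?N" | "\<not> r < ?N" "s < ?N" | "\<not> r < ?N" "\<not> s < ?N" by blast
  thus ?case
  proof cases
    case 1
    thus ?thesis using Suc.IH[of r s] Suc.prems unfolding p q by simp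
  next
    case 2
    thus ?thesis using gi neg[OF gi] unfolding p q by (auto simp: order_ge_def)
  next
    case 3
    thus ?thesis unfolding p q by auto
  next
    case 4
    have IH: "r - ?N < ?N" "s - ?N < ?N" using 4 rs by auto
    have eq: "r - ?N = s - ?N \<longleftrightarrow> r = s" "r - ?N < s - ?N \<longleftrightarrow> r < s" "s - ?N < r - ?N \<longleftrightarrow> s < r" using 4 by auto
    have i: "i \<le> n" using Suc.prems by simp
    note IH = Suc.IH[OF i IH, unfolded eq]
    have "r < s \<Longrightarrow> order_ge 3 (psi h g i $$ (r - ?N, s - ?N))" using IH neg by auto
    moreover have "cube_edge i j (r - ?N) (s - ?N) \<Longrightarrow> s < r" for j
      using cube_edgeD[of i j "r - ?N" "s - ?N"] eq by (metis less_add_same_cancel1 zero_less_power pos2)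
    ultimately show ?thesis using IH 4 unfolding p q by auto
  qed
qed

lemma phi_00: "phi h g i $$ (0, 0) = z_var ^ 2"
  by (induction i) (use phi_carrier in \<open>auto simp: phi_psi_0 phi_Suc four_block_entry[OF phi_carrier _ _ psi_carrier]\<close>)

lemma phi_psi_over:
  fixes h :: "'k :: field mpoly mps"
  assumes h: "h \<in> mps_over {0..n}" and g: "\<And>j. j \<in> {1..n} \<Longrightarrow> g j \<in> mps_over {0..n}"
    and i: "i \<le> n" and rs: "r < 2 ^ i" "s < 2 ^ i"
  shows "phi h g i $$ (r, s) \<in> mps_over {0..n} \<and> psi h g i $$ (r, s) \<in> mps_over {0..n}"
  using i rs
proof (induction i arbitrary: r s)
  case 0
  thus ?case using h by (auto simp: phi_psi_0 intro!: mps_over_power mps_over_var)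
next
  case (Suc i)
  let ?N = "2 ^ i :: nat"
  have rs: "r < 2 * ?N" "s < 2 * ?N" using Suc.prems by auto
  have l: "lin_form (Suc i) \<in> mps_over {0..n}"
    using Suc.prems by (auto simp: a_param_def intro!: mps_over_closed mps_over_var)
  have "g (Suc i) \<in> mps_over {0..n}" using g Suc.prems by auto
  thus ?case unfolding phi_Suc psi_Suc using rs Suc l
    by (auto simp: four_block_entry[OF phi_carrier _ _ psi_carrier rs] four_block_entry[OF psi_carrier _ _ phi_carrier rs]
        simp del: minus_diff_eq intro: mps_over_uminus)
qed

section \<open>The inflated matrix factorizations\<close>

locale expression = hypersurface n f for n :: nat and f :: "'k :: field mps" +
  fixes h :: "'k mpoly mps" and g :: "nat \<Rightarrow> 'k mpoly mps"
  assumes expr: "is_expression n f h g" and n_pos: "n \<ge> 1"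
begin

lemma h_over: "h \<in> mps_over {0..n}" and h_order: "order_ge 2 h"
  and g_over: "j \<in> {1..n} \<Longrightarrow> g j \<in> mps_over {0..n}" and g_order: "j \<in> {1..n} \<Longrightarrow> order_ge 3 (g j)"
  and f_eq: "extend_scalars f = z_var ^ 2 * h + (\<Sum>i = 1..n. lin_form i * g i)"
  using expr by (auto simp: is_expression_def param_series_def order_ge_iff numeral_eq_enat)

abbreviation "\<phi> \<equiv> phi h g n"
abbreviation "\<psi> \<equiv> psi h g n"

text \<open>The features common to \<open>\<phi>\<close> and \<open>\<psi>\<close> that the
  comparison of linear coefficients uses, so that it applies to both equations satisfied by a
  homomorphism. The function \<open>\<epsilon>\<close> records the signs of the linear
  forms.\<close>

definition edge_mat :: "'k mpoly mps mat \<Rightarrow> (nat \<Rightarrow> nat \<Rightarrow> 'k) \<Rightarrow> bool" where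
  "edge_mat B \<epsilon> \<longleftrightarrow> B \<in> carrier_mat (2 ^ n) (2 ^ n) \<and> (\<forall>r<2 ^ n. \<forall>s<2 ^ n.
     (\<forall>j. cube_edge n j r s \<longrightarrow> \<epsilon> r s = 1 \<and> B $$ (r, s) = lin_form (Suc j) \<or>
        \<epsilon> r s = -1 \<and> B $$ (r, s) = - lin_form (Suc j)) \<and>
     ((\<forall>j. \<not> cube_edge n j r s) \<longrightarrow> order_ge 2 (B $$ (r, s))))"

lemma cube_edge_unique: "cube_edge n j r s \<Longrightarrow> cube_edge n j' r s \<Longrightarrow> j = j'"
  using cube_edgeD[of n j r s] cube_edgeD[of n j' r s] by auto

lemma edge_matI:
  assumes B: "B \<in> carrier_mat (2 ^ n) (2 ^ n)"
    and 1: "\<And>r s j. r < 2 ^ n \<Longrightarrow> s < 2 ^ n \<Longrightarrow> cube_edge n j r s \<Longrightarrow>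
      B $$ (r, s) = lin_form (Suc j) \<or> B $$ (r, s) = - lin_form (Suc j)"
    and 2: "\<And>r s. r < 2 ^ n \<Longrightarrow> s < 2 ^ n \<Longrightarrow> (\<And>j. \<not> cube_edge n j r s) \<Longrightarrow> order_ge 2 (B $$ (r, s))"
  shows "\<exists>\<epsilon>. edge_mat B \<epsilon>"
proof -
  have "\<exists>e. r < 2 ^ n \<longrightarrow> s < 2 ^ n \<longrightarrow> (\<forall>j. cube_edge n j r s \<longrightarrow> e = (1 :: 'k) \<and> B $$ (r, s) = lin_form (Suc j) \<or>
        e = -1 \<and> B $$ (r, s) = - lin_form (Suc j))" for r s
  proof (cases "\<exists>j. cube_edge n j r s")
    case True
    then obtain j where j: "cube_edge n j r s" by blast
    have "j' = j" if "cube_edge n j' r s" for j' using cube_edge_unique[OF that j] .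
    thus ?thesis using 1[of r s j] j by (metis (no_types))
  qed auto
  then obtain \<epsilon> where "\<And>r s. r < 2 ^ n \<longrightarrow> s < 2 ^ n \<longrightarrow> (\<forall>j. cube_edge n j r s \<longrightarrow> \<epsilon> r s = (1 :: 'k) \<and> B $$ (r, s) = lin_form (Suc j) \<or>
        \<epsilon> r s = -1 \<and> B $$ (r, s) = - lin_form (Suc j))" by metis
  thus ?thesis using B 2 unfolding edge_mat_def by blast
qed

lemma order_ge_uminus: "order_ge d (- p) \<longleftrightarrow> order_ge d p" for p :: "'b :: comm_ring_1 mps"
  by (simp add: order_ge_def)

lemma edge_mat_phi: "\<exists>\<epsilon>. edge_mat \<phi> \<epsilon>" and edge_mat_psi: "\<exists>\<epsilon>. edge_mat \<psi> \<epsilon>"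
proof -
  have st: "(r \<noteq> s \<longrightarrow> \<psi> $$ (r, s) = - (\<phi> $$ (r, s))) \<and>
    (r < s \<longrightarrow> order_ge 3 (\<phi> $$ (r, s))) \<and>
    (r = s \<longrightarrow> order_ge 2 (\<phi> $$ (r, s)) \<and> order_ge 2 (\<psi> $$ (r, s))) \<and>
    (\<forall>j. cube_edge n j r s \<longrightarrow> \<phi> $$ (r, s) = lin_form (Suc j) \<or> \<phi> $$ (r, s) = - lin_form (Suc j)) \<and>
    (s < r \<longrightarrow> (\<forall>j. \<not> cube_edge n j r s) \<longrightarrow> \<phi> $$ (r, s) = 0)" if "r < 2 ^ n" "s < 2 ^ n" for r s
    by (rule phi_psi_structure[where n = n, OF h_order g_order order_refl that])
  have ne: "r \<noteq> s" if "cube_edge n j r s" for j r s using cube_edgeD[OF that] by auto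
  have ord: "order_ge 2 (\<phi> $$ (r, s))" if "r < 2 ^ n" "s < 2 ^ n" "\<And>j. \<not> cube_edge n j r s" for r s
  proof -
    consider "r < s" | "r = s" | "s < r" by linarith
    thus ?thesis
    proof cases
      case 1 thus ?thesis using st[OF that(1,2)] order_ge_mono[of 3 _ 2] by auto
    next
      case 2 thus ?thesis using st[OF that(1,2)] by auto
    next
      case 3 thus ?thesis using st[OF that(1,2)] that(3) by (simp add: order_ge_def)
    qed
  qed
  show "\<exists>\<epsilon>. edge_mat \<phi> \<epsilon>"
  proof (rule edge_matI[OF phi_carrier])
    fix r s j assume rs: "r < (2 :: nat) ^ n" "s < (2 :: nat) ^ n" "cube_edge n j r s"
    show "\<phi> $$ (r, s) = lin_form (Suc j) \<or> \<phi> $$ (r, s) = - lin_form (Suc j)"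
      using st[OF rs(1,2)] rs(3) by blast
  qed (rule ord)
  show "\<exists>\<epsilon>. edge_mat \<psi> \<epsilon>"
  proof (rule edge_matI[OF psi_carrier])
    fix r s j assume rs: "r < (2 :: nat) ^ n" "s < (2 :: nat) ^ n" "cube_edge n j r s"
    have "\<psi> $$ (r, s) = - (\<phi> $$ (r, s))" using st[OF rs(1,2)] ne[OF rs(3)] by blast
    moreover have "\<phi> $$ (r, s) = lin_form (Suc j) \<or> \<phi> $$ (r, s) = - lin_form (Suc j)"
      using st[OF rs(1,2)] rs(3) by blast
    ultimately show "\<psi> $$ (r, s) = lin_form (Suc j) \<or> \<psi> $$ (r, s) = - lin_form (Suc j)"
      by (metis minus_minus)
  next
    fix r s assume rs: "r < (2 :: nat) ^ n" "s < (2 :: nat) ^ n" "\<And>j. \<not> cube_edge n j r s"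
    thus "order_ge 2 (\<psi> $$ (r, s))" using st[OF rs(1,2)] ord[OF rs] by (cases "r = s") (auto simp: order_ge_uminus)
  qed
qed

end

section \<open>Inflated factorizations and their coefficients of degree at most one\<close>

locale inflation = expression n f h g + linear_rep n m A
  for n m :: nat and f :: "'k :: field mps" and h g and A :: "nat \<Rightarrow> 'k mat"
begin

abbreviation "\<Phi> \<equiv> inflate_mat n m A \<phi>"
abbreviation "\<Psi> \<equiv> inflate_mat n m A \<psi>"

lemma inflate_mat_over:
  assumes "B \<in> carrier_mat (2 ^ n) (2 ^ n)" "\<And>r s. r < 2 ^ n \<Longrightarrow> s < 2 ^ n \<Longrightarrow> B $$ (r, s) \<in> mps_over {0..n}"
  shows "inflate_mat n m A B \<in> mat_over n (2 ^ n * m) (2 ^ n * m)"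
proof (rule mat_overI[OF inflate_mat_carrier[OF assms(1)]])
  fix i j assume ij: "i < 2 ^ n * m" "j < 2 ^ n * m"
  hence m: "m > 0" by (cases m) auto
  have "i div m < 2 ^ n" "j div m < 2 ^ n" using ij by (auto simp: less_mult_imp_div_less)
  thus "inflate_mat n m A B $$ (i, j) \<in> mps_over {0..n}"
    using inflate_mat_entry'[OF assms(1) ij] m assms(2) by (simp add: infl_over)
qed

lemma inflate_scalar: "inflate_mat n m A (extend_scalars f \<cdot>\<^sub>m 1\<^sub>m (2 ^ n)) = f \<cdot>\<^sub>m 1\<^sub>m (2 ^ n * m)"
proof (rule eq_matI)
  have c: "extend_scalars f \<cdot>\<^sub>m 1\<^sub>m (2 ^ n) \<in> carrier_mat (2 ^ n) (2 ^ n)" by simp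
  fix i j assume "i < dim_row (f \<cdot>\<^sub>m 1\<^sub>m (2 ^ n * m))" "j < dim_col (f \<cdot>\<^sub>m 1\<^sub>m (2 ^ n * m))"
  hence ij: "i < 2 ^ n * m" "j < 2 ^ n * m" by auto
  hence m: "m > 0" by (cases m) auto
  have d: "i div m < 2 ^ n" "j div m < 2 ^ n" using ij by (auto simp: less_mult_imp_div_less)
  have "i = j \<longleftrightarrow> i div m = j div m \<and> i mod m = j mod m" by (metis div_mult_mod_eq)
  thus "inflate_mat n m A (extend_scalars f \<cdot>\<^sub>m 1\<^sub>m (2 ^ n)) $$ (i, j) = (f \<cdot>\<^sub>m 1\<^sub>m (2 ^ n * m)) $$ (i, j)"
    using ij d m by (auto simp: inflate_mat_entry'[OF c ij] infl_extend infl_zero)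
qed (auto simp: inflate_mat_def)

sublocale matrix_factorization n "2 ^ n * m" f \<Phi> \<Psi>
proof unfold_locales
  show "\<Phi> \<in> mat_over n (2 ^ n * m) (2 ^ n * m)" "\<Psi> \<in> mat_over n (2 ^ n * m) (2 ^ n * m)"
    using phi_psi_over[where n = n and i = n and h = h and g = g, OF h_over g_over]
    by (intro inflate_mat_over phi_carrier psi_carrier; simp)+
  show "\<Phi> * \<Psi> = f \<cdot>\<^sub>m 1\<^sub>m (2 ^ n * m)" "\<Psi> * \<Phi> = f \<cdot>\<^sub>m 1\<^sub>m (2 ^ n * m)"
    using phi_psi_mult[of h g n, folded f_eq]
    by (simp_all add: inflate_mat_mult[OF phi_carrier psi_carrier, symmetric]
        inflate_mat_mult[OF psi_carrier phi_carrier, symmetric] inflate_scalar)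
qed

context
  fixes B \<epsilon> assumes B: "edge_mat B \<epsilon>"
begin

lemma edge_no:
  assumes "r < 2 ^ n" "s < 2 ^ n" "\<rho> < m" "\<sigma> < m" "\<And>j. \<not> cube_edge n j r s"
  shows "order_ge 2 (infl (B $$ (r, s)) $$ (\<rho>, \<sigma>))"
  using B assms by (intro infl_order) (auto simp: edge_mat_def)

lemma edge_yes:
  assumes rs: "r < 2 ^ n" "s < 2 ^ n" "\<rho> < m" "\<sigma> < m" and e: "cube_edge n j r s"
  shows "infl (B $$ (r, s)) $$ (\<rho>, \<sigma>) =
    mps_const (\<epsilon> r s) * ((if \<rho> = \<sigma> then mps_var (Suc j) else 0) - mps_const (A (Suc j) $$ (\<rho>, \<sigma>)) * mps_var 0)"
proof -
  have "Suc j \<in> {1..n}" using cube_edgeD[OF e] by auto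
  note l = infl_linear[OF this rs(3,4)]
  have neg: "mps_const (- 1) = - (1 :: 'k mps)" by (rule mps_eqI) (simp add: mcoeff_const mcoeff_one)
  have "\<epsilon> r s = 1 \<and> B $$ (r, s) = lin_form (Suc j) \<or> \<epsilon> r s = -1 \<and> B $$ (r, s) = - lin_form (Suc j)"
    using B rs(1,2) e by (auto simp: edge_mat_def)
  thus ?thesis
  proof
    assume "\<epsilon> r s = 1 \<and> B $$ (r, s) = lin_form (Suc j)"
    thus ?thesis using l by simp
  next
    assume *: "\<epsilon> r s = -1 \<and> B $$ (r, s) = - lin_form (Suc j)"
    thus ?thesis using l infl_uminus[OF rs(3,4), of "lin_form (Suc j)"] by (simp add: neg del: minus_diff_eq)
  qed
qed

lemma edge_const: "r < 2 ^ n \<Longrightarrow> s < 2 ^ n \<Longrightarrow> \<rho> < m \<Longrightarrow> \<sigma> < m \<Longrightarrow> mcoeff (infl (B $$ (r, s)) $$ (\<rho>, \<sigma>)) 0 = 0"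
proof (cases "\<exists>j. cube_edge n j r s")
  case True
  assume rs: "r < 2 ^ n" "s < 2 ^ n" "\<rho> < m" "\<sigma> < m"
  obtain j where "cube_edge n j r s" using True by blast
  thus ?thesis by (simp add: edge_yes[OF rs] mcoeff_var_0)
next
  case False
  assume rs: "r < 2 ^ n" "s < 2 ^ n" "\<rho> < m" "\<sigma> < m"
  thus ?thesis using edge_no[OF rs] False by (auto intro: order_geD)
qed

text \<open>Only entries at edges have linear terms, and the variable \<open>x_(j+1)\<close> of such
  a linear form is inflated with the identity matrix as coefficient. The matrices \<open>A i\<close>
  appear only with \<open>z\<close>.\<close>

lemma edge_x:
  assumes rs: "r < 2 ^ n" "s < 2 ^ n" "\<rho> < m" "\<sigma> < m"
  shows "mcoeff (infl (B $$ (r, s)) $$ (\<rho>, \<sigma>)) (single (Suc j) (Suc 0)) =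
    (if cube_edge n j r s \<and> \<rho> = \<sigma> then \<epsilon> r s else 0)"
proof (cases "\<exists>j. cube_edge n j r s")
  case True
  obtain j' where e: "cube_edge n j' r s" using True by blast
  have "single (Suc j) (Suc 0) \<noteq> single 0 (Suc 0)" unfolding single_one_eq_iff by simp
  moreover have "cube_edge n j r s \<longleftrightarrow> j = j'" using e cube_edge_unique by blast
  ultimately show ?thesis by (simp add: edge_yes[OF rs e] mcoeff_var)
next
  case False
  thus ?thesis using edge_no[OF rs] by (auto intro: order_geD)
qed

lemma edge_z:
  assumes rs: "r < 2 ^ n" "s < 2 ^ n" "\<rho> < m" "\<sigma> < m"
  shows "cube_edge n j r s \<Longrightarrow> mcoeff (infl (B $$ (r, s)) $$ (\<rho>, \<sigma>)) (single 0 (Suc 0)) = - \<epsilon> r s * A (Suc j) $$ (\<rho>, \<sigma>)"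
    and "(\<And>j. \<not> cube_edge n j r s) \<Longrightarrow> mcoeff (infl (B $$ (r, s)) $$ (\<rho>, \<sigma>)) (single 0 (Suc 0)) = 0"
proof -
  assume e: "cube_edge n j r s"
  have "single 0 (Suc 0) \<noteq> single (Suc j) (Suc 0)" unfolding single_one_eq_iff by simp
  thus "mcoeff (infl (B $$ (r, s)) $$ (\<rho>, \<sigma>)) (single 0 (Suc 0)) = - \<epsilon> r s * A (Suc j) $$ (\<rho>, \<sigma>)"
    by (simp add: edge_yes[OF rs e] mcoeff_var del: single_one)
next
  assume "\<And>j. \<not> cube_edge n j r s"
  thus "mcoeff (infl (B $$ (r, s)) $$ (\<rho>, \<sigma>)) (single 0 (Suc 0)) = 0"
    using order_geD[OF edge_no[OF rs]] by (simp del: single_one)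
qed

end

lemma \<Phi>_const_0: "i < 2 ^ n * m \<Longrightarrow> j < 2 ^ n * m \<Longrightarrow> mcoeff (\<Phi> $$ (i, j)) 0 = 0"
proof -
  assume ij: "i < 2 ^ n * m" "j < 2 ^ n * m"
  hence m: "m > 0" by (cases m) auto
  obtain \<epsilon> where "edge_mat \<phi> \<epsilon>" using edge_mat_phi by blast
  thus ?thesis unfolding inflate_mat_entry'[OF phi_carrier ij]
    by (rule edge_const) (use ij m in \<open>auto simp: less_mult_imp_div_less\<close>)
qed

lemma \<Phi>_MCM: "infinite (UNIV :: 'k set) \<Longrightarrow> MCM R M"
  by (rule M_MCM) (auto intro: \<Phi>_const_0)

end

section \<open>Constant terms of homomorphisms\<close>

text \<open>If two exponent vectors add up to one of degree 1, then one of them is 0.\<close>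

lemma mcoeff_times_single:
  "mcoeff (p * q) (single i (Suc 0)) =
    mcoeff p 0 * mcoeff q (single i (Suc 0)) + mcoeff p (single i (Suc 0)) * mcoeff q 0"
  for p q :: "'a :: comm_ring_1 mps"
proof -
  let ?e = "single i (Suc 0) :: nat \<Rightarrow>\<^sub>0 nat"
  have ne: "?e \<noteq> 0" using total_degree_single[of i "Suc 0"] by (metis One_nat_def total_degree_zero zero_neq_one)
  have "mon_splits ?e = {(0, ?e), (?e, 0)}"
  proof (intro equalityI subsetI)
    fix x assume "x \<in> mon_splits ?e"
    then obtain \<alpha> \<beta> where x: "x = (\<alpha>, \<beta>)" "\<alpha> + \<beta> = ?e" by auto
    have "total_degree \<alpha> + total_degree \<beta> = 1" using x(2) by (metis total_degree_add total_degree_single One_nat_def)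
    hence "\<alpha> = 0 \<or> \<beta> = 0" by (metis One_nat_def add_is_1 total_degree_eq_0_iff)
    thus "x \<in> {(0, ?e), (?e, 0)}" using x by auto
  qed auto
  thus ?thesis unfolding mcoeff_times using ne by simp
qed

lemma mat_mult_blocks:
  fixes P B :: "'a :: comm_semiring_0 mat"
  assumes "P \<in> carrier_mat R (c * m)" "B \<in> carrier_mat (c * m) C" "i < R" "j < C"
  shows "(P * B) $$ (i, j) = (\<Sum>t<c. \<Sum>\<tau><m. P $$ (i, t * m + \<tau>) * B $$ (t * m + \<tau>, j))"
proof -
  have "(P * B) $$ (i, j) = (\<Sum>k<c * m. P $$ (i, k) * B $$ (k, j))"
    using assms by (simp add: scalar_prod_def atLeast0LessThan)
  also have "\<dots> = (\<Sum>k<c * m. P $$ (i, k div m * m + k mod m) * B $$ (k div m * m + k mod m, j))"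
    by (simp only: div_mult_mod_eq)
  also have "\<dots> = (\<Sum>t<c. \<Sum>\<tau><m. P $$ (i, t * m + \<tau>) * B $$ (t * m + \<tau>, j))"
    by (rule sum_blocks)
  finally show ?thesis .
qed

lemma cube_edge_less: "cube_edge i j r s \<Longrightarrow> r < 2 ^ i"
proof (induction i arbitrary: r s)
  case (Suc i)
  consider "r < 2 ^ i" | "\<not> r < 2 ^ i" "s < 2 ^ i" | "\<not> r < 2 ^ i" "\<not> s < 2 ^ i" by blast
  thus ?case
  proof cases
    case 3
    hence "cube_edge i j (r - 2 ^ i) (s - 2 ^ i)" using Suc.prems by simp
    from Suc.IH[OF this] show ?thesis using 3 by simp
  qed (use Suc.prems in auto)
qed simp

text \<open>In terms of sets this is the case of a singleton. A value \<open>t \<ge> 2 ^ i\<close>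
  is excluded by size, since \<open>2 ^ a\<close> would lie strictly between two consecutive powers
  of two.\<close>

lemma cube_edge_power_two: "cube_edge i j (2 ^ a) t \<Longrightarrow> t = 0 \<and> j = a"
proof (induction i arbitrary: t)
  case (Suc i)
  show ?case
  proof (cases "(2 :: nat) ^ a < 2 ^ i")
    case True thus ?thesis using Suc by auto
  next
    case False
    have d: "2 ^ a = t + 2 ^ j \<and> j < Suc i" by (rule cube_edgeD[OF Suc.prems])
    show ?thesis
    proof (cases "t < 2 ^ i")
      case True
      hence "j = i" "2 ^ a = t + 2 ^ i" using Suc.prems False by auto
      moreover have "(2 :: nat) ^ a < 2 ^ Suc i" using True calculation by simp
      hence "a \<le> i" by (metis less_Suc_eq_le nat_power_less_imp_less pos2)
      hence "(2 :: nat) ^ a \<le> 2 ^ i" by (intro power_increasing) auto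
      ultimately have "t = 0" by simp
      thus ?thesis using d by simp
    next
      case t: False
      hence e: "cube_edge i j (2 ^ a - 2 ^ i) (t - 2 ^ i)" using Suc.prems False by simp
      have "j < i" using cube_edgeD[OF e] by simp
      moreover have "2 ^ a > (2 :: nat) ^ i" using d t by (metis add_gr_0 leI le_less_trans less_add_same_cancel1 pos2 zero_less_power)
      hence "i < a" by (metis nat_power_less_imp_less pos2)
      hence "Suc i \<le> a" by simp
      hence "(2 :: nat) ^ Suc i \<le> 2 ^ a" by (rule power_increasing) simp
      moreover have "(2 :: nat) ^ a - 2 ^ i < 2 ^ i" using e by (rule cube_edge_less)
      ultimately show ?thesis by simp
    qed
  qed
qed simp

section \<open>Comparison of coefficients in homomorphisms of inflated factorizations\<close>

locale inflation_pair =
  A: inflation n m f h g A + B: inflation n m' f h g A'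
  for n m m' :: nat and f :: "'k :: field mps" and h g and A A' :: "nat \<Rightarrow> 'k mat"
begin

sublocale matrix_factorization_pair n "2 ^ n * m" "2 ^ n * m'" f A.\<Phi> A.\<Psi> B.\<Phi> B.\<Psi> ..

abbreviation blk :: "'k mps mat \<Rightarrow> nat \<Rightarrow> nat \<Rightarrow> nat \<Rightarrow> nat \<Rightarrow> 'k mps" where
  "blk P r \<rho> s \<sigma> \<equiv> P $$ (r * m' + \<rho>, s * m + \<sigma>)"

abbreviation cst :: "'k mps mat \<Rightarrow> nat \<Rightarrow> nat \<Rightarrow> nat \<Rightarrow> nat \<Rightarrow> 'k" where
  "cst P r \<rho> s \<sigma> \<equiv> mcoeff (blk P r \<rho> s \<sigma>) 0"

lemma block_product_left:
  assumes P: "P \<in> mat_over n (2 ^ n * m') (2 ^ n * m)" and B: "B \<in> carrier_mat (2 ^ n) (2 ^ n)"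
    and rs: "r < 2 ^ n" "s < 2 ^ n" "\<rho> < m'" "\<sigma> < m"
  shows "blk (P * inflate_mat n m A B) r \<rho> s \<sigma> =
    (\<Sum>t<2 ^ n. \<Sum>\<tau><m. blk P r \<rho> t \<tau> * A.infl (B $$ (t, s)) $$ (\<tau>, \<sigma>))"
  by (subst mat_mult_blocks[OF mat_over_carrier[OF P] A.inflate_mat_carrier[OF B]])
    (use rs in \<open>auto simp: block_index_less A.inflate_mat_entry[OF B] intro!: sum.cong\<close>)

lemma block_product_right:
  assumes Q: "Q \<in> mat_over n (2 ^ n * m') (2 ^ n * m)" and B: "B \<in> carrier_mat (2 ^ n) (2 ^ n)"
    and rs: "r < 2 ^ n" "s < 2 ^ n" "\<rho> < m'" "\<sigma> < m"
  shows "blk (inflate_mat n m' A' B * Q) r \<rho> s \<sigma> =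
    (\<Sum>t<2 ^ n. \<Sum>\<tau><m'. B.infl (B $$ (r, t)) $$ (\<rho>, \<tau>) * blk Q t \<tau> s \<sigma>)"
  by (subst mat_mult_blocks[OF B.inflate_mat_carrier[OF B] mat_over_carrier[OF Q]])
    (use rs in \<open>auto simp: block_index_less B.inflate_mat_entry[OF B] intro!: sum.cong\<close>)

text \<open>The inflated matrices have no constant terms, so in degree 1 only the constant terms of
  \<open>P\<close> and \<open>Q\<close> are involved.\<close>

lemma linear_terms:
  assumes P: "P \<in> mat_over n (2 ^ n * m') (2 ^ n * m)" and Q: "Q \<in> mat_over n (2 ^ n * m') (2 ^ n * m)"
    and B: "A.edge_mat B \<epsilon>" and PQ: "P * inflate_mat n m A B = inflate_mat n m' A' B * Q"
    and rs: "r < 2 ^ n" "s < 2 ^ n" "\<rho> < m'" "\<sigma> < m"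
  shows "(\<Sum>t<2 ^ n. \<Sum>\<tau><m. cst P r \<rho> t \<tau> * mcoeff (A.infl (B $$ (t, s)) $$ (\<tau>, \<sigma>)) (single i (Suc 0))) =
    (\<Sum>t<2 ^ n. \<Sum>\<tau><m'. mcoeff (B.infl (B $$ (r, t)) $$ (\<rho>, \<tau>)) (single i (Suc 0)) * cst Q t \<tau> s \<sigma>)"
proof -
  have Bc: "B \<in> carrier_mat (2 ^ n) (2 ^ n)" using B by (simp add: A.edge_mat_def)
  have "mcoeff (blk (P * inflate_mat n m A B) r \<rho> s \<sigma>) (single i (Suc 0)) =
     mcoeff (blk (inflate_mat n m' A' B * Q) r \<rho> s \<sigma>) (single i (Suc 0))" by (simp only: PQ)
  thus ?thesis unfolding block_product_left[OF P Bc rs] block_product_right[OF Q Bc rs]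
    using rs by (simp add: mcoeff_times_single A.edge_const[OF B] B.edge_const[OF B])
qed

text \<open>Coefficient of the variable with index \<open>Suc j\<close> in block row
  \<open>r\<close> and block column \<open>s'\<close>. On the left only the block
  \<open>t = s\<close> contributes, the unique vertex that becomes \<open>s'\<close> on losing
  \<open>j\<close>; on the right only the vertex that arises from \<open>r\<close> by removing
  \<open>j\<close>, if \<open>r\<close> contains \<open>j\<close>.\<close>

lemma shift_relation:
  assumes P: "P \<in> mat_over n (2 ^ n * m') (2 ^ n * m)" and Q: "Q \<in> mat_over n (2 ^ n * m') (2 ^ n * m)"
    and B: "A.edge_mat B \<epsilon>" and PQ: "P * inflate_mat n m A B = inflate_mat n m' A' B * Q"
    and r: "r < 2 ^ n" and s: "s < 2 ^ n" and e: "cube_edge n j s s'" and \<rho>\<sigma>: "\<rho> < m'" "\<sigma> < m"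
  shows "cube_edge n j r t \<Longrightarrow> \<epsilon> s s' * cst P r \<rho> s \<sigma> = \<epsilon> r t * cst Q t \<rho> s' \<sigma>"
    and "(\<And>t. \<not> cube_edge n j r t) \<Longrightarrow> cst P r \<rho> s \<sigma> = 0"
proof -
  have s': "s' < 2 ^ n" using cube_edgeD[OF e] s by simp
  have "\<epsilon> s s' = 1 \<or> \<epsilon> s s' = -1" using B s s' e unfolding A.edge_mat_def by blast
  hence eps: "\<epsilon> s s' \<noteq> 0" by auto
  have e_iff: "cube_edge n j t s' \<longleftrightarrow> t = s" for t using cube_edgeD[of n j t s'] cube_edgeD[OF e] e by auto
  have "(\<Sum>t<2 ^ n. \<Sum>\<tau><m. cst P r \<rho> t \<tau> * mcoeff (A.infl (B $$ (t, s')) $$ (\<tau>, \<sigma>)) (single (Suc j) (Suc 0))) =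
      (\<Sum>t<2 ^ n. \<Sum>\<tau><m. if t = s then if \<tau> = \<sigma> then cst P r \<rho> t \<tau> * \<epsilon> t s' else 0 else 0)"
    using s' \<rho>\<sigma> by (intro sum.cong refl) (simp add: A.edge_x[OF B] e_iff)
  also have "\<dots> = (\<Sum>t<2 ^ n. if t = s then cst P r \<rho> t \<sigma> * \<epsilon> t s' else 0)"
    using \<rho>\<sigma> by (intro sum.cong refl) simp
  also have "\<dots> = \<epsilon> s s' * cst P r \<rho> s \<sigma>" using s by simp
  finally have L: "\<epsilon> s s' * cst P r \<rho> s \<sigma> =
      (\<Sum>t<2 ^ n. \<Sum>\<tau><m'. mcoeff (B.infl (B $$ (r, t)) $$ (\<rho>, \<tau>)) (single (Suc j) (Suc 0)) * cst Q t \<tau> s' \<sigma>)"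
    using linear_terms[OF P Q B PQ r s' \<rho>\<sigma>, of "Suc j"] by simp
  show "\<epsilon> s s' * cst P r \<rho> s \<sigma> = \<epsilon> r t * cst Q t \<rho> s' \<sigma>" if t: "cube_edge n j r t"
  proof -
    have tn: "t < 2 ^ n" using cube_edgeD[OF t] r by simp
    have t_iff: "cube_edge n j r u \<longleftrightarrow> u = t" for u using cube_edgeD[of n j r u] cube_edgeD[OF t] t by auto
    note L
    also have "(\<Sum>t<2 ^ n. \<Sum>\<tau><m'. mcoeff (B.infl (B $$ (r, t)) $$ (\<rho>, \<tau>)) (single (Suc j) (Suc 0)) * cst Q t \<tau> s' \<sigma>) =
        (\<Sum>u<2 ^ n. \<Sum>\<tau><m'. if u = t then if \<tau> = \<rho> then \<epsilon> r u * cst Q u \<tau> s' \<sigma> else 0 else 0)"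
      using r \<rho>\<sigma> by (intro sum.cong refl) (auto simp: B.edge_x[OF B] t_iff)
    also have "\<dots> = (\<Sum>u<2 ^ n. if u = t then \<epsilon> r u * cst Q u \<rho> s' \<sigma> else 0)"
      using \<rho>\<sigma> by (intro sum.cong refl) simp
    also have "\<dots> = \<epsilon> r t * cst Q t \<rho> s' \<sigma>" using tn by simp
    finally show ?thesis .
  qed
  show "cst P r \<rho> s \<sigma> = 0" if no: "\<And>t. \<not> cube_edge n j r t"
  proof -
    have "(\<Sum>t<2 ^ n. \<Sum>\<tau><m'. mcoeff (B.infl (B $$ (r, t)) $$ (\<rho>, \<tau>)) (single (Suc j) (Suc 0)) * cst Q t \<tau> s' \<sigma>) = 0"
      using r \<rho>\<sigma> by (intro sum.neutral ballI) (simp add: B.edge_x[OF B] no)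
    thus ?thesis using L eps by simp
  qed
qed

text \<open>Multiplied by \<open>B.\<Phi>\<close> from the left, both sides become \<open>f\<close>
  times \<open>P\<close>, and \<open>B.\<Phi>\<close> is injective.\<close>

lemma psi_relation:
  assumes P: "P \<in> mat_over n (2 ^ n * m') (2 ^ n * m)" and Q: "Q \<in> mat_over n (2 ^ n * m') (2 ^ n * m)"
    and PQ: "P * A.\<Phi> = B.\<Phi> * Q"
  shows "Q * A.\<Psi> = B.\<Psi> * P"
proof (rule mat_eq_by_vecs[where n = n])
  note c = mat_over_carrier[OF P] mat_over_carrier[OF Q] A.\<Phi>_carrier A.\<Psi>_carrier B.\<Phi>_carrier B.\<Psi>_carrier
  show "Q * A.\<Psi> \<in> carrier_mat (2 ^ n * m') (2 ^ n * m)" "B.\<Psi> * P \<in> carrier_mat (2 ^ n * m') (2 ^ n * m)"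
    using c by auto
  fix v :: "'k mps vec" assume v: "v \<in> free_vecs n (2 ^ n * m)"
  note vc = A.V_carrier[OF v]
  have \<Psi>v: "A.\<Psi> *\<^sub>v v \<in> A.V" and Pv: "P *\<^sub>v v \<in> B.V" by (rule mat_over_mult_vec[OF A.\<Psi> v] mat_over_mult_vec[OF P v])+
  have 1: "(Q * A.\<Psi>) *\<^sub>v v = Q *\<^sub>v (A.\<Psi> *\<^sub>v v)" "(B.\<Psi> * P) *\<^sub>v v = B.\<Psi> *\<^sub>v (P *\<^sub>v v)"
    by (rule assoc_mult_mat_vec[OF c(2,4) vc] assoc_mult_mat_vec[OF c(6,1) vc])+
  have "B.\<Phi> *\<^sub>v (Q *\<^sub>v (A.\<Psi> *\<^sub>v v)) = P *\<^sub>v (A.\<Phi> *\<^sub>v (A.\<Psi> *\<^sub>v v))"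
    using assoc_mult_mat_vec[OF c(5,2) A.V_carrier[OF \<Psi>v]] assoc_mult_mat_vec[OF c(1,3) A.V_carrier[OF \<Psi>v]] PQ by metis
  also have "\<dots> = f \<cdot>\<^sub>v (P *\<^sub>v v)" unfolding A.\<Phi>\<Psi>_vec[OF v] by (rule mult_mat_smult_vec[OF c(1) vc])
  also have "\<dots> = B.\<Phi> *\<^sub>v (B.\<Psi> *\<^sub>v (P *\<^sub>v v))" by (rule B.\<Phi>\<Psi>_vec[OF Pv, symmetric])
  finally show "(Q * A.\<Psi>) *\<^sub>v v = (B.\<Psi> * P) *\<^sub>v v"
    unfolding 1 by (rule B.\<Phi>_inj[OF mat_over_mult_vec[OF Q \<Psi>v] mat_over_mult_vec[OF B.\<Psi> Pv]])
qed

end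

text \<open>The diagonal is required to vanish separately, so that no division by 2 occurs and
  fields of characteristic 2 are included.\<close>

lemma alternating_sum_zero:
  fixes G :: "nat \<Rightarrow> nat \<Rightarrow> 'a :: ab_group_add"
  assumes "\<And>i. i \<in> {1..n} \<Longrightarrow> G i i = 0" "\<And>i j. i \<in> {1..n} \<Longrightarrow> j \<in> {1..n} \<Longrightarrow> i \<noteq> j \<Longrightarrow> G i j + G j i = 0"
  shows "(\<Sum>i = 1..n. \<Sum>j = 1..n. G i j) = 0"
  using assms
proof (induction n)
  case (Suc n)
  have 0: "(\<Sum>i = 1..n. \<Sum>j = 1..n. G i j) = 0" by (rule Suc.IH) (use Suc.prems in auto)
  have "(\<Sum>i = 1..Suc n. \<Sum>j = 1..Suc n. G i j) =
      (\<Sum>i = 1..n. \<Sum>j = 1..n. G i j) + (\<Sum>i = 1..n. G i (Suc n) + G (Suc n) i) + G (Suc n) (Suc n)"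
    by (simp add: sum.distrib algebra_simps)
  also have "(\<Sum>i = 1..n. G i (Suc n) + G (Suc n) i) = 0" by (rule sum.neutral) (use Suc.prems(2) in auto)
  finally show ?case using 0 Suc.prems(1) by simp
qed simp

lemma order_ge_sum: "(\<And>i. i \<in> I \<Longrightarrow> order_ge d (p i)) \<Longrightarrow> order_ge d (sum p I)"
  for p :: "_ \<Rightarrow> 'a :: comm_ring_1 mps"
  by (simp add: order_ge_def)

text \<open>Substituting \<open>x\<^sub>i \<mapsto> A\<^sub>i z\<close> kills all \<open>x\<^sub>i - A\<^sub>i z\<close>; spelled out for the quadratic coefficients.\<close>

lemma (in linear_rep) quadratic_terms:
  fixes p :: "nat \<Rightarrow> nat \<Rightarrow> 'k mps" and w :: "nat \<Rightarrow> 'k mps"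
  assumes ord: "\<And>\<sigma>. \<sigma> < m \<Longrightarrow> order_ge 3 (mps_var 0 * (mps_var 0 * w \<sigma>) +
      (\<Sum>i = 1..n. \<Sum>\<tau><m. ((if \<tau> = \<sigma> then mps_var i else 0) - mps_const (A i $$ (\<tau>, \<sigma>)) * mps_var 0) * p i \<tau>))"
    and \<sigma>: "\<sigma> < m"
  shows "mcoeff (w \<sigma>) 0 = 0"
proof -
  define e where "e a = single a (Suc 0)" for a :: nat
  have le: "lookup (e a) i = (if i = a then 1 else 0)" for a i
    by (auto simp: e_def lookup_single when_def simp del: single_one)
  have ve: "mcoeff (mps_var i * q) \<mu> = (if lookup \<mu> i = 0 then 0 else mcoeff q (\<mu> - e i))" for i q and \<mu> :: "nat \<Rightarrow>\<^sub>0 nat"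
    by (simp add: mcoeff_var_times e_def del: single_one)
  have v1: "mcoeff (mps_var i * q) (e a) = (if i = a then mcoeff q 0 else 0)" for i a q
    by (simp add: ve le)
  have v2: "mcoeff (mps_var i * q) (e a + e b) = (if i = a then mcoeff q (e b) else if i = b then mcoeff q (e a) else 0)" for i a b q
    by (auto simp: ve le lookup_add)
  have deg: "total_degree (e a + e b) = 2" for a b
    unfolding e_def total_degree_add total_degree_single by simp
  \<comment> \<open>The linear coefficients of the \<open>p i\<close>; the index 0 stands for
    \<open>z\<close>. The vanishing coefficients at \<open>x_i x_j\<close>, \<open>x_i^2\<close>,
    \<open>x_j z\<close> and \<open>z^2\<close> give equations between them.\<close>
  define D where "D i a \<tau> = mcoeff (p i \<tau>) (e a)" for i a \<tau>
  have eq: "0 = (if a = 0 \<and> b = 0 then mcoeff (w \<sigma>) 0 else 0) +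
      (\<Sum>i = 1..n. (if i = a then D i b \<sigma> else if i = b then D i a \<sigma> else 0) -
        (\<Sum>\<tau><m. A i $$ (\<tau>, \<sigma>) * (if 0 = a then D i b \<tau> else if 0 = b then D i a \<tau> else 0)))"
    if "\<sigma> < m" for a b \<sigma>
  proof -
    have "0 = mcoeff (mps_var 0 * (mps_var 0 * w \<sigma>) +
      (\<Sum>i = 1..n. \<Sum>\<tau><m. ((if \<tau> = \<sigma> then mps_var i else 0) - mps_const (A i $$ (\<tau>, \<sigma>)) * mps_var 0) * p i \<tau>)) (e a + e b)"
      by (rule order_geD[OF ord[OF that], symmetric]) (simp add: deg)
    also have "\<dots> = (if a = 0 \<and> b = 0 then mcoeff (w \<sigma>) 0 else 0) +
        (\<Sum>i = 1..n. \<Sum>\<tau><m. (if \<tau> = \<sigma> then (if i = a then D i b \<sigma> else if i = b then D i a \<sigma> else 0) else 0) -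
        A i $$ (\<tau>, \<sigma>) * (if 0 = a then D i b \<tau> else if 0 = b then D i a \<tau> else 0))"
      unfolding mcoeff_add mcoeff_sum
    proof (rule arg_cong2[where f = "(+)"])
      show "mcoeff (mps_var 0 * (mps_var 0 * w \<sigma>)) (e a + e b) = (if a = 0 \<and> b = 0 then mcoeff (w \<sigma>) 0 else 0)"
        by (auto simp: v2 v1)
    qed (intro sum.cong refl, auto simp: left_diff_distrib mult.assoc v2 D_def)
    also have "\<dots> = (if a = 0 \<and> b = 0 then mcoeff (w \<sigma>) 0 else 0) +
        (\<Sum>i = 1..n. (if i = a then D i b \<sigma> else if i = b then D i a \<sigma> else 0) -
        (\<Sum>\<tau><m. A i $$ (\<tau>, \<sigma>) * (if 0 = a then D i b \<tau> else if 0 = b then D i a \<tau> else 0)))"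
      using that by (simp add: sum_subtractf)
    finally show ?thesis .
  qed
  have xx: "D i j \<sigma> + D j i \<sigma> = 0" if "i \<in> {1..n}" "j \<in> {1..n}" "i \<noteq> j" "\<sigma> < m" for i j \<sigma>
  proof -
    have "(\<Sum>l = 1..n. (if l = i then D l j \<sigma> else if l = j then D l i \<sigma> else 0) -
        (\<Sum>\<tau><m. A l $$ (\<tau>, \<sigma>) * (if 0 = i then D l j \<tau> else if 0 = j then D l i \<tau> else 0))) =
      (\<Sum>l = 1..n. (if l = i then D i j \<sigma> else 0) + (if l = j then D j i \<sigma> else 0))"
      by (intro sum.cong refl) (use that in auto)
    from eq[OF that(4), of i j, unfolded this] show ?thesis using that by (simp add: sum.distrib)
  qed
  \<comment> \<open>The coefficient at the square of \<open>x_i\<close> is \<open>D i i\<close>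
    itself and not twice it.\<close>
  have ii: "D i i \<sigma> = 0" if "i \<in> {1..n}" "\<sigma> < m" for i \<sigma>
  proof -
    have "(\<Sum>l = 1..n. (if l = i then D l i \<sigma> else if l = i then D l i \<sigma> else 0) -
        (\<Sum>\<tau><m. A l $$ (\<tau>, \<sigma>) * (if 0 = i then D l i \<tau> else if 0 = i then D l i \<tau> else 0))) =
      (\<Sum>l = 1..n. if l = i then D i i \<sigma> else 0)"
      by (intro sum.cong refl) (use that in auto)
    from eq[OF that(2), of i i, unfolded this] show ?thesis using that by simp
  qed
  have xz: "D j 0 \<sigma> = (\<Sum>i = 1..n. \<Sum>\<tau><m. A i $$ (\<tau>, \<sigma>) * D i j \<tau>)" if "j \<in> {1..n}" "\<sigma> < m" for j \<sigma>
  proof -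
    have "(\<Sum>l = 1..n. (if l = j then D l 0 \<sigma> else if l = 0 then D l j \<sigma> else 0) -
        (\<Sum>\<tau><m. A l $$ (\<tau>, \<sigma>) * (if 0 = j then D l 0 \<tau> else if 0 = (0 :: nat) then D l j \<tau> else 0))) =
      (\<Sum>l = 1..n. (if l = j then D j 0 \<sigma> else 0) - (\<Sum>\<tau><m. A l $$ (\<tau>, \<sigma>) * D l j \<tau>))"
      by (intro sum.cong refl) (use that in auto)
    from eq[OF that(2), of j 0, unfolded this] show ?thesis using that by (simp add: sum_subtractf)
  qed
  have "mcoeff (w \<sigma>) 0 = (\<Sum>i = 1..n. \<Sum>\<tau><m. A i $$ (\<tau>, \<sigma>) * D i 0 \<tau>)"
  proof -
    have "(\<Sum>l = 1..n. (if l = 0 then D l 0 \<sigma> else if l = 0 then D l 0 \<sigma> else 0) -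
        (\<Sum>\<tau><m. A l $$ (\<tau>, \<sigma>) * (if 0 = (0 :: nat) then D l 0 \<tau> else if 0 = (0 :: nat) then D l 0 \<tau> else 0))) =
      (\<Sum>l = 1..n. - (\<Sum>\<tau><m. A l $$ (\<tau>, \<sigma>) * D l 0 \<tau>))"
      by (intro sum.cong refl) auto
    from eq[OF \<sigma>, of 0 0, unfolded this] show ?thesis by (simp add: sum_negf)
  qed
  also have "\<dots> = (\<Sum>i = 1..n. \<Sum>\<tau><m. \<Sum>j = 1..n. \<Sum>\<kappa><m. D j i \<kappa> * (A j $$ (\<kappa>, \<tau>) * A i $$ (\<tau>, \<sigma>)))"
    by (intro sum.cong refl) (auto simp: xz sum_distrib_left ac_simps)
  also have "\<dots> = (\<Sum>i = 1..n. \<Sum>j = 1..n. \<Sum>\<tau><m. \<Sum>\<kappa><m. D j i \<kappa> * (A j $$ (\<kappa>, \<tau>) * A i $$ (\<tau>, \<sigma>)))"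
    by (intro sum.cong refl sum.swap)
  also have "\<dots> = (\<Sum>i = 1..n. \<Sum>j = 1..n. \<Sum>\<kappa><m. \<Sum>\<tau><m. D j i \<kappa> * (A j $$ (\<kappa>, \<tau>) * A i $$ (\<tau>, \<sigma>)))"
    by (intro sum.cong refl sum.swap)
  also have "\<dots> = (\<Sum>i = 1..n. \<Sum>j = 1..n. \<Sum>\<kappa><m. D j i \<kappa> * (A j * A i) $$ (\<kappa>, \<sigma>))"
  proof (intro sum.cong refl)
    fix i j \<kappa> assume "i \<in> {1..n}" "j \<in> {1..n}" "\<kappa> \<in> {..<m}"
    thus "(\<Sum>\<tau><m. D j i \<kappa> * (A j $$ (\<kappa>, \<tau>) * A i $$ (\<tau>, \<sigma>))) = D j i \<kappa> * (A j * A i) $$ (\<kappa>, \<sigma>)"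
      using A_dim[of i] A_dim[of j] \<sigma> by (simp add: scalar_prod_def atLeast0LessThan sum_distrib_left)
  qed
  \<comment> \<open>\<open>D\<close> is antisymmetric in its two variable indices, whereas
    \<open>A j * A i\<close> is symmetric in them.\<close>
  also have "\<dots> = 0"
  proof (rule alternating_sum_zero)
    fix i j assume ij: "i \<in> {1..n}" "j \<in> {1..n}" "i \<noteq> j"
    have "(\<Sum>\<kappa><m. D j i \<kappa> * (A j * A i) $$ (\<kappa>, \<sigma>)) + (\<Sum>\<kappa><m. D i j \<kappa> * (A i * A j) $$ (\<kappa>, \<sigma>)) =
        (\<Sum>\<kappa><m. (D j i \<kappa> + D i j \<kappa>) * (A j * A i) $$ (\<kappa>, \<sigma>))"
      by (simp add: A_comm[OF ij(1,2)] sum.distrib distrib_right)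
    also have "\<dots> = 0" by (rule sum.neutral) (use xx[OF ij(2,1)] ij(3) in auto)
    finally show "(\<Sum>\<kappa><m. D j i \<kappa> * (A j * A i) $$ (\<kappa>, \<sigma>)) + (\<Sum>\<kappa><m. D i j \<kappa> * (A i * A j) $$ (\<kappa>, \<sigma>)) = 0" .
  qed (simp add: ii)
  finally show ?thesis .
qed

context inflation_pair
begin

text \<open>Compare the upper left blocks of both products. The first column of
  \<open>\<phi>\<close> consists of \<open>z^2\<close>, linear forms up to sign at the powers of
  two, and zeros; the first row consists of \<open>z^2\<close> and entries of order at least 3. So
  \<open>z^2\<close> times the difference of the two corner series, plus a combination of the
  inflated linear forms, has order at least 3, and \<open>quadratic_terms\<close> applies.\<close>

lemma const_corner:
  assumes P: "P \<in> mat_over n (2 ^ n * m') (2 ^ n * m)" and Q: "Q \<in> mat_over n (2 ^ n * m') (2 ^ n * m)"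
    and PQ: "P * A.\<Phi> = B.\<Phi> * Q" and \<rho>: "\<rho> < m'" and \<sigma>: "\<sigma> < m"
  shows "cst P 0 \<rho> 0 \<sigma> = cst Q 0 \<rho> 0 \<sigma>"
proof -
  obtain \<epsilon> where B: "A.edge_mat A.\<phi> \<epsilon>" using A.edge_mat_phi by blast
  have st: "(s < r \<longrightarrow> (\<forall>j. \<not> cube_edge n j r s) \<longrightarrow> A.\<phi> $$ (r, s) = 0) \<and> (r < s \<longrightarrow> order_ge 3 (A.\<phi> $$ (r, s)))"
    if "r < 2 ^ n" "s < 2 ^ n" for r s
    using phi_psi_structure[where n = n and h = h and g = g, OF A.h_order A.g_order order_refl that] by blast
  have zsqA: "A.infl (z_var ^ 2) $$ (\<tau>, \<sigma>) = (if \<tau> = \<sigma> then mps_var 0 * mps_var 0 else 0)" if "\<tau> < m" "\<sigma> < m" for \<tau> \<sigma>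
  proof -
    have "extend_scalars (mps_var 0 * mps_var 0 :: 'k mps) = z_var ^ 2"
      unfolding power2_eq_square mps_var_eq_monom mps_monom_add[symmetric]
      by (rule mps_eqI) (auto simp: extend_scalars_def mcoeff_monom)
    thus ?thesis using A.infl_extend[OF that, of "mps_var 0 * mps_var 0"] by simp
  qed
  have zsqB: "B.infl (z_var ^ 2) $$ (\<tau>, \<sigma>) = (if \<tau> = \<sigma> then mps_var 0 * mps_var 0 else 0)" if "\<tau> < m'" "\<sigma> < m'" for \<tau> \<sigma>
  proof -
    have "extend_scalars (mps_var 0 * mps_var 0 :: 'k mps) = z_var ^ 2"
      unfolding power2_eq_square mps_var_eq_monom mps_monom_add[symmetric]
      by (rule mps_eqI) (auto simp: extend_scalars_def mcoeff_monom)
    thus ?thesis using B.infl_extend[OF that, of "mps_var 0 * mps_var 0"] by simp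
  qed
  \<comment> \<open>The form for \<open>x_i\<close> sits at the vertex with the single element
    \<open>i - 1\<close>; its sign is absorbed into the cofactor.\<close>
  define p where "p i \<tau> = mps_const (\<epsilon> (2 ^ (i - 1)) 0) * blk P 0 \<rho> (2 ^ (i - 1)) \<tau>" for i \<tau>
  have ord: "order_ge 3 (mps_var 0 * (mps_var 0 * (blk P 0 \<rho> 0 \<sigma> - blk Q 0 \<rho> 0 \<sigma>)) +
      (\<Sum>i = 1..n. \<Sum>\<tau><m. ((if \<tau> = \<sigma> then mps_var i else 0) - mps_const (A i $$ (\<tau>, \<sigma>)) * mps_var 0) * p i \<tau>))"
    if \<sigma>: "\<sigma> < m" for \<sigma>
  proof -
    let ?T = "\<lambda>t. \<Sum>\<tau><m. blk P 0 \<rho> t \<tau> * A.infl (A.\<phi> $$ (t, 0)) $$ (\<tau>, \<sigma>)"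
    let ?I = "(\<lambda>i. 2 ^ (i - 1)) ` {1..n} :: nat set"
    have I: "?I \<subseteq> {..<2 ^ n}" by (auto intro!: power_strict_increasing)
    have inj: "inj_on (\<lambda>i. 2 ^ (i - 1) :: nat) {1..n}" by (auto simp: inj_on_def)
    have "blk (P * A.\<Phi>) 0 \<rho> 0 \<sigma> = sum ?T {..<2 ^ n}"
      by (rule block_product_left[OF P phi_carrier]) (use \<rho> \<sigma> in auto)
    also have "\<dots> = sum ?T (insert 0 ?I)"
    proof (rule sum.mono_neutral_right)
      show "\<forall>t\<in>{..<2 ^ n} - insert 0 ?I. ?T t = 0"
      proof
        fix t assume t: "t \<in> {..<2 ^ n} - insert 0 ?I"
        have "\<not> cube_edge n j t 0" for j
        proof
          assume "cube_edge n j t 0"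
          hence "t = 2 ^ (Suc j - 1)" "Suc j \<in> {1..n}" using cube_edgeD by fastforce+
          thus False using t by blast
        qed
        hence "A.\<phi> $$ (t, 0) = 0" using st[of t 0] t by auto
        thus "?T t = 0" using \<sigma> by (simp add: A.infl_zero)
      qed
    qed (use I in auto)
    also have "\<dots> = ?T 0 + sum ?T ?I" by (rule sum.insert) auto
    also have "?T 0 = mps_var 0 * (mps_var 0 * blk P 0 \<rho> 0 \<sigma>)"
    proof -
      have "?T 0 = (\<Sum>\<tau><m. if \<tau> = \<sigma> then mps_var 0 * (mps_var 0 * blk P 0 \<rho> 0 \<sigma>) else 0)"
        unfolding phi_00 using \<sigma> by (intro sum.cong refl) (auto simp: zsqA ac_simps)
      thus ?thesis using \<sigma> by simp
    qed
    also have "sum ?T ?I = (\<Sum>i = 1..n. ?T (2 ^ (i - 1)))" by (simp only: sum.reindex[OF inj] o_def)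
    also have "\<dots> = (\<Sum>i = 1..n. \<Sum>\<tau><m. ((if \<tau> = \<sigma> then mps_var i else 0) - mps_const (A i $$ (\<tau>, \<sigma>)) * mps_var 0) * p i \<tau>)"
    proof (intro sum.cong refl)
      fix i \<tau> assume i: "i \<in> {1..n}" and \<tau>: "\<tau> \<in> {..<m}"
      hence e: "cube_edge n (i - 1) (2 ^ (i - 1)) 0" by (intro cube_edge_0) auto
      have "(2 :: nat) ^ (i - 1) < 2 ^ n" using i by (intro power_strict_increasing) auto
      thus "blk P 0 \<rho> (2 ^ (i - 1)) \<tau> * A.infl (A.\<phi> $$ (2 ^ (i - 1), 0)) $$ (\<tau>, \<sigma>) =
          ((if \<tau> = \<sigma> then mps_var i else 0) - mps_const (A i $$ (\<tau>, \<sigma>)) * mps_var 0) * p i \<tau>"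
        using A.edge_yes[OF B _ _ _ _ e, of \<tau> \<sigma>] \<tau> \<sigma> i by (simp add: p_def ac_simps)
    qed
    finally have L: "blk (P * A.\<Phi>) 0 \<rho> 0 \<sigma> = mps_var 0 * (mps_var 0 * blk P 0 \<rho> 0 \<sigma>) +
      (\<Sum>i = 1..n. \<Sum>\<tau><m. ((if \<tau> = \<sigma> then mps_var i else 0) - mps_const (A i $$ (\<tau>, \<sigma>)) * mps_var 0) * p i \<tau>)" .
    let ?S = "\<lambda>t. \<Sum>\<tau><m'. B.infl (A.\<phi> $$ (0, t)) $$ (\<rho>, \<tau>) * blk Q t \<tau> 0 \<sigma>"
    have "blk (B.\<Phi> * Q) 0 \<rho> 0 \<sigma> = sum ?S {..<2 ^ n}"
      by (rule block_product_right[OF Q phi_carrier]) (use \<rho> \<sigma> in auto)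
    also have "\<dots> = ?S 0 + sum ?S ({..<2 ^ n} - {0})" by (rule sum.remove) auto
    also have "?S 0 = mps_var 0 * (mps_var 0 * blk Q 0 \<rho> 0 \<sigma>)"
    proof -
      have "?S 0 = (\<Sum>\<tau><m'. if \<tau> = \<rho> then mps_var 0 * (mps_var 0 * blk Q 0 \<rho> 0 \<sigma>) else 0)"
        unfolding phi_00 using \<rho> by (intro sum.cong refl) (auto simp: zsqB ac_simps)
      thus ?thesis using \<rho> by simp
    qed
    finally have "mps_var 0 * (mps_var 0 * (blk P 0 \<rho> 0 \<sigma> - blk Q 0 \<rho> 0 \<sigma>)) +
      (\<Sum>i = 1..n. \<Sum>\<tau><m. ((if \<tau> = \<sigma> then mps_var i else 0) - mps_const (A i $$ (\<tau>, \<sigma>)) * mps_var 0) * p i \<tau>) =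
      sum ?S ({..<2 ^ n} - {0})"
      using L PQ by (simp add: algebra_simps)
    moreover have "order_ge 3 (sum ?S ({..<2 ^ n} - {0}))"
    proof (intro order_ge_sum)
      fix t \<tau> assume t: "t \<in> {..<2 ^ n} - {0 :: nat}" and \<tau>: "\<tau> \<in> {..<m'}"
      have "order_ge 3 (A.\<phi> $$ (0, t))" using st[of 0 t] t by auto
      hence "order_ge 3 (B.infl (A.\<phi> $$ (0, t)) $$ (\<rho>, \<tau>))" using \<rho> \<tau> by (intro B.infl_order) auto
      from order_ge_mult[OF this, of 0] show "order_ge 3 (B.infl (A.\<phi> $$ (0, t)) $$ (\<rho>, \<tau>) * blk Q t \<tau> 0 \<sigma>)" by simp
    qed
    ultimately show ?thesis by simp
  qed
  have "mcoeff (blk P 0 \<rho> 0 \<sigma> - blk Q 0 \<rho> 0 \<sigma>) 0 = 0"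
    by (rule A.quadratic_terms[OF ord \<sigma>])
  thus ?thesis by simp
qed

text \<open>Strong induction on the block column. Removing an element \<open>j\<close> from
  \<open>s\<close> leads to an earlier column, and \<open>shift_relation\<close> either moves row
  \<open>r\<close> to the row without \<open>j\<close> or gives 0. Each move exchanges
  \<open>P\<close> and \<open>Q\<close>, so both are treated together; \<open>const_corner\<close>
  starts the induction with equal diagonal blocks.\<close>

lemma const_triangular:
  assumes P: "P \<in> mat_over n (2 ^ n * m') (2 ^ n * m)" and Q: "Q \<in> mat_over n (2 ^ n * m') (2 ^ n * m)"
    and PQ: "P * A.\<Phi> = B.\<Phi> * Q" and \<rho>: "\<rho> < m'" and \<sigma>: "\<sigma> < m" and s: "s < 2 ^ n"
  shows "(\<forall>r<s. cst P r \<rho> s \<sigma> = 0 \<and> cst Q r \<rho> s \<sigma> = 0) \<and> cst P s \<rho> s \<sigma> = cst P 0 \<rho> 0 \<sigma> \<and> cst Q s \<rho> s \<sigma> = cst P 0 \<rho> 0 \<sigma>"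
  using s
proof (induction s rule: less_induct)
  case (less s)
  note QP = psi_relation[OF P Q PQ]
  obtain \<epsilon> \<delta> where B: "A.edge_mat A.\<phi> \<epsilon>" "A.edge_mat A.\<psi> \<delta>" using A.edge_mat_phi A.edge_mat_psi by blast
  show ?case
  proof (cases "s = 0")
    case True
    thus ?thesis using const_corner[OF P Q PQ \<rho> \<sigma>] by simp
  next
    case False
    then obtain j s' where e: "cube_edge n j s s'" using cube_edge_exists less.prems by blast
    have ss': "s = s' + 2 ^ j" using cube_edgeD[OF e] by simp
    hence lt: "s' < s" "s' < 2 ^ n" using less.prems by auto
    note IH = less.IH[OF lt]
    have nz: "\<epsilon> s s' \<noteq> 0" "\<delta> s s' \<noteq> 0"
    proof -
      have "\<epsilon> s s' = 1 \<or> \<epsilon> s s' = -1" "\<delta> s s' = 1 \<or> \<delta> s s' = -1"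
        using B e less.prems lt(2) unfolding A.edge_mat_def by blast+
      thus "\<epsilon> s s' \<noteq> 0" "\<delta> s s' \<noteq> 0" by auto
    qed
    note relP = shift_relation[OF P Q B(1) PQ _ less.prems e \<rho> \<sigma>]
    note relQ = shift_relation[OF Q P B(2) QP _ less.prems e \<rho> \<sigma>]
    have "cst P r \<rho> s \<sigma> = 0 \<and> cst Q r \<rho> s \<sigma> = 0" if r: "r < s" for r
    proof (cases "\<exists>t. cube_edge n j r t")
      case True
      then obtain t where t: "cube_edge n j r t" by blast
      have "t < s'" using cube_edgeD[OF t] ss' r by simp
      hence "cst P t \<rho> s' \<sigma> = 0" "cst Q t \<rho> s' \<sigma> = 0" using IH by auto
      thus ?thesis using relP(1)[OF _ t] relQ(1)[OF _ t] nz r less.prems by simp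
    next
      case False
      thus ?thesis using relP(2)[of r] relQ(2)[of r] r less.prems by auto
    qed
    moreover have "cst P s \<rho> s \<sigma> = cst Q s' \<rho> s' \<sigma>" "cst Q s \<rho> s \<sigma> = cst P s' \<rho> s' \<sigma>"
      using relP(1)[OF less.prems e] relQ(1)[OF less.prems e] nz by auto
    ultimately show ?thesis using IH by simp
  qed
qed

text \<open>Coefficient of \<open>z\<close> in block row \<open>2 ^ k\<close> and block column 0,
  where \<open>i = Suc k\<close>. On the left the vertex \<open>2 ^ k\<close> contributes
  \<open>U * A i\<close> up to sign, and the blocks at \<open>2 ^ j\<close> with
  \<open>j \<noteq> k\<close> vanish by \<open>shift_relation\<close>, as \<open>2 ^ k\<close> does
  not contain \<open>j\<close>. On the right only the vertex 0 is below \<open>2 ^ k\<close>, with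
  the contribution \<open>A' i * U\<close> and the same sign.\<close>

lemma const_intertwines:
  assumes P: "P \<in> mat_over n (2 ^ n * m') (2 ^ n * m)" and Q: "Q \<in> mat_over n (2 ^ n * m') (2 ^ n * m)"
    and PQ: "P * A.\<Phi> = B.\<Phi> * Q" and i: "i \<in> {1..n}"
  defines "U \<equiv> mat m' m (\<lambda>(\<rho>, \<sigma>). cst P 0 \<rho> 0 \<sigma>)"
  shows "U * A i = A' i * U"
proof (rule eq_matI)
  obtain \<epsilon> where B: "A.edge_mat A.\<phi> \<epsilon>" using A.edge_mat_phi by blast
  note Ai = A.A_carrier[OF i] and A'i = B.A_carrier[OF i]
  fix \<rho> \<sigma> assume "\<rho> < dim_row (A' i * U)" "\<sigma> < dim_col (A' i * U)"
  hence \<rho>: "\<rho> < m'" and \<sigma>: "\<sigma> < m" using A'i by (auto simp: U_def)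
  define k where "k = i - 1"
  have k: "k < n" "i = Suc k" using i by (auto simp: k_def)
  let ?r = "2 ^ k :: nat"
  have pow: "(2 :: nat) ^ l < 2 ^ n" if "l < n" for l using that by (intro power_strict_increasing) auto
  have r: "?r < 2 ^ n" by (rule pow[OF k(1)])
  have nz: "\<epsilon> ?r 0 \<noteq> 0"
  proof -
    have "\<epsilon> ?r 0 = 1 \<or> \<epsilon> ?r 0 = -1"
      using B r cube_edge_0[OF k(1)] unfolding A.edge_mat_def by (metis pos2 zero_less_power)
    thus ?thesis by auto
  qed
  have QU: "cst Q 0 \<rho> 0 \<tau> = cst P 0 \<rho> 0 \<tau>" if "\<rho> < m'" "\<tau> < m" for \<rho> \<tau> using const_corner[OF P Q PQ that] by simp
  have edge0: "(\<exists>j. cube_edge n j t 0) \<longleftrightarrow> (\<exists>j<n. t = 2 ^ j)" for t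
    using cube_edge_0 cube_edgeD by (metis add_0)
  have "(\<Sum>t<2 ^ n. \<Sum>\<tau><m. cst P ?r \<rho> t \<tau> * mcoeff (A.infl (A.\<phi> $$ (t, 0)) $$ (\<tau>, \<sigma>)) (single 0 (Suc 0))) =
      (\<Sum>t<2 ^ n. if t = ?r then - \<epsilon> ?r 0 * (\<Sum>\<tau><m. cst P 0 \<rho> 0 \<tau> * A i $$ (\<tau>, \<sigma>)) else 0)"
  proof (rule sum.cong[OF refl])
    fix t assume "t \<in> {..<2 ^ n :: nat}"
    hence t: "t < 2 ^ n" by simp
    show "(\<Sum>\<tau><m. cst P ?r \<rho> t \<tau> * mcoeff (A.infl (A.\<phi> $$ (t, 0)) $$ (\<tau>, \<sigma>)) (single 0 (Suc 0))) =
        (if t = ?r then - \<epsilon> ?r 0 * (\<Sum>\<tau><m. cst P 0 \<rho> 0 \<tau> * A i $$ (\<tau>, \<sigma>)) else 0)"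
    proof (cases "\<exists>j. cube_edge n j t 0")
      case False
      hence "t \<noteq> ?r" using cube_edge_0[OF k(1)] by blast
      thus ?thesis using A.edge_z(2)[OF B t _ _ \<sigma>] False by (auto intro!: sum.neutral simp del: single_one)
    next
      case True
      then obtain j where j: "cube_edge n j t 0" by blast
      hence tj: "t = 2 ^ j" "j < n" using cube_edgeD by fastforce+
      show ?thesis
      proof (cases "j = k")
        case True
        hence tr: "t = ?r" using tj by simp
        have "cst P ?r \<rho> t \<tau> = cst P 0 \<rho> 0 \<tau>" if "\<tau> < m" for \<tau>
          using const_triangular[OF P Q PQ \<rho> that r] by (simp add: tr)
        thus ?thesis using A.edge_z(1)[OF B t _ _ \<sigma> j] tr True k
          by (auto simp: sum_distrib_left ac_simps intro!: sum.cong simp del: single_one)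
      next
        case False
        have no: "\<not> cube_edge n j ?r u" for u using cube_edge_power_two[of n j k u] False by auto
        have "cst P ?r \<rho> t \<tau> = 0" if "\<tau> < m" for \<tau>
          by (rule shift_relation(2)[OF P Q B PQ r t j \<rho> that no])
        moreover have "t \<noteq> ?r" using False tj by simp
        ultimately show ?thesis by simp
      qed
    qed
  qed
  also have "\<dots> = - \<epsilon> ?r 0 * (\<Sum>\<tau><m. cst P 0 \<rho> 0 \<tau> * A i $$ (\<tau>, \<sigma>))" using r by simp
  finally have L: "- \<epsilon> ?r 0 * (\<Sum>\<tau><m. cst P 0 \<rho> 0 \<tau> * A i $$ (\<tau>, \<sigma>)) =
      (\<Sum>t<2 ^ n. \<Sum>\<tau><m'. mcoeff (B.infl (A.\<phi> $$ (?r, t)) $$ (\<rho>, \<tau>)) (single 0 (Suc 0)) * cst Q t \<tau> 0 \<sigma>)"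
    using linear_terms[OF P Q B PQ r _ \<rho> \<sigma>, of 0 0] by (simp del: single_one)
  also have "\<dots> = (\<Sum>t<(2 :: nat) ^ n. if t = 0 then - \<epsilon> ?r 0 * (\<Sum>\<tau><m'. A' i $$ (\<rho>, \<tau>) * cst P 0 \<tau> 0 \<sigma>) else 0)"
  proof (rule sum.cong[OF refl])
    fix t assume "t \<in> {..<2 ^ n :: nat}"
    hence t: "t < 2 ^ n" by simp
    show "(\<Sum>\<tau><m'. mcoeff (B.infl (A.\<phi> $$ (?r, t)) $$ (\<rho>, \<tau>)) (single 0 (Suc 0)) * cst Q t \<tau> 0 \<sigma>) =
      (if t = 0 then - \<epsilon> ?r 0 * (\<Sum>\<tau><m'. A' i $$ (\<rho>, \<tau>) * cst P 0 \<tau> 0 \<sigma>) else 0)"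
    proof (cases "t = 0")
      case True
      show ?thesis using B.edge_z(1)[OF B r t \<rho> _ cube_edge_0[OF k(1), folded True]] True k \<sigma>
        by (auto simp: sum_distrib_left ac_simps QU[simplified] intro!: sum.cong simp del: single_one)
    next
      case False
      hence "\<not> cube_edge n j ?r t" for j using cube_edge_power_two[of n j k t] by auto
      thus ?thesis using B.edge_z(2)[OF B r t \<rho>] False by (auto intro!: sum.neutral simp del: single_one)
    qed
  qed
  also have "\<dots> = - \<epsilon> ?r 0 * (\<Sum>\<tau><m'. A' i $$ (\<rho>, \<tau>) * cst P 0 \<tau> 0 \<sigma>)" by simp
  finally have "(\<Sum>\<tau><m. cst P 0 \<rho> 0 \<tau> * A i $$ (\<tau>, \<sigma>)) = (\<Sum>\<tau><m'. A' i $$ (\<rho>, \<tau>) * cst P 0 \<tau> 0 \<sigma>)"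
    using nz by simp
  thus "(U * A i) $$ (\<rho>, \<sigma>) = (A' i * U) $$ (\<rho>, \<sigma>)"
    using \<rho> \<sigma> Ai A'i by (simp add: U_def scalar_prod_def atLeast0LessThan)
qed (use A.A_carrier[OF i] B.A_carrier[OF i] in \<open>auto simp: U_def\<close>)

end

section \<open>Block diagonal matrices\<close>

lemma diag_block_replicate:
  fixes U :: "'a :: zero mat"
  assumes U: "U \<in> carrier_mat r s"
  shows "diag_block_mat (replicate c U) =
    mat (c * r) (c * s) (\<lambda>(i, j). if i div r = j div s then U $$ (i mod r, j mod s) else 0)"
proof (induction c)
  case 0 show ?case by (intro eq_matI) auto
next
  case (Suc c)
  let ?D = "diag_block_mat (replicate c U)"
  have D: "?D \<in> carrier_mat (c * r) (c * s)" unfolding Suc by simp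
  show ?case
  proof (rule eq_matI)
    fix i j assume "i < dim_row (mat (Suc c * r) (Suc c * s) (\<lambda>(i, j). if i div r = j div s then U $$ (i mod r, j mod s) else 0))"
      "j < dim_col (mat (Suc c * r) (Suc c * s) (\<lambda>(i, j). if i div r = j div s then U $$ (i mod r, j mod s) else 0))"
    hence ij: "i < r + c * r" "j < s + c * s" by auto
    have pos: "r > 0" "s > 0" using ij by (auto intro: gr0I)
    have sub: "i - r < c * r" if "\<not> i < r" using ij(1) that by linarith
    have sub': "j - s < c * s" if "\<not> j < s" using ij(2) that by linarith
    have dv: "i div r = Suc ((i - r) div r) \<and> i mod r = (i - r) mod r" if "\<not> i < r"
      using that pos by (auto simp: le_div_geq le_mod_geq)
    have dv': "j div s = Suc ((j - s) div s) \<and> j mod s = (j - s) mod s" if "\<not> j < s"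
      using that pos by (auto simp: le_div_geq le_mod_geq)
    have "diag_block_mat (replicate (Suc c) U) $$ (i, j) =
        (if i < r then if j < s then U $$ (i, j) else 0 else if j < s then 0 else ?D $$ (i - r, j - s))"
      using U D ij sub sub' by (auto simp: Let_def)
    also have "\<dots> = (if i div r = j div s then U $$ (i mod r, j mod s) else 0)"
      using dv dv' sub sub' pos by (cases "i < r"; cases "j < s") (auto simp: Suc)
    finally show "diag_block_mat (replicate (Suc c) U) $$ (i, j) =
        mat (Suc c * r) (Suc c * s) (\<lambda>(i, j). if i div r = j div s then U $$ (i mod r, j mod s) else 0) $$ (i, j)"
      using ij by simp
  qed (use U D in \<open>auto simp: Let_def\<close>)
qed

definition bdiag :: "nat \<Rightarrow> 'k :: field mat \<Rightarrow> 'k mps mat" where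
  "bdiag c U = map_mat mps_const (diag_block_mat (replicate c U))"

lemma bdiag_over: "U \<in> carrier_mat r s \<Longrightarrow> bdiag c U \<in> mat_over n (c * r) (c * s)"
  by (auto simp: bdiag_def diag_block_replicate mat_over_def)

lemma bdiag_entry:
  "U \<in> carrier_mat r s \<Longrightarrow> a < c \<Longrightarrow> b < c \<Longrightarrow> \<rho> < r \<Longrightarrow> \<sigma> < s \<Longrightarrow>
    bdiag c U $$ (a * r + \<rho>, b * s + \<sigma>) = (if a = b then mps_const (U $$ (\<rho>, \<sigma>)) else 0)"
  by (simp add: bdiag_def diag_block_replicate block_index_less)

lemma block_index_cases:
  assumes "i < c * (r :: nat)"
  obtains a \<rho> where "a < c" "\<rho> < r" "i = a * r + \<rho>"
proof (rule that[of "i div r" "i mod r"])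
  have "r > 0" using assms by (auto intro: gr0I)
  thus "i mod r < r" by simp
qed (use assms in \<open>auto simp: less_mult_imp_div_less\<close>)

text \<open>Splits a vector of series into vectors over \<open>k\<close>, one for each block and
  monomial. On these \<open>bdiag c U\<close> acts as \<open>U\<close>, which reduces linear
  equations over power series to linear algebra over \<open>k\<close>.\<close>

definition block_coeff :: "nat \<Rightarrow> 'k :: field mps vec \<Rightarrow> nat \<Rightarrow> (nat \<Rightarrow>\<^sub>0 nat) \<Rightarrow> 'k vec" where
  "block_coeff s v a \<mu> = vec s (\<lambda>\<tau>. mcoeff (v $ (a * s + \<tau>)) \<mu>)"

lemma block_coeff_carrier [simp]: "block_coeff s v a \<mu> \<in> carrier_vec s"
  by (simp add: block_coeff_def)

lemma block_coeff_bdiag: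
  assumes U: "U \<in> carrier_mat r s" and v: "v \<in> carrier_vec (c * s)" and a: "a < c"
  shows "block_coeff r (bdiag c U *\<^sub>v v) a \<mu> = U *\<^sub>v block_coeff s v a \<mu>"
proof (rule eq_vecI)
  note D = mat_over_carrier[OF bdiag_over[OF U, of c]]
  fix \<rho> assume "\<rho> < dim_vec (U *\<^sub>v block_coeff s v a \<mu>)"
  hence \<rho>: "\<rho> < r" using U by simp
  have i: "a * r + \<rho> < c * r" by (rule block_index_less[OF a \<rho>])
  have "(bdiag c U *\<^sub>v v) $ (a * r + \<rho>) = (\<Sum>k<c * s. bdiag c U $$ (a * r + \<rho>, k) * v $ k)"
    using D v i by (simp add: scalar_prod_def atLeast0LessThan)
  also have "\<dots> = (\<Sum>k<c * s. bdiag c U $$ (a * r + \<rho>, k div s * s + k mod s) * v $ (k div s * s + k mod s))"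
    by (simp only: div_mult_mod_eq)
  also have "\<dots> = (\<Sum>t<c. \<Sum>\<tau><s. bdiag c U $$ (a * r + \<rho>, t * s + \<tau>) * v $ (t * s + \<tau>))"
    by (rule sum_blocks)
  also have "\<dots> = (\<Sum>t<c. if t = a then \<Sum>\<tau><s. mps_const (U $$ (\<rho>, \<tau>)) * v $ (t * s + \<tau>) else 0)"
    by (intro sum.cong refl) (use a \<rho> in \<open>auto simp: bdiag_entry[OF U]\<close>)
  also have "\<dots> = (\<Sum>\<tau><s. mps_const (U $$ (\<rho>, \<tau>)) * v $ (a * s + \<tau>))" using a by simp
  finally show "block_coeff r (bdiag c U *\<^sub>v v) a \<mu> $ \<rho> = (U *\<^sub>v block_coeff s v a \<mu>) $ \<rho>"
    using \<rho> U by (simp add: block_coeff_def scalar_prod_def atLeast0LessThan)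
qed (use U in \<open>simp add: block_coeff_def\<close>)

lemma block_coeff_eqI:
  assumes "v \<in> carrier_vec (c * s)" "w \<in> carrier_vec (c * s)"
    "\<And>a \<mu>. a < c \<Longrightarrow> block_coeff s v a \<mu> = block_coeff s w a \<mu>"
  shows "v = w"
proof (rule eq_vecI)
  fix i assume "i < dim_vec w"
  hence "i < c * s" using assms by simp
  then obtain a \<rho> where a: "a < c" "\<rho> < s" "i = a * s + \<rho>" by (rule block_index_cases)
  have "mcoeff (v $ i) \<mu> = mcoeff (w $ i) \<mu>" for \<mu>
    using arg_cong[OF assms(3)[OF a(1), of \<mu>], of "\<lambda>x. x $ \<rho>"] a by (simp add: block_coeff_def)
  thus "v $ i = w $ i" by (rule mps_eqI)
qed (use assms in simp)

text \<open>The equation is solved separately for each block and monomial. Where the right-hand side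
  is 0 the solution 0 is chosen, since otherwise monomials outside the allowed variables could
  enter.\<close>

lemma bdiag_solve:
  fixes U :: "'k :: field mat"
  assumes U: "U \<in> carrier_mat r s" and v: "v \<in> free_vecs n (c * r)"
    and sol: "\<And>a \<mu>. a < c \<Longrightarrow> \<exists>x\<in>carrier_vec s. block_coeff r v a \<mu> = U *\<^sub>v x"
  shows "\<exists>u\<in>free_vecs n (c * s). v = bdiag c U *\<^sub>v u"
proof -
  have "\<exists>x. a < c \<longrightarrow> x \<in> carrier_vec s \<and> block_coeff r v a \<mu> = U *\<^sub>v x \<and> (block_coeff r v a \<mu> = 0\<^sub>v r \<longrightarrow> x = 0\<^sub>v s)" for a \<mu>
  proof (cases "block_coeff r v a \<mu> = 0\<^sub>v r")
    case True
    have "U *\<^sub>v 0\<^sub>v s = 0\<^sub>v r" using U by (intro eq_vecI) auto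
    thus ?thesis using True by (intro exI[of _ "0\<^sub>v s"]) auto
  next
    case False
    thus ?thesis using sol[of a \<mu>] by blast
  qed
  then obtain x where x: "\<And>a \<mu>. a < c \<Longrightarrow> x a \<mu> \<in> carrier_vec s" "\<And>a \<mu>. a < c \<Longrightarrow> block_coeff r v a \<mu> = U *\<^sub>v x a \<mu>"
    "\<And>a \<mu>. a < c \<Longrightarrow> block_coeff r v a \<mu> = 0\<^sub>v r \<Longrightarrow> x a \<mu> = 0\<^sub>v s" by metis
  define u where "u = vec (c * s) (\<lambda>i. Mps (\<lambda>\<mu>. x (i div s) \<mu> $ (i mod s)))"
  have u: "u \<in> free_vecs n (c * s)" unfolding free_vecs_iff
  proof (intro conjI allI impI)
    fix i assume i: "i < c * s"
    obtain a \<sigma> where a: "a < c" "\<sigma> < s" "i = a * s + \<sigma>" using i by (rule block_index_cases)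
    show "u $ i \<in> mps_over {0..n}"
    proof (rule mps_overI, rule ccontr)
      fix \<mu> assume nz: "mcoeff (u $ i) \<mu> \<noteq> 0" and "\<not> keys \<mu> \<subseteq> {0..n}"
      hence "block_coeff r v a \<mu> = 0\<^sub>v r"
        using mps_over_coeff_0[OF free_vecs_entry[OF v]] block_index_less[OF a(1), of _ r]
        by (intro eq_vecI) (auto simp: block_coeff_def)
      hence "x a \<mu> = 0\<^sub>v s" using x(3) a by blast
      thus False using nz i a by (simp add: u_def)
    qed
  qed (simp add: u_def)
  have bu: "block_coeff s u a \<mu> = x a \<mu>" if "a < c" for a \<mu>
    using x(1)[OF that, of \<mu>] that by (intro eq_vecI) (auto simp: block_coeff_def u_def block_index_less)
  have "v = bdiag c U *\<^sub>v u"
  proof (rule block_coeff_eqI[where c = c and s = r])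
    show "v \<in> carrier_vec (c * r)" using v by (rule free_vecs_carrier)
    show "bdiag c U *\<^sub>v u \<in> carrier_vec (c * r)"
      by (rule free_vecs_carrier[OF mat_over_mult_vec[OF bdiag_over[OF U] u]])
    fix a \<mu> assume "a < c"
    thus "block_coeff r v a \<mu> = block_coeff r (bdiag c U *\<^sub>v u) a \<mu>"
      using x(2) bu by (simp add: block_coeff_bdiag[OF U free_vecs_carrier[OF u]])
  qed
  thus ?thesis using u by blast
qed

lemma bdiag_one: "bdiag c (1\<^sub>m m) = (1\<^sub>m (c * m) :: 'k :: field mps mat)"
proof (rule eq_matI)
  fix i j assume "i < dim_row (1\<^sub>m (c * m) :: 'k mps mat)" "j < dim_col (1\<^sub>m (c * m) :: 'k mps mat)"
  hence ij: "i < c * m" "j < c * m" by auto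
  obtain a \<rho> where a: "a < c" "\<rho> < m" "i = a * m + \<rho>" using ij(1) by (rule block_index_cases)
  obtain b \<sigma> where b: "b < c" "\<sigma> < m" "j = b * m + \<sigma>" using ij(2) by (rule block_index_cases)
  have "i = j \<longleftrightarrow> a = b \<and> \<rho> = \<sigma>" using a b by (metis div_mult_self3 div_less mod_less mod_mult_self3 add.commute add_cancel_right_left gr_implies_not0)
  thus "bdiag c (1\<^sub>m m) $$ (i, j) = (1\<^sub>m (c * m) :: 'k mps mat) $$ (i, j)"
    using ij bdiag_entry[OF one_carrier_mat a(1) b(1) a(2) b(2), where ?'a = 'k] a b by auto
qed (use mat_over_carrier[OF bdiag_over[of "1\<^sub>m m :: 'k mat" m m c]] in auto)

lemma bdiag_mult:
  fixes U V :: "'k :: field mat"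
  assumes U: "U \<in> carrier_mat r s" and V: "V \<in> carrier_mat q r"
  shows "bdiag c (V * U) = bdiag c V * bdiag c U"
proof (rule mat_eq_by_vecs[where n = 0 and r = "c * q" and c = "c * s"])
  have VU: "V * U \<in> carrier_mat q s" using U V by simp
  note cU = mat_over_carrier[OF bdiag_over[OF U, of c]] and cV = mat_over_carrier[OF bdiag_over[OF V, of c]]
    and cVU = mat_over_carrier[OF bdiag_over[OF VU, of c]]
  show "bdiag c (V * U) \<in> carrier_mat (c * q) (c * s)" "bdiag c V * bdiag c U \<in> carrier_mat (c * q) (c * s)"
    using cU cV cVU by auto
  fix v :: "'k mps vec" assume v: "v \<in> free_vecs 0 (c * s)"
  note vc = free_vecs_carrier[OF v]
  have Uv: "bdiag c U *\<^sub>v v \<in> carrier_vec (c * r)" by (rule mult_mat_vec_carrier[OF cU vc])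
  have assoc: "bdiag c V * bdiag c U *\<^sub>v v = bdiag c V *\<^sub>v (bdiag c U *\<^sub>v v)"
    by (rule assoc_mult_mat_vec[OF cV cU vc])
  show "bdiag c (V * U) *\<^sub>v v = bdiag c V * bdiag c U *\<^sub>v v" unfolding assoc
  proof (rule block_coeff_eqI[where c = c and s = q])
    fix a \<mu> assume a: "a < c"
    show "block_coeff q (bdiag c (V * U) *\<^sub>v v) a \<mu> = block_coeff q (bdiag c V *\<^sub>v (bdiag c U *\<^sub>v v)) a \<mu>"
      unfolding block_coeff_bdiag[OF VU vc a] block_coeff_bdiag[OF V Uv a] block_coeff_bdiag[OF U vc a]
      by (rule assoc_mult_mat_vec[OF V U block_coeff_carrier])
  qed (rule mult_mat_vec_carrier[OF cVU vc] mult_mat_vec_carrier[OF cV Uv])+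
qed

text \<open>Each claim is checked on the vectors \<open>block_coeff\<close>, where it is exactness
  of the given sequence over \<open>k\<close>.\<close>

lemma bdiag_exact:
  fixes U V :: "'k :: field mat"
  assumes U: "U \<in> carrier_mat r s" and V: "V \<in> carrier_mat q r"
    and ex: "short_exact (rep_module n (s, A)) (rep_module n (r, A')) (rep_module n (q, A'')) ((*\<^sub>v) U) ((*\<^sub>v) V)"
  shows "\<And>v. v \<in> free_vecs n (c * s) \<Longrightarrow> bdiag c U *\<^sub>v v = 0\<^sub>v (c * r) \<Longrightarrow> v = 0\<^sub>v (c * s)"
    and "\<And>v. v \<in> free_vecs n (c * s) \<Longrightarrow> bdiag c V *\<^sub>v (bdiag c U *\<^sub>v v) = 0\<^sub>v (c * q)"
    and "\<And>v. v \<in> free_vecs n (c * r) \<Longrightarrow> bdiag c V *\<^sub>v v = 0\<^sub>v (c * q) \<Longrightarrow> \<exists>u\<in>free_vecs n (c * s). v = bdiag c U *\<^sub>v u"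
    and "\<And>w. w \<in> free_vecs n (c * q) \<Longrightarrow> \<exists>v\<in>free_vecs n (c * r). w = bdiag c V *\<^sub>v v"
proof -
  have inj: "inj_on ((*\<^sub>v) U) (carrier_vec s)" and im: "(*\<^sub>v) U ` carrier_vec s = {y \<in> carrier_vec r. V *\<^sub>v y = 0\<^sub>v q}"
    and sur: "(*\<^sub>v) V ` carrier_vec r = carrier_vec q"
    using ex by (simp_all add: short_exact_def rep_module_def)
  have bc0: "block_coeff t (0\<^sub>v (c * t)) a \<mu> = 0\<^sub>v t" if "a < c" for t a \<mu>
    using that by (intro eq_vecI) (auto simp: block_coeff_def block_index_less)
  have U0: "U *\<^sub>v 0\<^sub>v s = 0\<^sub>v r" using U by (intro eq_vecI) auto
  show "v = 0\<^sub>v (c * s)" if v: "v \<in> free_vecs n (c * s)" "bdiag c U *\<^sub>v v = 0\<^sub>v (c * r)" for v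
  proof (rule block_coeff_eqI[where c = c and s = s])
    fix a \<mu> assume a: "a < c"
    have "U *\<^sub>v block_coeff s v a \<mu> = U *\<^sub>v 0\<^sub>v s"
      unfolding block_coeff_bdiag[OF U free_vecs_carrier[OF v(1)] a, symmetric] v(2) U0 by (rule bc0[OF a])
    thus "block_coeff s v a \<mu> = block_coeff s (0\<^sub>v (c * s)) a \<mu>"
      unfolding bc0[OF a] by (rule inj_onD[OF inj]) auto
  qed (use free_vecs_carrier[OF v(1)] in auto)
  show "bdiag c V *\<^sub>v (bdiag c U *\<^sub>v v) = 0\<^sub>v (c * q)" if v: "v \<in> free_vecs n (c * s)" for v
  proof (rule block_coeff_eqI[where c = c and s = q])
    note Uv = free_vecs_carrier[OF mat_over_mult_vec[OF bdiag_over[OF U] v]]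
    fix a \<mu> assume a: "a < c"
    have "U *\<^sub>v block_coeff s v a \<mu> \<in> {y \<in> carrier_vec r. V *\<^sub>v y = 0\<^sub>v q}" unfolding im[symmetric] by simp
    thus "block_coeff q (bdiag c V *\<^sub>v (bdiag c U *\<^sub>v v)) a \<mu> = block_coeff q (0\<^sub>v (c * q)) a \<mu>"
      unfolding block_coeff_bdiag[OF V Uv a] block_coeff_bdiag[OF U free_vecs_carrier[OF v] a] bc0[OF a] by simp
  next
    show "bdiag c V *\<^sub>v (bdiag c U *\<^sub>v v) \<in> carrier_vec (c * q)"
      by (rule free_vecs_carrier[OF mat_over_mult_vec[OF bdiag_over[OF V] mat_over_mult_vec[OF bdiag_over[OF U] v]]])
  qed simp
  show "\<exists>u\<in>free_vecs n (c * s). v = bdiag c U *\<^sub>v u" if v: "v \<in> free_vecs n (c * r)" "bdiag c V *\<^sub>v v = 0\<^sub>v (c * q)" for v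
  proof (rule bdiag_solve[OF U v(1)])
    fix a \<mu> assume a: "a < c"
    have "V *\<^sub>v block_coeff r v a \<mu> = 0\<^sub>v q"
      unfolding block_coeff_bdiag[OF V free_vecs_carrier[OF v(1)] a, symmetric] v(2) by (rule bc0[OF a])
    hence "block_coeff r v a \<mu> \<in> (*\<^sub>v) U ` carrier_vec s" unfolding im by simp
    thus "\<exists>x\<in>carrier_vec s. block_coeff r v a \<mu> = U *\<^sub>v x" by blast
  qed
  show "\<exists>v\<in>free_vecs n (c * r). w = bdiag c V *\<^sub>v v" if w: "w \<in> free_vecs n (c * q)" for w
  proof (rule bdiag_solve[OF V w])
    fix a \<mu>
    have "block_coeff q w a \<mu> \<in> (*\<^sub>v) V ` carrier_vec r" unfolding sur by simp
    thus "\<exists>x\<in>carrier_vec r. block_coeff q w a \<mu> = V *\<^sub>v x" by blast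
  qed
qed

text \<open>Intertwining passes from the \<open>A i\<close> to monomials, to polynomials, and to the
  coefficients of each inflated entry; both sides inflate the same matrix
  \<open>\<phi>\<close>.\<close>

lemma (in inflation_pair) bdiag_commutes:
  assumes U: "U \<in> carrier_mat m' m" and UA: "\<And>i. i \<in> {1..n} \<Longrightarrow> U * A i = A' i * U"
  shows "bdiag (2 ^ n) U * A.\<Phi> = B.\<Phi> * bdiag (2 ^ n) U"
proof (rule eq_matI)
  note D = bdiag_over[OF U, of "2 ^ n" n]
  note Dc = mat_over_carrier[OF D]
  have monom: "(\<Sum>\<tau><m. U $$ (\<rho>, \<tau>) * monom_mat n m A \<epsilon> $$ (\<tau>, \<sigma>)) = (\<Sum>\<tau><m'. monom_mat n m' A' \<epsilon> $$ (\<rho>, \<tau>) * U $$ (\<tau>, \<sigma>))"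
    if "\<rho> < m'" "\<sigma> < m" for \<rho> \<sigma> \<epsilon>
  proof -
    have "U * monom_mat n m A \<epsilon> = monom_mat n m' A' \<epsilon> * U"
      unfolding monom_mat_def
      using foldr_intertwine[OF U, of "[1..<Suc n]" A A'] A.A_carrier B.A_carrier UA by (simp del: upt_Suc)
    from arg_cong[OF this, of "\<lambda>X. X $$ (\<rho>, \<sigma>)"] show ?thesis
      using that U carrier_matD[OF A.monom_mat_carrier[of \<epsilon>]] carrier_matD[OF B.monom_mat_carrier[of \<epsilon>]]
      by (simp add: scalar_prod_def atLeast0LessThan)
  qed
  have pm: "(\<Sum>\<tau><m. U $$ (\<rho>, \<tau>) * A.pm q $$ (\<tau>, \<sigma>)) = (\<Sum>\<tau><m'. B.pm q $$ (\<rho>, \<tau>) * U $$ (\<tau>, \<sigma>))"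
    if "\<rho> < m'" "\<sigma> < m" for \<rho> \<sigma> q
  proof -
    let ?K = "keys q" and ?l = "lookup q"
    have "(\<Sum>\<tau><m. U $$ (\<rho>, \<tau>) * A.pm q $$ (\<tau>, \<sigma>)) = (\<Sum>\<tau><m. \<Sum>\<epsilon>\<in>?K. ?l \<epsilon> * (U $$ (\<rho>, \<tau>) * monom_mat n m A \<epsilon> $$ (\<tau>, \<sigma>)))"
      using that by (simp add: poly_mat_def sum_distrib_left ac_simps)
    also have "\<dots> = (\<Sum>\<epsilon>\<in>?K. ?l \<epsilon> * (\<Sum>\<tau><m. U $$ (\<rho>, \<tau>) * monom_mat n m A \<epsilon> $$ (\<tau>, \<sigma>)))"
      unfolding sum_distrib_left by (rule sum.swap)
    also have "\<dots> = (\<Sum>\<tau><m'. \<Sum>\<epsilon>\<in>?K. ?l \<epsilon> * (monom_mat n m' A' \<epsilon> $$ (\<rho>, \<tau>) * U $$ (\<tau>, \<sigma>)))"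
      unfolding monom[OF that] sum_distrib_left by (rule sum.swap)
    also have "\<dots> = (\<Sum>\<tau><m'. B.pm q $$ (\<rho>, \<tau>) * U $$ (\<tau>, \<sigma>))"
      using that by (simp add: poly_mat_def sum_distrib_right mult.assoc)
    finally show ?thesis .
  qed
  fix i j assume "i < dim_row (B.\<Phi> * bdiag (2 ^ n) U)" "j < dim_col (B.\<Phi> * bdiag (2 ^ n) U)"
  hence ij: "i < 2 ^ n * m'" "j < 2 ^ n * m" using Dc B.dims by auto
  obtain r \<rho> where r: "r < 2 ^ n" "\<rho> < m'" "i = r * m' + \<rho>" using ij(1) by (rule block_index_cases)
  obtain s \<sigma> where s: "s < 2 ^ n" "\<sigma> < m" "j = s * m + \<sigma>" using ij(2) by (rule block_index_cases)
  have "(bdiag (2 ^ n) U * A.\<Phi>) $$ (i, j) =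
      (\<Sum>t<2 ^ n. \<Sum>\<tau><m. blk (bdiag (2 ^ n) U) r \<rho> t \<tau> * A.infl (A.\<phi> $$ (t, s)) $$ (\<tau>, \<sigma>))"
    unfolding r(3) s(3) by (rule block_product_left[OF D phi_carrier r(1) s(1) r(2) s(2)])
  also have "\<dots> = (\<Sum>t<2 ^ n. if t = r then \<Sum>\<tau><m. mps_const (U $$ (\<rho>, \<tau>)) * A.infl (A.\<phi> $$ (t, s)) $$ (\<tau>, \<sigma>) else 0)"
    by (intro sum.cong refl) (use r in \<open>auto simp: bdiag_entry[OF U]\<close>)
  also have "\<dots> = (\<Sum>\<tau><m. mps_const (U $$ (\<rho>, \<tau>)) * A.infl (A.\<phi> $$ (r, s)) $$ (\<tau>, \<sigma>))" using r by simp
  also have "\<dots> = (\<Sum>\<tau><m'. B.infl (A.\<phi> $$ (r, s)) $$ (\<rho>, \<tau>) * mps_const (U $$ (\<tau>, \<sigma>)))"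
    by (rule mps_eqI) (use r s pm in \<open>simp add: mult.commute[of _ "mps_const _"] A.mcoeff_infl B.mcoeff_infl mult.commute[of "U $$ (_, \<sigma>)"]\<close>)
  also have "\<dots> = (\<Sum>t<2 ^ n. if t = s then \<Sum>\<tau><m'. B.infl (A.\<phi> $$ (r, t)) $$ (\<rho>, \<tau>) * mps_const (U $$ (\<tau>, \<sigma>)) else 0)"
    using s by simp
  also have "\<dots> = (\<Sum>t<2 ^ n. \<Sum>\<tau><m'. B.infl (A.\<phi> $$ (r, t)) $$ (\<rho>, \<tau>) * blk (bdiag (2 ^ n) U) t \<tau> s \<sigma>)"
    by (intro sum.cong refl) (use s in \<open>auto simp: bdiag_entry[OF U]\<close>)
  also have "\<dots> = (B.\<Phi> * bdiag (2 ^ n) U) $$ (i, j)"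
    unfolding r(3) s(3) by (rule block_product_right[OF D phi_carrier r(1) s(1) r(2) s(2), symmetric])
  finally show "(bdiag (2 ^ n) U * A.\<Phi>) $$ (i, j) = (B.\<Phi> * bdiag (2 ^ n) U) $$ (i, j)" .
qed (use mat_over_carrier[OF bdiag_over[OF U, of "2 ^ n"]] A.dims B.dims in auto)

section \<open>Isomorphisms and idempotents\<close>

text \<open>Two representatives differ by a vector in the image of \<open>\<Phi>\<close>, whose
  matrix entries have no constant terms. So constant terms are well defined on the cokernel, and
  identities between maps of cokernels give identities between constant matrices.\<close>

lemma (in inflation) cok_eq_const:
  assumes "v \<in> V" "w \<in> V" "cok v = cok w" "i < 2 ^ n * m"
  shows "mcoeff (v $ i) 0 = mcoeff (w $ i) 0"
proof -
  obtain u where u: "u \<in> V" "v = w + \<Phi> *\<^sub>v u" using assms cok_eq_iff by blast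
  have "v $ i = w $ i + (\<Sum>k<2 ^ n * m. \<Phi> $$ (i, k) * u $ k)"
    unfolding u(2) using V_carrier[OF assms(2)] V_carrier[OF u(1)] assms(4) \<Phi>_carrier
    by (simp add: scalar_prod_def atLeast0LessThan)
  thus ?thesis using \<Phi>_const_0[OF assms(4)] by simp
qed

lemma (in inflation) cok_mat_eq_const:
  assumes "T \<in> mat_over n (2 ^ n * m) N" "T' \<in> mat_over n (2 ^ n * m) N"
    "\<And>v. v \<in> free_vecs n N \<Longrightarrow> cok (T *\<^sub>v v) = cok (T' *\<^sub>v v)" "i < 2 ^ n * m" "j < N"
  shows "mcoeff (T $$ (i, j)) 0 = mcoeff (T' $$ (i, j)) 0"
proof -
  note u = free_vecs_unit[of N j n]
  have "mcoeff ((T *\<^sub>v unit_vec N j) $ i) 0 = mcoeff ((T' *\<^sub>v unit_vec N j) $ i) 0"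
    by (rule cok_eq_const[OF mat_over_mult_vec[OF assms(1) u] mat_over_mult_vec[OF assms(2) u] assms(3)[OF u] assms(4)])
  thus ?thesis
    using mat_unit_vec_col[OF mat_over_carrier[OF assms(1)] assms(5)] mat_unit_vec_col[OF mat_over_carrier[OF assms(2)] assms(5)]
      carrier_matD[OF mat_over_carrier[OF assms(1)]] carrier_matD[OF mat_over_carrier[OF assms(2)]] assms(4,5)
    by simp
qed

text \<open>In the first block row of \<open>P'\<close> only the first block has constant terms, so
  the corner of the product is the product of the corners. \<open>T\<close> will be the identity for
  an isomorphism and \<open>P\<close> itself for an idempotent. Indices such as
  \<open>0 * m + \<rho>\<close> keep the block form in which corners occur elsewhere.\<close>

lemma (in inflation_pair) const_mult_corner:
  assumes P: "P \<in> mat_over n (2 ^ n * m') (2 ^ n * m)"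
    and P': "P' \<in> mat_over n (2 ^ n * m) (2 ^ n * m')" and Q': "Q' \<in> mat_over n (2 ^ n * m) (2 ^ n * m')"
    and PQ': "P' * B.\<Phi> = A.\<Phi> * Q'" and T: "T \<in> mat_over n (2 ^ n * m) (2 ^ n * m)"
    and eq: "\<And>v. v \<in> A.V \<Longrightarrow> A.cok (P' *\<^sub>v (P *\<^sub>v v)) = A.cok (T *\<^sub>v v)"
  shows "mat m m' (\<lambda>(\<rho>, \<sigma>). mcoeff (P' $$ (0 * m + \<rho>, 0 * m' + \<sigma>)) 0) * mat m' m (\<lambda>(\<rho>, \<sigma>). cst P 0 \<rho> 0 \<sigma>) =
    mat m m (\<lambda>(\<rho>, \<sigma>). mcoeff (T $$ (0 * m + \<rho>, 0 * m + \<sigma>)) 0)" (is "?U * ?U' = ?T")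
proof (rule eq_matI)
  interpret BA: inflation_pair n m' m f h g A' A ..
  fix \<rho> \<sigma> assume "\<rho> < dim_row ?T" "\<sigma> < dim_col ?T"
  hence \<rho>: "\<rho> < m" and \<sigma>: "\<sigma> < m" by auto
  have less: "\<rho> < 2 ^ n * m" "\<sigma> < 2 ^ n * m"
    using block_index_less[of 0 "2 ^ n" _ m] \<rho> \<sigma> by auto
  have PP: "cok_class n A.\<Phi> ((P' * P) *\<^sub>v v) = A.cok (T *\<^sub>v v)" if "v \<in> A.V" for v
    using eq[OF that] assoc_mult_mat_vec[OF mat_over_carrier[OF P'] mat_over_carrier[OF P] A.V_carrier[OF that]] by simp
  have one': "mcoeff ((P' * P) $$ (\<rho>, \<sigma>)) 0 = mcoeff (T $$ (\<rho>, \<sigma>)) 0"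
    by (rule A.cok_mat_eq_const[OF mat_over_mult[OF P' P] T PP less])
  have "(P' * P) $$ (\<rho>, \<sigma>) = (\<Sum>t<2 ^ n. \<Sum>\<tau><m'. P' $$ (\<rho>, t * m' + \<tau>) * P $$ (t * m' + \<tau>, \<sigma>))"
    by (rule mat_mult_blocks[OF mat_over_carrier[OF P'] mat_over_carrier[OF P] less])
  hence "mcoeff ((P' * P) $$ (\<rho>, \<sigma>)) 0 =
      (\<Sum>t<2 ^ n. \<Sum>\<tau><m'. mcoeff (P' $$ (\<rho>, t * m' + \<tau>)) 0 * mcoeff (P $$ (t * m' + \<tau>, \<sigma>)) 0)" by simp
  also have "\<dots> = (\<Sum>t<(2 :: nat) ^ n. if t = 0 then \<Sum>\<tau><m'. mcoeff (P' $$ (\<rho>, \<tau>)) 0 * mcoeff (P $$ (\<tau>, \<sigma>)) 0 else 0)"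
  proof (intro sum.cong refl)
    fix t assume t: "t \<in> {..<2 ^ n :: nat}"
    have "mcoeff (P' $$ (\<rho>, t * m' + \<tau>)) 0 = 0" if "t > 0" "\<tau> < m'" for \<tau>
      using BA.const_triangular[OF P' Q' PQ' \<rho> that(2), of t] t that(1) by auto
    thus "(\<Sum>\<tau><m'. mcoeff (P' $$ (\<rho>, t * m' + \<tau>)) 0 * mcoeff (P $$ (t * m' + \<tau>, \<sigma>)) 0) =
        (if t = 0 then \<Sum>\<tau><m'. mcoeff (P' $$ (\<rho>, \<tau>)) 0 * mcoeff (P $$ (\<tau>, \<sigma>)) 0 else 0)" by auto
  qed
  also have "\<dots> = (\<Sum>\<tau><m'. mcoeff (P' $$ (\<rho>, \<tau>)) 0 * mcoeff (P $$ (\<tau>, \<sigma>)) 0)" by simp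
  finally show "(?U * ?U') $$ (\<rho>, \<sigma>) = ?T $$ (\<rho>, \<sigma>)"
    using \<rho> \<sigma> one' by (simp add: scalar_prod_def atLeast0LessThan)
qed auto

text \<open>The determinant has constant term 1, so it is a unit and the adjugate provides an
  inverse; this is Nakayama's lemma in matrix form.\<close>

lemma mat_const_one_surj:
  fixes T :: "'k :: field mps mat"
  assumes T: "T \<in> mat_over n N N" and one: "\<And>i j. i < N \<Longrightarrow> j < N \<Longrightarrow> mcoeff (T $$ (i, j)) 0 = (if i = j then 1 else 0)"
    and v: "v \<in> free_vecs n N"
  shows "\<exists>w\<in>free_vecs n N. T *\<^sub>v w = v"
proof -
  interpret c: comm_ring_hom "\<lambda>p :: 'k mps. mcoeff p 0" by unfold_locales (auto simp: mcoeff_one)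
  note Tc = mat_over_carrier[OF T]
  have "map_mat (\<lambda>p. mcoeff p 0) T = 1\<^sub>m N" using one Tc by (intro eq_matI) auto
  hence "mcoeff (det T) 0 = 1" using c.hom_det[of T] by simp
  moreover have "det T \<in> mps_over UNIV" by (simp add: mps_over_def)
  ultimately obtain q where q: "q * det T = 1" using mps_unit[of "det T" UNIV] by auto
  note vc = free_vecs_carrier[OF v]
  define w0 where "w0 = q \<cdot>\<^sub>v (adj_mat T *\<^sub>v v)"
  have w0c: "w0 \<in> carrier_vec N" using adj_mat(1)[OF Tc] vc by (simp add: w0_def)
  have "T *\<^sub>v w0 = q \<cdot>\<^sub>v (T *\<^sub>v (adj_mat T *\<^sub>v v))"
    unfolding w0_def by (rule mult_mat_smult_vec[OF Tc]) (use adj_mat(1)[OF Tc] vc in auto)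
  also have "T *\<^sub>v (adj_mat T *\<^sub>v v) = (T * adj_mat T) *\<^sub>v v"
    by (rule assoc_mult_mat_vec[symmetric, OF Tc adj_mat(1)[OF Tc] vc])
  also have "\<dots> = det T \<cdot>\<^sub>v v" unfolding adj_mat(2)[OF Tc] using vc by (intro eq_vecI) auto
  also have "q \<cdot>\<^sub>v (det T \<cdot>\<^sub>v v) = v" using q by (simp add: smult_smult_assoc)
  finally have Tw: "T *\<^sub>v w0 = v" .
  \<comment> \<open>The inverse of the determinant was found without control of its variables. As
    \<open>T\<close> and \<open>v\<close> involve only the variables \<open>0, ..., n\<close>,
    restricting the solution to these keeps it a solution.\<close>
  define w where "w = map_vec (res_vars {0..n}) w0"
  have w: "w \<in> free_vecs n N" using w0c by (auto simp: w_def free_vecs_iff res_vars_over)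
  have res_sum: "res_vars {0..n} (sum g I) = (\<Sum>i\<in>I. res_vars {0..n} (g i))" for g :: "nat \<Rightarrow> 'k mps" and I
    by (induction I rule: infinite_finite_induct) (auto simp: res_vars_add)
  have "T *\<^sub>v w = v"
  proof (rule eq_vecI)
    fix i assume "i < dim_vec v"
    hence i: "i < N" using vc by simp
    have "(T *\<^sub>v w) $ i = (\<Sum>j<N. T $$ (i, j) * res_vars {0..n} (w0 $ j))"
      using i Tc w0c by (simp add: w_def scalar_prod_def atLeast0LessThan)
    also have "\<dots> = res_vars {0..n} (\<Sum>j<N. T $$ (i, j) * w0 $ j)"
      unfolding res_sum using i by (intro sum.cong refl) (simp add: res_vars_mult res_vars_id[OF mat_over_entry[OF T]])
    also have "(\<Sum>j<N. T $$ (i, j) * w0 $ j) = v $ i"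
      using arg_cong[OF Tw, of "\<lambda>x. x $ i"] i Tc w0c by (simp add: scalar_prod_def atLeast0LessThan)
    also have "res_vars {0..n} (v $ i) = v $ i" by (rule res_vars_id[OF free_vecs_entry[OF v i]])
    finally show "(T *\<^sub>v w) $ i = v $ i" .
  qed (use Tc vc in simp)
  thus ?thesis using w by blast
qed

lemma minus_add_cancel_vec: "v \<in> carrier_vec N \<Longrightarrow> w \<in> carrier_vec N \<Longrightarrow> v - w + (w :: 'a :: ab_group_add vec) = v"
  by (intro eq_vecI) auto

text \<open>The constant part of \<open>P\<close> is block lower triangular with zero diagonal,
  hence nilpotent; being idempotent as well, it is 0. Then \<open>1 - P\<close> is surjective on the
  free module, and \<open>v = w - P w\<close> gives \<open>e v = e w - e (e w) = 0\<close> on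
  classes.\<close>

lemma (in inflation) idempotent_zero:
  assumes e: "e \<in> module_hom R M M" and idem: "\<And>x. x \<in> carrier M \<Longrightarrow> e (e x) = e x"
    and P: "P \<in> mat_over n (2 ^ n * m) (2 ^ n * m)" and Q: "Q \<in> mat_over n (2 ^ n * m) (2 ^ n * m)"
    and PQ: "P * \<Phi> = \<Phi> * Q" and eP: "\<And>v. v \<in> V \<Longrightarrow> e (cok v) = cok (P *\<^sub>v v)"
    and U: "\<And>\<rho> \<sigma>. \<rho> < m \<Longrightarrow> \<sigma> < m \<Longrightarrow> mcoeff (P $$ (\<rho>, \<sigma>)) 0 = 0" and x: "x \<in> carrier M"
  shows "e x = \<zero>\<^bsub>M\<^esub>"
proof -
  interpret AA: inflation_pair n m m f h g A A ..
  interpret Mod: module R M by (rule M_module)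
  note PV = mat_over_mult_vec[OF P] and Pc = mat_over_carrier[OF P]
  have PP: "mcoeff ((P * P) $$ (i, j)) 0 = mcoeff (P $$ (i, j)) 0" if "i < 2 ^ n * m" "j < 2 ^ n * m" for i j
  proof (rule cok_mat_eq_const[OF mat_over_mult[OF P P] P _ that])
    fix v assume v: "v \<in> V"
    have "cok ((P * P) *\<^sub>v v) = cok (P *\<^sub>v (P *\<^sub>v v))" by (simp add: assoc_mult_mat_vec[OF Pc Pc V_carrier[OF v]])
    also have "\<dots> = e (e (cok v))" using v by (simp add: eP PV)
    also have "\<dots> = cok (P *\<^sub>v v)" unfolding idem[OF cok_closed[OF v]] by (rule eP[OF v])
    finally show "cok (P * P *\<^sub>v v) = cok (P *\<^sub>v v)" .
  qed
  have cst0: "AA.cst P r \<rho> s \<sigma> = 0" if "r < 2 ^ n" "s < 2 ^ n" "\<rho> < m" "\<sigma> < m" for r \<rho> s \<sigma>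
    using that
  \<comment> \<open>Subtraction of natural numbers is truncated, so the value 0 collects all
    positions on or above the diagonal.\<close>
  proof (induction "r - s" arbitrary: r \<rho> s \<sigma> rule: less_induct)
    case less
    have le0: "AA.cst P r \<rho> s \<sigma> = 0" if "r \<le> s" "s < 2 ^ n" "\<rho> < m" "\<sigma> < m" for r \<rho> s \<sigma>
      using AA.const_triangular[OF P Q PQ that(3,4,2)] U[OF that(3,4)] that(1) by (cases "r = s") auto
    have "AA.cst P r \<rho> s \<sigma> = mcoeff ((P * P) $$ (r * m + \<rho>, s * m + \<sigma>)) 0"
      by (rule PP[symmetric]) (use less.prems in \<open>auto intro: block_index_less\<close>)
    also have "\<dots> = (\<Sum>t<2 ^ n. \<Sum>\<tau><m. AA.cst P r \<rho> t \<tau> * AA.cst P t \<tau> s \<sigma>)"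
      by (subst mat_mult_blocks[OF Pc Pc]) (use less.prems in \<open>auto intro: block_index_less\<close>)
    also have "\<dots> = 0"
    proof (intro sum.neutral ballI)
      fix t \<tau> assume "t \<in> {..<2 ^ n :: nat}" "\<tau> \<in> {..<m}"
      hence t: "t < 2 ^ n" "\<tau> < m" by auto
      consider "t \<le> s" | "r \<le> t" | "s < t" "t < r" by linarith
      thus "AA.cst P r \<rho> t \<tau> * AA.cst P t \<tau> s \<sigma> = 0"
      proof cases
        case 1 thus ?thesis using le0[of t s \<tau> \<sigma>] less.prems t by simp
      next
        case 2 thus ?thesis using le0[of r t \<rho> \<tau>] less.prems t by simp
      next
        case 3 thus ?thesis using less.hyps[of r t \<rho> \<tau>] less.prems t by simp
      qed
    qed
    finally show ?case .
  qed
  have P0: "mcoeff (P $$ (i, j)) 0 = 0" if ij: "i < 2 ^ n * m" "j < 2 ^ n * m" for i j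
  proof -
    obtain r \<rho> where r: "r < 2 ^ n" "\<rho> < m" "i = r * m + \<rho>" using ij(1) by (rule block_index_cases)
    obtain s \<sigma> where s: "s < 2 ^ n" "\<sigma> < m" "j = s * m + \<sigma>" using ij(2) by (rule block_index_cases)
    show ?thesis using cst0[OF r(1) s(1) r(2) s(2)] r s by simp
  qed
  obtain v where v: "v \<in> V" "x = cok v" using x by (rule cok_cases)
  have "\<exists>w\<in>V. (1\<^sub>m (2 ^ n * m) - P) *\<^sub>v w = v"
    by (rule mat_const_one_surj[OF mat_over_minus[OF mat_over_one P] _ v(1)])
      (use P0 Pc in \<open>auto simp: mcoeff_one\<close>)
  then obtain w where w: "w \<in> V" "(1\<^sub>m (2 ^ n * m) - P) *\<^sub>v w = v" by blast
  have "w - P *\<^sub>v w = v"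
    using minus_mult_distrib_mat_vec[OF one_carrier_mat Pc V_carrier[OF w(1)]] w V_carrier[OF w(1)] by simp
  hence "v + P *\<^sub>v w = w" using V_carrier[OF w(1)] V_carrier[OF PV[OF w(1)]]
    using minus_add_cancel_vec by blast
  hence "cok v \<oplus>\<^bsub>M\<^esub> e (cok w) = cok w" using v w by (simp add: eP cok_add PV)
  moreover have "e (cok v \<oplus>\<^bsub>M\<^esub> e (cok w)) = e (cok v) \<oplus>\<^bsub>M\<^esub> e (e (cok w))"
    using e v w PV by (auto simp: module_hom_def cok_closed eP)
  ultimately have "e (cok w) = e (cok v) \<oplus>\<^bsub>M\<^esub> e (cok w)" using idem w cok_closed by simp
  moreover have "e (cok w) \<in> carrier M" "e (cok v) \<in> carrier M" using v w PV by (auto simp: eP cok_closed)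
  ultimately show ?thesis using v(2) Mod.add.r_cancel_one'[of "e (cok w)" "e (cok v)"] by simp
qed

section \<open>Direct sum decompositions and modules of linear representations\<close>

text \<open>The fixed points and the kernel of an idempotent are complementary submodules. Only
  closure and the action on zero are assumed of the scalars, so that the lemma serves modules over
  the commutative parameter ring and left modules over a noncommutative algebra alike.\<close>

lemma indecomposable_idempotent:
  fixes R :: "('a, 'x) ring_scheme" and M :: "('a, 'b, 'y) module_scheme"
  assumes "abelian_group M" and closed: "\<And>a x. a \<in> carrier R \<Longrightarrow> x \<in> carrier M \<Longrightarrow> a \<odot>\<^bsub>M\<^esub> x \<in> carrier M"
    and zero: "\<And>a. a \<in> carrier R \<Longrightarrow> a \<odot>\<^bsub>M\<^esub> \<zero>\<^bsub>M\<^esub> = \<zero>\<^bsub>M\<^esub>"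
    and ind: "indecomposable R M" and e: "e \<in> module_hom R M M"
    and idem: "\<And>x. x \<in> carrier M \<Longrightarrow> e (e x) = e x"
  shows "(\<forall>x\<in>carrier M. e x = \<zero>\<^bsub>M\<^esub>) \<or> (\<forall>x\<in>carrier M. e x = x)"
proof -
  interpret M: abelian_group M by fact
  let ?N = "{x \<in> carrier M. e x = x}" and ?K = "{x \<in> carrier M. e x = \<zero>\<^bsub>M\<^esub>}"
  have ec: "e x \<in> carrier M" if "x \<in> carrier M" for x using e that by (auto simp: module_hom_def)
  have ea: "e (x \<oplus>\<^bsub>M\<^esub> y) = e x \<oplus>\<^bsub>M\<^esub> e y" if "x \<in> carrier M" "y \<in> carrier M" for x y
    using e that by (auto simp: module_hom_def)
  have es: "e (a \<odot>\<^bsub>M\<^esub> x) = a \<odot>\<^bsub>M\<^esub> e x" if "a \<in> carrier R" "x \<in> carrier M" for a x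
    using e that by (auto simp: module_hom_def)
  have ez: "e \<zero>\<^bsub>M\<^esub> = \<zero>\<^bsub>M\<^esub>"
    using ea[of "\<zero>\<^bsub>M\<^esub>" "\<zero>\<^bsub>M\<^esub>"] ec[of "\<zero>\<^bsub>M\<^esub>"] by (simp add: M.add.r_cancel_one')
  have ei: "e (\<ominus>\<^bsub>M\<^esub> x) = \<ominus>\<^bsub>M\<^esub> e x" if "x \<in> carrier M" for x
    using ea[of "\<ominus>\<^bsub>M\<^esub> x" x] that ec ez by (intro M.minus_equality[symmetric]) (auto simp: M.l_neg)
  have diff: "x \<oplus>\<^bsub>M\<^esub> \<ominus>\<^bsub>M\<^esub> e x \<in> ?K" if "x \<in> carrier M" for x
    using that by (simp add: ea ei ec idem M.r_neg)
  have dec: "e x \<oplus>\<^bsub>M\<^esub> (x \<oplus>\<^bsub>M\<^esub> \<ominus>\<^bsub>M\<^esub> e x) = x" if "x \<in> carrier M" for x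
    using that ec[OF that] by (metis M.a_assoc M.a_comm M.a_inv_closed M.r_neg M.r_zero)
  have "Module.submodule ?N R M"
    by (intro Module.submodule.intro subgroup.intro Module.submodule_axioms.intro)
      (use ei in \<open>auto simp: closed es ea ez a_inv_def\<close>)
  moreover have "Module.submodule ?K R M"
    by (intro Module.submodule.intro subgroup.intro Module.submodule_axioms.intro)
      (use ei M.minus_equality[of "\<zero>\<^bsub>M\<^esub>" "\<zero>\<^bsub>M\<^esub>"] in \<open>auto simp: closed es ea ez zero a_inv_def\<close>)
  moreover have "?N \<inter> ?K = {\<zero>\<^bsub>M\<^esub>}" using ez by auto
  moreover have "?N <+>\<^bsub>M\<^esub> ?K = carrier M"
  proof (intro equalityI subsetI)
    fix x assume "x \<in> ?N <+>\<^bsub>M\<^esub> ?K" thus "x \<in> carrier M" by (auto simp: set_add_def')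
  next
    fix x assume x: "x \<in> carrier M"
    have "e x \<in> ?N" using x ec idem by simp
    thus "x \<in> ?N <+>\<^bsub>M\<^esub> ?K" using dec[OF x] diff[OF x] unfolding set_add_def' by blast
  qed
  ultimately have "?N = {\<zero>\<^bsub>M\<^esub>} \<or> ?K = {\<zero>\<^bsub>M\<^esub>}" using ind unfolding indecomposable_def by blast
  thus ?thesis
  proof
    assume N0: "?N = {\<zero>\<^bsub>M\<^esub>}"
    have "e x \<in> ?N" if "x \<in> carrier M" for x using ec idem that by simp
    thus ?thesis unfolding N0 by simp
  next
    assume "?K = {\<zero>\<^bsub>M\<^esub>}"
    hence "x \<oplus>\<^bsub>M\<^esub> \<ominus>\<^bsub>M\<^esub> e x = \<zero>\<^bsub>M\<^esub>" if "x \<in> carrier M" for x using diff[OF that] by blast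
    hence "e x = x" if "x \<in> carrier M" for x using dec[OF that] that ec by simp
    thus ?thesis by simp
  qed
qed

lemma (in module) direct_sum_projections:
  assumes N: "Module.submodule N R M" and N': "Module.submodule N' R M"
    and inter: "N \<inter> N' = {\<zero>\<^bsub>M\<^esub>}" and sum: "N <+>\<^bsub>M\<^esub> N' = carrier M"
  obtains e e' where "e \<in> module_hom R M M" "e' \<in> module_hom R M M"
    "\<And>x. x \<in> carrier M \<Longrightarrow> e x \<in> N \<and> e' x \<in> N' \<and> x = e x \<oplus>\<^bsub>M\<^esub> e' x"
    "\<And>x. x \<in> N \<Longrightarrow> e x = x" "\<And>x. x \<in> N' \<Longrightarrow> e' x = x" "\<And>x. x \<in> N' \<Longrightarrow> e x = \<zero>\<^bsub>M\<^esub>"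
proof -
  note NE = submoduleE[OF N] and N'E = submoduleE[OF N']
  have Nc: "a \<in> carrier M" if "a \<in> N" for a using NE(1) that by blast
  have N'c: "a \<in> carrier M" if "a \<in> N'" for a using N'E(1) that by blast
  have zN: "\<zero>\<^bsub>M\<^esub> \<in> N" "\<zero>\<^bsub>M\<^esub> \<in> N'" using inter by auto
  have uniq: "a = a' \<and> b = b'" if "a \<in> N" "a' \<in> N" "b \<in> N'" "b' \<in> N'" "a \<oplus>\<^bsub>M\<^esub> b = a' \<oplus>\<^bsub>M\<^esub> b'" for a a' b b'
  proof -
    note c = Nc[OF that(1)] Nc[OF that(2)] N'c[OF that(3)] N'c[OF that(4)]
    have "\<ominus>\<^bsub>M\<^esub> a' \<oplus>\<^bsub>M\<^esub> a = \<ominus>\<^bsub>M\<^esub> a' \<oplus>\<^bsub>M\<^esub> (a \<oplus>\<^bsub>M\<^esub> b \<oplus>\<^bsub>M\<^esub> \<ominus>\<^bsub>M\<^esub> b)"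
      using c by (simp add: M.a_assoc M.r_neg)
    also have "\<dots> = b' \<oplus>\<^bsub>M\<^esub> \<ominus>\<^bsub>M\<^esub> b"
      unfolding that(5) using c by (simp add: M.a_assoc M.r_neg1)
    finally have eq: "\<ominus>\<^bsub>M\<^esub> a' \<oplus>\<^bsub>M\<^esub> a = b' \<oplus>\<^bsub>M\<^esub> \<ominus>\<^bsub>M\<^esub> b" .
    have "\<ominus>\<^bsub>M\<^esub> a' \<oplus>\<^bsub>M\<^esub> a \<in> N" "b' \<oplus>\<^bsub>M\<^esub> \<ominus>\<^bsub>M\<^esub> b \<in> N'" using that NE N'E by auto
    hence "\<ominus>\<^bsub>M\<^esub> a' \<oplus>\<^bsub>M\<^esub> a = \<zero>\<^bsub>M\<^esub>" "b' \<oplus>\<^bsub>M\<^esub> \<ominus>\<^bsub>M\<^esub> b = \<zero>\<^bsub>M\<^esub>" using inter eq by auto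
    thus ?thesis using c by (metis M.a_inv_closed M.minus_equality M.minus_minus M.a_comm)
  qed
  have "\<exists>a b. x \<in> carrier M \<longrightarrow> a \<in> N \<and> b \<in> N' \<and> x = a \<oplus>\<^bsub>M\<^esub> b" for x
    using sum by (auto simp: set_add_def')
  then obtain e e' where e: "\<And>x. x \<in> carrier M \<Longrightarrow> e x \<in> N \<and> e' x \<in> N' \<and> x = e x \<oplus>\<^bsub>M\<^esub> e' x" by metis
  have dec: "e x = a \<and> e' x = b" if "a \<in> N" "b \<in> N'" "x = a \<oplus>\<^bsub>M\<^esub> b" for x a b
  proof -
    have "x \<in> carrier M" using that Nc N'c by simp
    thus ?thesis using e[of x] uniq[of "e x" a "e' x" b] that by metis
  qed
  have add: "e (x \<oplus>\<^bsub>M\<^esub> y) = e x \<oplus>\<^bsub>M\<^esub> e y \<and> e' (x \<oplus>\<^bsub>M\<^esub> y) = e' x \<oplus>\<^bsub>M\<^esub> e' y" if "x \<in> carrier M" "y \<in> carrier M" for x y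
  proof (rule dec)
    note ex = e[OF that(1)] and ey = e[OF that(2)]
    show "e x \<oplus>\<^bsub>M\<^esub> e y \<in> N" "e' x \<oplus>\<^bsub>M\<^esub> e' y \<in> N'" using ex ey NE N'E by auto
    have c: "e x \<in> carrier M" "e y \<in> carrier M" "e' x \<in> carrier M" "e' y \<in> carrier M"
      using ex ey Nc N'c by auto
    have "x \<oplus>\<^bsub>M\<^esub> y = (e x \<oplus>\<^bsub>M\<^esub> e' x) \<oplus>\<^bsub>M\<^esub> (e y \<oplus>\<^bsub>M\<^esub> e' y)" using ex ey by metis
    also have "\<dots> = e x \<oplus>\<^bsub>M\<^esub> e y \<oplus>\<^bsub>M\<^esub> (e' x \<oplus>\<^bsub>M\<^esub> e' y)" using c by (simp add: M.a_ac)
    finally show "x \<oplus>\<^bsub>M\<^esub> y = e x \<oplus>\<^bsub>M\<^esub> e y \<oplus>\<^bsub>M\<^esub> (e' x \<oplus>\<^bsub>M\<^esub> e' y)" .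
  qed
  have smult: "e (r \<odot>\<^bsub>M\<^esub> x) = r \<odot>\<^bsub>M\<^esub> e x \<and> e' (r \<odot>\<^bsub>M\<^esub> x) = r \<odot>\<^bsub>M\<^esub> e' x" if "r \<in> carrier R" "x \<in> carrier M" for r x
  proof (rule dec)
    note ex = e[OF that(2)]
    show "r \<odot>\<^bsub>M\<^esub> e x \<in> N" "r \<odot>\<^bsub>M\<^esub> e' x \<in> N'" using ex NE N'E that by auto
    have "r \<odot>\<^bsub>M\<^esub> x = r \<odot>\<^bsub>M\<^esub> (e x \<oplus>\<^bsub>M\<^esub> e' x)" using ex by metis
    thus "r \<odot>\<^bsub>M\<^esub> x = r \<odot>\<^bsub>M\<^esub> e x \<oplus>\<^bsub>M\<^esub> r \<odot>\<^bsub>M\<^esub> e' x" using that smult_r_distr[of r "e x" "e' x"] ex Nc N'c by metis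
  qed
  show ?thesis
  proof (rule that[of e e'])
    show "e \<in> module_hom R M M" "e' \<in> module_hom R M M"
      unfolding module_hom_def using e add smult Nc N'c by auto
    show "x \<in> N \<Longrightarrow> e x = x" for x using dec[of x "\<zero>\<^bsub>M\<^esub>" x] zN Nc by simp
    show "x \<in> N' \<Longrightarrow> e' x = x" "x \<in> N' \<Longrightarrow> e x = \<zero>\<^bsub>M\<^esub>" for x using dec[of "\<zero>\<^bsub>M\<^esub>" x x] zN N'c by simp_all
  qed (rule e)
qed

section \<open>Linear representations as modules over the parameter ring\<close>

lemma param_ring_simps [simp]: "(\<otimes>\<^bsub>param_ring n\<^esub>) = (*)" "\<one>\<^bsub>param_ring n\<^esub> = 1"
    "\<zero>\<^bsub>param_ring n\<^esub> = 0" "(\<oplus>\<^bsub>param_ring n\<^esub>) = (+)"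
  by (simp_all add: param_ring_def)

lemma carrier_param_ring: "q \<in> carrier (param_ring n) \<longleftrightarrow> (\<forall>\<epsilon>\<in>keys q. keys \<epsilon> \<subseteq> {1..n})"
  by (simp add: param_ring_def)

lemma param_ring_cring: "cring (param_ring n :: 'k :: field mpoly ring)"
proof (rule cringI)
  have add: "p + q \<in> carrier (param_ring n)" if "p \<in> carrier (param_ring n)" "q \<in> carrier (param_ring n)" for p q :: "'k mpoly"
    using that Poly_Mapping.keys_add[of p q] unfolding carrier_param_ring by blast
  show "abelian_group (param_ring n :: 'k mpoly ring)"
  proof (rule abelian_groupI)
    fix x :: "'k mpoly" assume "x \<in> carrier (param_ring n)"
    thus "\<exists>y\<in>carrier (param_ring n). y \<oplus>\<^bsub>param_ring n\<^esub> x = \<zero>\<^bsub>param_ring n\<^esub>"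
      by (intro bexI[of _ "- x"]) (auto simp: carrier_param_ring)
  qed (auto simp: add add.assoc add.commute, simp add: carrier_param_ring)
  have mult: "p * q \<in> carrier (param_ring n)" if "p \<in> carrier (param_ring n)" "q \<in> carrier (param_ring n)" for p q :: "'k mpoly"
    unfolding carrier_param_ring
  proof
    fix \<epsilon> assume "\<epsilon> \<in> keys (p * q)"
    then obtain \<alpha> \<beta> where "\<epsilon> = \<alpha> + \<beta>" "\<alpha> \<in> keys p" "\<beta> \<in> keys q"
      using keys_mult[of p q] by blast
    thus "keys \<epsilon> \<subseteq> {1..n}" using that by (auto simp: carrier_param_ring keys_add_nat)
  qed
  show "Group.comm_monoid (param_ring n :: 'k mpoly ring)"
    by (rule comm_monoidI) (auto simp: mult mult.assoc mult.commute, simp add: carrier_param_ring)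
qed (auto simp: distrib_right)

context linear_rep
begin

abbreviation "L \<equiv> rep_module n (m, A)"

lemma rep_module_simps [simp]: "carrier L = carrier_vec m" "\<zero>\<^bsub>L\<^esub> = 0\<^sub>v m" "(\<oplus>\<^bsub>L\<^esub>) = (+)"
    "(\<odot>\<^bsub>L\<^esub>) = (\<lambda>q v. pm q *\<^sub>v v)"
  by (simp_all add: rep_module_def)

lemma pm_mats: "pm (p + q) = pm p + pm q" "pm (p * q) = pm p * pm q" "pm 1 = 1\<^sub>m m"
  by (rule eq_matI; simp add: pm_add pm_mult pm_one scalar_prod_def atLeast0LessThan)+

lemma rep_module_module: "module (param_ring n) L"
proof (rule moduleI[OF param_ring_cring])
  show "abelian_group L"
  proof (rule abelian_groupI)
    fix x assume "x \<in> carrier L"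
    thus "\<exists>y\<in>carrier L. y \<oplus>\<^bsub>L\<^esub> x = \<zero>\<^bsub>L\<^esub>" by (intro bexI[of _ "- x"]) (auto simp: uminus_l_inv_vec)
  qed (auto simp: assoc_add_vec comm_add_vec)
qed (auto simp: pm_mats add_mult_distrib_mat_vec[OF pm_carrier pm_carrier] mult_add_distrib_mat_vec[OF pm_carrier]
    intro: mult_mat_vec_carrier[OF pm_carrier] assoc_mult_mat_vec[OF pm_carrier pm_carrier])

lemma pm_commutes:
  assumes U: "U \<in> carrier_mat m m" and UA: "\<And>i. i \<in> {1..n} \<Longrightarrow> U * A i = A i * U"
  shows "U * pm q = pm q * U"
proof (rule eq_matI)
  fix r s assume "r < dim_row (pm q * U)" "s < dim_col (pm q * U)"
  hence rs: "r < m" "s < m" using U by auto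
  have monom: "(\<Sum>t<m. U $$ (r, t) * monom_mat n m A \<epsilon> $$ (t, s)) = (\<Sum>t<m. monom_mat n m A \<epsilon> $$ (r, t) * U $$ (t, s))" for \<epsilon>
  proof -
    have "U * monom_mat n m A \<epsilon> = monom_mat n m A \<epsilon> * U"
      unfolding monom_mat_def using foldr_intertwine[OF U, of "[1..<Suc n]" A A] A_carrier UA by (simp del: upt_Suc)
    from arg_cong[OF this, of "\<lambda>X. X $$ (r, s)"] show ?thesis
      using rs U carrier_matD[OF monom_mat_carrier[of \<epsilon>]] by (simp add: scalar_prod_def atLeast0LessThan)
  qed
  let ?K = "keys q" and ?l = "lookup q"
  have "(\<Sum>t<m. U $$ (r, t) * pm q $$ (t, s)) = (\<Sum>t<m. \<Sum>\<epsilon>\<in>?K. ?l \<epsilon> * (U $$ (r, t) * monom_mat n m A \<epsilon> $$ (t, s)))"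
    using rs by (simp add: poly_mat_def sum_distrib_left ac_simps)
  also have "\<dots> = (\<Sum>\<epsilon>\<in>?K. ?l \<epsilon> * (\<Sum>t<m. U $$ (r, t) * monom_mat n m A \<epsilon> $$ (t, s)))"
    unfolding sum_distrib_left by (rule sum.swap)
  also have "\<dots> = (\<Sum>t<m. \<Sum>\<epsilon>\<in>?K. ?l \<epsilon> * (monom_mat n m A \<epsilon> $$ (r, t) * U $$ (t, s)))"
    unfolding monom sum_distrib_left by (rule sum.swap)
  also have "\<dots> = (\<Sum>t<m. pm q $$ (r, t) * U $$ (t, s))"
    using rs by (simp add: poly_mat_def sum_distrib_right mult.assoc)
  finally show "(U * pm q) $$ (r, s) = (pm q * U) $$ (r, s)"
    using rs U by (simp add: scalar_prod_def atLeast0LessThan)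
qed (use U in auto)

lemma indecomposable_idempotent_mat:
  assumes ind: "indecomposable (param_ring n) L" and U: "U \<in> carrier_mat m m" and idem: "U * U = U"
    and UA: "\<And>i. i \<in> {1..n} \<Longrightarrow> U * A i = A i * U"
  shows "U = 0\<^sub>m m m \<or> U = 1\<^sub>m m"
proof -
  interpret Mod: module "param_ring n" L by (rule rep_module_module)
  have "U *\<^sub>v (pm q *\<^sub>v v) = pm q *\<^sub>v (U *\<^sub>v v)" if "v \<in> carrier_vec m" for q v
    using assoc_mult_mat_vec[OF U pm_carrier that] assoc_mult_mat_vec[OF pm_carrier U that] pm_commutes[OF U UA] by metis
  hence "(*\<^sub>v) U \<in> module_hom (param_ring n) L L"
    unfolding module_hom_def using U by (auto simp: mult_add_distrib_mat_vec[OF U])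
  moreover have "U *\<^sub>v (U *\<^sub>v v) = U *\<^sub>v v" if "v \<in> carrier_vec m" for v
    using assoc_mult_mat_vec[OF U U that] idem by simp
  ultimately have "(\<forall>v\<in>carrier L. U *\<^sub>v v = \<zero>\<^bsub>L\<^esub>) \<or> (\<forall>v\<in>carrier L. U *\<^sub>v v = v)"
    using ind Mod.smult_closed Mod.smult_r_null
    by (intro indecomposable_idempotent[OF Mod.abelian_group_axioms]) auto
  thus ?thesis
  proof
    assume "\<forall>v\<in>carrier L. U *\<^sub>v v = \<zero>\<^bsub>L\<^esub>"
    hence "col U j = 0\<^sub>v m" if "j < m" for j using mat_unit_vec_col[OF U that] by simp
    thus ?thesis using U by (intro disjI1 mat_col_eqI) auto
  next
    assume "\<forall>v\<in>carrier L. U *\<^sub>v v = v"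
    hence "col U j = unit_vec m j" if "j < m" for j using mat_unit_vec_col[OF U that] by simp
    thus ?thesis using U by (intro disjI2 mat_col_eqI) auto
  qed
qed

end

section \<open>The functor F\<close>

lemma F_arr_eq:
  "F_arr n h g (m, A) (m', A') U =
    mf_map n (inflate_mat n m A (phi h g n), inflate_mat n m A (psi h g n))
      (inflate_mat n m' A' (phi h g n), inflate_mat n m' A' (psi h g n)) (bdiag (2 ^ n) U, bdiag (2 ^ n) U)"
  by (simp add: F_arr_def inflated_mf_def bdiag_def Let_def)

lemma F_obj_eq: "F_obj n h g (m, A) = cok_module n (inflate_mat n m A (phi h g n))"
  by (simp add: F_obj_def inflated_mf_def mf_module_def)

lemma Arr_lin_rep_cat:
  "U \<in> Arr (lin_rep_cat n) (m, A) (m', A') \<longleftrightarrow> U \<in> carrier_mat m' m \<and> (\<forall>i\<in>{1..n}. U * A i = A' i * U)"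
  by (simp add: lin_rep_cat_def)

lemma Obj_lin_rep_cat: "Obj (lin_rep_cat n) = lin_reps n"
  by (simp add: lin_rep_cat_def)

lemma linear_rep_lin_reps: "(m, A) \<in> lin_reps n \<Longrightarrow> linear_rep n m A"
  unfolding lin_reps_def by unfold_locales auto

lemma lin_reps_cases:
  assumes "X \<in> lin_reps n"
  obtains m A where "X = (m, A)" "linear_rep n m A"
  using assms linear_rep_lin_reps by (cases X) auto

context expression
begin

lemma inflationI: "linear_rep n m A \<Longrightarrow> inflation n m f h g A"
  by (rule inflation.intro[OF expression_axioms])

lemma F_arr_in:
  assumes "linear_rep n m A" "linear_rep n m' A'" and U: "U \<in> Arr (lin_rep_cat n) (m, A) (m', A')"
  shows "F_arr n h g (m, A) (m', A') U \<in> Arr (MCM_cat R) (F_obj n h g (m, A)) (F_obj n h g (m', A'))"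
proof -
  interpret inflation_pair n m m' f h g A A' using assms(1,2) by (intro inflation_pair.intro inflationI)
  have U: "U \<in> carrier_mat m' m" "\<And>i. i \<in> {1..n} \<Longrightarrow> U * A i = A' i * U" using U by (auto simp: Arr_lin_rep_cat)
  show ?thesis
    using induced_map_hom[OF bdiag_over[OF U(1)] bdiag_over[OF U(1)] bdiag_commutes[OF U]]
    unfolding F_arr_eq F_obj_eq by (simp add: MCM_cat_def module_cat_def)
qed

lemma F_arr_comp:
  assumes "linear_rep n m A" "linear_rep n m' A'" "linear_rep n m'' A''"
    and U: "U \<in> Arr (lin_rep_cat n) (m, A) (m', A')" and U': "U' \<in> Arr (lin_rep_cat n) (m', A') (m'', A'')"
  shows "F_arr n h g (m, A) (m'', A'') (U' * U) =
      Cmp (MCM_cat R) (F_obj n h g (m, A)) (F_obj n h g (m', A')) (F_obj n h g (m'', A''))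
        (F_arr n h g (m', A') (m'', A'') U') (F_arr n h g (m, A) (m', A') U)"
    and "Ses (lin_rep_cat n) (m, A) (m', A') (m'', A'') U U' \<Longrightarrow>
      Ses (MCM_cat R) (F_obj n h g (m, A)) (F_obj n h g (m', A')) (F_obj n h g (m'', A''))
        (F_arr n h g (m, A) (m', A') U) (F_arr n h g (m', A') (m'', A'') U')"
proof -
  interpret A: inflation_pair n m m' f h g A A' using assms(1,2) by (intro inflation_pair.intro inflationI)
  interpret B: inflation_pair n m' m'' f h g A' A'' using assms(2,3) by (intro inflation_pair.intro inflationI)
  have U: "U \<in> carrier_mat m' m" "\<And>i. i \<in> {1..n} \<Longrightarrow> U * A i = A' i * U" using U by (auto simp: Arr_lin_rep_cat)
  have U': "U' \<in> carrier_mat m'' m'" "\<And>i. i \<in> {1..n} \<Longrightarrow> U' * A' i = A'' i * U'" using U' by (auto simp: Arr_lin_rep_cat)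
  interpret T: matrix_factorization_triple n "2 ^ n * m" "2 ^ n * m'" "2 ^ n * m''" f A.A.\<Phi> A.A.\<Psi> A.B.\<Phi> A.B.\<Psi> B.B.\<Phi> B.B.\<Psi>
      "bdiag (2 ^ n) U" "bdiag (2 ^ n) U'"
    using bdiag_over[OF U(1)] A.bdiag_commutes[OF U] bdiag_over[OF U'(1)] B.bdiag_commutes[OF U'] by unfold_locales auto
  show "F_arr n h g (m, A) (m'', A'') (U' * U) =
      Cmp (MCM_cat R) (F_obj n h g (m, A)) (F_obj n h g (m', A')) (F_obj n h g (m'', A''))
        (F_arr n h g (m', A') (m'', A'') U') (F_arr n h g (m, A) (m', A') U)"
    using T.induced_map_comp bdiag_mult[OF U(1) U'(1)]
    unfolding F_arr_eq F_obj_eq by (simp add: MCM_cat_def module_cat_def)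
  assume "Ses (lin_rep_cat n) (m, A) (m', A') (m'', A'') U U'"
  hence ex: "short_exact (rep_module n (m, A)) (rep_module n (m', A')) (rep_module n (m'', A'')) ((*\<^sub>v) U) ((*\<^sub>v) U')"
    by (simp add: lin_rep_cat_def)
  show "Ses (MCM_cat R) (F_obj n h g (m, A)) (F_obj n h g (m', A')) (F_obj n h g (m'', A''))
        (F_arr n h g (m, A) (m', A') U) (F_arr n h g (m', A') (m'', A'') U')"
    unfolding F_arr_eq F_obj_eq MCM_cat_def module_cat_def exact_cat.simps
    by (rule T.induced_map_exact; rule bdiag_exact[OF U(1) U'(1) ex]; assumption)
qed

lemma F_arr_one:
  assumes "linear_rep n m A"
  shows "F_arr n h g (m, A) (m, A) (1\<^sub>m m) = Idt (MCM_cat R) (F_obj n h g (m, A))"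
proof -
  interpret inflation n m f h g A using assms by (rule inflationI)
  show ?thesis using induced_map_one unfolding F_arr_eq F_obj_eq bdiag_one by (simp add: MCM_cat_def module_cat_def)
qed

text \<open>Mutually inverse maps of cokernels lift to matrices whose products act as the identity
  up to the images of the factorizations. The corners of the lifts are then mutually inverse and
  intertwine the representations.\<close>

lemma F_reflects_iso:
  assumes "linear_rep n m A" "linear_rep n m' A'"
    and "isomorphic (MCM_cat R) (F_obj n h g (m, A)) (F_obj n h g (m', A'))"
  shows "isomorphic (lin_rep_cat n) (m, A) (m', A')"
proof -
  interpret inflation_pair n m m' f h g A A' using assms(1,2) by (intro inflation_pair.intro inflationI)
  interpret BA: inflation_pair n m' m f h g A' A ..
  obtain u v where u: "u \<in> module_hom R A.M B.M" and v: "v \<in> module_hom R B.M A.M"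
    and vu: "compose (carrier A.M) v u = (\<lambda>x\<in>carrier A.M. x)" and uv: "compose (carrier B.M) u v = (\<lambda>x\<in>carrier B.M. x)"
    using assms(3) by (auto simp: isomorphic_def MCM_cat_def module_cat_def F_obj_eq)
  obtain P Q where P: "P \<in> mat_over n (2 ^ n * m') (2 ^ n * m)" "Q \<in> mat_over n (2 ^ n * m') (2 ^ n * m)"
    "P * A.\<Phi> = B.\<Phi> * Q" and uP: "\<And>x. x \<in> A.V \<Longrightarrow> u (A.cok x) = B.cok (P *\<^sub>v x)"
    using hom_lift[OF u] by blast
  obtain P' Q' where P': "P' \<in> mat_over n (2 ^ n * m) (2 ^ n * m')" "Q' \<in> mat_over n (2 ^ n * m) (2 ^ n * m')"
    "P' * B.\<Phi> = A.\<Phi> * Q'" and vP: "\<And>x. x \<in> B.V \<Longrightarrow> v (B.cok x) = A.cok (P' *\<^sub>v x)"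
    using BA.hom_lift[OF v] by blast
  define U where "U = mat m' m (\<lambda>(\<rho>, \<sigma>). mcoeff (P $$ (0 * m' + \<rho>, 0 * m + \<sigma>)) 0)"
  define U' where "U' = mat m m' (\<lambda>(\<rho>, \<sigma>). mcoeff (P' $$ (0 * m + \<rho>, 0 * m' + \<sigma>)) 0)"
  have one: "mat k k (\<lambda>(\<rho>, \<sigma>). mcoeff (1\<^sub>m (2 ^ n * k) $$ (0 * k + \<rho>, 0 * k + \<sigma>) :: 'k mps) 0) = 1\<^sub>m k" for k
    by (rule eq_matI) (use block_index_less[of 0 "2 ^ n" _ k] in \<open>auto simp: mcoeff_one\<close>)
  have "A.cok (P' *\<^sub>v (P *\<^sub>v x)) = A.cok (1\<^sub>m (2 ^ n * m) *\<^sub>v x)" if "x \<in> A.V" for x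
  proof -
    have "v (u (A.cok x)) = A.cok x" using fun_cong[OF vu, of "A.cok x"] A.cok_closed[OF that] by (simp add: compose_def)
    thus ?thesis using that by (simp add: uP vP mat_over_mult_vec[OF P(1)] A.V_carrier)
  qed
  from const_mult_corner[OF P(1) P' mat_over_one this] have 1: "U' * U = 1\<^sub>m m" by (simp only: U_def U'_def one)
  have "B.cok (P *\<^sub>v (P' *\<^sub>v x)) = B.cok (1\<^sub>m (2 ^ n * m') *\<^sub>v x)" if "x \<in> B.V" for x
  proof -
    have "u (v (B.cok x)) = B.cok x" using fun_cong[OF uv, of "B.cok x"] B.cok_closed[OF that] by (simp add: compose_def)
    thus ?thesis using that by (simp add: uP vP mat_over_mult_vec[OF P'(1)] B.V_carrier)
  qed
  from BA.const_mult_corner[OF P'(1) P mat_over_one this] have 2: "U * U' = 1\<^sub>m m'" by (simp only: U_def U'_def one)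
  have "U \<in> Arr (lin_rep_cat n) (m, A) (m', A')" "U' \<in> Arr (lin_rep_cat n) (m', A') (m, A)"
    using const_intertwines[OF P] BA.const_intertwines[OF P'] unfolding Arr_lin_rep_cat U_def U'_def by auto
  thus ?thesis using 1 2 unfolding isomorphic_def by (auto simp: lin_rep_cat_def)
qed

text \<open>For a decomposition with projections \<open>e\<close> and \<open>e'\<close>, the corner
  of a lift of \<open>e\<close> is an idempotent endomorphism of the representation, hence 0 or 1.
  If it is 0, \<open>idempotent_zero\<close> gives \<open>e = 0\<close>. If it is 1, the corner for
  \<open>e'\<close> is 0, because the two lifts add up to the identity on constant terms, and
  \<open>e' = 0\<close>.\<close>

lemma F_indecomposable:
  assumes A: "linear_rep n m A" and ind: "indecomposable (param_ring n) (rep_module n (m, A))"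
  shows "indecomposable R (F_obj n h g (m, A))"
proof -
  interpret inflation n m f h g A using A by (rule inflationI)
  interpret P: inflation_pair n m m f h g A A ..
  interpret Mod: module R M by (rule M_module)
  have m: "m > 0"
  proof (rule ccontr)
    assume "\<not> m > 0"
    hence "carrier L = {\<zero>\<^bsub>L\<^esub>}" using carrier_vec_dim_vec by (auto simp: rep_module_def)
    thus False using ind by (simp add: indecomposable_def)
  qed
  have lt: "\<rho> < 2 ^ n * m" if "\<rho> < m" for \<rho> using block_index_less[of 0 "2 ^ n" \<rho> m] that by simp
  \<comment> \<open>An indecomposable module must be non-zero; constant terms tell this class from
    0.\<close>
  have "cok (unit_vec (2 ^ n * m) 0) \<noteq> \<zero>\<^bsub>M\<^esub>"
  proof
    assume "cok (unit_vec (2 ^ n * m) 0) = \<zero>\<^bsub>M\<^esub>"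
    hence "cok (unit_vec (2 ^ n * m) 0) = cok (0\<^sub>v (2 ^ n * m))" by (simp only: zero_M)
    from cok_eq_const[OF free_vecs_unit free_vecs_zero this lt[OF m]]
    have "mcoeff (unit_vec (2 ^ n * m) 0 $ 0 :: 'k mps) 0 = mcoeff (0\<^sub>v (2 ^ n * m) $ 0 :: 'k mps) 0" .
    thus False using lt[OF m] by (simp add: mcoeff_one)
  qed
  hence nz: "carrier M \<noteq> {\<zero>\<^bsub>M\<^esub>}" using cok_closed[OF free_vecs_unit] by blast
  have "N = {\<zero>\<^bsub>M\<^esub>} \<or> N' = {\<zero>\<^bsub>M\<^esub>}"
    if N: "Module.submodule N R M" "Module.submodule N' R M" "N \<inter> N' = {\<zero>\<^bsub>M\<^esub>}" "N <+>\<^bsub>M\<^esub> N' = carrier M" for N N'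
  proof -
    obtain e e' where e: "e \<in> module_hom R M M" "e' \<in> module_hom R M M"
      and dec: "\<And>x. x \<in> carrier M \<Longrightarrow> e x \<in> N \<and> e' x \<in> N' \<and> x = e x \<oplus>\<^bsub>M\<^esub> e' x"
      and id: "\<And>x. x \<in> N \<Longrightarrow> e x = x" "\<And>x. x \<in> N' \<Longrightarrow> e' x = x" and "\<And>x. x \<in> N' \<Longrightarrow> e x = \<zero>\<^bsub>M\<^esub>"
      by (rule Mod.direct_sum_projections[OF N]) (rule that)
    have Nc: "N \<subseteq> carrier M" "N' \<subseteq> carrier M" "\<zero>\<^bsub>M\<^esub> \<in> N" "\<zero>\<^bsub>M\<^esub> \<in> N'"
      using Mod.submoduleE(1)[OF N(1)] Mod.submoduleE(1)[OF N(2)] N(3) by auto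
    obtain P Q where P: "P \<in> mat_over n (2 ^ n * m) (2 ^ n * m)" "Q \<in> mat_over n (2 ^ n * m) (2 ^ n * m)"
      "P * \<Phi> = \<Phi> * Q" and eP: "\<And>x. x \<in> V \<Longrightarrow> e (cok x) = cok (P *\<^sub>v x)"
      using P.hom_lift[OF e(1)] by blast
    obtain P' Q' where P': "P' \<in> mat_over n (2 ^ n * m) (2 ^ n * m)" "Q' \<in> mat_over n (2 ^ n * m) (2 ^ n * m)"
      "P' * \<Phi> = \<Phi> * Q'" and eP': "\<And>x. x \<in> V \<Longrightarrow> e' (cok x) = cok (P' *\<^sub>v x)"
      using P.hom_lift[OF e(2)] by blast
    note PV = mat_over_mult_vec[OF P(1)] and PV' = mat_over_mult_vec[OF P'(1)]
    have idem: "e (e x) = e x" "e' (e' x) = e' x" if "x \<in> carrier M" for x using dec[OF that] id by auto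
    define U where "U = mat m m (\<lambda>(\<rho>, \<sigma>). mcoeff (P $$ (0 * m + \<rho>, 0 * m + \<sigma>)) 0)"
    have "cok (P *\<^sub>v (P *\<^sub>v x)) = cok (P *\<^sub>v x)" if "x \<in> V" for x
      using idem(1)[OF cok_closed[OF that]] by (simp add: eP that PV)
    from P.const_mult_corner[OF P(1) P P(1) this] have "U * U = U" by (simp only: U_def)
    moreover have "U * A i = A i * U" if "i \<in> {1..n}" for i
      using P.const_intertwines[OF P that] unfolding U_def .
    ultimately consider "U = 0\<^sub>m m m" | "U = 1\<^sub>m m"
      using indecomposable_idempotent_mat[OF ind, of U] by (auto simp: U_def)
    thus ?thesis
    proof cases
      case 1
      have "mcoeff (P $$ (\<rho>, \<sigma>)) 0 = 0" if "\<rho> < m" "\<sigma> < m" for \<rho> \<sigma>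
        using arg_cong[OF 1, of "\<lambda>X. X $$ (\<rho>, \<sigma>)"] that by (simp add: U_def)
      hence e0: "e x = \<zero>\<^bsub>M\<^esub>" if "x \<in> carrier M" for x
        using idempotent_zero[OF e(1) idem(1) P eP _ that] by blast
      have "x = \<zero>\<^bsub>M\<^esub>" if "x \<in> N" for x using e0[of x] id(1)[OF that] that Nc(1) by auto
      thus ?thesis using Nc by blast
    next
      case 2
      have PP': "cok ((P + P') *\<^sub>v x) = cok (1\<^sub>m (2 ^ n * m) *\<^sub>v x)" if x: "x \<in> V" for x
        using dec[OF cok_closed[OF x]] x
        by (simp add: eP eP' cok_add PV PV' V_carrier add_mult_distrib_mat_vec[OF mat_over_carrier[OF P(1)] mat_over_carrier[OF P'(1)]])
      have PPo: "P + P' \<in> mat_over n (2 ^ n * m) (2 ^ n * m)"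
        using P(1) P'(1) by (auto simp: mat_over_def mps_over_closed)
      have "mcoeff (P' $$ (\<rho>, \<sigma>)) 0 = 0" if "\<rho> < m" "\<sigma> < m" for \<rho> \<sigma>
      proof -
        have "mcoeff ((P + P') $$ (\<rho>, \<sigma>)) 0 = mcoeff (1\<^sub>m (2 ^ n * m) $$ (\<rho>, \<sigma>) :: 'k mps) 0"
          by (rule cok_mat_eq_const[OF PPo mat_over_one PP' lt[OF that(1)] lt[OF that(2)]])
        moreover have "mcoeff (P $$ (\<rho>, \<sigma>)) 0 = (if \<rho> = \<sigma> then 1 else 0)"
          using arg_cong[OF 2, of "\<lambda>X. X $$ (\<rho>, \<sigma>)"] that by (simp add: U_def)
        ultimately show ?thesis
          using lt[OF that(1)] lt[OF that(2)] carrier_matD[OF mat_over_carrier[OF P(1)]] carrier_matD[OF mat_over_carrier[OF P'(1)]]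
          by (cases "\<rho> = \<sigma>") (simp_all add: mcoeff_one)
      qed
      hence e'0: "e' x = \<zero>\<^bsub>M\<^esub>" if "x \<in> carrier M" for x
        using idempotent_zero[OF e(2) idem(2) P' eP' _ that] by blast
      have "x = \<zero>\<^bsub>M\<^esub>" if "x \<in> N'" for x using e'0[of x] id(2)[OF that] that Nc(2) by auto
      thus ?thesis using Nc by blast
    qed
  qed
  thus ?thesis using nz unfolding indecomposable_def F_obj_eq by blast
qed

theorem F_rep_embedding:
  assumes "infinite (UNIV :: 'k set)"
  shows "rep_embedding (lin_rep_cat n) (MCM_cat R) (F_obj n h g) (F_arr n h g)"
  unfolding rep_embedding_def is_functor_def Obj_lin_rep_cat
proof (intro conjI ballI impI; (elim lin_reps_cases)?)
  fix X m and A :: "nat \<Rightarrow> 'k mat" assume X: "X = (m, A)" "linear_rep n m A"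
  interpret inflation n m f h g A using X(2) by (rule inflationI)
  show "F_obj n h g X \<in> Obj (MCM_cat R)"
    using \<Phi>_MCM[OF assms] by (simp add: X F_obj_eq MCM_cat_def module_cat_def)
  show "F_arr n h g X X (Idt (lin_rep_cat n) X) = Idt (MCM_cat R) (F_obj n h g X)"
    using F_arr_one[OF X(2)] by (simp add: X lin_rep_cat_def)
  show "Indec (MCM_cat R) (F_obj n h g X)" if "Indec (lin_rep_cat n) X"
    using F_indecomposable[OF X(2)] that by (simp add: X lin_rep_cat_def MCM_cat_def module_cat_def)
next
  fix X Y m m' u and A A' :: "nat \<Rightarrow> 'k mat" assume X: "X = (m, A)" "linear_rep n m A" and Y: "Y = (m', A')" "linear_rep n m' A'"
  show "F_arr n h g X Y u \<in> Arr (MCM_cat R) (F_obj n h g X) (F_obj n h g Y)" if "u \<in> Arr (lin_rep_cat n) X Y"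
    using F_arr_in[OF X(2) Y(2)] that by (simp add: X Y)
  show "\<not> isomorphic (MCM_cat R) (F_obj n h g X) (F_obj n h g Y)" if "\<not> isomorphic (lin_rep_cat n) X Y"
    using F_reflects_iso[OF X(2) Y(2)] that by (auto simp: X Y)
next
  fix X Y Z m m' m'' u v and A A' A'' :: "nat \<Rightarrow> 'k mat"
  assume XYZ: "X = (m, A)" "linear_rep n m A" "Y = (m', A')" "linear_rep n m' A'" "Z = (m'', A'')" "linear_rep n m'' A''"
    and uv: "u \<in> Arr (lin_rep_cat n) X Y" "v \<in> Arr (lin_rep_cat n) Y Z"
  note c = F_arr_comp[OF XYZ(2,4,6) uv[unfolded XYZ(1,3,5)]]
  show "F_arr n h g X Z (Cmp (lin_rep_cat n) X Y Z v u) =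
      Cmp (MCM_cat R) (F_obj n h g X) (F_obj n h g Y) (F_obj n h g Z) (F_arr n h g Y Z v) (F_arr n h g X Y u)"
    using c(1) by (simp add: XYZ lin_rep_cat_def)
  show "Ses (MCM_cat R) (F_obj n h g X) (F_obj n h g Y) (F_obj n h g Z) (F_arr n h g X Y u) (F_arr n h g Y Z v)"
    if "Ses (lin_rep_cat n) X Y Z u v" using c(2) that by (simp add: XYZ)
qed

end

section \<open>Existence of an expression of f\<close>

lemma param_ring_closed:
  fixes p q :: "'k :: field mpoly"
  shows "0 \<in> carrier (param_ring n :: 'k mpoly ring)" "1 \<in> carrier (param_ring n :: 'k mpoly ring)"
    "p \<in> carrier (param_ring n) \<Longrightarrow> q \<in> carrier (param_ring n) \<Longrightarrow> p + q \<in> carrier (param_ring n)"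
    "p \<in> carrier (param_ring n) \<Longrightarrow> q \<in> carrier (param_ring n) \<Longrightarrow> p * q \<in> carrier (param_ring n)"
proof -
  interpret cring "param_ring n :: 'k mpoly ring" by (rule param_ring_cring)
  show "0 \<in> carrier (param_ring n :: 'k mpoly ring)" "1 \<in> carrier (param_ring n :: 'k mpoly ring)"
    "p \<in> carrier (param_ring n) \<Longrightarrow> q \<in> carrier (param_ring n) \<Longrightarrow> p + q \<in> carrier (param_ring n)"
    "p \<in> carrier (param_ring n) \<Longrightarrow> q \<in> carrier (param_ring n) \<Longrightarrow> p * q \<in> carrier (param_ring n)"
    using zero_closed one_closed add.m_closed[of p q] m_closed[of p q] by simp_all
qed

lemma param_ring_power_sum:
  fixes c :: "'k :: field mpoly"
  shows "c \<in> carrier (param_ring n) \<Longrightarrow> c ^ t \<in> carrier (param_ring n)"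
    "(\<And>t. t \<in> T \<Longrightarrow> u t \<in> carrier (param_ring n)) \<Longrightarrow> (\<Sum>t\<in>T. u t :: 'k mpoly) \<in> carrier (param_ring n)"
proof -
  show "c \<in> carrier (param_ring n) \<Longrightarrow> c ^ t \<in> carrier (param_ring n)"
    by (induction t) (auto intro: param_ring_closed)
  show "(\<And>t. t \<in> T \<Longrightarrow> u t \<in> carrier (param_ring n)) \<Longrightarrow> (\<Sum>t\<in>T. u t :: 'k mpoly) \<in> carrier (param_ring n)"
    by (induction T rule: infinite_finite_induct) (auto intro: param_ring_closed)
qed

text \<open>
  Division by \<open>x\<^sub>i - c z\<close>: substituting \<open>c z\<close> for \<open>x\<^sub>i\<close> step by step produces the coefficients \<open>W\<close>;
  those at monomials involving \<open>x\<^sub>i\<close> form the quotient, the others the remainder.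
\<close>

lemma linear_division:
  fixes p :: "'k :: field mpoly mps"
  assumes p: "p \<in> mps_over V" "order_ge (Suc d) p" "\<And>\<mu>. mcoeff p \<mu> \<in> carrier (param_ring n)"
    and c: "c \<in> carrier (param_ring n)" and V: "0 \<in> V" "i \<in> V" "i \<noteq> 0"
  obtains q e where "p = (mps_var i - mps_const c * mps_var 0) * q + e"
    "q \<in> mps_over V" "order_ge d q" "\<And>\<mu>. mcoeff q \<mu> \<in> carrier (param_ring n)"
    "e \<in> mps_over (V - {i})" "order_ge (Suc d) e" "\<And>\<mu>. mcoeff e \<mu> \<in> carrier (param_ring n)"
proof -
  let ?s = "single :: nat \<Rightarrow> nat \<Rightarrow> nat \<Rightarrow>\<^sub>0 nat" and ?l = "lookup :: (nat \<Rightarrow>\<^sub>0 nat) \<Rightarrow> nat \<Rightarrow> nat"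
  define W where "W \<nu> = (\<Sum>t\<le>?l \<nu> 0. c ^ t * mcoeff p (\<nu> - ?s 0 t + ?s i t))" for \<nu>
  have W0: "W \<nu> = mcoeff p \<nu>" if "?l \<nu> 0 = 0" for \<nu> using that by (simp add: W_def)
  \<comment> \<open>This recursion is the coefficient form of the identity
    \<open>p = (x_i - c z) q + e\<close>.\<close>
  have WS: "W \<nu> = mcoeff p \<nu> + c * W (\<nu> - ?s 0 1 + ?s i 1)" if "?l \<nu> 0 \<noteq> 0" for \<nu>
  proof -
    obtain k where k: "?l \<nu> 0 = Suc k" using \<open>?l \<nu> 0 \<noteq> 0\<close> by (cases "?l \<nu> 0") auto
    have l: "?l (\<nu> - ?s 0 1 + ?s i 1) 0 = k" using k V by (simp add: lookup_add lookup_minus lookup_single)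
    have sh: "\<nu> - ?s 0 1 + ?s i 1 - ?s 0 t + ?s i t = \<nu> - ?s 0 (Suc t) + ?s i (Suc t)" for t
      using V by (intro poly_mapping_eqI) (auto simp: lookup_add lookup_minus lookup_single when_def)
    have "W \<nu> = mcoeff p \<nu> + (\<Sum>t\<le>k. c ^ Suc t * mcoeff p (\<nu> - ?s 0 (Suc t) + ?s i (Suc t)))"
      unfolding W_def k by (simp add: sum.atMost_Suc_shift del: sum.atMost_Suc)
    also have "(\<Sum>t\<le>k. c ^ Suc t * mcoeff p (\<nu> - ?s 0 (Suc t) + ?s i (Suc t))) = c * W (\<nu> - ?s 0 1 + ?s i 1)"
      unfolding W_def l sh by (simp add: sum_distrib_left mult.assoc)
    finally show ?thesis .
  qed
  \<comment> \<open>The shift moves \<open>t\<close> units of exponent from \<open>z\<close> to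
    \<open>x_i\<close>, so it preserves degrees. It is stated additively because subtraction of
    exponents is truncated.\<close>
  have sub: "\<nu> - ?s 0 t + ?s i t + ?s 0 t = \<nu> + ?s i t" if "t \<le> ?l \<nu> 0" for \<nu> t
    using that by (intro poly_mapping_eqI) (auto simp: lookup_add lookup_minus lookup_single when_def)
  have W_order: "W \<nu> = 0" if "total_degree \<nu> < Suc d" for \<nu>
  proof -
    have "mcoeff p (\<nu> - ?s 0 t + ?s i t) = 0" if "t \<le> ?l \<nu> 0" for t
      using arg_cong[OF sub[OF that], of total_degree] \<open>total_degree \<nu> < Suc d\<close>
      by (intro order_geD[OF p(2)]) (simp add: total_degree_add)
    thus ?thesis by (simp add: W_def)
  qed
  have W_over: "keys \<nu> \<subseteq> V" if "W \<nu> \<noteq> 0" for \<nu>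
  proof -
    obtain t where "t \<in> {..?l \<nu> 0}" "c ^ t * mcoeff p (\<nu> - ?s 0 t + ?s i t) \<noteq> 0"
      using \<open>W \<nu> \<noteq> 0\<close> unfolding W_def by (rule sum.not_neutral_contains_not_neutral)
    hence t: "t \<le> ?l \<nu> 0" "mcoeff p (\<nu> - ?s 0 t + ?s i t) \<noteq> 0" by auto
    hence "keys (\<nu> - ?s 0 t + ?s i t) \<subseteq> V" using p(1) by (auto simp: mps_over_def)
    thus ?thesis using arg_cong[OF sub[OF t(1)], of keys] V by (auto simp: keys_add_nat split: if_splits)
  qed
  have W_param: "W \<nu> \<in> carrier (param_ring n)" for \<nu>
    unfolding W_def by (intro param_ring_power_sum(2) param_ring_closed(4) param_ring_power_sum(1) c p(3))
  define q where "q = Mps (\<lambda>\<mu>. W (\<mu> + ?s i 1))"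
  define e where "e = Mps (\<lambda>\<mu>. if ?l \<mu> i = 0 then W \<mu> else 0)"
  show ?thesis
  proof (rule that[of q e])
    show "p = (mps_var i - mps_const c * mps_var 0) * q + e"
    proof (rule mps_eqI)
      fix \<mu>
      have x: "mcoeff (mps_var i * q) \<mu> = (if ?l \<mu> i = 0 then 0 else W \<mu>)"
        using lookup_ge_1D[of \<mu> i] unfolding mcoeff_var_times by (auto simp: q_def add.commute)
      have z: "c * mcoeff (mps_var 0 * q) \<mu> = W \<mu> - mcoeff p \<mu>"
        using W0[of \<mu>] WS[of \<mu>] unfolding mcoeff_var_times by (simp add: q_def)
      have "mcoeff ((mps_var i - mps_const c * mps_var 0) * q + e) \<mu> =
          mcoeff (mps_var i * q) \<mu> - c * mcoeff (mps_var 0 * q) \<mu> + mcoeff e \<mu>"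
        by (simp add: left_diff_distrib mult.assoc)
      thus "mcoeff p \<mu> = mcoeff ((mps_var i - mps_const c * mps_var 0) * q + e) \<mu>"
        by (simp add: x z e_def)
    qed
    show "q \<in> mps_over V"
      using W_over by (intro mps_overI) (fastforce simp: q_def keys_add_nat)
    show "order_ge d q"
      using W_order by (auto simp: order_ge_def q_def total_degree_add)
    show "e \<in> mps_over (V - {i})"
      using W_over by (intro mps_overI) (auto simp: e_def in_keys_iff split: if_splits)
    show "order_ge (Suc d) e"
      using W_order by (auto simp: order_ge_def e_def)
    show "mcoeff q \<mu> \<in> carrier (param_ring n)" "mcoeff e \<mu> \<in> carrier (param_ring n)" for \<mu>
      using W_param by (auto simp: q_def e_def param_ring_closed)
  qed
qed

text \<open>Wildness is claimed for \<open>f\<close> alone, without a given expression. Dividing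
  successively by the linear forms gives quotients of order at least 3 and leaves a remainder of
  order at least 4 that involves only \<open>z\<close>; splitting off \<open>z^2\<close> leaves a
  cofactor of order at least 2.\<close>

lemma expression_exists:
  fixes f :: "'k :: field mps"
  assumes f: "f \<in> mps_over {0..n}" "order_ge 4 f"
  shows "\<exists>h g. is_expression n f h g"
proof -
  let ?K = "carrier (param_ring n) :: 'k mpoly set"
  have "\<exists>g e. extend_scalars f = (\<Sum>i = 1..j. (x_var i - a_param i * z_var) * g i) + e \<and>
      (\<forall>i\<in>{1..j}. g i \<in> mps_over {0..n} \<and> order_ge 3 (g i) \<and> (\<forall>\<mu>. mcoeff (g i) \<mu> \<in> ?K)) \<and>
      e \<in> mps_over ({0..n} - {1..j}) \<and> order_ge 4 e \<and> (\<forall>\<mu>. mcoeff e \<mu> \<in> ?K)" if "j \<le> n" for j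
    using that
  proof (induction j)
    case 0
    have "single (0 :: nat \<Rightarrow>\<^sub>0 nat) c = 0 \<longleftrightarrow> c = 0" for c :: 'k
      by (metis lookup_single_eq lookup_zero single_zero)
    thus ?case
      using f by (intro exI[of _ "extend_scalars f"] exI)
        (auto simp: extend_scalars_def mps_over_def order_ge_def carrier_param_ring split: if_splits)
  next
    case (Suc j)
    then obtain g e where g: "extend_scalars f = (\<Sum>i = 1..j. (x_var i - a_param i * z_var) * g i) + e"
        "\<And>i. i \<in> {1..j} \<Longrightarrow> g i \<in> mps_over {0..n} \<and> order_ge 3 (g i) \<and> (\<forall>\<mu>. mcoeff (g i) \<mu> \<in> ?K)"
      and e: "e \<in> mps_over ({0..n} - {1..j})" "order_ge (Suc 3) e" "\<And>\<mu>. mcoeff e \<mu> \<in> ?K"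
      by (auto simp: numeral_eq_Suc)
    have c: "single (single (Suc j) 1) 1 \<in> ?K"
      using Suc.prems by (auto simp: carrier_param_ring)
    obtain q e' where q: "e = (x_var (Suc j) - mps_const (single (single (Suc j) 1) 1) * z_var) * q + e'"
        "q \<in> mps_over ({0..n} - {1..j})" "order_ge 3 q" "\<And>\<mu>. mcoeff q \<mu> \<in> ?K"
      and e': "e' \<in> mps_over ({0..n} - {1..j} - {Suc j})" "order_ge (Suc 3) e'" "\<And>\<mu>. mcoeff e' \<mu> \<in> ?K"
      using linear_division[OF e c] Suc.prems by (metis Diff_iff atLeastAtMost_iff le0 nat.distinct(1) not_less_eq_eq order_refl zero_le_one not_one_le_zero)
    let ?g = "g(Suc j := q)"
    have "(\<Sum>i = 1..j. (x_var i - a_param i * z_var) * ?g i) = (\<Sum>i = 1..j. (x_var i - a_param i * z_var) * g i)"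
      by (intro sum.cong) auto
    hence "extend_scalars f = (\<Sum>i = 1..Suc j. (x_var i - a_param i * z_var) * ?g i) + e'"
      using g(1) q(1) by (simp add: a_param_def)
    moreover have "q \<in> mps_over {0..n}" using q(2) mps_over_mono[of "{0..n} - {1..j}" "{0..n}"] by blast
    moreover have "{0..n} - {1..j} - {Suc j} = {0..n} - {1..Suc j}" by auto
    ultimately show ?case
      using g(2) q e' by (intro exI[of _ ?g] exI[of _ e']) (auto simp: numeral_eq_Suc)
  qed
  from this[OF order_refl] obtain g e where
    g: "extend_scalars f = (\<Sum>i = 1..n. (x_var i - a_param i * z_var) * g i) + e"
      "\<And>i. i \<in> {1..n} \<Longrightarrow> g i \<in> mps_over {0..n} \<and> order_ge 3 (g i) \<and> (\<forall>\<mu>. mcoeff (g i) \<mu> \<in> ?K)"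
    and e: "e \<in> mps_over ({0..n} - {1..n})" "order_ge 4 e" "\<And>\<mu>. mcoeff e \<mu> \<in> ?K" by auto
  let ?s = "single 0 2 :: nat \<Rightarrow>\<^sub>0 nat"
  define h where "h = Mps (\<lambda>\<mu>. mcoeff e (\<mu> + ?s))"
  have ke: "keys \<mu> \<subseteq> {0}" if "mcoeff e \<mu> \<noteq> 0" for \<mu>
    using e(1) that by (force simp: mps_over_def)
  have "e = z_var ^ 2 * h"
  proof (rule mps_eqI)
    fix \<mu>
    have sh: "\<mu> - single 0 1 - single 0 1 + ?s = \<mu>" if "2 \<le> lookup \<mu> 0"
      using that by (intro poly_mapping_eqI) (auto simp: lookup_add lookup_minus lookup_single when_def simp del: single_numeral)
    have "mcoeff e \<mu> = 0" if "lookup \<mu> 0 < 2"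
    proof (rule ccontr)
      assume nz: "mcoeff e \<mu> \<noteq> 0"
      hence "total_degree \<mu> = lookup \<mu> 0" using total_degree_eq[OF _ ke[OF nz]] by simp
      thus False using order_geD[OF e(2), of \<mu>] that nz by simp
    qed
    thus "mcoeff e \<mu> = mcoeff (z_var ^ 2 * h) \<mu>"
      using sh unfolding power2_eq_square mult.assoc mcoeff_var_times
      by (cases "lookup \<mu> 0 < 2") (auto simp: h_def lookup_minus)
  qed
  moreover have "h \<in> mps_over {0..n}"
    using ke by (intro mps_overI) (force simp: h_def keys_add_nat)
  moreover have "order_ge 2 h"
    using e(2) by (auto simp: order_ge_def h_def total_degree_add simp del: single_numeral)
  moreover have "mcoeff h \<mu> \<in> ?K" for \<mu> using e(3) by (simp add: h_def)
  ultimately have "is_expression n f h g"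
    using g by (auto simp: is_expression_def param_series_def carrier_mps_ring order_ge_iff numeral_eq_enat)
  thus ?thesis by blast
qed

section \<open>Tuples of matrices as commuting pairs\<close>

abbreviation blocks :: "nat \<Rightarrow> 'a :: zero mat \<Rightarrow> 'a mat" where
  "blocks c U \<equiv> diag_block_mat (replicate c U)"

lemma blocks_carrier: "U \<in> carrier_mat r s \<Longrightarrow> blocks c U \<in> carrier_mat (c * r) (c * s)"
  by (simp add: diag_block_replicate)

interpretation mps_const_hom: comm_semiring_hom "mps_const :: 'k :: field \<Rightarrow> 'k mps"
  by unfold_locales (auto intro!: mps_eqI simp: mcoeff_const mcoeff_one)

interpretation mcoeff_0_hom: comm_semiring_hom "\<lambda>p :: 'k :: field mps. mcoeff p 0"
  by unfold_locales (auto simp: mcoeff_one)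

lemma coeff_bdiag: "map_mat (\<lambda>p. mcoeff p 0) (bdiag c U) = blocks c U"
  by (rule eq_matI) (auto simp: bdiag_def mcoeff_const)

lemma blocks_one: "blocks c (1\<^sub>m s) = (1\<^sub>m (c * s) :: 'k :: field mat)"
  using coeff_bdiag[of c "1\<^sub>m s :: 'k mat"] by (simp add: bdiag_one mcoeff_0_hom.mat_hom_one)

lemma blocks_mult:
  fixes U V :: "'k :: field mat"
  assumes "U \<in> carrier_mat r s" "V \<in> carrier_mat q r"
  shows "blocks c (V * U) = blocks c V * blocks c U"
  using mcoeff_0_hom.mat_hom_mult[OF mat_over_carrier[OF bdiag_over[OF assms(2)]] mat_over_carrier[OF bdiag_over[OF assms(1)]], of c]
  unfolding bdiag_mult[OF assms, symmetric] coeff_bdiag by simp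

text \<open>Transferred from the power series version: vectors over \<open>k\<close> are embedded as
  constant series, and solutions are brought back by taking constant terms.\<close>

lemma blocks_exact:
  fixes U V :: "'k :: field mat"
  assumes U: "U \<in> carrier_mat r s" and V: "V \<in> carrier_mat q r"
    and ex: "short_exact (rep_module n (s, A)) (rep_module n (r, A')) (rep_module n (q, A'')) ((*\<^sub>v) U) ((*\<^sub>v) V)"
  shows "short_exact (rep_module n (c * s, C)) (rep_module n (c * r, C')) (rep_module n (c * q, C''))
    ((*\<^sub>v) (blocks c U)) ((*\<^sub>v) (blocks c V))"
proof -
  note ex = bdiag_exact[OF U V ex, where c = c]
  note Uc = blocks_carrier[OF U, of c] and Vc = blocks_carrier[OF V, of c]
  have const: "bdiag c W *\<^sub>v map_vec mps_const v = map_vec mps_const (blocks c W *\<^sub>v v)"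
    if "W \<in> carrier_mat a b" "v \<in> carrier_vec (c * b)" for W :: "'k mat" and a b v
    unfolding bdiag_def using mps_const_hom.mult_mat_vec_hom[OF blocks_carrier[OF that(1)] that(2)] by simp
  have coeff: "map_vec (\<lambda>p. mcoeff p 0) (bdiag c W *\<^sub>v v) = blocks c W *\<^sub>v map_vec (\<lambda>p. mcoeff p 0) v"
    if "W \<in> carrier_mat a b" "v \<in> carrier_vec (c * b)" for W :: "'k mat" and a b v
    using mcoeff_0_hom.mult_mat_vec_hom[OF mat_over_carrier[OF bdiag_over[OF that(1)]] that(2)] by (simp add: coeff_bdiag)
  have free: "map_vec mps_const v \<in> free_vecs n N" if "v \<in> carrier_vec N" for v :: "'k vec" and N
    using that by (auto simp: free_vecs_iff)
  have coeff_const: "map_vec (\<lambda>p. mcoeff p 0) (map_vec mps_const v) = v" for v :: "'k vec"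
    by (intro eq_vecI) (auto simp: mcoeff_const)
  have zero: "map_vec mps_const (0\<^sub>v N) = (0\<^sub>v N :: 'k mps vec)" for N by (intro eq_vecI) auto
  have ker: "v = 0\<^sub>v (c * s)" if v: "v \<in> carrier_vec (c * s)" "blocks c U *\<^sub>v v = 0\<^sub>v (c * r)" for v
    using ex(1)[OF free[OF v(1)]] const[OF U v(1)] zero v coeff_const by metis
  have "inj_on ((*\<^sub>v) (blocks c U)) (carrier_vec (c * s))"
  proof (rule inj_onI)
    fix x y assume xy: "x \<in> carrier_vec (c * s)" "y \<in> carrier_vec (c * s)" "blocks c U *\<^sub>v x = blocks c U *\<^sub>v y"
    have "blocks c U *\<^sub>v (x - y) = 0\<^sub>v (c * r)"
      using mult_minus_distrib_mat_vec[OF Uc xy(1,2)] xy(3) minus_cancel_vec[OF mult_mat_vec_carrier[OF Uc xy(2)]] by simp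
    hence z: "x - y = 0\<^sub>v (c * s)" using ker xy by simp
    show "x = y" using minus_add_cancel_vec[OF xy(1,2)] xy(2) unfolding z by simp
  qed
  moreover have "(*\<^sub>v) (blocks c U) ` carrier_vec (c * s) = {y \<in> carrier_vec (c * r). blocks c V *\<^sub>v y = 0\<^sub>v (c * q)}"
  proof (intro equalityI subsetI)
    fix y assume "y \<in> (*\<^sub>v) (blocks c U) ` carrier_vec (c * s)"
    then obtain x where x: "x \<in> carrier_vec (c * s)" "y = blocks c U *\<^sub>v x" by blast
    have "map_vec mps_const (blocks c V *\<^sub>v y) = 0\<^sub>v (c * q)"
      using ex(2)[OF free[OF x(1)]] const[OF U x(1)] const[OF V, of y] x Uc by simp
    thus "y \<in> {y \<in> carrier_vec (c * r). blocks c V *\<^sub>v y = 0\<^sub>v (c * q)}"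
      using coeff_const zero x Uc by (metis (mono_tags, lifting) mem_Collect_eq mult_mat_vec_carrier)
  next
    fix y assume y: "y \<in> {y \<in> carrier_vec (c * r). blocks c V *\<^sub>v y = 0\<^sub>v (c * q)}"
    hence "bdiag c V *\<^sub>v map_vec mps_const y = 0\<^sub>v (c * q)" using const[OF V] zero by auto
    then obtain u where u: "u \<in> free_vecs n (c * s)" "map_vec mps_const y = bdiag c U *\<^sub>v u"
      using ex(3)[OF free] y by blast
    have "y = blocks c U *\<^sub>v map_vec (\<lambda>p. mcoeff p 0) u"
      using coeff[OF U free_vecs_carrier[OF u(1)]] coeff_const[of y] u(2) by simp
    thus "y \<in> (*\<^sub>v) (blocks c U) ` carrier_vec (c * s)" using free_vecs_carrier[OF u(1)] by auto
  qed
  moreover have "(*\<^sub>v) (blocks c V) ` carrier_vec (c * r) = carrier_vec (c * q)"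
  proof (intro equalityI subsetI)
    fix y assume "y \<in> (*\<^sub>v) (blocks c V) ` carrier_vec (c * r)"
    thus "y \<in> carrier_vec (c * q)" using Vc by auto
  next
    fix y :: "'k vec" assume y: "y \<in> carrier_vec (c * q)"
    obtain u where u: "u \<in> free_vecs n (c * r)" "map_vec mps_const y = bdiag c V *\<^sub>v u"
      using ex(4)[OF free[OF y]] by blast
    have "y = blocks c V *\<^sub>v map_vec (\<lambda>p. mcoeff p 0) u"
      using coeff[OF V free_vecs_carrier[OF u(1)]] coeff_const[of y] u(2) by simp
    thus "y \<in> (*\<^sub>v) (blocks c V) ` carrier_vec (c * r)" using free_vecs_carrier[OF u(1)] by auto
  qed
  ultimately show ?thesis by (simp add: short_exact_def rep_module_def)
qed

text \<open>
  A tuple \<open>B\<^sub>0, \<dots>, B\<^sub>N\<^sub>-\<^sub>1\<close> of \<open>s \<times> s\<close> matrices is encoded in two steps: as the pair of \<open>X = diag(\<lambda>\<^sub>r)\<close> and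
  \<open>Y\<close>, which has identity blocks below the diagonal and \<open>B\<^sub>0, \<dots>, B\<^sub>N\<^sub>-\<^sub>1\<close> in its first row, and this pair
  as the commuting pair on four copies of the space given by
  \<open>a(w\<^sub>0, w\<^sub>1, w\<^sub>2, w\<^sub>3) = (0, w\<^sub>0, 0, w\<^sub>1 + X w\<^sub>2)\<close> and \<open>b(w\<^sub>0, w\<^sub>1, w\<^sub>2, w\<^sub>3) = (0, 0, w\<^sub>0, X w\<^sub>1 + Y w\<^sub>2)\<close>.
  The index of the \<open>\<rho>\<close>-th coordinate of the \<open>r\<close>-th block of \<open>w\<^sub>q\<close> is \<open>ix s q r \<rho>\<close>.
\<close>

locale tuple_encoding =
  fixes N :: nat and lam :: "nat \<Rightarrow> 'k :: field"
  assumes N: "N > 0" and lam: "inj_on lam {..<N}"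
begin

definition ix :: "nat \<Rightarrow> nat \<Rightarrow> nat \<Rightarrow> nat \<Rightarrow> nat" where
  "ix s q r \<rho> = (q * N + r) * s + \<rho>"

abbreviation ent :: "nat \<Rightarrow> nat \<Rightarrow> 'k mat \<Rightarrow> nat \<Rightarrow> nat \<Rightarrow> nat \<Rightarrow> nat \<Rightarrow> nat \<Rightarrow> nat \<Rightarrow> 'k" where
  "ent s s' C q r \<rho> q' r' \<sigma> \<equiv> C $$ (ix s q r \<rho>, ix s' q' r' \<sigma>)"

definition tmat :: "nat \<Rightarrow> nat \<Rightarrow> (nat \<Rightarrow> nat \<Rightarrow> nat \<Rightarrow> nat \<Rightarrow> nat \<Rightarrow> nat \<Rightarrow> 'k) \<Rightarrow> 'k mat" where
  "tmat s s' E = mat (4 * N * s) (4 * N * s') (\<lambda>(i, j).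
     E (i div s div N) (i div s mod N) (i mod s) (j div s' div N) (j div s' mod N) (j mod s'))"

lemma ix_less: "q < 4 \<Longrightarrow> r < N \<Longrightarrow> \<rho> < s \<Longrightarrow> ix s q r \<rho> < 4 * N * s"
  unfolding ix_def by (intro block_index_less)

lemma ix_decode: "r < N \<Longrightarrow> \<rho> < s \<Longrightarrow> ix s q r \<rho> div s div N = q \<and> ix s q r \<rho> div s mod N = r \<and> ix s q r \<rho> mod s = \<rho>"
  by (simp add: ix_def)

lemma ix_cases:
  assumes "i < 4 * N * s"
  obtains q r \<rho> where "q < 4" "r < N" "\<rho> < s" "i = ix s q r \<rho>"
  using assms unfolding ix_def by (elim block_index_cases) blast

lemma tmat_carrier [simp]: "tmat s s' E \<in> carrier_mat (4 * N * s) (4 * N * s')"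
  by (simp add: tmat_def)

lemma tmat_ent:
  "q < 4 \<Longrightarrow> r < N \<Longrightarrow> \<rho> < s \<Longrightarrow> q' < 4 \<Longrightarrow> r' < N \<Longrightarrow> \<sigma> < s' \<Longrightarrow> ent s s' (tmat s s' E) q r \<rho> q' r' \<sigma> = E q r \<rho> q' r' \<sigma>"
  by (simp add: tmat_def ix_less ix_decode)

lemma mat_ixI:
  assumes "C \<in> carrier_mat (4 * N * s) (4 * N * s')" "D \<in> carrier_mat (4 * N * s) (4 * N * s')"
    "\<And>q r \<rho> q' r' \<sigma>. q < 4 \<Longrightarrow> r < N \<Longrightarrow> \<rho> < s \<Longrightarrow> q' < 4 \<Longrightarrow> r' < N \<Longrightarrow> \<sigma> < s' \<Longrightarrow>
      ent s s' C q r \<rho> q' r' \<sigma> = ent s s' D q r \<rho> q' r' \<sigma>"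
  shows "C = D"
proof (rule eq_matI)
  fix i j assume "i < dim_row D" "j < dim_col D"
  hence "i < 4 * N * s" "j < 4 * N * s'" using assms(2) by auto
  thus "C $$ (i, j) = D $$ (i, j)" using assms(3) by (elim ix_cases) simp
qed (use assms in auto)

lemma mult_ent:
  assumes "C \<in> carrier_mat (4 * N * s) (4 * N * t)" "D \<in> carrier_mat (4 * N * t) (4 * N * u)"
    "q < 4" "r < N" "\<rho> < s" "q' < 4" "r' < N" "\<sigma> < u"
  shows "ent s u (C * D) q r \<rho> q' r' \<sigma> =
    (\<Sum>q1<4. \<Sum>r1<N. \<Sum>\<tau><t. ent s t C q r \<rho> q1 r1 \<tau> * ent t u D q1 r1 \<tau> q' r' \<sigma>)"
proof -
  let ?F = "\<lambda>a \<tau>. C $$ (ix s q r \<rho>, a * t + \<tau>) * D $$ (a * t + \<tau>, ix u q' r' \<sigma>)"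
  have "ent s u (C * D) q r \<rho> q' r' \<sigma> = (\<Sum>a<4 * N. \<Sum>\<tau><t. ?F a \<tau>)"
    using assms by (intro mat_mult_blocks) (auto intro: ix_less)
  also have "\<dots> = (\<Sum>a<4 * N. \<Sum>\<tau><t. ?F (a div N * N + a mod N) \<tau>)" by simp
  also have "\<dots> = (\<Sum>q1<4. \<Sum>r1<N. \<Sum>\<tau><t. ?F (q1 * N + r1) \<tau>)"
    using sum_blocks[of "\<lambda>q1 r1. \<Sum>\<tau><t. ?F (q1 * N + r1) \<tau>" N 4] by simp
  finally show ?thesis by (simp add: ix_def)
qed

definition aM :: "nat \<Rightarrow> 'k mat" where
  "aM s = tmat s s (\<lambda>q r \<rho> q' r' \<sigma>. if r = r' then if \<rho> = \<sigma> then
     (if q = 1 \<and> q' = 0 \<or> q = 3 \<and> q' = 1 then 1 else if q = 3 \<and> q' = 2 then lam r else 0) else 0 else 0)"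

definition bM :: "nat \<Rightarrow> (nat \<Rightarrow> 'k mat) \<Rightarrow> 'k mat" where
  "bM s B = tmat s s (\<lambda>q r \<rho> q' r' \<sigma>.
     if q = 3 \<and> q' = 2 then if r = Suc r' then if \<rho> = \<sigma> then 1 else 0 else if r = 0 then B r' $$ (\<rho>, \<sigma>) else 0
     else if r = r' then if \<rho> = \<sigma> then (if q = 2 \<and> q' = 0 then 1 else if q = 3 \<and> q' = 1 then lam r else 0) else 0 else 0)"

lemma aM_carrier: "aM s \<in> carrier_mat (4 * N * s) (4 * N * s)" and bM_carrier: "bM s B \<in> carrier_mat (4 * N * s) (4 * N * s)"
  by (simp_all add: aM_def bM_def)

lemma sum_4: "(\<Sum>q<4. F q) = F 0 + F 1 + F 2 + F (3 :: nat)" for F :: "nat \<Rightarrow> 'k"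
  by (simp add: numeral_eq_Suc)

lemma times_if_zero: "x * (if P then y else 0) = (if P then x * y else (0 :: 'k))" "(if P then y else 0) * x = (if P then y * x else (0 :: 'k))"
  by auto

lemma sum_if_zero: "(\<Sum>t\<in>T. if P then F t else 0) = (if P then sum F T else (0 :: 'k))"
  by auto

lemma mult_aM:
  assumes "C \<in> carrier_mat (4 * N * s) (4 * N * t)" "q < 4" "r < N" "\<rho> < s" "q' < 4" "r' < N" "\<sigma> < t"
  shows "ent s t (C * aM t) q r \<rho> q' r' \<sigma> =
    (if q' = 0 then ent s t C q r \<rho> 1 r' \<sigma> else if q' = 1 then ent s t C q r \<rho> 3 r' \<sigma>
     else if q' = 2 then ent s t C q r \<rho> 3 r' \<sigma> * lam r' else 0)"
  unfolding mult_ent[OF assms(1) aM_carrier assms(2-)]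
  using assms(2-) by (simp add: aM_def tmat_ent sum_4 times_if_zero sum_if_zero)

lemma aM_mult:
  assumes "C \<in> carrier_mat (4 * N * s) (4 * N * t)" "q < 4" "r < N" "\<rho> < s" "q' < 4" "r' < N" "\<sigma> < t"
  shows "ent s t (aM s * C) q r \<rho> q' r' \<sigma> =
    (if q = 1 then ent s t C 0 r \<rho> q' r' \<sigma>
     else if q = 3 then ent s t C 1 r \<rho> q' r' \<sigma> + lam r * ent s t C 2 r \<rho> q' r' \<sigma> else 0)"
  unfolding mult_ent[OF aM_carrier assms]
  using assms(2-) by (simp add: aM_def tmat_ent sum_4 times_if_zero sum_if_zero)

lemma mult_bM:
  assumes "C \<in> carrier_mat (4 * N * s) (4 * N * t)" "q < 4" "r < N" "\<rho> < s" "q' < 4" "r' < N" "\<sigma> < t"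
  shows "ent s t (C * bM t B) q r \<rho> q' r' \<sigma> =
    (if q' = 0 then ent s t C q r \<rho> 2 r' \<sigma> else if q' = 1 then ent s t C q r \<rho> 3 r' \<sigma> * lam r'
     else if q' = 2 then (\<Sum>\<tau><t. ent s t C q r \<rho> 3 0 \<tau> * B r' $$ (\<tau>, \<sigma>)) +
       (if Suc r' < N then ent s t C q r \<rho> 3 (Suc r') \<sigma> else 0) else 0)"
proof -
  have *: "(\<Sum>r1<N. \<Sum>\<tau><t. ent s t C q r \<rho> 3 r1 \<tau> *
      (if r1 = Suc r' then if \<tau> = \<sigma> then 1 else 0 else if r1 = 0 then B r' $$ (\<tau>, \<sigma>) else 0)) =
    (\<Sum>\<tau><t. ent s t C q r \<rho> 3 0 \<tau> * B r' $$ (\<tau>, \<sigma>)) + (if Suc r' < N then ent s t C q r \<rho> 3 (Suc r') \<sigma> else 0)"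
  proof -
    have "(\<Sum>r1<N. \<Sum>\<tau><t. ent s t C q r \<rho> 3 r1 \<tau> *
        (if r1 = Suc r' then if \<tau> = \<sigma> then 1 else 0 else if r1 = 0 then B r' $$ (\<tau>, \<sigma>) else 0)) =
      (\<Sum>r1<N. (if r1 = 0 then \<Sum>\<tau><t. ent s t C q r \<rho> 3 0 \<tau> * B r' $$ (\<tau>, \<sigma>) else 0) +
        (if r1 = Suc r' then ent s t C q r \<rho> 3 (Suc r') \<sigma> else 0))"
      using assms(7) by (intro sum.cong) (auto simp: times_if_zero)
    also have "\<dots> = (\<Sum>\<tau><t. ent s t C q r \<rho> 3 0 \<tau> * B r' $$ (\<tau>, \<sigma>)) + (if Suc r' < N then ent s t C q r \<rho> 3 (Suc r') \<sigma> else 0)"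
      using N by (simp add: sum.distrib)
    finally show ?thesis .
  qed
  consider "q' = 0" | "q' = 1" | "q' = 2" | "q' = 3" using assms(5) by linarith
  thus ?thesis
    unfolding mult_ent[OF assms(1) bM_carrier assms(2-)]
    using assms(2-) * by cases (simp_all add: bM_def tmat_ent sum_4 times_if_zero sum_if_zero)
qed

lemma bM_mult:
  assumes "C \<in> carrier_mat (4 * N * s) (4 * N * t)" "q < 4" "r < N" "\<rho> < s" "q' < 4" "r' < N" "\<sigma> < t"
  shows "ent s t (bM s B * C) q r \<rho> q' r' \<sigma> =
    (if q = 2 then ent s t C 0 r \<rho> q' r' \<sigma>
     else if q = 3 then lam r * ent s t C 1 r \<rho> q' r' \<sigma> +
       (if r = 0 then \<Sum>i<N. \<Sum>\<tau><s. B i $$ (\<rho>, \<tau>) * ent s t C 2 i \<tau> q' r' \<sigma> else ent s t C 2 (r - 1) \<rho> q' r' \<sigma>)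
     else 0)"
proof -
  have *: "(\<Sum>r1<N. \<Sum>\<tau><s. (if r = Suc r1 then if \<rho> = \<tau> then 1 else 0 else if r = 0 then B r1 $$ (\<rho>, \<tau>) else 0) *
      ent s t C 2 r1 \<tau> q' r' \<sigma>) =
    (if r = 0 then \<Sum>i<N. \<Sum>\<tau><s. B i $$ (\<rho>, \<tau>) * ent s t C 2 i \<tau> q' r' \<sigma> else ent s t C 2 (r - 1) \<rho> q' r' \<sigma>)"
  proof (cases r)
    case 0 show ?thesis unfolding 0 by simp
  next
    case (Suc k) show ?thesis using assms(3,4) unfolding Suc by (simp add: times_if_zero sum_if_zero cong: if_cong)
  qed
  show ?thesis
    unfolding mult_ent[OF bM_carrier assms]
    using assms(2-) * by (auto simp: bM_def tmat_ent sum_4 times_if_zero sum_if_zero)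
qed

text \<open>Both products send \<open>(w_0, w_1, w_2, w_3)\<close> to
  \<open>(0, 0, 0, X w_0)\<close>.\<close>

lemma aM_bM_commute: "aM s * bM s B = bM s B * aM s"
proof (rule mat_ixI)
  fix q r \<rho> q' r' \<sigma> :: nat assume *: "q < 4" "r < N" "\<rho> < s" "q' < 4" "r' < N" "\<sigma> < s"
  show "ent s s (aM s * bM s B) q r \<rho> q' r' \<sigma> = ent s s (bM s B * aM s) q r \<rho> q' r' \<sigma>"
    unfolding aM_mult[OF bM_carrier *] mult_aM[OF bM_carrier *]
    using * by (auto simp: bM_def tmat_ent)
qed (use mult_carrier_mat aM_carrier bM_carrier in blast)+

lemma blocks_ent:
  assumes "U \<in> carrier_mat s t" "q < 4" "r < N" "\<rho> < s" "q' < 4" "r' < N" "\<sigma> < t"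
  shows "ent s t (blocks (4 * N) U) q r \<rho> q' r' \<sigma> = (if q = q' \<and> r = r' then U $$ (\<rho>, \<sigma>) else 0)"
proof -
  have "ix s q r \<rho> div s = ix t q' r' \<sigma> div t \<longleftrightarrow> q = q' \<and> r = r'"
    using ix_decode[OF assms(3,4), of q] ix_decode[OF assms(6,7), of q'] assms by (metis div_mult_mod_eq)
  thus ?thesis using assms by (simp add: diag_block_replicate ix_less ix_decode)
qed

lemma blocks_intertwines:
  assumes U: "U \<in> carrier_mat s t" and UB: "\<And>i. i < N \<Longrightarrow> U * B i = B' i * U"
    and B: "\<And>i. i < N \<Longrightarrow> B i \<in> carrier_mat t t" "\<And>i. i < N \<Longrightarrow> B' i \<in> carrier_mat s s"
  shows "blocks (4 * N) U * aM t = aM s * blocks (4 * N) U"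
    and "blocks (4 * N) U * bM t B = bM s B' * blocks (4 * N) U"
proof -
  note D = blocks_carrier[OF U, of "4 * N"]
  show "blocks (4 * N) U * aM t = aM s * blocks (4 * N) U"
  proof (rule mat_ixI)
    fix q r \<rho> q' r' \<sigma> :: nat assume *: "q < 4" "r < N" "\<rho> < s" "q' < 4" "r' < N" "\<sigma> < t"
    show "ent s t (blocks (4 * N) U * aM t) q r \<rho> q' r' \<sigma> = ent s t (aM s * blocks (4 * N) U) q r \<rho> q' r' \<sigma>"
      unfolding mult_aM[OF D *] aM_mult[OF D *] using * by (auto simp: blocks_ent[OF U])
  qed (use mult_carrier_mat aM_carrier D in blast)+
  show "blocks (4 * N) U * bM t B = bM s B' * blocks (4 * N) U"
  proof (rule mat_ixI)
    fix q r \<rho> q' r' \<sigma> :: nat assume *: "q < 4" "r < N" "\<rho> < s" "q' < 4" "r' < N" "\<sigma> < t"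
    have "(\<Sum>\<tau><t. U $$ (\<rho>, \<tau>) * B r' $$ (\<tau>, \<sigma>)) = (\<Sum>\<tau><s. B' r' $$ (\<rho>, \<tau>) * U $$ (\<tau>, \<sigma>))"
      using arg_cong[OF UB[OF *(5)], of "\<lambda>X. X $$ (\<rho>, \<sigma>)"] U B[OF *(5)] * by (simp add: scalar_prod_def atLeast0LessThan)
    moreover have "(\<Sum>i<N. \<Sum>\<tau><s. B' i $$ (\<rho>, \<tau>) * ent s t (blocks (4 * N) U) 2 i \<tau> q' r' \<sigma>) =
        (if q' = 2 then \<Sum>\<tau><s. B' r' $$ (\<rho>, \<tau>) * U $$ (\<tau>, \<sigma>) else 0)"
    proof -
      have "(\<Sum>i<N. \<Sum>\<tau><s. B' i $$ (\<rho>, \<tau>) * ent s t (blocks (4 * N) U) 2 i \<tau> q' r' \<sigma>) =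
          (\<Sum>i<N. if i = r' then (if q' = 2 then \<Sum>\<tau><s. B' r' $$ (\<rho>, \<tau>) * U $$ (\<tau>, \<sigma>) else 0) else 0)"
        using * by (intro sum.cong) (auto simp: blocks_ent[OF U])
      thus ?thesis using * by simp
    qed
    ultimately show "ent s t (blocks (4 * N) U * bM t B) q r \<rho> q' r' \<sigma> = ent s t (bM s B' * blocks (4 * N) U) q r \<rho> q' r' \<sigma>"
      unfolding mult_bM[OF D *] bM_mult[OF D *] using * N by (auto simp: blocks_ent[OF U])
  qed (use mult_carrier_mat bM_carrier D in blast)+
qed

text \<open>
  A homomorphism between encoded tuples is block lower triangular for the four copies, and its diagonal
  blocks coincide and commute with \<open>X\<close> and \<open>Y\<close>. Commuting with \<open>X\<close> makes them block diagonal because the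
  \<open>\<lambda>\<^sub>r\<close> are distinct, commuting with \<open>Y\<close> makes all \<open>N\<close> blocks equal to one matrix commuting with the \<open>B\<^sub>i\<close>.
\<close>

lemma encoding_hom:
  assumes C: "C \<in> carrier_mat (4 * N * s) (4 * N * t)"
    and a: "C * aM t = aM s * C" and b: "C * bM t B = bM s B' * C"
    and B: "\<And>i. i < N \<Longrightarrow> B i \<in> carrier_mat t t" "\<And>i. i < N \<Longrightarrow> B' i \<in> carrier_mat s s"
  defines "U \<equiv> mat s t (\<lambda>(\<rho>, \<sigma>). ent s t C 0 0 \<rho> 0 0 \<sigma>)"
  shows "i < N \<Longrightarrow> U * B i = B' i * U"
    and "q < 4 \<Longrightarrow> r < N \<Longrightarrow> \<rho> < s \<Longrightarrow> q' < 4 \<Longrightarrow> r' < N \<Longrightarrow> \<sigma> < t \<Longrightarrow> q \<le> q' \<Longrightarrow>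
      ent s t C q r \<rho> q' r' \<sigma> = (if q = q' \<and> r = r' then U $$ (\<rho>, \<sigma>) else 0)"
proof -
  have ea: "ent s t (C * aM t) q r \<rho> q' r' \<sigma> = ent s t (aM s * C) q r \<rho> q' r' \<sigma>"
    and eb: "ent s t (C * bM t B) q r \<rho> q' r' \<sigma> = ent s t (bM s B' * C) q r \<rho> q' r' \<sigma>" for q r \<rho> q' r' \<sigma>
    using a b by simp_all
  define c where "c = (\<lambda>r \<rho> r' \<sigma>. ent s t C 0 r \<rho> 0 r' \<sigma>)"
  \<comment> \<open>Relations between the blocks of \<open>C\<close> for the four copies: those
    above the diagonal and the one in row 2 and column 1 vanish, and all diagonal blocks equal
    \<open>c\<close>, the block of copy 0.\<close>
  have L: "ent s t C 0 r \<rho> 1 r' \<sigma> = 0" "ent s t C 0 r \<rho> 3 r' \<sigma> = 0" "ent s t C 0 r \<rho> 2 r' \<sigma> = 0"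
    "ent s t C 1 r \<rho> 2 r' \<sigma> = 0" "ent s t C 1 r \<rho> 3 r' \<sigma> = 0" "ent s t C 2 r \<rho> 3 r' \<sigma> = 0"
    "ent s t C 2 r \<rho> 1 r' \<sigma> = 0"
    "ent s t C 1 r \<rho> 1 r' \<sigma> = c r \<rho> r' \<sigma>" "ent s t C 2 r \<rho> 2 r' \<sigma> = c r \<rho> r' \<sigma>" "ent s t C 3 r \<rho> 3 r' \<sigma> = c r \<rho> r' \<sigma>"
    if *: "r < N" "\<rho> < s" "r' < N" "\<sigma> < t" for r \<rho> r' \<sigma>
  proof -
    have A: "q < 4 \<Longrightarrow> q' < 4 \<Longrightarrow>
      (if q' = 0 then ent s t C q r \<rho> 1 r' \<sigma> else if q' = 1 then ent s t C q r \<rho> 3 r' \<sigma>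
       else if q' = 2 then ent s t C q r \<rho> 3 r' \<sigma> * lam r' else 0) =
      (if q = 1 then ent s t C 0 r \<rho> q' r' \<sigma>
       else if q = 3 then ent s t C 1 r \<rho> q' r' \<sigma> + lam r * ent s t C 2 r \<rho> q' r' \<sigma> else 0)" for q q'
      using ea[of q r \<rho> q' r' \<sigma>] mult_aM[OF C _ *(1,2) _ *(3,4), of q q'] aM_mult[OF C _ *(1,2) _ *(3,4), of q q'] by simp
    have Bq: "q < 4 \<Longrightarrow>
      ent s t C q r \<rho> 2 r' \<sigma> = ent s t (bM s B' * C) q r \<rho> 0 r' \<sigma>" for q
      using eb[of q r \<rho> 0 r' \<sigma>] mult_bM[OF C _ *(1,2) _ *(3,4), of q 0 B] by simp
    have B0: "ent s t C 0 r \<rho> 2 r' \<sigma> = 0" "ent s t C 1 r \<rho> 2 r' \<sigma> = 0" "ent s t C 2 r \<rho> 2 r' \<sigma> = c r \<rho> r' \<sigma>"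
      using Bq[of 0] Bq[of 1] Bq[of 2] bM_mult[OF C _ *(1,2) _ *(3,4), of _ 0 B'] by (simp_all add: c_def)
    show A01: "ent s t C 0 r \<rho> 1 r' \<sigma> = 0" using A[of 0 0] by simp
    show A03: "ent s t C 0 r \<rho> 3 r' \<sigma> = 0" using A[of 0 1] by simp
    show "ent s t C 0 r \<rho> 2 r' \<sigma> = 0" "ent s t C 1 r \<rho> 2 r' \<sigma> = 0" "ent s t C 2 r \<rho> 2 r' \<sigma> = c r \<rho> r' \<sigma>" by (rule B0)+
    show A11: "ent s t C 1 r \<rho> 1 r' \<sigma> = c r \<rho> r' \<sigma>" using A[of 1 0] by (simp add: c_def)
    show "ent s t C 1 r \<rho> 3 r' \<sigma> = 0" using A[of 1 1] A01 by simp
    show "ent s t C 2 r \<rho> 3 r' \<sigma> = 0" using A[of 2 1] by simp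
    show A21: "ent s t C 2 r \<rho> 1 r' \<sigma> = 0" using A[of 2 0] by simp
    show "ent s t C 3 r \<rho> 3 r' \<sigma> = c r \<rho> r' \<sigma>" using A[of 3 1] A11 A21 by simp
  qed
  have b3: "ent s t (C * bM t B) 3 r \<rho> q' r' \<sigma> = ent s t (bM s B' * C) 3 r \<rho> q' r' \<sigma>" for r \<rho> q' r' \<sigma> by (rule eb)
  \<comment> \<open>Row 3 and column 1 of the equation for \<open>b\<close>: as the block in row 2
    and column 1 vanishes, \<open>c\<close> commutes with \<open>X\<close>.\<close>
  have X: "c r \<rho> r' \<sigma> = 0" if *: "r < N" "\<rho> < s" "r' < N" "\<sigma> < t" "r \<noteq> r'" for r \<rho> r' \<sigma>
  proof -
    have sum0: "(\<Sum>i<N. \<Sum>\<tau><s. B' i $$ (\<rho>, \<tau>) * ent s t C 2 i \<tau> 1 r' \<sigma>) = 0"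
      using L(7)[OF _ _ *(3,4)] by simp
    have "ent s t C 3 r \<rho> 3 r' \<sigma> * lam r' = lam r * ent s t C 1 r \<rho> 1 r' \<sigma>"
      using b3[of r \<rho> 1 r' \<sigma>] mult_bM[OF C _ *(1,2) _ *(3,4), of 3 1 B] bM_mult[OF C _ *(1,2) _ *(3,4), of 3 1 B']
        sum0 L(7)[of "r - 1", OF _ *(2,3,4)] *(1) by (simp split: if_splits)
    hence "c r \<rho> r' \<sigma> * (lam r' - lam r) = 0" using L(8,10)[OF *(1-4)] by (simp add: algebra_simps)
    moreover have "lam r' \<noteq> lam r" using inj_onD[OF lam, of r' r] * by auto
    ultimately show ?thesis by simp
  qed
  \<comment> \<open>Row 3 and column 2 of the same equation: as the block in row 1 and column 2
    vanishes, \<open>c\<close> intertwines the two matrices \<open>Y\<close>.\<close>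
  have Y: "(\<Sum>\<tau><t. c r \<rho> 0 \<tau> * B r' $$ (\<tau>, \<sigma>)) + (if Suc r' < N then c r \<rho> (Suc r') \<sigma> else 0) =
      (if r = 0 then \<Sum>i<N. \<Sum>\<tau><s. B' i $$ (\<rho>, \<tau>) * c i \<tau> r' \<sigma> else c (r - 1) \<rho> r' \<sigma>)"
    if *: "r < N" "\<rho> < s" "r' < N" "\<sigma> < t" for r \<rho> r' \<sigma>
  proof -
    have 1: "(\<Sum>\<tau><t. c r \<rho> 0 \<tau> * B r' $$ (\<tau>, \<sigma>)) = (\<Sum>\<tau><t. ent s t C 3 r \<rho> 3 0 \<tau> * B r' $$ (\<tau>, \<sigma>))"
      using L(10)[OF *(1,2) N] by (intro sum.cong) auto
    have 2: "(\<Sum>i<N. \<Sum>\<tau><s. B' i $$ (\<rho>, \<tau>) * c i \<tau> r' \<sigma>) = (\<Sum>i<N. \<Sum>\<tau><s. B' i $$ (\<rho>, \<tau>) * ent s t C 2 i \<tau> 2 r' \<sigma>)"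
      using L(9)[OF _ _ *(3,4)] by (intro sum.cong) auto
    show ?thesis unfolding 1 2
      using b3[of r \<rho> 2 r' \<sigma>] mult_bM[OF C _ *(1,2) _ *(3,4), of 3 2 B] bM_mult[OF C _ *(1,2) _ *(3,4), of 3 2 B']
        L(4)[OF *] L(10)[OF *(1,2) _ *(4), of "Suc r'"] L(9)[of "r - 1", OF less_imp_diff_less[OF *(1)] *(2,3,4)]
      by (cases "Suc r' < N"; cases "r = 0") simp_all
  qed
  \<comment> \<open>The identity blocks below the diagonal of \<open>Y\<close> equate consecutive
    diagonal blocks of \<open>c\<close>; the first row of \<open>Y\<close> is left for the relation
    with the \<open>B i\<close>.\<close>
  have diag: "c r \<rho> r \<sigma> = U $$ (\<rho>, \<sigma>)" if "r < N" "\<rho> < s" "\<sigma> < t" for r \<rho> \<sigma>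
    using that(1)
  proof (induction r)
    case 0 show ?case using that by (simp add: U_def c_def)
  next
    case (Suc r)
    have "(\<Sum>\<tau><t. c (Suc r) \<rho> 0 \<tau> * B r $$ (\<tau>, \<sigma>)) = 0"
      using X[OF Suc.prems that(2) N] by simp
    hence "c (Suc r) \<rho> (Suc r) \<sigma> = c r \<rho> r \<sigma>"
      using Y[OF Suc.prems that(2) _ that(3), of r] Suc.prems by simp
    thus ?case using Suc by simp
  qed
  show "U * B i = B' i * U" if i: "i < N" for i
  proof (rule eq_matI)
    fix \<rho> \<sigma> assume "\<rho> < dim_row (B' i * U)" "\<sigma> < dim_col (B' i * U)"
    hence *: "\<rho> < s" "\<sigma> < t" using B(2)[OF i] by (auto simp: U_def)
    have 1: "(\<Sum>\<tau><t. c 0 \<rho> 0 \<tau> * B i $$ (\<tau>, \<sigma>)) = (\<Sum>\<tau><t. U $$ (\<rho>, \<tau>) * B i $$ (\<tau>, \<sigma>))"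
      using diag[OF N *(1)] by (intro sum.cong) auto
    have "(\<Sum>j<N. \<Sum>\<tau><s. B' j $$ (\<rho>, \<tau>) * c j \<tau> i \<sigma>) = (\<Sum>j<N. if j = i then \<Sum>\<tau><s. B' i $$ (\<rho>, \<tau>) * U $$ (\<tau>, \<sigma>) else 0)"
      using X[OF _ _ i *(2)] diag[OF i _ *(2)] by (intro sum.cong) auto
    also have "\<dots> = (\<Sum>\<tau><s. B' i $$ (\<rho>, \<tau>) * U $$ (\<tau>, \<sigma>))" using i by simp
    finally have 2: "(\<Sum>j<N. \<Sum>\<tau><s. B' j $$ (\<rho>, \<tau>) * c j \<tau> i \<sigma>) = (\<Sum>\<tau><s. B' i $$ (\<rho>, \<tau>) * U $$ (\<tau>, \<sigma>))" .
    have "(\<Sum>\<tau><t. U $$ (\<rho>, \<tau>) * B i $$ (\<tau>, \<sigma>)) = (\<Sum>\<tau><s. B' i $$ (\<rho>, \<tau>) * U $$ (\<tau>, \<sigma>))"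
      using Y[OF N *(1) i *(2)] X[OF N *(1) _ *(2), of "Suc i"] unfolding 1 2 by (simp split: if_splits)
    thus "(U * B i) $$ (\<rho>, \<sigma>) = (B' i * U) $$ (\<rho>, \<sigma>)"
      using * B[OF i] by (simp add: U_def scalar_prod_def atLeast0LessThan)
  qed (use B[OF i] in \<open>auto simp: U_def\<close>)
  show "ent s t C q r \<rho> q' r' \<sigma> = (if q = q' \<and> r = r' then U $$ (\<rho>, \<sigma>) else 0)"
    if "q < 4" "r < N" "\<rho> < s" "q' < 4" "r' < N" "\<sigma> < t" "q \<le> q'" for q r \<rho> q' r' \<sigma>
  proof -
    note L = L[OF that(2,3,5,6)]
    have d: "c r \<rho> r' \<sigma> = (if r = r' then U $$ (\<rho>, \<sigma>) else 0)" using X diag that by auto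
    have "q = 0 \<or> q = 1 \<or> q = 2 \<or> q = 3" "q' = 0 \<or> q' = 1 \<or> q' = 2 \<or> q' = 3" using that by auto
    thus ?thesis using L d that(7) by (elim disjE) (simp_all add: c_def)
  qed
qed

section \<open>Corners of homomorphisms between encoded tuples\<close>

definition corner :: "nat \<Rightarrow> nat \<Rightarrow> 'k mat \<Rightarrow> 'k mat" where
  "corner s t C = mat s t (\<lambda>(\<rho>, \<sigma>). ent s t C 0 0 \<rho> 0 0 \<sigma>)"

definition is_hom :: "nat \<Rightarrow> nat \<Rightarrow> (nat \<Rightarrow> 'k mat) \<Rightarrow> (nat \<Rightarrow> 'k mat) \<Rightarrow> 'k mat \<Rightarrow> bool" where
  "is_hom s t B' B C \<longleftrightarrow> C \<in> carrier_mat (4 * N * s) (4 * N * t) \<and> C * aM t = aM s * C \<and> C * bM t B = bM s B' * C"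

lemma corner_carrier [simp]: "corner s t C \<in> carrier_mat s t"
  by (simp add: corner_def)

lemma is_hom_carrier: "is_hom s t B' B C \<Longrightarrow> C \<in> carrier_mat (4 * N * s) (4 * N * t)"
  by (simp add: is_hom_def)

lemma corner_intertwines:
  assumes "is_hom s t B' B C" "\<And>i. i < N \<Longrightarrow> B i \<in> carrier_mat t t" "\<And>i. i < N \<Longrightarrow> B' i \<in> carrier_mat s s" "i < N"
  shows "corner s t C * B i = B' i * corner s t C"
  unfolding corner_def using assms by (intro encoding_hom(1)) (auto simp: is_hom_def)

lemma is_hom_triangular:
  assumes "is_hom s t B' B C" "\<And>i. i < N \<Longrightarrow> B i \<in> carrier_mat t t" "\<And>i. i < N \<Longrightarrow> B' i \<in> carrier_mat s s"
    "q < 4" "r < N" "\<rho> < s" "q' < 4" "r' < N" "\<sigma> < t" "q \<le> q'"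
  shows "ent s t C q r \<rho> q' r' \<sigma> = (if q = q' \<and> r = r' then corner s t C $$ (\<rho>, \<sigma>) else 0)"
  unfolding corner_def using assms by (intro encoding_hom(2)) (auto simp: is_hom_def)

text \<open>The first row of blocks of \<open>C'\<close> vanishes outside its corner.\<close>

lemma corner_mult:
  assumes C: "C \<in> carrier_mat (4 * N * s) (4 * N * t)" and C': "is_hom t s B B' C'"
    and B: "\<And>i. i < N \<Longrightarrow> B i \<in> carrier_mat t t" "\<And>i. i < N \<Longrightarrow> B' i \<in> carrier_mat s s"
  shows "corner t t (C' * C) = corner t s C' * corner s t C"
proof (rule eq_matI)
  fix \<rho> \<sigma> assume "\<rho> < dim_row (corner t s C' * corner s t C)" "\<sigma> < dim_col (corner t s C' * corner s t C)"
  hence *: "\<rho> < t" "\<sigma> < t" by (auto simp: corner_def)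
  have "ent t t (C' * C) 0 0 \<rho> 0 0 \<sigma> = (\<Sum>q1<4. \<Sum>r1<N. \<Sum>\<tau><s. ent t s C' 0 0 \<rho> q1 r1 \<tau> * ent s t C q1 r1 \<tau> 0 0 \<sigma>)"
    by (rule mult_ent[OF is_hom_carrier[OF C'] C]) (use * N in auto)
  also have "\<dots> = (\<Sum>q1<4 :: nat. \<Sum>r1<N. if r1 = 0 then if q1 = 0 then \<Sum>\<tau><s. corner t s C' $$ (\<rho>, \<tau>) * ent s t C 0 0 \<tau> 0 0 \<sigma> else 0 else 0)"
    using is_hom_triangular[OF C' B(2,1), of 0 0 \<rho>] * N by (intro sum.cong refl) auto
  also have "\<dots> = (\<Sum>\<tau><s. corner t s C' $$ (\<rho>, \<tau>) * ent s t C 0 0 \<tau> 0 0 \<sigma>)" using N by (simp add: sum_4)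
  finally show "corner t t (C' * C) $$ (\<rho>, \<sigma>) = (corner t s C' * corner s t C) $$ (\<rho>, \<sigma>)"
    using * by (simp add: corner_def scalar_prod_def atLeast0LessThan)
qed (auto simp: corner_def)

lemma corner_one: "corner s s (1\<^sub>m (4 * N * s)) = 1\<^sub>m s"
proof (rule eq_matI)
  fix \<rho> \<sigma> assume "\<rho> < dim_row (1\<^sub>m s :: 'k mat)" "\<sigma> < dim_col (1\<^sub>m s :: 'k mat)"
  hence *: "\<rho> < s" "\<sigma> < s" by auto
  have "ix s 0 0 \<rho> < 4 * N * s" "ix s 0 0 \<sigma> < 4 * N * s" using * N by (auto intro: ix_less)
  thus "corner s s (1\<^sub>m (4 * N * s)) $$ (\<rho>, \<sigma>) = 1\<^sub>m s $$ (\<rho>, \<sigma>)" using * by (auto simp: corner_def ix_def)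
qed (auto simp: corner_def)

text \<open>With corner 0 the matrix is strictly block lower triangular for the four copies, hence
  nilpotent, and a nilpotent idempotent is 0. The induction is on the distance below the
  diagonal.\<close>

lemma idempotent_corner_zero:
  assumes C: "is_hom s s B B C" and B: "\<And>i. i < N \<Longrightarrow> B i \<in> carrier_mat s s"
    and idem: "C * C = C" and zero: "corner s s C = 0\<^sub>m s s"
  shows "C = 0\<^sub>m (4 * N * s) (4 * N * s)"
proof (rule mat_ixI)
  note Cc = is_hom_carrier[OF C]
  have up: "ent s s C q r \<rho> q' r' \<sigma> = 0"
    if "q < 4" "r < N" "\<rho> < s" "q' < 4" "r' < N" "\<sigma> < s" "q \<le> q'" for q r \<rho> q' r' \<sigma>
    using is_hom_triangular[OF C B B that] zero that by simp
  have "ent s s C q r \<rho> q' r' \<sigma> = 0"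
    if "q < 4" "r < N" "\<rho> < s" "q' < 4" "r' < N" "\<sigma> < s" for q r \<rho> q' r' \<sigma>
    using that
  proof (induction "q - q'" arbitrary: q r \<rho> q' r' \<sigma> rule: less_induct)
    case less
    show ?case
    proof (cases "q \<le> q'")
      case True thus ?thesis using up less.prems by simp
    next
      case False
      have "ent s s C q r \<rho> q1 r1 \<tau> * ent s s C q1 r1 \<tau> q' r' \<sigma> = 0" if *: "q1 < 4" "r1 < N" "\<tau> < s" for q1 r1 \<tau>
      proof (cases "q \<le> q1")
        case True thus ?thesis using up[OF less.prems(1-3) *] by simp
      next
        case nle: False
        have "ent s s C q1 r1 \<tau> q' r' \<sigma> = 0"
        proof (cases "q1 \<le> q'")
          case True thus ?thesis using up[OF * less.prems(4-6)] by simp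
        next
          case False thus ?thesis using less.hyps[of q1 q'] nle * less.prems by simp
        qed
        thus ?thesis by simp
      qed
      hence "ent s s (C * C) q r \<rho> q' r' \<sigma> = 0" unfolding mult_ent[OF Cc Cc less.prems] by (intro sum.neutral ballI) auto
      thus ?thesis unfolding idem .
    qed
  qed
  thus "ent s s C q r \<rho> q' r' \<sigma> = ent s s (0\<^sub>m (4 * N * s) (4 * N * s)) q r \<rho> q' r' \<sigma>"
    if "q < 4" "r < N" "\<rho> < s" "q' < 4" "r' < N" "\<sigma> < s" for q r \<rho> q' r' \<sigma>
    using that ix_less by simp
qed (use is_hom_carrier[OF C] in auto)

text \<open>The corner is an idempotent endomorphism of the tuple, hence 0 or 1 by
  \<open>triv\<close>. If it is 1, the complementary idempotent \<open>1 - C\<close> has corner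
  0.\<close>

lemma is_hom_idempotent:
  assumes C: "is_hom s s B B C" and B: "\<And>i. i < N \<Longrightarrow> B i \<in> carrier_mat s s" and idem: "C * C = C"
    and triv: "\<And>U. U \<in> carrier_mat s s \<Longrightarrow> U * U = U \<Longrightarrow> (\<And>i. i < N \<Longrightarrow> U * B i = B i * U) \<Longrightarrow> U = 0\<^sub>m s s \<or> U = 1\<^sub>m s"
  shows "C = 0\<^sub>m (4 * N * s) (4 * N * s) \<or> C = 1\<^sub>m (4 * N * s)"
proof -
  let ?n = "4 * N * s"
  note Cc = is_hom_carrier[OF C]
  have "corner s s C * corner s s C = corner s s C"
    using corner_mult[OF Cc C B B] idem by simp
  then consider "corner s s C = 0\<^sub>m s s" | "corner s s C = 1\<^sub>m s"
    using triv[OF corner_carrier] corner_intertwines[OF C B B] by blast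
  thus ?thesis
  proof cases
    case 1 thus ?thesis using idempotent_corner_zero[OF C B idem] by simp
  next
    case 2
    define D where "D = 1\<^sub>m ?n - C"
    have D: "D \<in> carrier_mat ?n ?n" using Cc by (simp add: D_def minus_carrier_mat)
    have diff: "D * X = X - C * X" "X * D = X - X * C" if "X \<in> carrier_mat ?n ?n" for X
      using that Cc minus_mult_distrib_mat[OF one_carrier_mat Cc that] mult_minus_distrib_mat[OF that one_carrier_mat Cc]
      by (simp_all add: D_def)
    have DC: "D * C = 0\<^sub>m ?n ?n" unfolding diff(1)[OF Cc] idem using Cc by simp
    have "is_hom s s B B D"
      using C D unfolding is_hom_def diff[OF aM_carrier] diff[OF bM_carrier] by simp
    moreover have "D * D = D"
      unfolding diff(2)[OF D] DC using D by (intro eq_matI) auto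
    moreover have "corner s s D = 0\<^sub>m s s"
    proof (rule eq_matI)
      fix \<rho> \<sigma> assume "\<rho> < dim_row (0\<^sub>m s s :: 'k mat)" "\<sigma> < dim_col (0\<^sub>m s s :: 'k mat)"
      hence *: "\<rho> < s" "\<sigma> < s" by auto
      have lt: "ix s 0 0 \<rho> < ?n" "ix s 0 0 \<sigma> < ?n" using * N by (auto intro: ix_less)
      have "corner s s C $$ (\<rho>, \<sigma>) = (if \<rho> = \<sigma> then 1 else 0)" using 2 * by simp
      thus "corner s s D $$ (\<rho>, \<sigma>) = 0\<^sub>m s s $$ (\<rho>, \<sigma>)"
        using * lt Cc by (auto simp: corner_def D_def) (simp_all add: ix_def)
    qed (auto simp: corner_def)
    ultimately have D0: "D = 0\<^sub>m ?n ?n" using idempotent_corner_zero B by blast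
    have "C $$ (i, j) = 1\<^sub>m ?n $$ (i, j)" if "i < ?n" "j < ?n" for i j
      using arg_cong[OF D0, of "\<lambda>X. X $$ (i, j)"] that Cc by (auto simp: D_def split: if_splits)
    hence "C = 1\<^sub>m ?n" using Cc by (intro eq_matI) auto
    thus ?thesis by simp
  qed
qed

text \<open>With all further parameters acting as 0, the commuting pair becomes a representation for
  every \<open>n \<ge> 2\<close>.\<close>

definition encode :: "nat \<Rightarrow> nat \<Rightarrow> (nat \<Rightarrow> 'k mat) \<Rightarrow> nat \<times> (nat \<Rightarrow> 'k mat)" where
  "encode n s B = (4 * N * s, \<lambda>i\<in>{1..n}. if i = 1 then aM s else if i = 2 then bM s B else 0\<^sub>m (4 * N * s) (4 * N * s))"

lemma encode_lin_reps: "encode n s B \<in> lin_reps n"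
  using aM_carrier[of s] bM_carrier[of s B] aM_bM_commute[of s B] by (auto simp: encode_def lin_reps_def)

lemma encode_Arr:
  assumes "n \<ge> 2"
  shows "C \<in> Arr (lin_rep_cat n) (encode n t B) (encode n s B') \<longleftrightarrow> is_hom s t B' B C"
proof
  assume "C \<in> Arr (lin_rep_cat n) (encode n t B) (encode n s B')"
  hence C: "C \<in> carrier_mat (4 * N * s) (4 * N * t)"
    "\<And>i. i \<in> {1..n} \<Longrightarrow> C * snd (encode n t B) i = snd (encode n s B') i * C"
    unfolding encode_def Arr_lin_rep_cat by simp_all
  have "snd (encode n t B) 1 = aM t" "snd (encode n t B) 2 = bM t B" "snd (encode n s B') 1 = aM s" "snd (encode n s B') 2 = bM s B'"
    using assms by (simp_all add: encode_def)
  thus "is_hom s t B' B C" using C(1) C(2)[of 1] C(2)[of 2] assms unfolding is_hom_def by simp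
next
  assume "is_hom s t B' B C"
  thus "C \<in> Arr (lin_rep_cat n) (encode n t B) (encode n s B')"
    unfolding encode_def Arr_lin_rep_cat is_hom_def by auto
qed

end

section \<open>Linear maps as matrices, and indecomposable representations\<close>

lemma mat_eq_vecsI:
  fixes A B :: "'k :: field mat"
  assumes "A \<in> carrier_mat r c" "B \<in> carrier_mat r c" "\<And>v. v \<in> carrier_vec c \<Longrightarrow> A *\<^sub>v v = B *\<^sub>v v"
  shows "A = B"
  using assms by (intro mat_col_eqI) (auto simp: mat_unit_vec_col[symmetric])

lemma smult_one_mat_vec: "v \<in> carrier_vec m \<Longrightarrow> (c \<cdot>\<^sub>m 1\<^sub>m m) *\<^sub>v v = c \<cdot>\<^sub>v v" for v :: "'k :: field vec"
  by (intro eq_vecI) auto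

lemma linear_map_mat:
  fixes f :: "'k :: field vec \<Rightarrow> 'k vec"
  assumes f: "\<And>v. v \<in> carrier_vec s \<Longrightarrow> f v \<in> carrier_vec r"
    and add: "\<And>v w. v \<in> carrier_vec s \<Longrightarrow> w \<in> carrier_vec s \<Longrightarrow> f (v + w) = f v + f w"
    and smult: "\<And>c v. v \<in> carrier_vec s \<Longrightarrow> f (c \<cdot>\<^sub>v v) = c \<cdot>\<^sub>v f v"
  shows "\<exists>E\<in>carrier_mat r s. \<forall>v\<in>carrier_vec s. f v = E *\<^sub>v v"
proof -
  define E where "E = mat r s (\<lambda>(i, j). f (unit_vec s j) $ i)"
  have E: "E \<in> carrier_mat r s" by (simp add: E_def)
  have E_unit: "E *\<^sub>v unit_vec s j = f (unit_vec s j)" if "j < s" for j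
    using that f[of "unit_vec s j"] unfolding mat_unit_vec_col[OF E that] by (intro eq_vecI) (auto simp: E_def)
  have "f v = E *\<^sub>v v" if v: "v \<in> carrier_vec s" for v
  proof -
    define p where "p k = vec s (\<lambda>j. if j < k then v $ j else 0)" for k
    have "f (p k) = E *\<^sub>v p k" if "k \<le> s" for k
      using that
    proof (induction k)
      case 0
      have "p 0 = 0 \<cdot>\<^sub>v 0\<^sub>v s" by (intro eq_vecI) (auto simp: p_def)
      thus ?case using smult[of "0\<^sub>v s" 0] f[of "0\<^sub>v s"] E by (auto intro!: eq_vecI)
    next
      case (Suc k)
      have p: "p (Suc k) = p k + v $ k \<cdot>\<^sub>v unit_vec s k"
        using Suc.prems by (intro eq_vecI) (auto simp: p_def unit_vec_def less_Suc_eq)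
      have pk: "p k \<in> carrier_vec s" by (simp add: p_def)
      show ?case
        unfolding p using Suc pk add[OF pk, of "v $ k \<cdot>\<^sub>v unit_vec s k"] smult[of "unit_vec s k" "v $ k"] E_unit[of k]
        by (simp add: mult_add_distrib_mat_vec[OF E pk] mult_mat_vec[OF E])
    qed
    from this[of s] have "f (p s) = E *\<^sub>v p s" by simp
    moreover have "p s = v" using v by (intro eq_vecI) (auto simp: p_def)
    ultimately show ?thesis by simp
  qed
  thus ?thesis using E by blast
qed

text \<open>The projection onto a summand is linear over the parameter ring. The constants of this
  ring make it \<open>k\<close>-linear, so it is given by a matrix, and the variables make the
  matrix commute with the \<open>A i\<close>.\<close>

lemma (in linear_rep) indecomposable_matI:
  assumes m: "m > 0" and triv: "\<And>E. E \<in> carrier_mat m m \<Longrightarrow> E * E = E \<Longrightarrow> (\<And>i. i \<in> {1..n} \<Longrightarrow> E * A i = A i * E) \<Longrightarrow>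
    E = 0\<^sub>m m m \<or> E = 1\<^sub>m m"
  shows "indecomposable (param_ring n) L"
proof -
  interpret Mod: module "param_ring n" L by (rule rep_module_module)
  have "unit_vec m 0 $ 0 \<noteq> (0\<^sub>v m :: 'k vec) $ 0" using m by simp
  hence "unit_vec m 0 \<in> carrier L" "unit_vec m 0 \<noteq> \<zero>\<^bsub>L\<^esub>" by auto
  hence nz: "carrier L \<noteq> {\<zero>\<^bsub>L\<^esub>}" by blast
  have "N = {\<zero>\<^bsub>L\<^esub>} \<or> N' = {\<zero>\<^bsub>L\<^esub>}"
    if N: "Module.submodule N (param_ring n) L" "Module.submodule N' (param_ring n) L" "N \<inter> N' = {\<zero>\<^bsub>L\<^esub>}" "N <+>\<^bsub>L\<^esub> N' = carrier L" for N N'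
  proof -
    obtain e e' where e: "e \<in> module_hom (param_ring n) L L" "e' \<in> module_hom (param_ring n) L L"
      and dec: "\<And>x. x \<in> carrier L \<Longrightarrow> e x \<in> N \<and> e' x \<in> N' \<and> x = e x \<oplus>\<^bsub>L\<^esub> e' x"
      and id: "\<And>x. x \<in> N \<Longrightarrow> e x = x" "\<And>x. x \<in> N' \<Longrightarrow> e' x = x" and e0: "\<And>x. x \<in> N' \<Longrightarrow> e x = \<zero>\<^bsub>L\<^esub>"
      by (rule Mod.direct_sum_projections[OF N]) (rule that)
    have Nc: "N \<subseteq> carrier_vec m" "N' \<subseteq> carrier_vec m" "0\<^sub>v m \<in> N" "0\<^sub>v m \<in> N'"
      using Mod.submoduleE(1)[OF N(1)] Mod.submoduleE(1)[OF N(2)] N(3) by auto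
    have ec: "e v \<in> carrier_vec m" if "v \<in> carrier_vec m" for v using e that by (auto simp: module_hom_def)
    have epm: "e (pm q *\<^sub>v v) = pm q *\<^sub>v e v" if "v \<in> carrier_vec m" "q \<in> carrier (param_ring n)" for q v
      using e that by (auto simp: module_hom_def)
    have pm_const: "pm (single 0 c) = c \<cdot>\<^sub>m 1\<^sub>m m" for c
      by (rule eq_matI) (auto simp: pm_single monom_mat_zero)
    have pm_var: "pm (single (single i 1) 1) = A i" if "i \<in> {1..n}" for i
      by (rule eq_matI) (use that in \<open>auto simp: pm_single monom_mat_single[OF that, unfolded One_nat_def] A_dim\<close>)
    have const: "single 0 c \<in> carrier (param_ring n)" for c :: 'k
      by (auto simp: carrier_param_ring)
    have var: "single (single i 1) 1 \<in> carrier (param_ring n)" if "i \<in> {1..n}" for i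
      using that by (auto simp: carrier_param_ring)
    have "\<exists>E\<in>carrier_mat m m. \<forall>v\<in>carrier_vec m. e v = E *\<^sub>v v"
    proof (rule linear_map_mat)
      show "e (v + w) = e v + e w" if "v \<in> carrier_vec m" "w \<in> carrier_vec m" for v w
        using e that by (auto simp: module_hom_def)
      show "e (c \<cdot>\<^sub>v v) = c \<cdot>\<^sub>v e v" if "v \<in> carrier_vec m" for c v
        using epm[OF that const, of c] unfolding pm_const smult_one_mat_vec[OF that] smult_one_mat_vec[OF ec[OF that]] .
    qed (rule ec)
    then obtain E where E: "E \<in> carrier_mat m m" "\<And>v. v \<in> carrier_vec m \<Longrightarrow> e v = E *\<^sub>v v" by blast
    have "E * E = E"
    proof (rule mat_eq_vecsI)
      fix v :: "'k vec" assume v: "v \<in> carrier_vec m"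
      show "E * E *\<^sub>v v = E *\<^sub>v v"
        using dec[of v] id(1)[of "e v"] v ec[OF v] assoc_mult_mat_vec[OF E(1) E(1) v] by (simp add: E)
    qed (use E in auto)
    moreover have "E * A i = A i * E" if i: "i \<in> {1..n}" for i
    proof (rule mat_eq_vecsI)
      fix v :: "'k vec" assume v: "v \<in> carrier_vec m"
      have Av: "A i *\<^sub>v v \<in> carrier_vec m" using A_carrier[OF i] v by simp
      show "E * A i *\<^sub>v v = A i * E *\<^sub>v v"
        using epm[OF v var[OF i]] unfolding pm_var[OF i] E(2)[OF v] E(2)[OF Av]
        using assoc_mult_mat_vec[OF E(1) A_carrier[OF i] v] assoc_mult_mat_vec[OF A_carrier[OF i] E(1) v] by simp
    qed (use E A_carrier[OF i] in auto)
    ultimately have "E = 0\<^sub>m m m \<or> E = 1\<^sub>m m" using triv E(1) by blast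
    thus ?thesis
    proof
      assume "E = 0\<^sub>m m m"
      moreover have "0\<^sub>m m m *\<^sub>v v = 0\<^sub>v m" if "v \<in> carrier_vec m" for v :: "'k vec" using that by (intro eq_vecI) auto
      ultimately have "v = 0\<^sub>v m" if "v \<in> N" for v using id(1)[OF that] E(2)[of v] that Nc by auto
      thus ?thesis using Nc unfolding rep_module_simps by blast
    next
      assume "E = 1\<^sub>m m"
      hence "v = 0\<^sub>v m" if "v \<in> N'" for v using e0[OF that] E(2)[of v] that Nc by auto
      thus ?thesis using Nc unfolding rep_module_simps by blast
    qed
  qed
  thus ?thesis using nz unfolding indecomposable_def by blast
qed

section \<open>Finite-dimensional algebras\<close>

lemma fin_dim_coordinates:
  fixes V :: "('k :: field, 'v, 'z) module_scheme"
  assumes V: "vectorspace class_ring V" and fin: "vectorspace.fin_dim class_ring V"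
  shows "\<exists>s \<phi>. bij_betw \<phi> (carrier V) (carrier_vec s) \<and>
    (\<forall>x\<in>carrier V. \<forall>y\<in>carrier V. \<phi> (x \<oplus>\<^bsub>V\<^esub> y) = \<phi> x + \<phi> y) \<and>
    (\<forall>c. \<forall>x\<in>carrier V. \<phi> (c \<odot>\<^bsub>V\<^esub> x) = c \<cdot>\<^sub>v \<phi> x)"
proof -
  interpret V: vectorspace "class_ring :: 'k ring" V by (rule V)
  obtain A where A: "finite A" "V.basis A" using V.finite_basis_exists[OF fin] by blast
  hence Ac: "A \<subseteq> carrier V" and li: "\<not> V.lin_dep A" and gen: "V.span A = carrier V" by (auto simp: V.basis_def)
  obtain e where e: "bij_betw e {0..<card A} A" using ex_bij_betw_nat_finite[OF A(1)] by blast
  define e' where "e' = inv_into {0..<card A} e"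
  have e': "e' a < card A" "e (e' a) = a" if "a \<in> A" for a
    using that e bij_betw_inv_into_right[OF e] bij_betwE[OF bij_betw_inv_into[OF e]] by (auto simp: e'_def)
  have e'e: "e' (e i) = i" "e i \<in> A" if "i < card A" for i
    using that bij_betw_inv_into_left[OF e, of i] bij_betwE[OF e] by (auto simp: e'_def)
  define \<Phi> where "\<Phi> v = V.lincomb (\<lambda>a. v $ e' a) A" for v :: "'k vec"
  have \<Phi>_c: "\<Phi> v \<in> carrier V" for v unfolding \<Phi>_def using Ac by (intro V.lincomb_closed) auto
  have \<Phi>_add: "\<Phi> (v + w) = \<Phi> v \<oplus>\<^bsub>V\<^esub> \<Phi> w" if "v \<in> carrier_vec (card A)" "w \<in> carrier_vec (card A)" for v w
  proof -
    have "\<Phi> (v + w) = V.lincomb (\<lambda>a. v $ e' a \<oplus>\<^bsub>class_ring\<^esub> w $ e' a) A"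
      unfolding \<Phi>_def using that e' by (intro V.lincomb_cong Ac refl) auto
    also have "\<dots> = \<Phi> v \<oplus>\<^bsub>V\<^esub> \<Phi> w" unfolding \<Phi>_def by (rule V.lincomb_sum[OF A(1) Ac]) auto
    finally show ?thesis .
  qed
  have \<Phi>_smult: "\<Phi> (c \<cdot>\<^sub>v v) = c \<odot>\<^bsub>V\<^esub> \<Phi> v" if "v \<in> carrier_vec (card A)" for c v
  proof -
    have "\<Phi> (c \<cdot>\<^sub>v v) = V.lincomb (\<lambda>a. c \<otimes>\<^bsub>class_ring\<^esub> v $ e' a) A"
      unfolding \<Phi>_def using that e' by (intro V.lincomb_cong Ac refl) auto
    also have "\<dots> = c \<odot>\<^bsub>V\<^esub> \<Phi> v" unfolding \<Phi>_def by (rule V.lincomb_smult[OF Ac]) auto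
    finally show ?thesis .
  qed
  have ker: "v = 0\<^sub>v (card A)" if v: "v \<in> carrier_vec (card A)" "\<Phi> v = \<zero>\<^bsub>V\<^esub>" for v
  proof (rule eq_vecI)
    fix i assume "i < dim_vec (0\<^sub>v (card A) :: 'k vec)"
    hence i: "i < card A" by simp
    have "v $ e' (e i) = \<zero>\<^bsub>class_ring\<^esub>"
      using li v(2) A(1) e'e(2)[OF i] unfolding V.lin_dep_def \<Phi>_def by auto
    thus "v $ i = 0\<^sub>v (card A) $ i" using i e'e by simp
  qed (use v in simp)
  have inj: "inj_on \<Phi> (carrier_vec (card A))"
  proof (rule inj_onI)
    fix v w :: "'k vec" assume vw: "v \<in> carrier_vec (card A)" "w \<in> carrier_vec (card A)" "\<Phi> v = \<Phi> w"
    have "\<Phi> (v - w) \<oplus>\<^bsub>V\<^esub> \<Phi> w = \<Phi> w"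
      using \<Phi>_add[of "v - w" w] minus_add_cancel_vec[OF vw(1,2)] vw by simp
    hence "\<Phi> (v - w) = \<zero>\<^bsub>V\<^esub>" using \<Phi>_c by simp
    hence "v - w = 0\<^sub>v (card A)" using ker vw by simp
    thus "v = w" using minus_add_cancel_vec[OF vw(1,2)] vw(2) by simp
  qed
  have "\<Phi> ` carrier_vec (card A) = carrier V"
  proof (intro equalityI subsetI)
    fix x assume "x \<in> carrier V"
    then obtain a where a: "x = V.lincomb a A" using gen V.finite_span[OF A(1) Ac] by auto
    have "x = \<Phi> (vec (card A) (\<lambda>i. a (e i)))"
      unfolding a \<Phi>_def using e' by (intro V.lincomb_cong Ac refl) auto
    thus "x \<in> \<Phi> ` carrier_vec (card A)" by simp
  qed (use \<Phi>_c in auto)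
  hence bij: "bij_betw \<Phi> (carrier_vec (card A)) (carrier V)" using inj by (simp add: bij_betw_def)
  define \<phi> where "\<phi> = inv_into (carrier_vec (card A)) \<Phi>"
  have \<phi>: "\<phi> x \<in> carrier_vec (card A)" "\<Phi> (\<phi> x) = x" if "x \<in> carrier V" for x
    using that bij_betwE[OF bij_betw_inv_into[OF bij]] bij_betw_inv_into_right[OF bij] by (auto simp: \<phi>_def)
  have \<phi>\<Phi>: "\<phi> (\<Phi> v) = v" if "v \<in> carrier_vec (card A)" for v
    using bij_betw_inv_into_left[OF bij that] by (simp add: \<phi>_def)
  have "bij_betw \<phi> (carrier V) (carrier_vec (card A))" unfolding \<phi>_def by (rule bij_betw_inv_into[OF bij])
  moreover have "\<phi> (x \<oplus>\<^bsub>V\<^esub> y) = \<phi> x + \<phi> y" if "x \<in> carrier V" "y \<in> carrier V" for x y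
    using \<phi>\<Phi>[of "\<phi> x + \<phi> y"] \<Phi>_add[of "\<phi> x" "\<phi> y"] \<phi> that by simp
  moreover have "\<phi> (c \<odot>\<^bsub>V\<^esub> x) = c \<cdot>\<^sub>v \<phi> x" if "x \<in> carrier V" for c x
    using \<phi>\<Phi>[of "c \<cdot>\<^sub>v \<phi> x"] \<Phi>_smult[of "\<phi> x" c] \<phi> that by simp
  ultimately show ?thesis by blast
qed

locale fd_algebra =
  fixes \<Lambda> :: "('k :: field, 'l) module"
  assumes fd: "fin_dim_algebra \<Lambda>"
begin

sublocale ring \<Lambda> using fd by (simp add: fin_dim_algebra_def)

sublocale V: vectorspace "class_ring :: 'k ring" \<Lambda> using fd by (simp add: fin_dim_algebra_def)

text \<open>The structure map of the algebra. Modules over the algebra receive their scalar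
  multiplication by \<open>k\<close> through it.\<close>

definition \<iota> :: "'k \<Rightarrow> 'l" where
  "\<iota> c = c \<odot>\<^bsub>\<Lambda>\<^esub> \<one>\<^bsub>\<Lambda>\<^esub>"

lemma \<iota>_closed [simp]: "\<iota> c \<in> carrier \<Lambda>"
  by (simp add: \<iota>_def)

lemma \<iota>_mult: "x \<in> carrier \<Lambda> \<Longrightarrow> \<iota> c \<otimes>\<^bsub>\<Lambda>\<^esub> x = c \<odot>\<^bsub>\<Lambda>\<^esub> x" "x \<in> carrier \<Lambda> \<Longrightarrow> x \<otimes>\<^bsub>\<Lambda>\<^esub> \<iota> c = c \<odot>\<^bsub>\<Lambda>\<^esub> x"
  using fd by (simp_all add: fin_dim_algebra_def \<iota>_def)

lemma \<iota>_hom: "\<iota> (c + d) = \<iota> c \<oplus>\<^bsub>\<Lambda>\<^esub> \<iota> d" "\<iota> (c * d) = \<iota> c \<otimes>\<^bsub>\<Lambda>\<^esub> \<iota> d" "\<iota> 1 = \<one>\<^bsub>\<Lambda>\<^esub>"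
proof -
  show "\<iota> (c + d) = \<iota> c \<oplus>\<^bsub>\<Lambda>\<^esub> \<iota> d" using V.smult_l_distr[of c d "\<one>\<^bsub>\<Lambda>\<^esub>"] by (simp add: \<iota>_def)
  show "\<iota> (c * d) = \<iota> c \<otimes>\<^bsub>\<Lambda>\<^esub> \<iota> d" unfolding \<iota>_mult(1)[OF \<iota>_closed]
    using V.smult_assoc1[of c d "\<one>\<^bsub>\<Lambda>\<^esub>"] by (simp add: \<iota>_def)
  show "\<iota> 1 = \<one>\<^bsub>\<Lambda>\<^esub>" using V.smult_one[of "\<one>\<^bsub>\<Lambda>\<^esub>"] by (simp add: \<iota>_def)
qed

text \<open>Says that the \<open>b i\<close> span the algebra over \<open>k\<close>, in the form of
  an induction principle for properties closed under sums and scalars. Positivity of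
  \<open>N\<close> is what the encoding of tuples asks for.\<close>

definition generating :: "nat \<Rightarrow> (nat \<Rightarrow> 'l) \<Rightarrow> bool" where
  "generating N b \<longleftrightarrow> N > 0 \<and> (\<forall>i<N. b i \<in> carrier \<Lambda>) \<and>
     (\<forall>S. S \<subseteq> carrier \<Lambda> \<and> \<zero>\<^bsub>\<Lambda>\<^esub> \<in> S \<and> (\<forall>x\<in>S. \<forall>y\<in>S. x \<oplus>\<^bsub>\<Lambda>\<^esub> y \<in> S) \<and> (\<forall>c. \<forall>x\<in>S. c \<odot>\<^bsub>\<Lambda>\<^esub> x \<in> S) \<and>
       (\<forall>i<N. b i \<in> S) \<longrightarrow> S = carrier \<Lambda>)"

lemma generating_exists: "\<exists>N b. generating N b"
proof -
  obtain A where A: "finite A" "A \<subseteq> carrier \<Lambda>" "V.span A = carrier \<Lambda>"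
    using fd V.fin_dim_def by (auto simp: fin_dim_algebra_def)
  obtain e where e: "bij_betw e {0..<card A} A" using ex_bij_betw_nat_finite[OF A(1)] by blast
  \<comment> \<open>A zero element is appended, so that the number of generators is positive even if
    the spanning set is empty.\<close>
  define b where "b i = (if i < card A then e i else \<zero>\<^bsub>\<Lambda>\<^esub>)" for i
  have bA: "b i \<in> A" if "i < card A" for i using that bij_betwE[OF e] by (simp add: b_def)
  have "S = carrier \<Lambda>" if S: "S \<subseteq> carrier \<Lambda>" "\<zero>\<^bsub>\<Lambda>\<^esub> \<in> S" "\<forall>x\<in>S. \<forall>y\<in>S. x \<oplus>\<^bsub>\<Lambda>\<^esub> y \<in> S" "\<forall>c. \<forall>x\<in>S. c \<odot>\<^bsub>\<Lambda>\<^esub> x \<in> S"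
    "\<forall>i<Suc (card A). b i \<in> S" for S
  proof -
    have "A \<subseteq> S"
    proof
      fix a assume "a \<in> A"
      then obtain i where "i < card A" "a = e i" using bij_betw_imp_surj_on[OF e] by (metis atLeastLessThan_iff imageE)
      thus "a \<in> S" using S(5) by (auto simp: b_def dest: spec[of _ i])
    qed
    moreover have "LinearCombinations.submodule class_ring S \<Lambda>"
      using S by (intro LinearCombinations.submodule.intro V.module_axioms) auto
    ultimately have "V.span A \<subseteq> S" by (rule V.span_is_subset)
    thus ?thesis using A(3) S(1) by simp
  qed
  moreover have "b i \<in> carrier \<Lambda>" for i using bA A(2) by (cases "i < card A") (auto simp: b_def)
  ultimately have "generating (Suc (card A)) b" unfolding generating_def by (intro conjI allI impI) auto
  thus ?thesis by blast
qed

abbreviation fg_module :: "('l, 'm) module \<Rightarrow> bool" where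
  "fg_module X \<equiv> left_module \<Lambda> X \<and> fin_gen_module \<Lambda> X"

text \<open>Restriction of scalars along \<open>\<iota>\<close>, which makes the theory of vector
  spaces applicable.\<close>

definition scal :: "('l, 'm) module \<Rightarrow> ('k, 'm) module" where
  "scal X = \<lparr>carrier = carrier X, monoid.mult = undefined, one = undefined, zero = \<zero>\<^bsub>X\<^esub>, add = (\<oplus>\<^bsub>X\<^esub>),
     module.smult = (\<lambda>c x. \<iota> c \<odot>\<^bsub>X\<^esub> x)\<rparr>"

lemma scal_vectorspace:
  assumes "left_module \<Lambda> X"
  shows "vectorspace class_ring (scal X)"
proof -
  interpret X: left_module \<Lambda> X by fact
  have ab: "abelian_group (scal X)"
    by (rule abelian_groupI) (auto simp: scal_def X.M.a_ac intro!: bexI[of _ "\<ominus>\<^bsub>X\<^esub> _"] X.M.l_neg)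
  show ?thesis
  proof (rule vectorspace.intro)
    show "module (class_ring :: 'k ring) (scal X)"
      using domain.axioms(1)[OF field.axioms(1)[OF class_field]]
      by (intro moduleI ab) (auto simp: scal_def \<iota>_hom X.left_smult_l_distr X.left_smult_r_distr X.left_smult_assoc
          X.left_smult_one X.left_smult_closed)
  qed (rule class_field)
qed

text \<open>The products of the \<open>b i\<close> with finitely many module generators span over
  \<open>k\<close>: for a fixed generator, the algebra elements that send it into this span form a
  subspace containing all \<open>b i\<close>.\<close>

lemma scal_fin_dim:
  assumes X: "left_module \<Lambda> X" and fin: "fin_gen_module \<Lambda> X"
  shows "vectorspace.fin_dim class_ring (scal X)"
proof -
  interpret X: left_module \<Lambda> X by fact
  interpret W: vectorspace "class_ring :: 'k ring" "scal X" by (rule scal_vectorspace[OF X])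
  obtain N b where b: "generating N b" using generating_exists by blast
  hence bc: "b i \<in> carrier \<Lambda>" if "i < N" for i using that by (simp add: generating_def)
  obtain B where B: "finite B" "B \<subseteq> carrier X"
      "\<And>v. v \<in> carrier X \<Longrightarrow> \<exists>c\<in>B \<rightarrow> carrier \<Lambda>. v = finsum X (\<lambda>x. c x \<odot>\<^bsub>X\<^esub> x) B"
    using fin by (auto simp: fin_gen_module_def)
  define A where "A = (\<lambda>(i, x). b i \<odot>\<^bsub>X\<^esub> x) ` ({..<N} \<times> B)"
  have Ac: "A \<subseteq> carrier (scal X)" using B(2) bc by (auto simp: A_def scal_def intro!: X.left_smult_closed)
  have sub: "LinearCombinations.submodule class_ring (W.span A) (scal X)" by (rule W.span_is_submodule[OF Ac])
  note sub = LinearCombinations.submodule.m_closed[OF sub] LinearCombinations.submodule.zero_closed[OF sub]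
    LinearCombinations.submodule.smult_closed[OF sub] LinearCombinations.submodule.subset[OF sub]
  have gen: "l \<odot>\<^bsub>X\<^esub> x \<in> W.span A" if x: "x \<in> B" and l: "l \<in> carrier \<Lambda>" for x l
  proof -
    have xc: "x \<in> carrier X" using x B(2) by blast
    let ?S = "{m \<in> carrier \<Lambda>. m \<odot>\<^bsub>X\<^esub> x \<in> W.span A}"
    have "\<iota> 0 = \<zero>\<^bsub>\<Lambda>\<^esub>" using \<iota>_hom(1)[of 0 0] by (simp add: add.l_cancel_one')
    hence "\<zero>\<^bsub>\<Lambda>\<^esub> \<odot>\<^bsub>X\<^esub> x \<in> W.span A"
      using W.smult_l_null[of x] xc sub(2) by (simp add: scal_def)
    moreover have "(c \<odot>\<^bsub>\<Lambda>\<^esub> m) \<odot>\<^bsub>X\<^esub> x \<in> W.span A" if "m \<in> ?S" for c m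
      using sub(3)[of c "m \<odot>\<^bsub>X\<^esub> x"] that xc X.left_smult_assoc[of "\<iota> c" m x] by (simp add: \<iota>_mult scal_def)
    moreover have "(l \<oplus>\<^bsub>\<Lambda>\<^esub> m) \<odot>\<^bsub>X\<^esub> x \<in> W.span A" if "l \<in> ?S" "m \<in> ?S" for l m
      using sub(1)[of "l \<odot>\<^bsub>X\<^esub> x" "m \<odot>\<^bsub>X\<^esub> x"] that xc by (simp add: X.left_smult_l_distr scal_def)
    moreover have "b i \<odot>\<^bsub>X\<^esub> x \<in> W.span A" if "i < N" for i
      using W.in_own_span[OF Ac] that x by (auto simp: A_def)
    ultimately have "?S = carrier \<Lambda>"
      using b bc unfolding generating_def by (elim conjE allE[of _ ?S]) auto
    thus ?thesis using l by blast
  qed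
  have "finsum X (\<lambda>x. c x \<odot>\<^bsub>X\<^esub> x) B' \<in> W.span A" if "finite B'" "B' \<subseteq> B" "c \<in> B \<rightarrow> carrier \<Lambda>" for B' c
    using that(1,2)
  proof (induction B' rule: finite_induct)
    case empty thus ?case using sub(2) by (simp add: scal_def)
  next
    case (insert x B')
    have "c y \<odot>\<^bsub>X\<^esub> y \<in> carrier X" if "y \<in> insert x B'" for y
      using that insert.prems B(2) \<open>c \<in> _\<close> by (intro X.left_smult_closed) auto
    hence "finsum X (\<lambda>x. c x \<odot>\<^bsub>X\<^esub> x) (insert x B') = c x \<odot>\<^bsub>X\<^esub> x \<oplus>\<^bsub>X\<^esub> finsum X (\<lambda>x. c x \<odot>\<^bsub>X\<^esub> x) B'"
      using insert.hyps by (intro X.M.finsum_insert) auto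
    moreover have "c x \<odot>\<^bsub>X\<^esub> x \<in> W.span A" using insert.prems \<open>c \<in> _\<close> by (intro gen) auto
    ultimately show ?case using insert sub(1) by (simp add: scal_def)
  qed
  hence "carrier X \<subseteq> W.span A" using B(1) B(3) by blast
  hence "W.span A = carrier (scal X)" using sub(4) by (auto simp: scal_def)
  moreover have "finite A" using B(1) by (simp add: A_def)
  ultimately show ?thesis using Ac unfolding W.fin_dim_def by blast
qed

end

section \<open>Embedding modules over a finite-dimensional algebra\<close>

context fd_algebra
begin

definition is_coord :: "('l, 'm) module \<Rightarrow> nat \<Rightarrow> ('m \<Rightarrow> 'k vec) \<Rightarrow> bool" where
  "is_coord X s \<phi> \<longleftrightarrow> bij_betw \<phi> (carrier X) (carrier_vec s) \<and>
    (\<forall>x\<in>carrier X. \<forall>y\<in>carrier X. \<phi> (x \<oplus>\<^bsub>X\<^esub> y) = \<phi> x + \<phi> y) \<and>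
    (\<forall>c. \<forall>x\<in>carrier X. \<phi> (\<iota> c \<odot>\<^bsub>X\<^esub> x) = c \<cdot>\<^sub>v \<phi> x)"

text \<open>Coordinates are chosen once for each module, so that the functor into representations
  has definite values on objects.\<close>

definition coord :: "('l, 'm) module \<Rightarrow> nat \<times> ('m \<Rightarrow> 'k vec)" where
  "coord X = (SOME p. is_coord X (fst p) (snd p))"

abbreviation "cdim X \<equiv> fst (coord X)"
abbreviation "\<phi> X \<equiv> snd (coord X)"

lemma coord: "fg_module X \<Longrightarrow> is_coord X (cdim X) (\<phi> X)"
proof -
  assume "fg_module X"
  hence "\<exists>s \<phi>. is_coord X s \<phi>"
    using fin_dim_coordinates[OF scal_vectorspace[of X] scal_fin_dim[of X]] by (simp add: is_coord_def scal_def)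
  hence "\<exists>p. is_coord X (fst p) (snd p)" by auto
  thus ?thesis unfolding coord_def by (rule someI_ex)
qed

lemma coord_facts:
  assumes "fg_module X"
  shows "x \<in> carrier X \<Longrightarrow> \<phi> X x \<in> carrier_vec (cdim X)"
    and "x \<in> carrier X \<Longrightarrow> y \<in> carrier X \<Longrightarrow> \<phi> X (x \<oplus>\<^bsub>X\<^esub> y) = \<phi> X x + \<phi> X y"
    and "x \<in> carrier X \<Longrightarrow> \<phi> X (\<iota> c \<odot>\<^bsub>X\<^esub> x) = c \<cdot>\<^sub>v \<phi> X x"
    and "x \<in> carrier X \<Longrightarrow> y \<in> carrier X \<Longrightarrow> \<phi> X x = \<phi> X y \<longleftrightarrow> x = y"
    and "v \<in> carrier_vec (cdim X) \<Longrightarrow> \<exists>x\<in>carrier X. \<phi> X x = v"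
    and "\<phi> X \<zero>\<^bsub>X\<^esub> = 0\<^sub>v (cdim X)"
proof -
  note c = coord[OF assms, unfolded is_coord_def]
  hence bij: "bij_betw (\<phi> X) (carrier X) (carrier_vec (cdim X))" by blast
  show cl: "\<phi> X x \<in> carrier_vec (cdim X)" if "x \<in> carrier X" for x using bij_betwE[OF bij] that by blast
  show add: "\<phi> X (x \<oplus>\<^bsub>X\<^esub> y) = \<phi> X x + \<phi> X y" if "x \<in> carrier X" "y \<in> carrier X" for x y using c that by blast
  show "x \<in> carrier X \<Longrightarrow> \<phi> X (\<iota> c \<odot>\<^bsub>X\<^esub> x) = c \<cdot>\<^sub>v \<phi> X x" using c by blast
  show "x \<in> carrier X \<Longrightarrow> y \<in> carrier X \<Longrightarrow> \<phi> X x = \<phi> X y \<longleftrightarrow> x = y"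
    using bij_betw_imp_inj_on[OF bij] by (rule inj_on_eq_iff)
  show "v \<in> carrier_vec (cdim X) \<Longrightarrow> \<exists>x\<in>carrier X. \<phi> X x = v" using bij_betw_imp_surj_on[OF bij] by (metis imageE)
  interpret X: left_module \<Lambda> X using assms by blast
  have "\<phi> X \<zero>\<^bsub>X\<^esub> + \<phi> X \<zero>\<^bsub>X\<^esub> = \<phi> X \<zero>\<^bsub>X\<^esub>" using add[of "\<zero>\<^bsub>X\<^esub>" "\<zero>\<^bsub>X\<^esub>"] by simp
  hence eq: "(\<phi> X \<zero>\<^bsub>X\<^esub> + \<phi> X \<zero>\<^bsub>X\<^esub>) $ i = \<phi> X \<zero>\<^bsub>X\<^esub> $ i" for i by simp
  note zc = cl[OF X.M.zero_closed]
  show "\<phi> X \<zero>\<^bsub>X\<^esub> = 0\<^sub>v (cdim X)"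
  proof (rule eq_vecI)
    fix i assume "i < dim_vec (0\<^sub>v (cdim X) :: 'k vec)"
    hence i: "i < cdim X" by simp
    hence "\<phi> X \<zero>\<^bsub>X\<^esub> $ i + \<phi> X \<zero>\<^bsub>X\<^esub> $ i = \<phi> X \<zero>\<^bsub>X\<^esub> $ i"
      using eq[of i] index_add_vec(1)[of i "\<phi> X \<zero>\<^bsub>X\<^esub>" "\<phi> X \<zero>\<^bsub>X\<^esub>"] carrier_vecD[OF zc] by metis
    thus "\<phi> X \<zero>\<^bsub>X\<^esub> $ i = 0\<^sub>v (cdim X) $ i" unfolding add_cancel_left_right using i by simp
  qed (use zc in simp)
qed

section \<open>Linear maps between modules in the chosen coordinates\<close>

definition mat_of :: "('l, 'm) module \<Rightarrow> ('l, 'm) module \<Rightarrow> ('m \<Rightarrow> 'm) \<Rightarrow> 'k mat" where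
  "mat_of X Y f = (SOME E. E \<in> carrier_mat (cdim Y) (cdim X) \<and> (\<forall>x\<in>carrier X. \<phi> Y (f x) = E *\<^sub>v \<phi> X x))"

definition map_of :: "('l, 'm) module \<Rightarrow> ('l, 'm) module \<Rightarrow> 'k mat \<Rightarrow> 'm \<Rightarrow> 'm" where
  "map_of X Y U = (\<lambda>x\<in>carrier X. SOME y. y \<in> carrier Y \<and> \<phi> Y y = U *\<^sub>v \<phi> X x)"

definition klin :: "('l, 'm) module \<Rightarrow> ('l, 'm) module \<Rightarrow> ('m \<Rightarrow> 'm) \<Rightarrow> bool" where
  "klin X Y f \<longleftrightarrow> f \<in> carrier X \<rightarrow> carrier Y \<and>
    (\<forall>x\<in>carrier X. \<forall>y\<in>carrier X. f (x \<oplus>\<^bsub>X\<^esub> y) = f x \<oplus>\<^bsub>Y\<^esub> f y) \<and>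
    (\<forall>c. \<forall>x\<in>carrier X. f (\<iota> c \<odot>\<^bsub>X\<^esub> x) = \<iota> c \<odot>\<^bsub>Y\<^esub> f x)"

lemma mat_of_unique:
  assumes X: "fg_module X" and E: "E \<in> carrier_mat s (cdim X)" and E': "E' \<in> carrier_mat s (cdim X)"
    and eq: "\<And>x. x \<in> carrier X \<Longrightarrow> E *\<^sub>v \<phi> X x = E' *\<^sub>v \<phi> X x"
  shows "E = E'"
  by (rule mat_eq_vecsI[OF E E']) (use coord_facts(5)[OF X] eq in blast)

lemma mat_of:
  assumes X: "fg_module X" and Y: "fg_module Y" and f: "klin X Y f"
  shows "mat_of X Y f \<in> carrier_mat (cdim Y) (cdim X)"
    and "x \<in> carrier X \<Longrightarrow> mat_of X Y f *\<^sub>v \<phi> X x = \<phi> Y (f x)"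
proof -
  interpret X: left_module \<Lambda> X using X by blast
  note cX = coord_facts[OF X] and cY = coord_facts[OF Y]
  obtain \<psi> where \<psi>: "\<And>v. v \<in> carrier_vec (cdim X) \<Longrightarrow> \<psi> v \<in> carrier X \<and> \<phi> X (\<psi> v) = v"
    using cX(5) by metis
  have \<psi>\<phi>: "\<psi> (\<phi> X x) = x" if "x \<in> carrier X" for x using \<psi> cX(1,4) that by metis
  have fc: "f x \<in> carrier Y" if "x \<in> carrier X" for x using f that by (auto simp: klin_def)
  have "\<exists>E\<in>carrier_mat (cdim Y) (cdim X). \<forall>v\<in>carrier_vec (cdim X). \<phi> Y (f (\<psi> v)) = E *\<^sub>v v"
  proof (rule linear_map_mat)
    show "\<phi> Y (f (\<psi> v)) \<in> carrier_vec (cdim Y)" if "v \<in> carrier_vec (cdim X)" for v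
      using \<psi>[OF that] fc cY(1) by blast
    show "\<phi> Y (f (\<psi> (v + w))) = \<phi> Y (f (\<psi> v)) + \<phi> Y (f (\<psi> w))"
      if "v \<in> carrier_vec (cdim X)" "w \<in> carrier_vec (cdim X)" for v w
    proof -
      have "\<psi> (v + w) = \<psi> v \<oplus>\<^bsub>X\<^esub> \<psi> w"
        using \<psi>\<phi>[of "\<psi> v \<oplus>\<^bsub>X\<^esub> \<psi> w"] cX(2)[of "\<psi> v" "\<psi> w"] \<psi>[OF that(1)] \<psi>[OF that(2)] by simp
      thus ?thesis using f \<psi>[OF that(1)] \<psi>[OF that(2)] cY(2) fc by (simp add: klin_def)
    qed
    show "\<phi> Y (f (\<psi> (c \<cdot>\<^sub>v v))) = c \<cdot>\<^sub>v \<phi> Y (f (\<psi> v))" if "v \<in> carrier_vec (cdim X)" for c v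
    proof -
      have "\<psi> (c \<cdot>\<^sub>v v) = \<iota> c \<odot>\<^bsub>X\<^esub> \<psi> v"
        using \<psi>\<phi>[of "\<iota> c \<odot>\<^bsub>X\<^esub> \<psi> v"] cX(3)[of "\<psi> v" c] \<psi>[OF that] X.left_smult_closed[of "\<iota> c" "\<psi> v"] by simp
      thus ?thesis using f \<psi>[OF that] cY(3) fc by (simp add: klin_def)
    qed
  qed
  hence "\<exists>E. E \<in> carrier_mat (cdim Y) (cdim X) \<and> (\<forall>x\<in>carrier X. \<phi> Y (f x) = E *\<^sub>v \<phi> X x)"
    using cX(1) \<psi>\<phi> by metis
  hence "mat_of X Y f \<in> carrier_mat (cdim Y) (cdim X) \<and> (\<forall>x\<in>carrier X. \<phi> Y (f x) = mat_of X Y f *\<^sub>v \<phi> X x)"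
    unfolding mat_of_def by (rule someI_ex)
  thus "mat_of X Y f \<in> carrier_mat (cdim Y) (cdim X)" "x \<in> carrier X \<Longrightarrow> mat_of X Y f *\<^sub>v \<phi> X x = \<phi> Y (f x)" by simp_all
qed

lemma mat_of_comp:
  assumes XYZ: "fg_module X" "fg_module Y" "fg_module Z" and u: "klin X Y u" and v: "klin Y Z v" and w: "klin X Z w"
    and eq: "\<And>x. x \<in> carrier X \<Longrightarrow> w x = v (u x)"
  shows "mat_of X Z w = mat_of Y Z v * mat_of X Y u"
proof (rule mat_of_unique[OF XYZ(1) mat_of(1)[OF XYZ(1,3) w]])
  note mu = mat_of[OF XYZ(1,2) u] and mv = mat_of[OF XYZ(2,3) v]
  show "mat_of Y Z v * mat_of X Y u \<in> carrier_mat (cdim Z) (cdim X)" using mu(1) mv(1) by simp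
  fix x assume x: "x \<in> carrier X"
  hence "u x \<in> carrier Y" using u by (auto simp: klin_def)
  thus "mat_of X Z w *\<^sub>v \<phi> X x = mat_of Y Z v * mat_of X Y u *\<^sub>v \<phi> X x"
    using mat_of(2)[OF XYZ(1,3) w x] mu(2)[OF x] mv(2)[of "u x"] eq[OF x]
      assoc_mult_mat_vec[OF mv(1) mu(1) coord_facts(1)[OF XYZ(1) x]] by simp
qed

lemma mat_of_id:
  assumes X: "fg_module X" and f: "klin X X f" and id: "\<And>x. x \<in> carrier X \<Longrightarrow> f x = x"
  shows "mat_of X X f = 1\<^sub>m (cdim X)"
  by (rule mat_of_unique[OF X mat_of(1)[OF X X f] one_carrier_mat])
    (use mat_of(2)[OF X X f] id coord_facts(1)[OF X] in simp)

lemma map_of: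
  assumes X: "fg_module X" and Y: "fg_module Y" and U: "U \<in> carrier_mat (cdim Y) (cdim X)" and x: "x \<in> carrier X"
  shows "map_of X Y U x \<in> carrier Y" and "\<phi> Y (map_of X Y U x) = U *\<^sub>v \<phi> X x"
proof -
  have "U *\<^sub>v \<phi> X x \<in> carrier_vec (cdim Y)" using U coord_facts(1)[OF X x] by simp
  hence "\<exists>y. y \<in> carrier Y \<and> \<phi> Y y = U *\<^sub>v \<phi> X x" using coord_facts(5)[OF Y] by blast
  hence "map_of X Y U x \<in> carrier Y \<and> \<phi> Y (map_of X Y U x) = U *\<^sub>v \<phi> X x"
    unfolding map_of_def restrict_apply'[OF x] by (rule someI_ex)
  thus "map_of X Y U x \<in> carrier Y" "\<phi> Y (map_of X Y U x) = U *\<^sub>v \<phi> X x" by blast+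
qed

lemma klin_smult:
  assumes X: "left_module \<Lambda> X" and l: "l \<in> carrier \<Lambda>"
  shows "klin X X (\<lambda>x. l \<odot>\<^bsub>X\<^esub> x)"
proof -
  interpret X: left_module \<Lambda> X by fact
  have "l \<odot>\<^bsub>X\<^esub> (\<iota> c \<odot>\<^bsub>X\<^esub> x) = \<iota> c \<odot>\<^bsub>X\<^esub> (l \<odot>\<^bsub>X\<^esub> x)" if "x \<in> carrier X" for c x
    using X.left_smult_assoc[OF l \<iota>_closed that, of c] X.left_smult_assoc[OF \<iota>_closed l that, of c] \<iota>_mult[OF l] by simp
  thus ?thesis using l by (auto simp: klin_def X.left_smult_closed X.left_smult_r_distr)
qed

lemma klin_hom: "u \<in> module_hom \<Lambda> X Y \<Longrightarrow> klin X Y u"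
  by (simp add: klin_def module_hom_def)

end

section \<open>The functor from modules over the algebra to linear representations\<close>

locale module_encoding = fd_algebra \<Lambda> + tuple_encoding N lam
  for \<Lambda> :: "('k :: field, 'l) module" and N :: nat and lam :: "nat \<Rightarrow> 'k" +
  fixes b :: "nat \<Rightarrow> 'l" and n :: nat
  assumes b: "generating N b" and n: "n \<ge> 2"
begin

lemma b_carrier: "i < N \<Longrightarrow> b i \<in> carrier \<Lambda>"
  using b by (simp add: generating_def)

abbreviation "act X \<equiv> \<lambda>i. mat_of X X (\<lambda>x. b i \<odot>\<^bsub>X\<^esub> x)"

lemma act:
  assumes X: "fg_module X" and i: "i < N"
  shows "act X i \<in> carrier_mat (cdim X) (cdim X)"
    and "x \<in> carrier X \<Longrightarrow> act X i *\<^sub>v \<phi> X x = \<phi> X (b i \<odot>\<^bsub>X\<^esub> x)"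
  using mat_of[OF X X klin_smult[OF _ b_carrier[OF i]]] X by auto

lemma act_mat_of:
  assumes X: "fg_module X" and Y: "fg_module Y" and u: "u \<in> module_hom \<Lambda> X Y" and i: "i < N"
  shows "mat_of X Y u * act X i = act Y i * mat_of X Y u"
proof (rule mat_of_unique[OF X, of _ "cdim Y"])
  interpret X: left_module \<Lambda> X using X by blast
  note m = mat_of[OF X Y klin_hom[OF u]] and aX = act[OF X i] and aY = act[OF Y i]
  show "mat_of X Y u * act X i \<in> carrier_mat (cdim Y) (cdim X)" "act Y i * mat_of X Y u \<in> carrier_mat (cdim Y) (cdim X)"
    using m(1) aX(1) aY(1) by auto
  fix x assume x: "x \<in> carrier X"
  have bx: "b i \<odot>\<^bsub>X\<^esub> x \<in> carrier X" using x b_carrier[OF i] by (rule X.left_smult_closed[rotated])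
  have ux: "u x \<in> carrier Y" "u (b i \<odot>\<^bsub>X\<^esub> x) = b i \<odot>\<^bsub>Y\<^esub> u x" using u x b_carrier[OF i] by (auto simp: module_hom_def)
  show "mat_of X Y u * act X i *\<^sub>v \<phi> X x = act Y i * mat_of X Y u *\<^sub>v \<phi> X x"
    using assoc_mult_mat_vec[OF m(1) aX(1) coord_facts(1)[OF X x]] assoc_mult_mat_vec[OF aY(1) m(1) coord_facts(1)[OF X x]]
    by (simp add: aX(2)[OF x] m(2)[OF x] m(2)[OF bx] aY(2)[OF ux(1)] ux(2))
qed

text \<open>The algebra elements with which the map is compatible form a subspace containing all
  \<open>b i\<close>, hence the whole algebra. This recovers linearity over the algebra from
  finitely many matrix equations.\<close>

lemma map_of_hom:
  assumes X: "fg_module X" and Y: "fg_module Y" and U: "U \<in> carrier_mat (cdim Y) (cdim X)"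
    and UA: "\<And>i. i < N \<Longrightarrow> U * act X i = act Y i * U"
  shows "map_of X Y U \<in> module_hom \<Lambda> X Y"
proof -
  interpret X: left_module \<Lambda> X using X by blast
  interpret Y: left_module \<Lambda> Y using Y by blast
  let ?u = "map_of X Y U"
  note u = map_of[OF X Y U] and cX = coord_facts[OF X] and cY = coord_facts[OF Y]
  have add: "?u (x \<oplus>\<^bsub>X\<^esub> y) = ?u x \<oplus>\<^bsub>Y\<^esub> ?u y" if "x \<in> carrier X" "y \<in> carrier X" for x y
  proof -
    have "\<phi> Y (?u (x \<oplus>\<^bsub>X\<^esub> y)) = \<phi> Y (?u x \<oplus>\<^bsub>Y\<^esub> ?u y)"
      using that by (simp add: u cX(2) cY(2) mult_add_distrib_mat_vec[OF U cX(1) cX(1)])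
    thus ?thesis using cY(4) u(1) that by simp
  qed
  have scal: "?u (\<iota> c \<odot>\<^bsub>X\<^esub> x) = \<iota> c \<odot>\<^bsub>Y\<^esub> ?u x" if "x \<in> carrier X" for c x
  proof -
    have c: "\<iota> c \<odot>\<^bsub>X\<^esub> x \<in> carrier X" "\<iota> c \<odot>\<^bsub>Y\<^esub> ?u x \<in> carrier Y"
      using that u(1) by (simp_all add: X.left_smult_closed Y.left_smult_closed)
    have "\<phi> Y (?u (\<iota> c \<odot>\<^bsub>X\<^esub> x)) = \<phi> Y (\<iota> c \<odot>\<^bsub>Y\<^esub> ?u x)"
      using that by (simp add: u(2)[OF c(1)] u(2) cX(3) cY(3) u(1) mult_mat_vec[OF U cX(1)])
    thus ?thesis using cY(4)[OF u(1)[OF c(1)] c(2)] by simp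
  qed
  have gen: "?u (b i \<odot>\<^bsub>X\<^esub> x) = b i \<odot>\<^bsub>Y\<^esub> ?u x" if i: "i < N" and x: "x \<in> carrier X" for i x
  proof -
    have c: "b i \<odot>\<^bsub>X\<^esub> x \<in> carrier X" "b i \<odot>\<^bsub>Y\<^esub> ?u x \<in> carrier Y"
      using x u(1) b_carrier[OF i] by (simp_all add: X.left_smult_closed Y.left_smult_closed)
    have "\<phi> Y (?u (b i \<odot>\<^bsub>X\<^esub> x)) = U * act X i *\<^sub>v \<phi> X x"
      unfolding u(2)[OF c(1)] act(2)[OF X i x, symmetric]
      by (rule assoc_mult_mat_vec[OF U act(1)[OF X i] cX(1)[OF x], symmetric])
    also have "\<dots> = \<phi> Y (b i \<odot>\<^bsub>Y\<^esub> ?u x)"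
      unfolding UA[OF i] act(2)[OF Y i u(1)[OF x], symmetric] u(2)[OF x]
      by (rule assoc_mult_mat_vec[OF act(1)[OF Y i] U cX(1)[OF x]])
    finally show ?thesis using cY(4)[OF u(1)[OF c(1)] c(2)] by simp
  qed
  let ?S = "{l \<in> carrier \<Lambda>. \<forall>x\<in>carrier X. ?u (l \<odot>\<^bsub>X\<^esub> x) = l \<odot>\<^bsub>Y\<^esub> ?u x}"
  have "\<iota> 0 = \<zero>\<^bsub>\<Lambda>\<^esub>" using \<iota>_hom(1)[of 0 0] by (simp add: add.l_cancel_one')
  hence "\<zero>\<^bsub>\<Lambda>\<^esub> \<in> ?S" using scal[of _ 0] by simp
  moreover have "l \<oplus>\<^bsub>\<Lambda>\<^esub> m \<in> ?S" if "l \<in> ?S" "m \<in> ?S" for l m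
    using that u(1) by (auto simp: X.left_smult_l_distr Y.left_smult_l_distr add X.left_smult_closed)
  moreover have "c \<odot>\<^bsub>\<Lambda>\<^esub> l \<in> ?S" if "l \<in> ?S" for c l
    using that u(1) by (auto simp: \<iota>_mult(1)[symmetric] X.left_smult_assoc Y.left_smult_assoc scal X.left_smult_closed)
  moreover have "b i \<in> ?S" if "i < N" for i using gen that b_carrier by simp
  ultimately have "?S = carrier \<Lambda>"
    using b unfolding generating_def by (elim conjE allE[of _ ?S]) auto
  hence "?u (l \<odot>\<^bsub>X\<^esub> x) = l \<odot>\<^bsub>Y\<^esub> ?u x" if "l \<in> carrier \<Lambda>" "x \<in> carrier X" for l x using that by blast
  thus ?thesis using u(1) add by (auto simp: module_hom_def)
qed

definition "G_obj X = encode n (cdim X) (act X)"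
definition "G_arr X Y u = blocks (4 * N) (mat_of X Y u)"

lemma Cmp_lin_rep_cat: "Cmp (lin_rep_cat n) X Y Z V U = V * U"
  by (simp add: lin_rep_cat_def)

lemma Idt_encode: "Idt (lin_rep_cat n) (encode n s B) = 1\<^sub>m (4 * N * s)"
  by (simp add: lin_rep_cat_def encode_def)

lemma G_arr_in:
  assumes X: "fg_module X" and Y: "fg_module Y" and u: "u \<in> module_hom \<Lambda> X Y"
  shows "G_arr X Y u \<in> Arr (lin_rep_cat n) (G_obj X) (G_obj Y)"
  unfolding G_obj_def G_arr_def encode_Arr[OF n] is_hom_def
  using blocks_intertwines[where B = "act X" and B' = "act Y", OF mat_of(1)[OF X Y klin_hom[OF u]] act_mat_of[OF X Y u] act(1)[OF X] act(1)[OF Y]]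
    blocks_carrier[OF mat_of(1)[OF X Y klin_hom[OF u]]] by blast

text \<open>Exactness is carried from the modules to their coordinate spaces, and from there to the
  \<open>4 * N\<close> copies by \<open>blocks_exact\<close>.\<close>

lemma G_exact:
  assumes XYZ: "fg_module X" "fg_module Y" "fg_module Z" and u: "u \<in> module_hom \<Lambda> X Y" and v: "v \<in> module_hom \<Lambda> Y Z"
    and ex: "short_exact X Y Z u v"
  shows "Ses (lin_rep_cat n) (G_obj X) (G_obj Y) (G_obj Z) (G_arr X Y u) (G_arr Y Z v)"
proof -
  interpret X: left_module \<Lambda> X using XYZ by blast
  interpret Z: left_module \<Lambda> Z using XYZ by blast
  note cX = coord_facts[OF XYZ(1)] and cY = coord_facts[OF XYZ(2)] and cZ = coord_facts[OF XYZ(3)]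
  note mu = mat_of[OF XYZ(1,2) klin_hom[OF u]] and mv = mat_of[OF XYZ(2,3) klin_hom[OF v]]
  have uc: "u x \<in> carrier Y" if "x \<in> carrier X" for x using u that by (auto simp: module_hom_def)
  have vc: "v x \<in> carrier Z" if "x \<in> carrier Y" for x using v that by (auto simp: module_hom_def)
  have inj: "inj_on u (carrier X)" and im: "u ` carrier X = {y \<in> carrier Y. v y = \<zero>\<^bsub>Z\<^esub>}" and sur: "v ` carrier Y = carrier Z"
    using ex by (auto simp: short_exact_def)
  have im': "x \<in> carrier X \<Longrightarrow> v (u x) = \<zero>\<^bsub>Z\<^esub>" "y \<in> carrier Y \<Longrightarrow> v y = \<zero>\<^bsub>Z\<^esub> \<Longrightarrow> \<exists>x\<in>carrier X. y = u x" for x y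
    using im by auto
  have "inj_on ((*\<^sub>v) (mat_of X Y u)) (carrier_vec (cdim X))"
  proof (rule inj_onI)
    fix x y assume "x \<in> carrier_vec (cdim X)" "y \<in> carrier_vec (cdim X)" and eq: "mat_of X Y u *\<^sub>v x = mat_of X Y u *\<^sub>v y"
    then obtain x' y' where x': "x' \<in> carrier X" "x = \<phi> X x'" "y' \<in> carrier X" "y = \<phi> X y'" using cX(5) by metis
    hence "u x' = u y'" using eq cY(4)[OF uc[OF x'(1)] uc[OF x'(3)]] by (simp add: mu(2))
    thus "x = y" using inj_onD[OF inj] x' by blast
  qed
  moreover have "(*\<^sub>v) (mat_of X Y u) ` carrier_vec (cdim X) = {y \<in> carrier_vec (cdim Y). mat_of Y Z v *\<^sub>v y = 0\<^sub>v (cdim Z)}"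
  proof (intro equalityI subsetI)
    fix y assume "y \<in> (*\<^sub>v) (mat_of X Y u) ` carrier_vec (cdim X)"
    then obtain w where w: "w \<in> carrier_vec (cdim X)" "y = mat_of X Y u *\<^sub>v w" by blast
    obtain x where x: "x \<in> carrier X" "\<phi> X x = w" using cX(5)[OF w(1)] by blast
    have y: "y = \<phi> Y (u x)" unfolding w(2) x(2)[symmetric] by (rule mu(2)[OF x(1)])
    show "y \<in> {y \<in> carrier_vec (cdim Y). mat_of Y Z v *\<^sub>v y = 0\<^sub>v (cdim Z)}"
      unfolding y using mv(2)[OF uc[OF x(1)]] im'(1)[OF x(1)] cZ(6) cY(1)[OF uc[OF x(1)]] by simp
  next
    fix y assume y: "y \<in> {y \<in> carrier_vec (cdim Y). mat_of Y Z v *\<^sub>v y = 0\<^sub>v (cdim Z)}"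
    then obtain y' where y': "y' \<in> carrier Y" "y = \<phi> Y y'" using cY(5) by blast
    have "\<phi> Z (v y') = \<phi> Z \<zero>\<^bsub>Z\<^esub>" using mv(2)[OF y'(1)] y y' cZ(6) by simp
    hence "v y' = \<zero>\<^bsub>Z\<^esub>" using cZ(4)[OF vc[OF y'(1)] Z.M.zero_closed] by simp
    then obtain x where x: "x \<in> carrier X" "y' = u x" using im'(2)[OF y'(1)] by blast
    hence "y = mat_of X Y u *\<^sub>v \<phi> X x" using y' mu(2) by simp
    thus "y \<in> (*\<^sub>v) (mat_of X Y u) ` carrier_vec (cdim X)" using cX(1)[OF x(1)] by blast
  qed
  moreover have "(*\<^sub>v) (mat_of Y Z v) ` carrier_vec (cdim Y) = carrier_vec (cdim Z)"
  proof (intro equalityI subsetI)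
    fix z assume "z \<in> (*\<^sub>v) (mat_of Y Z v) ` carrier_vec (cdim Y)"
    thus "z \<in> carrier_vec (cdim Z)" using mv(1) by auto
  next
    fix z :: "'k vec" assume "z \<in> carrier_vec (cdim Z)"
    then obtain z' where z': "z' \<in> carrier Z" "z = \<phi> Z z'" using cZ(5) by blast
    then obtain y where y: "y \<in> carrier Y" "z' = v y" using sur by blast
    hence "z = mat_of Y Z v *\<^sub>v \<phi> Y y" using z' mv(2) by simp
    thus "z \<in> (*\<^sub>v) (mat_of Y Z v) ` carrier_vec (cdim Y)" using cY(1)[OF y(1)] by blast
  qed
  \<comment> \<open>\<open>short_exact\<close> sees only the underlying spaces, so the families of
    matrices may be left unspecified here.\<close>
  ultimately have "short_exact (rep_module n (cdim X, undefined)) (rep_module n (cdim Y, undefined)) (rep_module n (cdim Z, undefined))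
      ((*\<^sub>v) (mat_of X Y u)) ((*\<^sub>v) (mat_of Y Z v))"
    by (simp add: short_exact_def rep_module_def)
  from blocks_exact[OF mu(1) mv(1) this, of "4 * N"] show ?thesis
    by (simp add: lin_rep_cat_def G_obj_def G_arr_def encode_def)
qed

text \<open>The corners of mutually inverse homomorphisms of encodings are mutually inverse and
  commute with the actions of the \<open>b i\<close>, so they come from module
  homomorphisms.\<close>

lemma G_reflects_iso:
  assumes X: "fg_module X" and Y: "fg_module Y" and iso: "isomorphic (lin_rep_cat n) (G_obj X) (G_obj Y)"
  shows "isomorphic (fin_gen_cat \<Lambda>) X Y"
proof -
  obtain C C' where C: "is_hom (cdim Y) (cdim X) (act Y) (act X) C" and C': "is_hom (cdim X) (cdim Y) (act X) (act Y) C'"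
    and one: "C' * C = 1\<^sub>m (4 * N * cdim X)" "C * C' = 1\<^sub>m (4 * N * cdim Y)"
    using iso unfolding isomorphic_def G_obj_def Idt_encode Cmp_lin_rep_cat
    unfolding Bex_def encode_Arr[OF n] by blast
  define U where "U = corner (cdim Y) (cdim X) C"
  define U' where "U' = corner (cdim X) (cdim Y) C'"
  have Uc: "U \<in> carrier_mat (cdim Y) (cdim X)" "U' \<in> carrier_mat (cdim X) (cdim Y)" by (simp_all add: U_def U'_def)
  have UU: "U' * U = 1\<^sub>m (cdim X)" "U * U' = 1\<^sub>m (cdim Y)"
    using corner_mult[OF is_hom_carrier[OF C] C' act(1)[OF X] act(1)[OF Y]]
      corner_mult[OF is_hom_carrier[OF C'] C act(1)[OF Y] act(1)[OF X]] one
    by (simp_all add: U_def U'_def corner_one)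
  have hom: "map_of X Y U \<in> module_hom \<Lambda> X Y" "map_of Y X U' \<in> module_hom \<Lambda> Y X"
    using map_of_hom[OF X Y Uc(1)] map_of_hom[OF Y X Uc(2)]
      corner_intertwines[OF C act(1)[OF X] act(1)[OF Y]] corner_intertwines[OF C' act(1)[OF Y] act(1)[OF X]]
    unfolding U_def U'_def by blast+
  have inv: "map_of B A W' (map_of A B W x) = x"
    if "fg_module A" "fg_module B" "W \<in> carrier_mat (cdim B) (cdim A)" "W' \<in> carrier_mat (cdim A) (cdim B)"
      "W' * W = 1\<^sub>m (cdim A)" "x \<in> carrier A" for A B W W' x
  proof -
    note m = map_of[OF that(1,2,3,6)] and cA = coord_facts[OF that(1)]
    note m' = map_of[OF that(2,1,4) m(1)]
    have "\<phi> A (map_of B A W' (map_of A B W x)) = W' * W *\<^sub>v \<phi> A x"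
      unfolding m'(2) m(2) by (rule assoc_mult_mat_vec[OF that(4,3) cA(1)[OF that(6)], symmetric])
    also have "\<dots> = \<phi> A x" using cA(1)[OF that(6)] unfolding that(5) by simp
    finally show ?thesis using cA(4)[OF m'(1) that(6)] by simp
  qed
  have "compose (carrier X) (map_of Y X U') (map_of X Y U) = (\<lambda>x\<in>carrier X. x)"
    "compose (carrier Y) (map_of X Y U) (map_of Y X U') = (\<lambda>x\<in>carrier Y. x)"
    using inv[OF X Y Uc UU(1)] inv[OF Y X Uc(2,1) UU(2)] by (auto simp: compose_def fun_eq_iff)
  moreover have "map_of X Y U \<in> extensional (carrier X)" "map_of Y X U' \<in> extensional (carrier Y)"
    by (simp_all add: map_of_def)
  ultimately show ?thesis
    using hom unfolding isomorphic_def fin_gen_cat_def module_cat_def by auto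
qed

text \<open>By \<open>is_hom_idempotent\<close> it is enough to consider idempotent matrices that
  commute with all \<open>act X i\<close>. Such a matrix is an idempotent endomorphism of the module
  \<open>X\<close>, hence trivial.\<close>

lemma G_indecomposable:
  assumes X: "fg_module X" and ind: "indecomposable \<Lambda> X"
  shows "indecomposable (param_ring n) (rep_module n (G_obj X))"
proof -
  interpret X: left_module \<Lambda> X using X by blast
  note cX = coord_facts[OF X]
  obtain A where A: "G_obj X = (4 * N * cdim X, A)" by (simp add: G_obj_def encode_def)
  interpret L: linear_rep n "4 * N * cdim X" A
    by (rule linear_rep_lin_reps) (simp only: A[symmetric] G_obj_def encode_lin_reps)
  obtain x where x: "x \<in> carrier X" "x \<noteq> \<zero>\<^bsub>X\<^esub>" using ind by (auto simp: indecomposable_def)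
  have "cdim X \<noteq> 0"
  proof
    assume z: "cdim X = 0"
    have "\<phi> X x = \<phi> X \<zero>\<^bsub>X\<^esub>" using cX(1)[OF x(1)] cX(1)[OF X.M.zero_closed] unfolding z by (intro eq_vecI) auto
    thus False using cX(4)[OF x(1) X.M.zero_closed] x(2) by simp
  qed
  hence pos: "4 * N * cdim X > 0" using N by simp
  have triv: "U = 0\<^sub>m (cdim X) (cdim X) \<or> U = 1\<^sub>m (cdim X)"
    if U: "U \<in> carrier_mat (cdim X) (cdim X)" and idem: "U * U = U" and UA: "\<And>i. i < N \<Longrightarrow> U * act X i = act X i * U" for U
  proof -
    let ?e = "map_of X X U"
    note e = map_of[OF X X U]
    have "?e (?e x) = ?e x" if "x \<in> carrier X" for x
    proof -
      have "\<phi> X (?e (?e x)) = \<phi> X (?e x)"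
        unfolding e(2)[OF e(1)[OF that]] e(2)[OF that] using assoc_mult_mat_vec[OF U U cX(1)[OF that]] idem by simp
      thus ?thesis using cX(4)[OF e(1)[OF e(1)[OF that]] e(1)[OF that]] by simp
    qed
    moreover have "l \<odot>\<^bsub>X\<^esub> \<zero>\<^bsub>X\<^esub> = \<zero>\<^bsub>X\<^esub>" if "l \<in> carrier \<Lambda>" for l
      using X.left_smult_r_distr[OF that X.M.zero_closed X.M.zero_closed] X.left_smult_closed[OF that X.M.zero_closed]
      by (simp add: X.M.add.l_cancel_one')
    ultimately have "(\<forall>x\<in>carrier X. ?e x = \<zero>\<^bsub>X\<^esub>) \<or> (\<forall>x\<in>carrier X. ?e x = x)"
      using indecomposable_idempotent[OF X.M.abelian_group_axioms X.left_smult_closed _ ind map_of_hom[OF X X U UA]] by blast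
    thus ?thesis
    proof
      assume 0: "\<forall>x\<in>carrier X. ?e x = \<zero>\<^bsub>X\<^esub>"
      have "U = 0\<^sub>m (cdim X) (cdim X)"
      proof (rule mat_of_unique[OF X U])
        fix x assume x: "x \<in> carrier X"
        have "0\<^sub>m (cdim X) (cdim X) *\<^sub>v \<phi> X x = 0\<^sub>v (cdim X)" using cX(1)[OF x] by (intro eq_vecI) auto
        thus "U *\<^sub>v \<phi> X x = 0\<^sub>m (cdim X) (cdim X) *\<^sub>v \<phi> X x"
          using e(2)[OF x] 0 cX(6) x by simp
      qed simp
      thus ?thesis by simp
    next
      assume 1: "\<forall>x\<in>carrier X. ?e x = x"
      have "U = 1\<^sub>m (cdim X)"
      proof (rule mat_of_unique[OF X U one_carrier_mat])
        fix x assume "x \<in> carrier X"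
        thus "U *\<^sub>v \<phi> X x = 1\<^sub>m (cdim X) *\<^sub>v \<phi> X x"
          using e(2)[of x] 1 cX(1)[of x] by simp
      qed
      thus ?thesis by simp
    qed
  qed
  show ?thesis
    unfolding A
  proof (rule L.indecomposable_matI[OF pos])
    fix E assume E: "E \<in> carrier_mat (4 * N * cdim X) (4 * N * cdim X)" "E * E = E"
      and EA: "\<And>i. i \<in> {1..n} \<Longrightarrow> E * A i = A i * E"
    have "E \<in> Arr (lin_rep_cat n) (G_obj X) (G_obj X)" unfolding A Arr_lin_rep_cat using E EA by blast
    hence "is_hom (cdim X) (cdim X) (act X) (act X) E" unfolding G_obj_def encode_Arr[OF n] .
    thus "E = 0\<^sub>m (4 * N * cdim X) (4 * N * cdim X) \<or> E = 1\<^sub>m (4 * N * cdim X)"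
      by (rule is_hom_idempotent[OF _ act(1)[OF X] E(2) triv])
  qed
qed

theorem G_rep_embedding: "rep_embedding (fin_gen_cat \<Lambda> :: (('l, 'm) module, 'm \<Rightarrow> 'm) exact_cat) (lin_rep_cat n) G_obj G_arr"
  unfolding rep_embedding_def is_functor_def
proof (intro conjI ballI impI)
  fix X :: "('l, 'm) module" assume "X \<in> Obj (fin_gen_cat \<Lambda>)"
  hence X: "fg_module X" by (simp add: fin_gen_cat_def module_cat_def)
  show "G_obj X \<in> Obj (lin_rep_cat n)" by (simp add: G_obj_def encode_lin_reps Obj_lin_rep_cat)
  have id: "Idt (fin_gen_cat \<Lambda>) X = (\<lambda>x\<in>carrier X. x)" by (simp add: fin_gen_cat_def module_cat_def)
  interpret X: left_module \<Lambda> X using X by blast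
  have "klin X X (\<lambda>x\<in>carrier X. x)" by (auto simp: klin_def X.left_smult_closed)
  thus "G_arr X X (Idt (fin_gen_cat \<Lambda>) X) = Idt (lin_rep_cat n) (G_obj X)"
    unfolding id G_arr_def G_obj_def Idt_encode using mat_of_id[OF X] blocks_one by simp
  show "Indec (lin_rep_cat n) (G_obj X)" if "Indec (fin_gen_cat \<Lambda>) X"
    using G_indecomposable[OF X] that by (simp add: fin_gen_cat_def module_cat_def lin_rep_cat_def)
next
  fix X Y :: "('l, 'm) module" assume "X \<in> Obj (fin_gen_cat \<Lambda>)" "Y \<in> Obj (fin_gen_cat \<Lambda>)"
  hence XY: "fg_module X" "fg_module Y" by (simp_all add: fin_gen_cat_def module_cat_def)
  show "\<not> isomorphic (lin_rep_cat n) (G_obj X) (G_obj Y)" if "\<not> isomorphic (fin_gen_cat \<Lambda>) X Y"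
    using G_reflects_iso[OF XY] that by blast
  fix u :: "'m \<Rightarrow> 'm" assume "u \<in> Arr (fin_gen_cat \<Lambda>) X Y"
  thus "G_arr X Y u \<in> Arr (lin_rep_cat n) (G_obj X) (G_obj Y)"
    using G_arr_in[OF XY] by (simp add: fin_gen_cat_def module_cat_def)
next
  fix X Y Z :: "('l, 'm) module" and u v assume "X \<in> Obj (fin_gen_cat \<Lambda>)" "Y \<in> Obj (fin_gen_cat \<Lambda>)" "Z \<in> Obj (fin_gen_cat \<Lambda>)"
    "u \<in> Arr (fin_gen_cat \<Lambda>) X Y" "v \<in> Arr (fin_gen_cat \<Lambda>) Y Z"
  hence XYZ: "fg_module X" "fg_module Y" "fg_module Z" and u: "u \<in> module_hom \<Lambda> X Y" and v: "v \<in> module_hom \<Lambda> Y Z"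
    by (simp_all add: fin_gen_cat_def module_cat_def)
  interpret X: left_module \<Lambda> X using XYZ by blast
  have vu: "compose (carrier X) v u \<in> module_hom \<Lambda> X Z"
    using u v X.left_smult_closed by (auto simp: module_hom_def compose_def Pi_iff)
  have "mat_of X Z (compose (carrier X) v u) = mat_of Y Z v * mat_of X Y u"
    by (rule mat_of_comp[OF XYZ klin_hom[OF u] klin_hom[OF v] klin_hom[OF vu]]) (simp add: compose_def)
  thus "G_arr X Z (Cmp (fin_gen_cat \<Lambda>) X Y Z v u) = Cmp (lin_rep_cat n) (G_obj X) (G_obj Y) (G_obj Z) (G_arr Y Z v) (G_arr X Y u)"
    using blocks_mult[OF mat_of(1)[OF XYZ(1,2) klin_hom[OF u]] mat_of(1)[OF XYZ(2,3) klin_hom[OF v]]]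
    by (simp add: fin_gen_cat_def module_cat_def lin_rep_cat_def G_arr_def)
  show "Ses (lin_rep_cat n) (G_obj X) (G_obj Y) (G_obj Z) (G_arr X Y u) (G_arr Y Z v)" if "Ses (fin_gen_cat \<Lambda>) X Y Z u v"
    using G_exact[OF XYZ u v] that by (simp add: fin_gen_cat_def module_cat_def)
qed

end

section \<open>Composition of the embeddings and wildness\<close>

lemma rep_embedding_comp:
  assumes F: "rep_embedding C D F G" and F': "rep_embedding D E F' G'"
  shows "rep_embedding C E (F' \<circ> F) (\<lambda>X Y u. G' (F X) (F Y) (G X Y u))"
proof -
  have f: "is_functor C D F G" "is_functor D E F' G'" using F F' by (auto simp: rep_embedding_def)
  have "is_functor C E (F' \<circ> F) (\<lambda>X Y u. G' (F X) (F Y) (G X Y u))"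
    using f unfolding is_functor_def by simp
  thus ?thesis using F F' unfolding rep_embedding_def is_functor_def by simp
qed

text \<open>The infinite field supplies the pairwise distinct diagonal values \<open>lam\<close> of
  the matrix \<open>X\<close> in the encoding.\<close>

lemma fin_dim_algebra_embedding:
  fixes \<Lambda> :: "('k :: field, 'l) module"
  assumes "infinite (UNIV :: 'k set)" "fin_dim_algebra \<Lambda>" "n \<ge> 2"
  shows "\<exists>F G. rep_embedding (fin_gen_cat \<Lambda> :: (('l, 'm) module, 'm \<Rightarrow> 'm) exact_cat) (lin_rep_cat n :: (_, 'k mat) exact_cat) F G"
proof -
  interpret fd_algebra \<Lambda> by unfold_locales fact
  obtain N b where b: "generating N b" using generating_exists by blast
  obtain lam :: "nat \<Rightarrow> 'k" where "inj lam" using infinite_countable_subset[OF assms(1)] by blast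
  then interpret module_encoding \<Lambda> N lam b n
    using b assms(3) by unfold_locales (auto simp: generating_def intro: inj_on_subset)
  show ?thesis using G_rep_embedding by blast
qed

theorem theorem13:
  fixes f :: "'k :: field mps" and n :: nat
  assumes "infinite (UNIV :: 'k set)"
    and "n \<ge> 1"
    and "f \<in> carrier (mps_ring n)"
    and "f \<noteq> 0"
    and "mps_order f \<ge> 4"
  shows "(\<forall>h g. is_expression n f h g \<longrightarrow>
            rep_embedding (lin_rep_cat n) (MCM_cat (hypersurface_ring n f))
              (F_obj n h g) (F_arr n h g))
       \<and> (n \<ge> 2 \<longrightarrow>
            wild_CM_type TYPE('k) TYPE('l) TYPE('m) TYPE('k mps vec set) (hypersurface_ring n f))"
proof -
  have f: "f \<in> mps_over {0..n}" "order_ge 4 f"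
    using assms by (simp_all add: carrier_mps_ring order_ge_iff numeral_eq_enat)
  interpret hypersurface n f
    using f assms(4) order_geD[OF f(2), of 0] by unfold_locales auto
  have F: "rep_embedding (lin_rep_cat n) (MCM_cat (hypersurface_ring n f)) (F_obj n h g) (F_arr n h g)"
    if "is_expression n f h g" for h g
  proof -
    interpret expression n f h g using that assms(2) by unfold_locales
    show ?thesis using F_rep_embedding[OF assms(1)] .
  qed
  have "wild_CM_type TYPE('k) TYPE('l) TYPE('m) TYPE('k mps vec set) (hypersurface_ring n f)" if n2: "n \<ge> 2"
    unfolding wild_CM_type_def wild_def
  proof (intro allI impI)
    fix \<Lambda> :: "('k, 'l) module" assume "fin_dim_algebra \<Lambda>"
    then obtain G H where "rep_embedding (fin_gen_cat \<Lambda> :: (('l, 'm) module, 'm \<Rightarrow> 'm) exact_cat) (lin_rep_cat n :: (_, 'k mat) exact_cat) G H"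
      using fin_dim_algebra_embedding[OF assms(1) _ n2] by blast
    \<comment> \<open>The embedding into MCM modules needs some expression of \<open>f\<close>, and
      none is given in this part of the claim.\<close>
    moreover obtain h g where "is_expression n f h g" using expression_exists[OF f] by blast
    ultimately show "\<exists>F G. rep_embedding (fin_gen_cat \<Lambda> :: (('l, 'm) module, 'm \<Rightarrow> 'm) exact_cat)
        (MCM_cat (hypersurface_ring n f) :: (_, 'k mps vec set \<Rightarrow> 'k mps vec set) exact_cat) F G"
      using rep_embedding_comp F by blast
  qed
  thus ?thesis using F by blast
qed

end
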